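(* The orthogonal complement of $\mathbf{P}^0$ in $\mathbf{L}^2=(L^2(\Omega))^3$ has the characterization $$(\mathbf{P}^0)^{\perp}=\{\nabla q : q\in {}^0H^1_{\mathrm p}\}.$$
   Context: Let $0<\kappa<1$, $\ell>0$, $\mathbb{D}=\{(a_1,a_2)\in\mathbb{R}^2: a_1^2+a_2^2<\kappa^2\}$, $\Omega=\mathbb{D}\times(0,\ell)$, and $S_F=\{(a_1,a_2,a_3)\in\partial\Omega: a_1^2+a_2^2=\kappa^2\}$. All functions are complex valued, and $\mathbf{L}^2$ carries the inner product $(\mathbf{u},\mathbf{v})_{\mathbf{L}^2}=\int_\Omega \mathbf{u}\cdot\overline{\mathbf{v}}$. For $k\in\mathbb{N}_0$, $H^k_{\mathrm p}$ is the space of functions $u=\sum_{n\in\mathbb{Z}}\hat u_n(a_1,a_2)e^{2\pi i n a_3/\ell}\in H^k(\Omega)$ with $\hat u_n\in H^k(\mathbb{D})$ and $$\|u\|_{H^k_{\mathrm p}}^2=\sum_{n}\sum_{m=0}^k \frac{(2\pi n)^{2m}}{\ell^{2m-1}}\|\hat u_n\|^2_{H^{k-m}(\mathbb{D})}<\infty .$$ In particular $H^0_{\mathrm p}=L^2(\Omega)$, and $H^1_{\mathrm p}$ consists of the $f\in H^1(\Omega)$ whose traces on $\mathbb{D}\times\{0\}$ and $\mathbb{D}\times\{\ell\}$ coincide. ${}^0H^1_{\mathrm p}=\{u\in H^1_{\mathrm p}: u=0 \text{ on } S_F\}$. $\mathbf{P}^0=\{\mathbf{u}\in (H^0_{\mathrm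 p})^3=(L^2(\Omega))^3 : \nabla\cdot\mathbf{u}=0\}$, the divergence being taken on $\Omega$ (in the sense of distributions).
   Formalization: The divergence in P^0 is taken on Ω with its end discs identified (test functions l-periodic in a_3, supported off S_F), not in D'(Ω): there the claim fails, as u=(-a_1,-a_2,2a_3) is solenoidal but not orthogonal to ∇(κ^2-a_1^2-a_2^2). *)

theory Defs
  imports "HOL-Analysis.Analysis"
begin

section \<open>Square-integrable functions\<close>

text \<open>
  Functions are representatives: \<open>L2 S\<close> is closed under changes on null sets and outside \<open>S\<close>,
  and so are all the function spaces built from it below.
\<close>

definition L2 :: "'a::euclidean_space set \<Rightarrow> ('a \<Rightarrow> 'b::real_normed_vector) set" where
  "L2 S = {f. f \<in> borel_measurable (lebesgue_on S) \<and>
              integrable (lebesgue_on S) (\<lambda>x. (norm (f x))\<^sup>2)}"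

definition L2_norm :: "'a::euclidean_space set \<Rightarrow> ('a \<Rightarrow> 'b::real_normed_vector) \<Rightarrow> real" where
  "L2_norm S f = sqrt (LINT x|lebesgue_on S. (norm (f x))\<^sup>2)"

definition L2_inner :: "'a::euclidean_space set \<Rightarrow> ('a \<Rightarrow> complex^'n) \<Rightarrow> ('a \<Rightarrow> complex^'n) \<Rightarrow> complex"
  where "L2_inner S u v = (LINT x|lebesgue_on S. (\<Sum>i\<in>UNIV. u x $ i * cnj (v x $ i)))"

definition L2_orth :: "'a::euclidean_space set \<Rightarrow> ('a \<Rightarrow> complex^'n) set \<Rightarrow> ('a \<Rightarrow> complex^'n) set"
  where "L2_orth S M = {v \<in> L2 S. \<forall>u\<in>M. L2_inner S u v = 0}"

section \<open>Weak derivatives and Sobolev spaces\<close>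

primrec pderivs :: "'n::finite list \<Rightarrow> (real^'n \<Rightarrow> complex) \<Rightarrow> real^'n \<Rightarrow> complex" where
  "pderivs [] f = f"
| "pderivs (i # is) f = (\<lambda>x. frechet_derivative (pderivs is f) (at x) (axis i 1))"

definition smooth :: "(real^'n::finite \<Rightarrow> complex) \<Rightarrow> bool" where
  "smooth f \<longleftrightarrow> (\<forall>is x. pderivs is f differentiable (at x))"

definition test_functions :: "(real^'n::finite) set \<Rightarrow> (real^'n \<Rightarrow> complex) set" where
  "test_functions S =
     {\<phi>. smooth \<phi> \<and> compact (closure {x. \<phi> x \<noteq> 0}) \<and> closure {x. \<phi> x \<noteq> 0} \<subseteq> S}"

definition weak_deriv ::
    "(real^'n::finite) set \<Rightarrow> 'n list \<Rightarrow> (real^'n \<Rightarrow> complex) \<Rightarrow> (real^'n \<Rightarrow> complex) \<Rightarrow> bool" where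
  "weak_deriv S is f g \<longleftrightarrow>
     (\<forall>\<phi>\<in>test_functions S.
        (LINT x|lebesgue_on S. f x * pderivs is \<phi> x) =
        (-1) ^ length is * (LINT x|lebesgue_on S. g x * \<phi> x))"

definition sobolev :: "nat \<Rightarrow> (real^'n::finite) set \<Rightarrow> (real^'n \<Rightarrow> complex) set" where
  "sobolev k S = {f \<in> L2 S. \<forall>is. length is \<le> k \<longrightarrow> (\<exists>g\<in>L2 S. weak_deriv S is f g)}"

text \<open>
  The norm is \<open>\<parallel>f\<parallel>\<^sup>2 = \<Sum>j\<le>k. \<parallel>D\<^sup>j f\<parallel>\<^sup>2\<close>, with the Euclidean norm of the array of all partial derivatives
  of order \<open>j\<close>; for \<open>k \<le> 1\<close> it coincides with the sum over multi-indices, and for larger \<open>k\<close> it is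
  equivalent to it.  The weak derivative is unique up to null sets, so the choice is harmless.
\<close>

definition sobolev_norm :: "nat \<Rightarrow> (real^'n::finite) set \<Rightarrow> (real^'n \<Rightarrow> complex) \<Rightarrow> real" where
  "sobolev_norm k S f =
     sqrt (\<Sum>is | length is \<le> k. (L2_norm S (SOME g. g \<in> L2 S \<and> weak_deriv S is f g))\<^sup>2)"

definition is_weak_gradient ::
    "(real^'n::finite) set \<Rightarrow> (real^'n \<Rightarrow> complex) \<Rightarrow> (real^'n \<Rightarrow> complex^'n) \<Rightarrow> bool" where
  "is_weak_gradient S q v \<longleftrightarrow> v \<in> L2 S \<and> (\<forall>i. weak_deriv S [i] q (\<lambda>x. v x $ i))"

section \<open>The cylinder\<close>

definition disc :: "real \<Rightarrow> (real^2) set" where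
  "disc \<kappa> = {a. (a $ 1)\<^sup>2 + (a $ 2)\<^sup>2 < \<kappa>\<^sup>2}"

definition horiz :: "real^3 \<Rightarrow> real^2" where
  "horiz a = vector [a $ 1, a $ 2]"

definition cyl :: "real \<Rightarrow> real \<Rightarrow> (real^3) set" where
  "cyl \<kappa> l = {a. horiz a \<in> disc \<kappa> \<and> 0 < a $ 3 \<and> a $ 3 < l}"

definition SF :: "real \<Rightarrow> real \<Rightarrow> (real^3) set" where
  "SF \<kappa> l = {a \<in> frontier (cyl \<kappa> l). (a $ 1)\<^sup>2 + (a $ 2)\<^sup>2 = \<kappa>\<^sup>2}"

definition SF_param :: "real \<Rightarrow> real \<times> real \<Rightarrow> real^3" where
  "SF_param \<kappa> = (\<lambda>(\<theta>, s). vector [\<kappa> * cos \<theta>, \<kappa> * sin \<theta>, s])"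

lemma closure_cyl:
  assumes "0 < \<kappa>" "0 < l"
  shows "closure (cyl \<kappa> l) = {a. (a $ 1)\<^sup>2 + (a $ 2)\<^sup>2 \<le> \<kappa>\<^sup>2 \<and> 0 \<le> a $ 3 \<and> a $ 3 \<le> l}"
    (is "_ = ?C")
proof
  have "closed ?C"
    by (intro closed_Collect_conj closed_Collect_le continuous_intros)
  moreover have "cyl \<kappa> l \<subseteq> ?C"
    by (auto simp: cyl_def disc_def horiz_def)
  ultimately show "closure (cyl \<kappa> l) \<subseteq> ?C"
    by (rule closure_minimal[rotated])
next
  show "?C \<subseteq> closure (cyl \<kappa> l)"
  proof
    fix a assume a: "a \<in> ?C"
    define t :: "nat \<Rightarrow> real" where "t n = 1 - inverse (real (Suc (Suc n)))" for n
    define x :: "nat \<Rightarrow> real^3" where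
      "x n = vector [t n * a $ 1, t n * a $ 2, l/2 + t n * (a $ 3 - l/2)]" for n
    have t: "0 < t n" "t n < 1" for n
      by (auto simp: t_def field_simps)
    have "x n \<in> cyl \<kappa> l" for n
    proof -
      have "(t n)\<^sup>2 * ((a $ 1)\<^sup>2 + (a $ 2)\<^sup>2) \<le> (t n)\<^sup>2 * \<kappa>\<^sup>2"
        using a by (intro mult_left_mono) auto
      also have "\<dots> < 1 * \<kappa>\<^sup>2"
        using t[of n] assms by (intro mult_strict_right_mono) (auto simp: power_less_one_iff)
      finally have 1: "(t n * a $ 1)\<^sup>2 + (t n * a $ 2)\<^sup>2 < \<kappa>\<^sup>2"
        by (simp add: power_mult_distrib algebra_simps)
      have "\<bar>t n * (a $ 3 - l/2)\<bar> = t n * \<bar>a $ 3 - l/2\<bar>"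
        using t[of n] by (simp add: abs_mult)
      also have "\<dots> \<le> t n * (l/2)"
        using a t[of n] by (intro mult_left_mono) (auto simp: abs_le_iff field_simps)
      also have "\<dots> < 1 * (l/2)"
        using t[of n] assms by (intro mult_strict_right_mono) auto
      finally show ?thesis
        using 1 by (auto simp: x_def cyl_def disc_def horiz_def abs_less_iff)
    qed
    moreover have "t \<longlonglongrightarrow> 1 - 0"
      unfolding t_def by (intro tendsto_intros LIMSEQ_Suc[OF LIMSEQ_inverse_real_of_nat])
    hence tl: "t \<longlonglongrightarrow> 1" by simp
    have "x \<longlonglongrightarrow> a"
    proof (rule vec_tendstoI)
      fix i :: 3
      have "(\<lambda>n. t n * a $ 1) \<longlonglongrightarrow> 1 * a $ 1" "(\<lambda>n. t n * a $ 2) \<longlonglongrightarrow> 1 * a $ 2"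
        "(\<lambda>n. l/2 + t n * (a $ 3 - l/2)) \<longlonglongrightarrow> l/2 + 1 * (a $ 3 - l/2)"
        by (intro tendsto_intros tl)+
      then show "(\<lambda>n. x n $ i) \<longlonglongrightarrow> a $ i"
        using exhaust_3[of i] by (auto simp: x_def)
    qed
    ultimately show "a \<in> closure (cyl \<kappa> l)"
      unfolding closure_sequential by blast
  qed
qed

lemma SF_eq_param_image:
  assumes "0 < \<kappa>" "0 < l"
  shows "SF \<kappa> l = SF_param \<kappa> ` ({0..<2*pi} \<times> {0..l})"
proof -
  have op: "open (cyl \<kappa> l)"
    unfolding cyl_def disc_def horiz_def mem_Collect_eq vector_2
    by (intro open_Collect_conj open_Collect_less continuous_intros)
  have SF: "SF \<kappa> l = {a. (a $ 1)\<^sup>2 + (a $ 2)\<^sup>2 = \<kappa>\<^sup>2 \<and> 0 \<le> a $ 3 \<and> a $ 3 \<le> l}"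
    unfolding SF_def frontier_def interior_open[OF op] closure_cyl[OF assms]
    by (auto simp: cyl_def disc_def horiz_def)
  show ?thesis
  proof (intro equalityI subsetI)
    fix a assume "a \<in> SF \<kappa> l"
    hence a: "(a $ 1)\<^sup>2 + (a $ 2)\<^sup>2 = \<kappa>\<^sup>2" "0 \<le> a $ 3" "a $ 3 \<le> l"
      by (auto simp: SF)
    have "(a $ 1 / \<kappa>)\<^sup>2 + (a $ 2 / \<kappa>)\<^sup>2 = 1"
      using a(1) assms by (simp add: power_divide flip: add_divide_distrib)
    then obtain \<theta> where \<theta>: "0 \<le> \<theta>" "\<theta> < 2*pi" "a $ 1 / \<kappa> = cos \<theta>" "a $ 2 / \<kappa> = sin \<theta>"
      using sincos_total_2pi by metis
    have "a $ i = SF_param \<kappa> (\<theta>, a $ 3) $ i" for i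
      using exhaust_3[of i] \<theta> assms by (auto simp: SF_param_def field_simps)
    hence "a = SF_param \<kappa> (\<theta>, a $ 3)"
      unfolding vec_eq_iff by blast
    then show "a \<in> SF_param \<kappa> ` ({0..<2*pi} \<times> {0..l})"
      using \<theta> a by auto
  next
    fix a assume "a \<in> SF_param \<kappa> ` ({0..<2*pi} \<times> {0..l})"
    then show "a \<in> SF \<kappa> l"
      by (auto simp: SF SF_param_def power_mult_distrib simp flip: distrib_left)
  qed
qed

text \<open>Surface measure on \<^term>\<open>SF \<kappa> l\<close>: the area element is \<open>\<kappa> d\<theta> ds\<close>.\<close>

definition SF_measure :: "real \<Rightarrow> real \<Rightarrow> (real^3) measure" where
  "SF_measure \<kappa> l =
     scale_measure (ennreal \<kappa>)
       (distr (restrict_space lborel ({0..<2*pi} \<times> {0..l})) borel (SF_param \<kappa>))"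

section \<open>Periodic Sobolev spaces\<close>

definition fourier_mode :: "real \<Rightarrow> int \<Rightarrow> (real^2 \<Rightarrow> complex) \<Rightarrow> real^3 \<Rightarrow> complex" where
  "fourier_mode l n c a = c (horiz a) * exp (2 * pi * \<i> * of_int n * (a $ 3) / l)"

text \<open>The series \<open>u = \<Sum>n. c\<^sub>n exp (2\<pi>ina\<^sub>3/l)\<close> converges in \<open>L\<^sup>2\<close> on the cylinder.\<close>

definition Hp :: "nat \<Rightarrow> real \<Rightarrow> real \<Rightarrow> (real^3 \<Rightarrow> complex) set" where
  "Hp k \<kappa> l =
     {u \<in> sobolev k (cyl \<kappa> l). \<exists>c :: int \<Rightarrow> real^2 \<Rightarrow> complex.
        (\<forall>n. c n \<in> sobolev k (disc \<kappa>)) \<and>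
        (\<lambda>N. L2_norm (cyl \<kappa> l) (\<lambda>a. u a - (\<Sum>n\<in>{- int N..int N}. fourier_mode l n (c n) a)))
          \<longlonglongrightarrow> 0 \<and>
        (\<lambda>n. \<Sum>m\<le>k. (2 * pi * of_int n) ^ (2 * m) / l powi (2 * int m - 1) *
                    (sobolev_norm (k - m) (disc \<kappa>) (c n))\<^sup>2) summable_on UNIV}"

text \<open>
  \<open>g\<close> is the trace on \<^term>\<open>SF \<kappa> l\<close> of \<open>u \<in> H\<^sup>1\<close>: the trace operator is the continuous extension to
  \<open>H\<^sup>1\<close>, with values in \<open>L\<^sup>2\<close> of the surface, of the restriction of smooth functions.
\<close>

definition has_trace_SF ::
    "real \<Rightarrow> real \<Rightarrow> (real^3 \<Rightarrow> complex) \<Rightarrow> (real^3 \<Rightarrow> complex) \<Rightarrow> bool" where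
  "has_trace_SF \<kappa> l u g \<longleftrightarrow>
     g \<in> borel_measurable (SF_measure \<kappa> l) \<and>
     integrable (SF_measure \<kappa> l) (\<lambda>a. (norm (g a))\<^sup>2) \<and>
     (\<exists>\<phi> :: nat \<Rightarrow> real^3 \<Rightarrow> complex. (\<forall>j. smooth (\<phi> j)) \<and>
        (\<lambda>j. sobolev_norm 1 (cyl \<kappa> l) (\<lambda>a. u a - \<phi> j a)) \<longlonglongrightarrow> 0 \<and>
        (\<lambda>j. LINT a|SF_measure \<kappa> l. (norm (\<phi> j a - g a))\<^sup>2) \<longlonglongrightarrow> 0)"

definition H1p_zero :: "real \<Rightarrow> real \<Rightarrow> (real^3 \<Rightarrow> complex) set" where
  "H1p_zero \<kappa> l = {u \<in> Hp 1 \<kappa> l. has_trace_SF \<kappa> l u (\<lambda>_. 0)}"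

section \<open>Solenoidal fields\<close>

text \<open>
  The elements of \<open>Hp 0\<close> are periodic in \<open>a\<^sub>3\<close>, so distributions are taken on the cylinder with its two
  end discs identified: test functions are periodic in \<open>a\<^sub>3\<close> and supported away from the lateral
  surface only.  With test functions compactly supported in the open cylinder, jumps of the normal
  component across the identified discs would go unnoticed, and \<open>(-a\<^sub>1, -a\<^sub>2, 2a\<^sub>3)\<close> would be a
  solenoidal field not orthogonal to the gradient of \<open>\<kappa>\<^sup>2 - a\<^sub>1\<^sup>2 - a\<^sub>2\<^sup>2\<close>.
\<close>

definition periodic_test_functions :: "real \<Rightarrow> real \<Rightarrow> (real^3 \<Rightarrow> complex) set" where
  "periodic_test_functions \<kappa> l =
     {\<phi>. smooth \<phi> \<and> (\<forall>a. \<phi> (a + axis 3 l) = \<phi> a) \<and>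
         closure {a. \<phi> a \<noteq> 0} \<subseteq> {a. horiz a \<in> disc \<kappa>}}"

definition divergence_free :: "real \<Rightarrow> real \<Rightarrow> (real^3 \<Rightarrow> complex^3) \<Rightarrow> bool" where
  "divergence_free \<kappa> l u \<longleftrightarrow>
     (\<forall>\<phi>\<in>periodic_test_functions \<kappa> l.
        (LINT a|lebesgue_on (cyl \<kappa> l). (\<Sum>i\<in>UNIV. u a $ i * pderivs [i] \<phi> a)) = 0)"

definition P0 :: "real \<Rightarrow> real \<Rightarrow> (real^3 \<Rightarrow> complex^3) set" where
  "P0 \<kappa> l = {u. (\<forall>i. (\<lambda>a. u a $ i) \<in> Hp 0 \<kappa> l) \<and> divergence_free \<kappa> l u}"

end

theory Submission imports Defs
begin

text \<open>
  Gradients of periodic test functions are orthogonal to solenoidal fields by definition.  Projecting a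
  field orthogonal to all solenoidal fields onto the closure of these gradients leaves a remainder that is
  itself solenoidal, hence \<open>0\<close>; by Poincare's inequality the potentials converge along with their gradients.

  Conversely, expand \<open>\<nabla>q\<close> in Fourier modes in \<open>a\<^sub>3\<close>.  The coefficients \<open>c\<close> of \<open>q\<close> are limits in \<open>H\<^sup>1\<close> of
  smooth functions on the disc whose boundary values tend to \<open>0\<close>, so by Hardy's inequality \<open>c\<close> divided by the
  distance to the circle is square integrable.  Hence \<open>c\<close> can be cut off near the circle with a vanishing
  error in the gradient, and every mode of \<open>\<nabla>q\<close> is a limit of gradients of periodic test functions.
  Periodicity of \<open>q\<close> enters through the identity \<open>(\<partial>\<^sub>3 q)\<^sub>n = (2\<pi>in/l) q\<^sub>n\<close> for the coefficients.
\<close>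

section \<open>Square-integrable functions on a measure space\<close>

text \<open>The obstacle: \<open>has_trace_SF\<close> supplies smooth approximants of q that are
  neither periodic in the third coordinate nor zero on the lateral surface, so
  \<open>divergence_free\<close> says nothing about their gradients. Passing to one Fourier mode
  cures the first defect, since \<open>fourier_mode l n f\<close> is periodic for every f;
  multiplying by \<open>cutoff\<close> cures the second. The price of the first cure is a jump
  across the end discs in the coefficients of the vertical derivative; it is the same for every n,
  so it vanishes once the coefficients are known to tend to 0. The price of the second is the term c
  times the gradient of the cutoff, which grows like the inverse distance to the circle; square
  integrability of c alone cannot absorb it. \<open>divergence_free\<close> pairs without
  conjugation and \<open>L2_inner\<close> with it, while projections use the real inner product; the
  link is that test functions are closed under \<open>cnj\<close> and complex multiples.
  Coefficients are integrals along vertical lines, hence the recurring passage to Borel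
  representatives, for which product measures are available.\<close>

definition square_integrable :: "'a measure \<Rightarrow> ('a \<Rightarrow> 'b::euclidean_space) \<Rightarrow> bool" where
  "square_integrable M f \<longleftrightarrow> f \<in> borel_measurable M \<and> integrable M (\<lambda>x. (norm (f x))\<^sup>2)"

text \<open>The squared norm is the working quantity: it is additive over components, modes and
  fibres and keeps square roots out of the estimates. The measure is arbitrary because the same
  facts serve \<open>lebesgue_on S\<close>, \<open>lborel\<close> and product measures; the codomain
  is Euclidean so that vector fields are covered, with their real inner product.\<close>

definition sqnorm :: "'a measure \<Rightarrow> ('a \<Rightarrow> 'b::euclidean_space) \<Rightarrow> real" where
  "sqnorm M f = (LINT x|M. (norm (f x))\<^sup>2)"

lemma square_integrable_measurable [measurable_dest]:
  "square_integrable M f \<Longrightarrow> f \<in> borel_measurable M"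
  by (simp add: square_integrable_def)

lemma square_integrable_integrable:
  "square_integrable M f \<Longrightarrow> integrable M (\<lambda>x. (norm (f x))\<^sup>2)"
  by (simp add: square_integrable_def)

lemma sqnorm_nonneg [simp]: "0 \<le> sqnorm M f"
  by (simp add: sqnorm_def)

lemma square_integrable_bound:
  assumes "square_integrable M f" "g \<in> borel_measurable M" "AE x in M. norm (g x) \<le> C * norm (f x)"
  shows "square_integrable M g"
  unfolding square_integrable_def
proof
  show "integrable M (\<lambda>x. (norm (g x))\<^sup>2)"
  proof (rule Bochner_Integration.integrable_bound)
    show "integrable M (\<lambda>x. C\<^sup>2 * (norm (f x))\<^sup>2)"
      using assms(1) by (intro integrable_mult_right square_integrable_integrable)
    show "(\<lambda>x. (norm (g x))\<^sup>2) \<in> borel_measurable M"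
      using assms(2) by measurable
    show "AE x in M. norm ((norm (g x))\<^sup>2) \<le> norm (C\<^sup>2 * (norm (f x))\<^sup>2)"
      using assms(3)
    proof eventually_elim
      case (elim x)
      then have "(norm (g x))\<^sup>2 \<le> (C * norm (f x))\<^sup>2" by (intro power_mono) auto
      then show ?case by (simp add: power_mult_distrib)
    qed
  qed
qed (use assms in auto)

lemma square_integrable_cong_AE:
  assumes "f \<in> borel_measurable M" "g \<in> borel_measurable M" "AE x in M. f x = g x"
  shows "square_integrable M f \<longleftrightarrow> square_integrable M g"
proof -
  have "integrable M (\<lambda>x. (norm (f x))\<^sup>2) \<longleftrightarrow> integrable M (\<lambda>x. (norm (g x))\<^sup>2)"
    using assms by (intro integrable_cong_AE) auto
  then show ?thesis using assms by (simp add: square_integrable_def)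
qed

lemma sqnorm_cong_AE:
  assumes "f \<in> borel_measurable M" "g \<in> borel_measurable M" "AE x in M. f x = g x"
  shows "sqnorm M f = sqnorm M g"
  unfolding sqnorm_def using assms by (intro integral_cong_AE) auto

lemma norm_add_sq_le:
  fixes a b :: "'b::real_inner"
  shows "(norm (a + b))\<^sup>2 \<le> 2 * (norm a)\<^sup>2 + 2 * (norm b)\<^sup>2"
proof -
  have "(norm (a + b))\<^sup>2 \<le> (norm a + norm b)\<^sup>2"
    by (intro power_mono norm_triangle_ineq) auto
  also have "\<dots> \<le> 2 * (norm a)\<^sup>2 + 2 * (norm b)\<^sup>2"
    using sum_squares_bound[of "norm a" "norm b"] by (simp add: power2_sum)
  finally show ?thesis .
qed

lemma square_integrable_add [intro]:
  assumes "square_integrable M f" "square_integrable M g"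
  shows "square_integrable M (\<lambda>x. f x + g x)"
  unfolding square_integrable_def
proof
  have m [measurable]: "f \<in> borel_measurable M" "g \<in> borel_measurable M"
    using assms by auto
  show "(\<lambda>x. f x + g x) \<in> borel_measurable M" by measurable
  show "integrable M (\<lambda>x. (norm (f x + g x))\<^sup>2)"
  proof (rule Bochner_Integration.integrable_bound)
    show "integrable M (\<lambda>x. 2 * (norm (f x))\<^sup>2 + 2 * (norm (g x))\<^sup>2)"
      using assms by (intro Bochner_Integration.integrable_add integrable_mult_right square_integrable_integrable)
    show "(\<lambda>x. (norm (f x + g x))\<^sup>2) \<in> borel_measurable M"
      by measurable
    show "AE x in M. norm ((norm (f x + g x))\<^sup>2) \<le> norm (2 * (norm (f x))\<^sup>2 + 2 * (norm (g x))\<^sup>2)"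
      using norm_add_sq_le by (intro AE_I2) (auto simp: abs_of_nonneg)
  qed
qed

lemma square_integrable_zero [simp, intro]: "square_integrable M (\<lambda>x. 0)"
  by (simp add: square_integrable_def)

lemma square_integrable_scaleR [intro]:
  assumes "square_integrable M f" shows "square_integrable M (\<lambda>x. c *\<^sub>R f x)"
  using assms by (intro square_integrable_bound[OF assms, of _ "\<bar>c\<bar>"]) auto

lemma square_integrable_uminus [intro]:
  assumes "square_integrable M f" shows "square_integrable M (\<lambda>x. - f x)"
  using square_integrable_scaleR[OF assms, of "-1"] by simp

lemma square_integrable_diff [intro]:
  assumes "square_integrable M f" "square_integrable M g"
  shows "square_integrable M (\<lambda>x. f x - g x)"
  using square_integrable_add[OF assms(1) square_integrable_uminus[OF assms(2)]] by simp

lemma square_integrable_sum [intro]: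
  assumes "\<And>i. i \<in> I \<Longrightarrow> square_integrable M (f i)"
  shows "square_integrable M (\<lambda>x. \<Sum>i\<in>I. f i x)"
  using assms by (induction I rule: infinite_finite_induct) auto

lemma square_integrable_mult_bounded:
  fixes f :: "'a \<Rightarrow> complex"
  assumes "square_integrable M f" "g \<in> borel_measurable M" "AE x in M. norm (g x) \<le> C"
  shows "square_integrable M (\<lambda>x. f x * g x)"
proof (rule square_integrable_bound[OF assms(1)])
  show "AE x in M. norm (f x * g x) \<le> C * norm (f x)"
    using assms(3) by eventually_elim (simp add: norm_mult mult_left_mono mult.commute[of C])
qed (use assms in measurable)

lemma square_integrable_cmult [intro]:
  fixes f :: "'a \<Rightarrow> complex"
  assumes "square_integrable M f" shows "square_integrable M (\<lambda>x. c * f x)"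
  using square_integrable_mult_bounded[OF assms, of "\<lambda>_. c" "norm c"] by (simp add: mult.commute)

lemma borel_measurable_cnj [measurable]:
  "f \<in> borel_measurable M \<Longrightarrow> (\<lambda>x. cnj (f x)) \<in> borel_measurable M"
  by (rule borel_measurable_continuous_on[OF continuous_on_cnj]) (auto intro: continuous_intros)

lemma square_integrable_cnj [intro]:
  assumes "square_integrable M f" shows "square_integrable M (\<lambda>x. cnj (f x))"
  by (rule square_integrable_bound[OF assms, of _ 1]) (use assms in auto)

lemma square_integrable_vec_nth [intro]:
  fixes f :: "'a \<Rightarrow> complex^'n"
  assumes "square_integrable M f" shows "square_integrable M (\<lambda>x. f x $ i)"
proof (rule square_integrable_bound[OF assms, of _ 1])
  show "(\<lambda>x. f x $ i) \<in> borel_measurable M"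
    using assms by (intro borel_measurable_continuous_on[where f = "\<lambda>z. z $ i"] continuous_intros) auto
qed (simp add: Finite_Cartesian_Product.norm_nth_le)

lemma sqnorm_add_le:
  assumes "square_integrable M f" "square_integrable M g"
  shows "sqnorm M (\<lambda>x. f x + g x) \<le> 2 * sqnorm M f + 2 * sqnorm M g"
proof -
  have "sqnorm M (\<lambda>x. f x + g x) \<le> (LINT x|M. 2 * (norm (f x))\<^sup>2 + 2 * (norm (g x))\<^sup>2)"
    unfolding sqnorm_def
    by (intro integral_mono square_integrable_integrable norm_add_sq_le square_integrable_add
      Bochner_Integration.integrable_add integrable_mult_right assms)
  then show ?thesis
    using assms by (simp add: sqnorm_def square_integrable_integrable)
qed

lemma sqnorm_uminus [simp]: "sqnorm M (\<lambda>x. - f x) = sqnorm M f"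
  by (simp add: sqnorm_def)

lemma sqnorm_diff_le:
  assumes "square_integrable M f" "square_integrable M g"
  shows "sqnorm M (\<lambda>x. f x - g x) \<le> 2 * sqnorm M f + 2 * sqnorm M g"
  using sqnorm_add_le[OF assms(1) square_integrable_uminus[OF assms(2)]] by simp

lemma sqnorm_minus_commute: "sqnorm M (\<lambda>x. f x - g x) = sqnorm M (\<lambda>x. g x - f x)"
  by (simp add: sqnorm_def norm_minus_commute)

lemma sqnorm_scaleR: "sqnorm M (\<lambda>x. c *\<^sub>R f x) = c\<^sup>2 * sqnorm M f"
  by (simp add: sqnorm_def power_mult_distrib)

lemma sqnorm_cmult: "sqnorm M (\<lambda>x. c * f x) = (norm c)\<^sup>2 * sqnorm M f" for c :: complex
  by (simp add: sqnorm_def power_mult_distrib norm_mult)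

lemma sqnorm_eq_0_AE:
  assumes "square_integrable M f" "sqnorm M f = 0"
  shows "AE x in M. f x = 0"
proof -
  have "AE x in M. (norm (f x))\<^sup>2 = 0"
    using assms integral_nonneg_eq_0_iff_AE[of M "\<lambda>x. (norm (f x))\<^sup>2"]
    by (simp add: sqnorm_def square_integrable_integrable)
  then show ?thesis by simp
qed

lemma integrable_norm_mult:
  assumes "square_integrable M f" "square_integrable M g"
  shows "integrable M (\<lambda>x. norm (f x) * norm (g x))"
proof (rule Bochner_Integration.integrable_bound)
  have m [measurable]: "f \<in> borel_measurable M" "g \<in> borel_measurable M"
    using assms by auto
  show "integrable M (\<lambda>x. (norm (f x))\<^sup>2 + (norm (g x))\<^sup>2)"
    using assms by (intro Bochner_Integration.integrable_add square_integrable_integrable)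
  show "(\<lambda>x. norm (f x) * norm (g x)) \<in> borel_measurable M" by measurable
  have "a * b \<le> a\<^sup>2 + b\<^sup>2" if "a \<ge> 0" "b \<ge> 0" for a b :: real
    using sum_squares_bound[of a b] that mult_nonneg_nonneg[of a b] by linarith
  then show "AE x in M. norm (norm (f x) * norm (g x)) \<le> norm ((norm (f x))\<^sup>2 + (norm (g x))\<^sup>2)"
    by (intro AE_I2) auto
qed

text \<open>The form s^2 A - 2 s t C + t^2 B is the integral of a square. At s = C, t = A it equals
  A (A B - C^2), which settles A > 0; for A = 0, t = 1 the bound 2 s C \<le> B for all s forces C =
  0.\<close>

lemma Cauchy_Schwarz_norm_mult:
  assumes "square_integrable M f" "square_integrable M g"
  shows "(LINT x|M. norm (f x) * norm (g x))\<^sup>2 \<le> sqnorm M f * sqnorm M g"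
proof -
  define A B C where "A = sqnorm M f" and "B = sqnorm M g" and "C = (LINT x|M. norm (f x) * norm (g x))"
  have C0: "0 \<le> C" by (auto simp: C_def)
  have *: "0 \<le> s\<^sup>2 * A - 2 * s * t * C + t\<^sup>2 * B" for s t
  proof -
    have "0 \<le> (LINT x|M. (s * norm (f x) - t * norm (g x))\<^sup>2)" by simp
    also have "\<dots> = (LINT x|M. s\<^sup>2 * (norm (f x))\<^sup>2 - 2 * s * t * (norm (f x) * norm (g x)) + t\<^sup>2 * (norm (g x))\<^sup>2)"
      by (intro Bochner_Integration.integral_cong) (auto simp: power2_eq_square algebra_simps)
    also have "\<dots> = s\<^sup>2 * A - 2 * s * t * C + t\<^sup>2 * B"
      using square_integrable_integrable[OF assms(1)] square_integrable_integrable[OF assms(2)] integrable_norm_mult[OF assms]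
      by (simp add: A_def B_def C_def sqnorm_def)
    finally show ?thesis .
  qed
  have "0 \<le> A" "0 \<le> B" by (auto simp: A_def B_def)
  have "C\<^sup>2 \<le> A * B"
  proof (cases "A = 0")
    case True
    have "2 * s * C \<le> B" for s using *[of s 1] True by simp
    from this[of "(B + 1) / (2 * C)"] have "C = 0" by (rule_tac ccontr) simp
    then show ?thesis using True by simp
  next
    case False
    then have "A > 0" using \<open>0 \<le> A\<close> by simp
    have "0 \<le> A * (A * B - C\<^sup>2)"
      using *[of C A] by (simp add: power2_eq_square algebra_simps)
    then show ?thesis using \<open>A > 0\<close> by (simp add: zero_le_mult_iff)
  qed
  then show ?thesis by (simp add: A_def B_def C_def)
qed

lemma integrable_mult_complex:
  fixes f g :: "'a \<Rightarrow> complex"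
  assumes "square_integrable M f" "square_integrable M g"
  shows "integrable M (\<lambda>x. f x * g x)"
  by (rule Bochner_Integration.integrable_bound[OF integrable_norm_mult[OF assms]])
     (use assms in \<open>auto simp: norm_mult\<close>)

lemma integrable_inner:
  assumes "square_integrable M f" "square_integrable M g"
  shows "integrable M (\<lambda>x. f x \<bullet> g x)"
  by (rule Bochner_Integration.integrable_bound[OF integrable_norm_mult[OF assms]])
     (use assms in \<open>auto simp: Cauchy_Schwarz_ineq2\<close>)

lemma Cauchy_Schwarz_mult:
  fixes f g :: "'a \<Rightarrow> complex"
  assumes "square_integrable M f" "square_integrable M g"
  shows "(norm (LINT x|M. f x * g x))\<^sup>2 \<le> sqnorm M f * sqnorm M g"
proof -
  have "norm (LINT x|M. f x * g x) \<le> (LINT x|M. norm (f x) * norm (g x))"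
    using integral_norm_bound[of M "\<lambda>x. f x * g x"] by (simp add: norm_mult)
  then have "(norm (LINT x|M. f x * g x))\<^sup>2 \<le> (LINT x|M. norm (f x) * norm (g x))\<^sup>2"
    by (intro power_mono) auto
  then show ?thesis using Cauchy_Schwarz_norm_mult[OF assms] by linarith
qed

lemma Cauchy_Schwarz_inner:
  assumes "square_integrable M f" "square_integrable M g"
  shows "(LINT x|M. f x \<bullet> g x)\<^sup>2 \<le> sqnorm M f * sqnorm M g"
proof -
  have "norm (LINT x|M. f x \<bullet> g x) \<le> (LINT x|M. norm (f x) * norm (g x))"
    by (rule order_trans[OF integral_norm_bound
          integral_mono[OF integrable_norm[OF integrable_inner[OF assms]] integrable_norm_mult[OF assms]]])
      (simp add: Cauchy_Schwarz_ineq2)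
  then have "(norm (LINT x|M. f x \<bullet> g x))\<^sup>2 \<le> (LINT x|M. norm (f x) * norm (g x))\<^sup>2"
    by (intro power_mono) auto
  then show ?thesis using Cauchy_Schwarz_norm_mult[OF assms] by simp
qed

section \<open>Limits in the square mean, completeness and projection\<close>

lemma tendsto_sq_zero: "(\<lambda>k. (a k)\<^sup>2) \<longlonglongrightarrow> 0 \<Longrightarrow> a \<longlonglongrightarrow> (0::real)"
  using tendsto_real_sqrt[of "\<lambda>k. (a k)\<^sup>2" 0 sequentially] by (simp add: tendsto_rabs_zero_iff)

lemma L2_tendsto_integral_mult:
  fixes f :: "nat \<Rightarrow> 'a \<Rightarrow> complex" and g :: "'a \<Rightarrow> complex"
  assumes "\<And>k. square_integrable M (f k)" "square_integrable M f'" "square_integrable M g"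
    and "(\<lambda>k. sqnorm M (\<lambda>x. f k x - f' x)) \<longlonglongrightarrow> 0"
  shows "(\<lambda>k. LINT x|M. f k x * g x) \<longlonglongrightarrow> (LINT x|M. f' x * g x)"
proof -
  have "(\<lambda>k. (norm (LINT x|M. (f k x - f' x) * g x))\<^sup>2) \<longlonglongrightarrow> 0"
  proof (rule tendsto_sandwich[OF _ _ tendsto_const])
    show "(\<lambda>k. sqnorm M (\<lambda>x. f k x - f' x) * sqnorm M g) \<longlonglongrightarrow> 0"
      using tendsto_mult_left_zero[OF assms(4)] by simp
  qed (use assms in \<open>auto intro!: Cauchy_Schwarz_mult always_eventually\<close>)
  then have "(\<lambda>k. LINT x|M. (f k x - f' x) * g x) \<longlonglongrightarrow> 0"
    by (rule tendsto_norm_zero_cancel[OF tendsto_sq_zero])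
  moreover have "(LINT x|M. (f k x - f' x) * g x) = (LINT x|M. f k x * g x) - (LINT x|M. f' x * g x)" for k
    unfolding left_diff_distrib
    by (rule Bochner_Integration.integral_diff) (intro integrable_mult_complex assms)+
  ultimately show ?thesis by (simp add: LIM_zero_iff)
qed

lemma L2_tendsto_integral_inner:
  assumes "\<And>k. square_integrable M (f k)" "square_integrable M f'" "square_integrable M g"
    and "(\<lambda>k. sqnorm M (\<lambda>x. f k x - f' x)) \<longlonglongrightarrow> 0"
  shows "(\<lambda>k. LINT x|M. f k x \<bullet> g x) \<longlonglongrightarrow> (LINT x|M. f' x \<bullet> g x)"
proof -
  have "(\<lambda>k. (LINT x|M. (f k x - f' x) \<bullet> g x)\<^sup>2) \<longlonglongrightarrow> 0"
  proof (rule tendsto_sandwich[OF _ _ tendsto_const])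
    show "(\<lambda>k. sqnorm M (\<lambda>x. f k x - f' x) * sqnorm M g) \<longlonglongrightarrow> 0"
      using tendsto_mult_left_zero[OF assms(4)] by simp
  qed (use assms in \<open>auto intro!: Cauchy_Schwarz_inner always_eventually\<close>)
  then have "(\<lambda>k. LINT x|M. (f k x - f' x) \<bullet> g x) \<longlonglongrightarrow> 0"
    by (rule tendsto_sq_zero)
  moreover have "(LINT x|M. (f k x - f' x) \<bullet> g x) = (LINT x|M. f k x \<bullet> g x) - (LINT x|M. f' x \<bullet> g x)" for k
    using assms by (simp add: inner_diff_left integrable_inner)
  ultimately show ?thesis by (simp add: LIM_zero_iff)
qed

lemma sqnorm_add_expand:
  assumes "square_integrable M f" "square_integrable M g"
  shows "sqnorm M (\<lambda>x. f x + g x) = sqnorm M f + 2 * (LINT x|M. f x \<bullet> g x) + sqnorm M g"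
proof -
  have "sqnorm M (\<lambda>x. f x + g x) = (LINT x|M. (norm (f x))\<^sup>2 + 2 * (f x \<bullet> g x) + (norm (g x))\<^sup>2)"
    unfolding sqnorm_def
    by (intro Bochner_Integration.integral_cong) (auto simp: power2_norm_eq_inner algebra_simps inner_commute)
  also have "\<dots> = sqnorm M f + 2 * (LINT x|M. f x \<bullet> g x) + sqnorm M g"
    using assms by (simp add: sqnorm_def square_integrable_integrable integrable_inner)
  finally show ?thesis .
qed

text \<open>In the expansion of \<open>f k\<close> as (f k - f') + f' the cross term is a pairing of
  a null sequence with a fixed function, hence vanishes in the limit.\<close>

lemma L2_tendsto_sqnorm:
  assumes "\<And>k. square_integrable M (f k)" "square_integrable M f'"
    and "(\<lambda>k. sqnorm M (\<lambda>x. f k x - f' x)) \<longlonglongrightarrow> 0"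
  shows "(\<lambda>k. sqnorm M (f k)) \<longlonglongrightarrow> sqnorm M f'"
proof -
  have "(\<lambda>k. LINT x|M. (f k x - f' x) \<bullet> f' x) \<longlonglongrightarrow> (LINT x|M. 0 \<bullet> f' x)"
    by (rule L2_tendsto_integral_inner) (use assms in auto)
  then have "(\<lambda>k. sqnorm M (\<lambda>x. f k x - f' x) + 2 * (LINT x|M. (f k x - f' x) \<bullet> f' x) + sqnorm M f') \<longlonglongrightarrow> 0 + 2 * 0 + sqnorm M f'"
    by (intro tendsto_intros assms) simp
  moreover have "sqnorm M (f k) = sqnorm M (\<lambda>x. f k x - f' x) + 2 * (LINT x|M. (f k x - f' x) \<bullet> f' x) + sqnorm M f'" for k
    using sqnorm_add_expand[of M "\<lambda>x. f k x - f' x" f'] assms by auto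
  ultimately show ?thesis by simp
qed

lemma L2_tendsto_unique_AE:
  assumes "\<And>k. square_integrable M (f k)" "square_integrable M g" "square_integrable M h"
    and "(\<lambda>k. sqnorm M (\<lambda>x. f k x - g x)) \<longlonglongrightarrow> 0" "(\<lambda>k. sqnorm M (\<lambda>x. f k x - h x)) \<longlonglongrightarrow> 0"
  shows "AE x in M. g x = h x"
proof -
  have "sqnorm M (\<lambda>x. g x - h x) \<le> 0"
  proof (rule LIMSEQ_le[OF tendsto_const])
    show "(\<lambda>k. 2 * sqnorm M (\<lambda>x. f k x - h x) + 2 * sqnorm M (\<lambda>x. f k x - g x)) \<longlonglongrightarrow> 0"
      by (auto intro!: tendsto_eq_intros assms)
    have "sqnorm M (\<lambda>x. g x - h x) \<le> 2 * sqnorm M (\<lambda>x. f k x - h x) + 2 * sqnorm M (\<lambda>x. f k x - g x)" for k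
      using sqnorm_diff_le[of M "\<lambda>x. f k x - h x" "\<lambda>x. f k x - g x"] assms by auto
    then show "\<exists>N. \<forall>n\<ge>N. sqnorm M (\<lambda>x. g x - h x) \<le> 2 * sqnorm M (\<lambda>x. f n x - h x) + 2 * sqnorm M (\<lambda>x. f n x - g x)"
      by blast
  qed
  then have "sqnorm M (\<lambda>x. g x - h x) = 0" using sqnorm_nonneg[of M "\<lambda>x. g x - h x"] by linarith
  from sqnorm_eq_0_AE[OF _ this] assms show ?thesis by auto
qed

text \<open>Along a subsequence with \<open>\<parallel>f\<^sub>k\<^sub>+\<^sub>1 - f\<^sub>k\<parallel>\<^sup>2 \<le> 8\<^sup>-\<^sup>k\<close> the sum of \<open>4\<^sup>k \<bar>f\<^sub>k\<^sub>+\<^sub>1 - f\<^sub>k\<bar>\<^sup>2\<close> is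
  integrable, hence finite almost everywhere, which forces geometric convergence there.\<close>

lemma Riesz_Fischer:
  fixes f :: "nat \<Rightarrow> 'a \<Rightarrow> 'b::euclidean_space"
  assumes si: "\<And>k. square_integrable M (f k)"
    and cauchy: "\<And>e. 0 < e \<Longrightarrow> \<exists>N. \<forall>m\<ge>N. \<forall>n\<ge>N. sqnorm M (\<lambda>x. f m x - f n x) < e"
  shows "\<exists>g. square_integrable M g \<and> (\<lambda>k. sqnorm M (\<lambda>x. f k x - g x)) \<longlonglongrightarrow> 0"
proof -
  have [measurable]: "f k \<in> borel_measurable M" for k using si by auto
  \<comment> \<open>Every index is taken beyond its predecessor so that \<open>r\<close> is a
    subsequence; the start has the bound 1, the case k = 0 of (1/8)^k.\<close>
  define r where "r = rec_nat (SOME N. \<forall>m\<ge>N. \<forall>n\<ge>N. sqnorm M (\<lambda>x. f m x - f n x) < 1)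
    (\<lambda>k p. SOME N. N > p \<and> (\<forall>m\<ge>N. \<forall>n\<ge>N. sqnorm M (\<lambda>x. f m x - f n x) < (1/8)^(Suc k)))"
  have r0: "\<forall>m\<ge>r 0. \<forall>n\<ge>r 0. sqnorm M (\<lambda>x. f m x - f n x) < 1"
    using someI_ex[OF cauchy[of 1]] by (simp add: r_def)
  have rS: "r (Suc k) > r k \<and> (\<forall>m\<ge>r (Suc k). \<forall>n\<ge>r (Suc k). sqnorm M (\<lambda>x. f m x - f n x) < (1/8)^(Suc k))" for k
  proof -
    obtain N where N: "\<forall>m\<ge>N. \<forall>n\<ge>N. sqnorm M (\<lambda>x. f m x - f n x) < (1/8)^(Suc k)"
      using cauchy[of "(1/8)^(Suc k)"] by auto
    have "r (Suc k) = (SOME N. N > r k \<and> (\<forall>m\<ge>N. \<forall>n\<ge>N. sqnorm M (\<lambda>x. f m x - f n x) < (1/8)^(Suc k)))"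
      by (simp add: r_def)
    moreover have "max N (Suc (r k)) > r k \<and> (\<forall>m\<ge>max N (Suc (r k)). \<forall>n\<ge>max N (Suc (r k)). sqnorm M (\<lambda>x. f m x - f n x) < (1/8)^(Suc k))"
      using N by auto
    ultimately show ?thesis by (simp only:) (rule someI)
  qed
  have rb: "\<forall>m\<ge>r k. \<forall>n\<ge>r k. sqnorm M (\<lambda>x. f m x - f n x) < (1/8)^k" for k
  proof (cases k)
    case (Suc k')
    then show ?thesis using rS[of k'] by blast
  qed (use r0 in simp)
  have mono: "strict_mono r" using rS by (simp add: strict_mono_Suc_iff)
  define d where "d k x = f (r (Suc k)) x - f (r k) x" for k x
  have [measurable]: "d k \<in> borel_measurable M" for k unfolding d_def by measurable
  have dsi: "square_integrable M (d k)" for k unfolding d_def using si by auto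
  have ds: "sqnorm M (d k) \<le> (1/8)^k" for k
  proof -
    have "sqnorm M (\<lambda>x. f (r (Suc k)) x - f (r k) x) < (1/8)^k"
      using rb[of k] rS[of k] by (meson less_imp_le order_refl)
    then show ?thesis by (simp add: d_def[abs_def])
  qed
  have "(\<integral>\<^sup>+ x. (\<Sum>k. ennreal (4^k * (norm (d k x))\<^sup>2)) \<partial>M) = (\<Sum>k. \<integral>\<^sup>+ x. ennreal (4^k * (norm (d k x))\<^sup>2) \<partial>M)"
    by (intro nn_integral_suminf) measurable
  also have "\<dots> \<le> (\<Sum>k. ennreal ((1/2)^k))"
  proof (intro suminf_le summableI)
    fix k
    have "(\<integral>\<^sup>+ x. ennreal (4^k * (norm (d k x))\<^sup>2) \<partial>M) = ennreal (LINT x|M. 4^k * (norm (d k x))\<^sup>2)"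
      using dsi[of k] by (intro nn_integral_eq_integral) (auto intro: square_integrable_integrable)
    also have "(LINT x|M. 4^k * (norm (d k x))\<^sup>2) = 4^k * sqnorm M (d k)"
      unfolding sqnorm_def by (rule integral_mult_right_zero)
    also have "\<dots> \<le> 4^k * (1/8)^k" using ds by (intro mult_left_mono) auto
    also have "4^k * (1/8)^k = (1/2::real)^k" by (simp add: power_mult_distrib[symmetric])
    finally show "(\<integral>\<^sup>+ x. ennreal (4^k * (norm (d k x))\<^sup>2) \<partial>M) \<le> ennreal ((1/2)^k)" by (simp add: ennreal_leI)
  qed
  also have "\<dots> = ennreal (\<Sum>k. (1/2)^k)" by (intro suminf_ennreal2) auto
  also have "\<dots> < \<infinity>" by simp
  finally have "AE x in M. (\<Sum>k. ennreal (4^k * (norm (d k x))\<^sup>2)) \<noteq> \<infinity>"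
    by (intro nn_integral_noteq_infinite) auto
  then have conv: "AE x in M. (\<lambda>k. f (r k) x) \<longlonglongrightarrow> lim (\<lambda>k. f (r k) x)"
  proof eventually_elim
    case (elim x)
    have "summable (\<lambda>k. 4^k * (norm (d k x))\<^sup>2)"
      by (rule summable_suminf_not_top) (use elim in auto)
    then have "(\<lambda>k. 4^k * (norm (d k x))\<^sup>2) \<longlonglongrightarrow> 0" by (rule summable_LIMSEQ_zero)
    then have "eventually (\<lambda>k. 4^k * (norm (d k x))\<^sup>2 < 1) sequentially"
      by (rule order_tendstoD) simp
    then have ev: "eventually (\<lambda>k. norm (d k x) \<le> (1/2)^k) sequentially"
    proof eventually_elim
      case (elim k)
      have "(norm (d k x))\<^sup>2 \<le> ((1/2)^k)\<^sup>2"
      proof -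
        have "(2 ^ k)\<^sup>2 = (4::real) ^ k" by (simp add: power2_eq_square flip: power_mult_distrib)
        then show ?thesis using elim by (simp add: power_divide field_simps)
      qed
      then show ?case by (rule power2_le_imp_le) auto
    qed
    have "summable (\<lambda>k. d k x)"
    proof -
      from ev obtain N where "\<And>n. n \<ge> N \<Longrightarrow> norm (d n x) \<le> (1/2)^n" unfolding eventually_sequentially by blast
      then have "\<exists>N. \<forall>n\<ge>N. norm (d n x) \<le> (1/2)^n" by blast
      then show ?thesis by (rule summable_comparison_test) (simp add: summable_geometric)
    qed
    then have "convergent (\<lambda>n. \<Sum>k<n. d k x)" by (simp add: summable_iff_convergent)
    moreover have "(\<Sum>k<n. d k x) = f (r n) x - f (r 0) x" for n
      unfolding d_def by (rule sum_lessThan_telescope)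
    ultimately have "convergent (\<lambda>n. f (r n) x - f (r 0) x)" by simp
    then have "convergent (\<lambda>n. (f (r n) x - f (r 0) x) + f (r 0) x)" by (intro convergent_add convergent_const)
    then show ?case by (simp add: convergent_LIMSEQ_iff)
  qed
  define g where "g x = lim (\<lambda>k. f (r k) x)" for x
  have gm [measurable]: "g \<in> borel_measurable M"
    unfolding g_def by measurable
  \<comment> \<open>Fatou's lemma along the subsequence: the limit is known pointwise only, and the
    Cauchy bound on \<open>f (r k) - f n\<close> passes to \<open>g - f n\<close>. Integrability of
    the limit is obtained from the same estimate.\<close>
  have bound: "integrable M (\<lambda>x. (norm (g x - f n x))\<^sup>2) \<and> sqnorm M (\<lambda>x. f n x - g x) \<le> e"
    if "e > 0" "\<forall>m\<ge>N. \<forall>n\<ge>N. sqnorm M (\<lambda>x. f m x - f n x) < e" "n \<ge> N" for e N n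
  proof -
    have "(\<integral>\<^sup>+ x. ennreal ((norm (g x - f n x))\<^sup>2) \<partial>M) = (\<integral>\<^sup>+ x. liminf (\<lambda>k. ennreal ((norm (f (r k) x - f n x))\<^sup>2)) \<partial>M)"
    proof (rule nn_integral_cong_AE)
      show "AE x in M. ennreal ((norm (g x - f n x))\<^sup>2) = liminf (\<lambda>k. ennreal ((norm (f (r k) x - f n x))\<^sup>2))"
        using conv
      proof eventually_elim
        case (elim x)
        have "(\<lambda>k. ennreal ((norm (f (r k) x - f n x))\<^sup>2)) \<longlonglongrightarrow> ennreal ((norm (g x - f n x))\<^sup>2)"
          using elim unfolding g_def by (intro tendsto_intros)
        then show ?case by (rule lim_imp_Liminf[OF trivial_limit_sequentially, symmetric])
      qed
    qed
    also have "\<dots> \<le> liminf (\<lambda>k. \<integral>\<^sup>+ x. ennreal ((norm (f (r k) x - f n x))\<^sup>2) \<partial>M)"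
      by (rule nn_integral_liminf) measurable
    also have "\<dots> \<le> liminf (\<lambda>k. ennreal e)"
    proof (rule Liminf_mono)
      show "\<forall>\<^sub>F k in sequentially. (\<integral>\<^sup>+ x. ennreal ((norm (f (r k) x - f n x))\<^sup>2) \<partial>M) \<le> ennreal e"
      proof (rule eventually_sequentiallyI[of N])
        fix k assume "k \<ge> N"
        then have "r k \<ge> N" using seq_suble[OF mono, of k] by (rule order_trans)
        then have "sqnorm M (\<lambda>x. f (r k) x - f n x) \<le> e" using that by (auto intro: less_imp_le)
        moreover have "(\<integral>\<^sup>+ x. ennreal ((norm (f (r k) x - f n x))\<^sup>2) \<partial>M) = ennreal (sqnorm M (\<lambda>x. f (r k) x - f n x))"
          unfolding sqnorm_def using si by (intro nn_integral_eq_integral square_integrable_integrable) auto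
        ultimately show "(\<integral>\<^sup>+ x. ennreal ((norm (f (r k) x - f n x))\<^sup>2) \<partial>M) \<le> ennreal e" by (simp add: ennreal_leI)
      qed
    qed
    also have "\<dots> = ennreal e" by (simp add: Liminf_const)
    finally have le: "(\<integral>\<^sup>+ x. ennreal ((norm (g x - f n x))\<^sup>2) \<partial>M) \<le> ennreal e" .
    have int: "integrable M (\<lambda>x. (norm (g x - f n x))\<^sup>2)"
      by (rule integrableI_bounded) (use le in \<open>auto simp: order_le_less_trans[OF le]\<close>)
    moreover have "ennreal (sqnorm M (\<lambda>x. f n x - g x)) \<le> ennreal e"
      using le nn_integral_eq_integral[OF int] unfolding sqnorm_minus_commute[of _ "f n"] by (simp add: sqnorm_def)
    ultimately show ?thesis using that(1) by (simp add: ennreal_le_iff)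
  qed
  obtain N where "\<forall>m\<ge>N. \<forall>n\<ge>N. sqnorm M (\<lambda>x. f m x - f n x) < 1" using cauchy[of 1] by auto
  with bound[of 1 N N] have "square_integrable M (\<lambda>x. g x - f N x)" by (simp add: square_integrable_def)
  from square_integrable_add[OF this si[of N]] have "square_integrable M g" by simp
  moreover have "(\<lambda>k. sqnorm M (\<lambda>x. f k x - g x)) \<longlonglongrightarrow> 0"
  proof (rule LIMSEQ_I)
    fix e :: real assume "e > 0"
    then obtain N where N: "\<forall>m\<ge>N. \<forall>n\<ge>N. sqnorm M (\<lambda>x. f m x - f n x) < e/2" using cauchy[of "e/2"] by auto
    have "norm (sqnorm M (\<lambda>x. f n x - g x) - 0) < e" if "n \<ge> N" for n
      using bound[OF _ N that] \<open>e > 0\<close> by simp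
    then show "\<exists>no. \<forall>n\<ge>no. norm (sqnorm M (\<lambda>x. f n x - g x) - 0) < e" by blast
  qed
  ultimately show ?thesis by blast
qed

text \<open>Minimising sequences and the parallelogram law, for a real subspace G that need not be
  closed: g is the projection of v onto the closure of G. The sequence g' in G is returned with it
  because the applications need genuine elements of G (trigonometric sums, gradients of test
  functions) close to g.\<close>

lemma L2_projection:
  fixes v :: "'a \<Rightarrow> 'b::euclidean_space"
  assumes v: "square_integrable M v" and G: "\<And>g. g \<in> G \<Longrightarrow> square_integrable M g"
    and ne: "(\<lambda>x. 0) \<in> G"
    and add: "\<And>g h. g \<in> G \<Longrightarrow> h \<in> G \<Longrightarrow> (\<lambda>x. g x + h x) \<in> G"
    and scale: "\<And>c g. g \<in> G \<Longrightarrow> (\<lambda>x. c *\<^sub>R g x) \<in> G"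
  obtains g' g where "\<And>k. g' k \<in> G" "square_integrable M g"
    "(\<lambda>k. sqnorm M (\<lambda>x. g' k x - g x)) \<longlonglongrightarrow> 0"
    "\<And>h. h \<in> G \<Longrightarrow> (LINT x|M. (v x - g x) \<bullet> h x) = 0"
proof -
  define D where "D = (\<lambda>g. sqnorm M (\<lambda>x. v x - g x)) ` G"
  define \<delta> where "\<delta> = Inf D"
  have bdd: "bdd_below D" by (rule bdd_belowI[of _ 0]) (auto simp: D_def)
  have Dne: "D \<noteq> {}" using ne by (auto simp: D_def)
  have low: "\<delta> \<le> sqnorm M (\<lambda>x. v x - g x)" if "g \<in> G" for g
    unfolding \<delta>_def by (rule cInf_lower[OF _ bdd]) (use that in \<open>auto simp: D_def\<close>)
  have "\<exists>g\<in>G. sqnorm M (\<lambda>x. v x - g x) < \<delta> + 1 / Suc k" for k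
    using cInf_less_iff[OF Dne bdd, of "\<delta> + 1 / Suc k"] by (auto simp: D_def \<delta>_def)
  then obtain g' where g': "\<And>k. g' k \<in> G" "\<And>k. sqnorm M (\<lambda>x. v x - g' k x) < \<delta> + 1 / Suc k" by metis
  have si: "square_integrable M (g' k)" for k using g' G by auto
  \<comment> \<open>The midpoint of g' m and g' n lies in G, so the sum of the two errors has
    squared norm at least 4 \<delta>; the parallelogram law then leaves only the excess over
    \<delta> for their difference.\<close>
  have par: "sqnorm M (\<lambda>x. g' m x - g' n x) \<le> 2 * (1 / Suc m + 1 / Suc n)" for m n
  proof -
    let ?a = "\<lambda>x. v x - g' m x" and ?b = "\<lambda>x. v x - g' n x"
    have a: "square_integrable M ?a" "square_integrable M ?b" using v si by auto
    have "(\<lambda>x. (1/2) *\<^sub>R (g' m x + g' n x)) \<in> G" using g' add scale by auto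
    from low[OF this] have "\<delta> \<le> sqnorm M (\<lambda>x. (1/2) *\<^sub>R (?a x + ?b x))"
      by (simp add: algebra_simps flip: scaleR_add_left)
    also have "\<dots> = (1/4) * sqnorm M (\<lambda>x. ?a x + ?b x)"
      by (subst sqnorm_scaleR) (simp add: power2_eq_square)
    finally have 1: "4 * \<delta> \<le> sqnorm M (\<lambda>x. ?a x + ?b x)" by simp
    have 2: "sqnorm M (\<lambda>x. ?a x + ?b x) = sqnorm M ?a + 2 * (LINT x|M. ?a x \<bullet> ?b x) + sqnorm M ?b"
      by (rule sqnorm_add_expand[OF a])
    have 3: "sqnorm M (\<lambda>x. ?a x + - ?b x) = sqnorm M ?a + 2 * (LINT x|M. ?a x \<bullet> - ?b x) + sqnorm M (\<lambda>x. - ?b x)"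
      by (rule sqnorm_add_expand[OF a(1) square_integrable_uminus[OF a(2)]])
    have 4: "sqnorm M (\<lambda>x. ?a x + - ?b x) = sqnorm M (\<lambda>x. g' m x - g' n x)"
      unfolding sqnorm_minus_commute[of _ "g' m"] by simp
    have 5: "(LINT x|M. ?a x \<bullet> - ?b x) = - (LINT x|M. ?a x \<bullet> ?b x)"
      unfolding inner_minus_right by (rule integral_minus)
    have 6: "sqnorm M (\<lambda>x. - ?b x) = sqnorm M ?b" by (rule sqnorm_uminus)
    have 7: "sqnorm M (\<lambda>x. g' m x - g' n x) = sqnorm M ?a - 2 * (LINT x|M. ?a x \<bullet> ?b x) + sqnorm M ?b"
      using 3 unfolding 4 5 6 by simp
    have "d \<le> 2 * (e + e')"
      if "4 * \<delta> \<le> s" "s = a + 2 * i + b" "d = a - 2 * i + b" "a < \<delta> + e" "b < \<delta> + e'" for a b d e e' i s :: real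
      using that by argo
    from this[OF 1 2 7 g'(2) g'(2)] show ?thesis .
  qed
  have "\<exists>g. square_integrable M g \<and> (\<lambda>k. sqnorm M (\<lambda>x. g' k x - g x)) \<longlonglongrightarrow> 0"
  proof (rule Riesz_Fischer[OF si])
    fix e :: real assume "e > 0"
    obtain N :: nat where N: "1 / Suc N < e / 4" using \<open>e > 0\<close> nat_approx_posE[of "e/4"] by auto
    have "sqnorm M (\<lambda>x. g' m x - g' n x) < e" if "m \<ge> N" "n \<ge> N" for m n
    proof -
      have "1 / Suc m \<le> 1 / Suc N" "1 / Suc n \<le> 1 / Suc N" using that by (auto simp: field_simps)
      then show ?thesis using par[of m n] N by argo
    qed
    then show "\<exists>N. \<forall>m\<ge>N. \<forall>n\<ge>N. sqnorm M (\<lambda>x. g' m x - g' n x) < e" by blast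
  qed
  then obtain g where g: "square_integrable M g" "(\<lambda>k. sqnorm M (\<lambda>x. g' k x - g x)) \<longlonglongrightarrow> 0" by blast
  have vg: "(\<lambda>k. sqnorm M (\<lambda>x. v x - g' k x + h x)) \<longlonglongrightarrow> sqnorm M (\<lambda>x. v x - g x + h x)"
    if h: "square_integrable M h" for h
  proof (rule L2_tendsto_sqnorm)
    have "(v x - g' k x + h x) - (v x - g x + h x) = g x - g' k x" for k x by simp
    then show "(\<lambda>k. sqnorm M (\<lambda>x. (v x - g' k x + h x) - (v x - g x + h x))) \<longlonglongrightarrow> 0"
      using g(2) by (simp only:) (simp add: sqnorm_minus_commute[of M g])
  qed (intro square_integrable_add square_integrable_diff v si g h)+
  have eq: "sqnorm M (\<lambda>x. v x - g x) \<le> \<delta>"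
  proof (rule LIMSEQ_le)
    show "(\<lambda>k. sqnorm M (\<lambda>x. v x - g' k x)) \<longlonglongrightarrow> sqnorm M (\<lambda>x. v x - g x)" using vg[of "\<lambda>_. 0"] by simp
    have "(\<lambda>k. \<delta> + 1 / Suc k) \<longlonglongrightarrow> \<delta> + 0"
      using LIMSEQ_inverse_real_of_nat by (intro tendsto_intros) (simp add: inverse_eq_divide)
    then show "(\<lambda>k. \<delta> + 1 / Suc k) \<longlonglongrightarrow> \<delta>" by simp
    show "\<exists>N. \<forall>n\<ge>N. sqnorm M (\<lambda>x. v x - g' n x) \<le> \<delta> + 1 / real (Suc n)"
      using g'(2) less_imp_le by blast
  qed
  have orth: "(LINT x|M. (v x - g x) \<bullet> h x) = 0" if h: "h \<in> G" for h
  proof -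
    have hs: "square_integrable M h" using h G by auto
    define c where "c = (LINT x|M. (v x - g x) \<bullet> h x)"
    \<comment> \<open>Moving from g in the direction h cannot bring v closer. The quadratic in t is
      minimal at t = - c / \<open>sqnorm M h\<close> with value - c^2 / \<open>sqnorm M h\<close>,
      so c = 0.\<close>
    have ineq: "0 \<le> 2 * t * c + t\<^sup>2 * sqnorm M h" for t
    proof -
      have "\<delta> \<le> sqnorm M (\<lambda>x. v x - g x + t *\<^sub>R h x)"
      proof (rule LIMSEQ_le_const[OF vg])
        show "square_integrable M (\<lambda>x. t *\<^sub>R h x)" using hs by auto
        have "\<delta> \<le> sqnorm M (\<lambda>x. v x - g' n x + t *\<^sub>R h x)" for n
          using low[OF add[OF g'(1)[of n] scale[OF h, of "-t"]]] by (simp add: algebra_simps)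
        then show "\<exists>N. \<forall>n\<ge>N. \<delta> \<le> sqnorm M (\<lambda>x. v x - g' n x + t *\<^sub>R h x)" by blast
      qed
      also have "\<dots> = sqnorm M (\<lambda>x. v x - g x) + 2 * (LINT x|M. (v x - g x) \<bullet> (t *\<^sub>R h x)) + sqnorm M (\<lambda>x. t *\<^sub>R h x)"
        by (rule sqnorm_add_expand) (use v g hs in auto)
      also have "\<dots> = sqnorm M (\<lambda>x. v x - g x) + 2 * t * c + t\<^sup>2 * sqnorm M h"
        by (simp add: c_def sqnorm_scaleR)
      finally show ?thesis using eq by linarith
    qed
    show ?thesis
    proof (cases "sqnorm M h = 0")
      case True
      show ?thesis using ineq[of 1] ineq[of "-1"] True by (simp add: c_def)
    next
      case False
      then have "sqnorm M h > 0" using sqnorm_nonneg[of M h] by linarith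
      have "0 \<le> 2 * (- c / sqnorm M h) * c + (- c / sqnorm M h)\<^sup>2 * sqnorm M h" by (rule ineq)
      also have "\<dots> = - (c\<^sup>2 / sqnorm M h)" using \<open>sqnorm M h > 0\<close> by (simp add: field_simps power2_eq_square)
      finally have "c\<^sup>2 / sqnorm M h \<le> 0" by simp
      then have "c = 0" using \<open>sqnorm M h > 0\<close> by (simp add: divide_le_0_iff)
      then show ?thesis by (simp add: c_def)
    qed
  qed
  show thesis using that g' g orth by blast
qed

section \<open>Calculus of smooth functions\<close>

lemma pderivs_append: "pderivs (is @ js) f = pderivs is (pderivs js f)"
  by (induction "is") auto

lemma smooth_differentiable: "smooth f \<Longrightarrow> f differentiable (at x)"
  unfolding smooth_def by (metis pderivs.simps(1))

lemma smooth_pderiv: "smooth f \<Longrightarrow> smooth (pderivs [i] f)"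
  unfolding smooth_def by (metis pderivs_append)

text \<open>\<open>smooth\<close> speaks of iterated derivatives of every order; this rule replaces
  an induction on the order by the search for a class of differentiable functions closed under one
  derivative. The auxiliary classes below are designed for it.\<close>

lemma smooth_coinduct:
  assumes "f \<in> F" and diff: "\<And>f x. f \<in> F \<Longrightarrow> f differentiable (at x)"
    and step: "\<And>f i. f \<in> F \<Longrightarrow> pderivs [i] f \<in> F"
  shows "smooth f"
proof -
  have "pderivs is f \<in> F" for "is"
  proof (induction "is")
    case (Cons i "is")
    then show ?case using step[OF Cons] by simp
  qed (use assms in simp)
  then show ?thesis using diff by (auto simp: smooth_def)
qed

lemma smooth_continuous_on: "smooth f \<Longrightarrow> continuous_on S f"
  by (meson continuous_at_imp_continuous_on differentiable_imp_continuous_within smooth_differentiable)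

lemma smooth_borel [measurable_dest]: "smooth f \<Longrightarrow> f \<in> borel_measurable borel"
  using smooth_continuous_on by (intro borel_measurable_continuous_onI) auto

lemma pderiv_eqI:
  assumes "(f has_derivative f') (at x)" shows "pderivs [i] f x = f' (axis i 1)"
  using frechet_derivative_at[OF assms] by simp

lemma has_derivative_pderivs:
  fixes f :: "real^'n \<Rightarrow> complex"
  assumes "f differentiable (at x)"
  shows "(f has_derivative (\<lambda>h. \<Sum>i\<in>UNIV. h $ i *\<^sub>R pderivs [i] f x)) (at x)"
proof -
  have d: "(f has_derivative frechet_derivative f (at x)) (at x)"
    using assms by (simp add: frechet_derivative_works)
  then have l: "linear (frechet_derivative f (at x))" by (rule has_derivative_linear)
  have "frechet_derivative f (at x) h = (\<Sum>i\<in>UNIV. h $ i *\<^sub>R pderivs [i] f x)" for h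
  proof -
    have "h = (\<Sum>i\<in>UNIV. h $ i *\<^sub>R axis i 1)"
      using basis_expansion[of h] by (simp add: scalar_mult_eq_scaleR)
    then have "frechet_derivative f (at x) h = frechet_derivative f (at x) (\<Sum>i\<in>UNIV. h $ i *\<^sub>R axis i 1)"
      by simp
    also have "\<dots> = (\<Sum>i\<in>UNIV. h $ i *\<^sub>R frechet_derivative f (at x) (axis i 1))"
      by (simp add: linear_sum[OF l] linear_scale[OF l])
    finally show ?thesis by simp
  qed
  then have "frechet_derivative f (at x) = (\<lambda>h. \<Sum>i\<in>UNIV. h $ i *\<^sub>R pderivs [i] f x)" by (rule ext)
  with d show ?thesis by (simp only:)
qed

lemmas smooth_has_derivative = has_derivative_pderivs[OF smooth_differentiable]

lemma pderiv_add:
  assumes "f differentiable (at x)" "g differentiable (at x)"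
  shows "pderivs [i] (\<lambda>x. f x + g x) x = pderivs [i] f x + pderivs [i] g x"
  by (subst pderiv_eqI[OF has_derivative_add]) (use assms frechet_derivative_works in auto)

lemma pderiv_mult:
  assumes "f differentiable (at x)" "g differentiable (at x)"
  shows "pderivs [i] (\<lambda>x. f x * g x) x = f x * pderivs [i] g x + pderivs [i] f x * g x"
  by (subst pderiv_eqI[OF has_derivative_mult]) (use assms frechet_derivative_works in auto)

lemma pderiv_const [simp]: "pderivs [i] (\<lambda>x. c) = (\<lambda>x. 0)"
  by (rule ext, subst pderiv_eqI[OF has_derivative_const]) simp

text \<open>The product rule turns one product into a sum of two, so products of smooth functions
  are not by themselves closed under derivatives; the generated algebra is.\<close>

inductive_set smooth_alg :: "(real^'n \<Rightarrow> complex) set" where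
  base: "smooth f \<Longrightarrow> f \<in> smooth_alg"
| add: "f \<in> smooth_alg \<Longrightarrow> g \<in> smooth_alg \<Longrightarrow> (\<lambda>x. f x + g x) \<in> smooth_alg"
| mult: "f \<in> smooth_alg \<Longrightarrow> g \<in> smooth_alg \<Longrightarrow> (\<lambda>x. f x * g x) \<in> smooth_alg"

lemma smooth_alg_smooth: assumes "f \<in> smooth_alg" shows "smooth f"
proof -
  have *: "(\<forall>x. f differentiable (at x)) \<and> (\<forall>i. pderivs [i] f \<in> smooth_alg)" if "f \<in> smooth_alg" for f :: "real^'n \<Rightarrow> complex"
    using that
  proof induction
    case (base f)
    then show ?case using smooth_differentiable smooth_pderiv smooth_alg.base by blast
  next
    case (add f g)
    then have "pderivs [i] (\<lambda>x. f x + g x) = (\<lambda>x. pderivs [i] f x + pderivs [i] g x)" for i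
      using pderiv_add by blast
    moreover have "(\<lambda>x. pderivs [i] f x + pderivs [i] g x) \<in> smooth_alg" for i
      by (intro smooth_alg.add) (use add in auto)
    ultimately show ?case using add by (auto intro: differentiable_add)
  next
    case (mult f g)
    then have "pderivs [i] (\<lambda>x. f x * g x) = (\<lambda>x. f x * pderivs [i] g x + pderivs [i] f x * g x)" for i
      using pderiv_mult by blast
    moreover have "(\<lambda>x. f x * pderivs [i] g x + pderivs [i] f x * g x) \<in> smooth_alg" for i
      by (intro smooth_alg.add smooth_alg.mult) (use mult in auto)
    ultimately show ?case using mult by (auto intro: differentiable_mult)
  qed
  show ?thesis by (rule smooth_coinduct[of f smooth_alg]) (use assms * in auto)
qed

lemma smooth_add [intro]: "smooth f \<Longrightarrow> smooth g \<Longrightarrow> smooth (\<lambda>x. f x + g x)"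
  and smooth_mult [intro]: "smooth f \<Longrightarrow> smooth g \<Longrightarrow> smooth (\<lambda>x. f x * g x)"
  by (auto intro!: smooth_alg_smooth intro: smooth_alg.intros)

lemma smooth_const [intro, simp]: "smooth (\<lambda>x. c)"
  by (rule smooth_coinduct[of _ "range (\<lambda>c x. c)"]) auto

lemma smooth_prod [intro]: "(\<And>i. i \<in> I \<Longrightarrow> smooth (f i)) \<Longrightarrow> smooth (\<lambda>x. \<Prod>i\<in>I. f i x)"
  by (induction I rule: infinite_finite_induct) auto

lemma pderiv_linear:
  assumes "bounded_linear f" shows "pderivs [i] f = (\<lambda>x. f (axis i 1))"
  by (rule ext, rule pderiv_eqI, rule bounded_linear_imp_has_derivative[OF assms])

lemma smooth_linear:
  fixes f :: "real^'n \<Rightarrow> complex"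
  assumes "bounded_linear f" shows "smooth f"
proof (rule smooth_coinduct[of _ "insert f (range (\<lambda>c x. c))"])
  fix g and x :: "real^'n" assume "g \<in> insert f (range (\<lambda>c x. c))"
  then show "g differentiable (at x)"
    using assms by (auto intro: bounded_linear_imp_differentiable)
qed (auto simp: pderiv_linear[OF assms] simp del: pderivs.simps)

lemma smooth_coord [intro]: "smooth (\<lambda>x. complex_of_real (x $ i))"
  by (intro smooth_linear bounded_linear_compose[OF bounded_linear_of_real] bounded_linear_vec_nth)

lemma pderiv_coord: "pderivs [i] (\<lambda>x. complex_of_real (x $ j)) x = of_bool (i = j)"
proof -
  have "bounded_linear (\<lambda>x. complex_of_real (x $ j))"
    by (intro bounded_linear_compose[OF bounded_linear_of_real] bounded_linear_vec_nth)
  from pderiv_linear[OF this] show ?thesis by (simp add: axis_def)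
qed

lemma pderiv_cnj:
  assumes "f differentiable (at x)" shows "pderivs [i] (\<lambda>x. cnj (f x)) x = cnj (pderivs [i] f x)"
proof -
  have "(f has_derivative frechet_derivative f (at x)) (at x)"
    using assms by (simp add: frechet_derivative_works)
  from bounded_linear.has_derivative[OF bounded_linear_cnj this] show ?thesis
    by (subst pderiv_eqI) simp_all
qed

lemma smooth_cnj [intro]:
  fixes f :: "real^'n \<Rightarrow> complex"
  assumes "smooth f" shows "smooth (\<lambda>x. cnj (f x))"
proof (rule smooth_coinduct[of _ "(\<lambda>f x. cnj (f x)) ` Collect smooth"])
  fix g :: "real^'n \<Rightarrow> complex" and x :: "real^'n" assume "g \<in> (\<lambda>f x. cnj (f x)) ` Collect smooth"
  then obtain f where f: "smooth f" "g = (\<lambda>x. cnj (f x))" by auto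
  show "g differentiable (at x)"
    using bounded_linear.has_derivative[OF bounded_linear_cnj smooth_has_derivative[OF f(1)]]
    unfolding f(2) differentiable_def by blast
next
  fix g :: "real^'n \<Rightarrow> complex" and i assume "g \<in> (\<lambda>f x. cnj (f x)) ` Collect smooth"
  then obtain f where f: "smooth f" "g = (\<lambda>x. cnj (f x))" by auto
  have "pderivs [i] g = (\<lambda>x. cnj (pderivs [i] f x))"
    unfolding f(2) using pderiv_cnj[OF smooth_differentiable[OF f(1)]] by blast
  then show "pderivs [i] g \<in> (\<lambda>f x. cnj (f x)) ` Collect smooth" using smooth_pderiv[OF f(1)] by blast
qed (use assms in auto)

lemma pderiv_exp:
  assumes "f differentiable (at x)" shows "pderivs [i] (\<lambda>x. exp (f x)) x = exp (f x) * pderivs [i] f x"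
proof -
  have "(f has_derivative frechet_derivative f (at x)) (at x)"
    using assms by (simp add: frechet_derivative_works)
  from has_derivative_compose[OF this DERIV_exp[unfolded has_field_derivative_def]] show ?thesis
    by (subst pderiv_eqI) simp_all
qed

text \<open>The functions exp(f) g with g smooth form a closed class: the derivative is exp(f) (g' +
  f' g).\<close>

lemma smooth_exp [intro]:
  fixes f :: "real^'n \<Rightarrow> complex"
  assumes "smooth f" shows "smooth (\<lambda>x. exp (f x))"
proof (rule smooth_coinduct[of _ "{\<lambda>x. exp (f x) * g x | g. smooth g}"])
  have d: "(\<lambda>x. exp (f x)) differentiable (at x)" for x
    using has_derivative_compose[OF smooth_has_derivative[OF assms] DERIV_exp[unfolded has_field_derivative_def]] unfolding differentiable_def by blast
  fix h assume "h \<in> {\<lambda>x. exp (f x) * g x | g. smooth g}"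
  then obtain g where g: "h = (\<lambda>x. exp (f x) * g x)" "smooth g" by blast
  show "h differentiable (at x)" for x
    unfolding g by (intro differentiable_mult d smooth_differentiable g)
  have "pderivs [i] h = (\<lambda>x. exp (f x) * (pderivs [i] g x + pderivs [i] f x * g x))" for i
    unfolding g(1)
    by (rule ext, subst pderiv_mult[OF d smooth_differentiable[OF g(2)]],
        subst pderiv_exp[OF smooth_differentiable[OF assms]]) (simp only: algebra_simps)
  moreover have "smooth (\<lambda>x. pderivs [i] g x + pderivs [i] f x * g x)" for i
    using assms g(2) by (intro smooth_add smooth_mult smooth_pderiv)
  ultimately show "pderivs [i] h \<in> {\<lambda>x. exp (f x) * g x | g. smooth g}" for i
    by (intro CollectI exI[of _ "\<lambda>x. pderivs [i] g x + pderivs [i] f x * g x"] conjI)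
next
  show "(\<lambda>x. exp (f x)) \<in> {\<lambda>x. exp (f x) * g x | g. smooth g}"
    by (rule CollectI, rule exI[of _ "\<lambda>x. 1"]) simp
qed

text \<open>\<open>bump 0\<close> is the classical flat function exp(-1/t). The division by a power
  of t is there because the derivatives of exp(-1/t) produce such powers; with it the family is
  closed under differentiation up to linear combinations.\<close>

definition bump :: "nat \<Rightarrow> real \<Rightarrow> real" where
  "bump k t = (if 0 < t then exp (- (1 / t)) / t ^ k else 0)"

lemma bump_nonneg [simp]: "0 \<le> bump k t"
  by (simp add: bump_def)

lemma bump_0_le_1: "bump 0 t \<le> 1"
  by (simp add: bump_def)

lemma bump_nonpos: "t \<le> 0 \<Longrightarrow> bump k t = 0"
  by (simp add: bump_def)

text \<open>A single term of the exponential series is at most the whole sum. At x = 1/t this shows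
  that exp(-1/t) is smaller than every power of t near 0.\<close>

lemma power_le_fact_exp: "0 \<le> x \<Longrightarrow> x ^ n \<le> fact n * exp x" for x :: real
proof -
  assume x: "0 \<le> x"
  have "(\<Sum>k\<in>{n}. inverse (fact k) * x ^ k) \<le> (\<Sum>k. inverse (fact k) * x ^ k)"
    by (rule sum_le_suminf) (use x summable_exp[of x] in auto)
  also have "\<dots> = exp x" by (simp add: exp_def divide_inverse mult.commute scaleR_conv_of_real)
  finally show ?thesis by (simp add: field_simps)
qed

lemma bump_le: "bump k t \<le> fact (Suc k) * \<bar>t\<bar>"
proof (cases "0 < t")
  case True
  have "(1 / t) ^ Suc k \<le> fact (Suc k) * exp (1 / t)" by (rule power_le_fact_exp) (use True in simp)
  then have "exp (- (1 / t)) / t ^ k \<le> fact (Suc k) * t"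
    using True by (simp add: exp_minus field_simps del: fact_Suc)
  then show ?thesis using True by (simp add: bump_def del: fact_Suc)
next
  case False
  have "(0::real) \<le> fact (Suc k) * \<bar>t\<bar>" by (intro mult_nonneg_nonneg) (auto simp del: fact_Suc)
  with False show ?thesis by (simp only: bump_def if_False)
qed

lemma has_derivative_bump:
  "(bump k has_real_derivative (bump (k + 2) t - real k * bump (k + 1) t)) (at t)"
proof -
  consider "0 < t" | "t < 0" | "t = 0" by linarith
  then show ?thesis
  proof cases
    case 1
    have "((\<lambda>t. exp (- (1 / t)) / t ^ k) has_real_derivative
        ((exp (- (1 / t)) * (1 / t\<^sup>2)) * t ^ k - exp (- (1 / t)) * (real k * t ^ (k - 1))) / (t ^ k)\<^sup>2) (at t)"
      using 1 by (auto intro!: derivative_eq_intros simp: power2_eq_square)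
    moreover have "((exp (- (1 / t)) * (1 / t\<^sup>2)) * t ^ k - exp (- (1 / t)) * (real k * t ^ (k - 1))) / (t ^ k)\<^sup>2
       = bump (k + 2) t - real k * bump (k + 1) t"
      using 1 by (cases k) (simp_all add: bump_def field_simps power2_eq_square)
    ultimately have "((\<lambda>t. exp (- (1 / t)) / t ^ k) has_real_derivative (bump (k + 2) t - real k * bump (k + 1) t)) (at t)"
      by simp
    then show ?thesis
      by (rule has_field_derivative_transform_within_open[of _ _ _ "{0<..}"]) (use 1 in \<open>auto simp: bump_def\<close>)
  next
    case 2
    have "((\<lambda>t. 0) has_real_derivative (bump (k + 2) t - real k * bump (k + 1) t)) (at t)"
      using 2 by (simp add: bump_def)
    then show ?thesis
      by (rule has_field_derivative_transform_within_open[of _ _ _ "{..<0}"]) (use 2 in \<open>auto simp: bump_def\<close>)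
  next
    case 3
    have "(\<lambda>h. (bump k h - bump k 0) / (h - 0)) \<midarrow>0\<rightarrow> 0"
    proof (rule tendsto_rabs_zero_cancel, rule tendsto_sandwich[OF _ _ tendsto_const])
      show "(\<lambda>h. fact (Suc (Suc k)) * \<bar>h\<bar>) \<midarrow>0\<rightarrow> (0::real)"
        by (auto intro!: tendsto_eq_intros)
      \<comment> \<open>The difference quotient at 0 is, up to sign, the next member of the family,
        which \<open>bump_le\<close> bounds by a multiple of |h|.\<close>
      have "\<bar>(bump k h - bump k 0) / (h - 0)\<bar> = bump (Suc k) h" for h
        by (auto simp: bump_def abs_mult)
      then show "\<forall>\<^sub>F h in at 0. \<bar>(bump k h - bump k 0) / (h - 0)\<bar> \<le> fact (Suc (Suc k)) * \<bar>h\<bar>"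
        using bump_le[of "Suc k"] by (simp del: fact_Suc)
    qed auto
    then show ?thesis unfolding 3 by (subst has_field_derivative_iff) (simp add: bump_def)
  qed
qed

lemma has_derivative_bump_comp:
  fixes p :: "real^'n \<Rightarrow> complex"
  assumes "p differentiable (at x)"
  shows "((\<lambda>x. complex_of_real (bump k (Re (p x)))) has_derivative
    (\<lambda>h. complex_of_real ((bump (k + 2) (Re (p x)) - real k * bump (k + 1) (Re (p x))) * Re (frechet_derivative p (at x) h)))) (at x)"
proof -
  have "(p has_derivative frechet_derivative p (at x)) (at x)"
    using assms by (simp add: frechet_derivative_works)
  then have "((\<lambda>x. Re (p x)) has_derivative (\<lambda>h. Re (frechet_derivative p (at x) h))) (at x)"
    by (rule bounded_linear.has_derivative[OF bounded_linear_Re])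
  from has_derivative_compose[OF this has_derivative_bump[unfolded has_field_derivative_def]]
  show ?thesis by (rule bounded_linear.has_derivative[OF bounded_linear_of_real])
qed

text \<open>One derivative of g times \<open>bump j\<close> of the real part of p yields terms with
  \<open>bump (j + 2)\<close>, \<open>bump (j + 1)\<close> and \<open>bump j\<close>, again with
  smooth factors, so sums of such terms form a class for \<open>smooth_coinduct\<close>. The real
  part appears because smooth functions are complex valued while \<open>bump\<close> has a real
  argument.\<close>

inductive_set bump_alg :: "(real^'n \<Rightarrow> complex) \<Rightarrow> (real^'n \<Rightarrow> complex) set" for p where
  base: "smooth g \<Longrightarrow> (\<lambda>x. g x * complex_of_real (bump j (Re (p x)))) \<in> bump_alg p"
| add: "f \<in> bump_alg p \<Longrightarrow> g \<in> bump_alg p \<Longrightarrow> (\<lambda>x. f x + g x) \<in> bump_alg p"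

lemma pderiv_bump:
  assumes "p differentiable (at x)"
  shows "pderivs [i] (\<lambda>x. complex_of_real (bump k (Re (p x)))) x =
    complex_of_real ((bump (k + 2) (Re (p x)) - real k * bump (k + 1) (Re (p x))) * Re (pderivs [i] p x))"
  by (subst pderiv_eqI[OF has_derivative_bump_comp[OF assms]]) simp

lemma smooth_bump:
  fixes p :: "real^'n \<Rightarrow> complex"
  assumes p: "smooth p" shows "smooth (\<lambda>x. complex_of_real (bump k (Re (p x))))"
proof -
  let ?b = "\<lambda>j x. complex_of_real (bump j (Re (p x)))"
  have d: "?b j differentiable (at x)" for j x
    using has_derivative_bump_comp[OF smooth_differentiable[OF p]] unfolding differentiable_def by blast
  \<comment> \<open>The real part of the derivative written as (z + cnj z) / 2, which makes its
    smoothness visible.\<close>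
  define p' where "p' i x = (pderivs [i] p x + cnj (pderivs [i] p x)) * (1/2)" for i x
  have p's: "smooth (p' i)" for i
    unfolding p'_def[abs_def] by (intro smooth_mult smooth_add smooth_cnj smooth_pderiv p smooth_const)
  have p'e: "complex_of_real (Re (pderivs [i] p x)) = p' i x" for i x
    by (simp add: p'_def complex_eq_iff)
  have *: "(\<forall>x. f differentiable (at x)) \<and> (\<forall>i. pderivs [i] f \<in> bump_alg p)" if "f \<in> bump_alg p" for f
    using that
  proof induction
    case (base g j)
    have "pderivs [i] (\<lambda>x. g x * ?b j x) =
      (\<lambda>x. (g x * p' i x) * ?b (j + 2) x + ((- of_nat j * g x * p' i x) * ?b (j + 1) x + pderivs [i] g x * ?b j x))" for i
    proof
      fix x
      have "pderivs [i] (\<lambda>x. g x * ?b j x) x = g x * pderivs [i] (?b j) x + pderivs [i] g x * ?b j x"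
        by (rule pderiv_mult[OF smooth_differentiable[OF base] d])
      also have "pderivs [i] (?b j) x = (?b (j + 2) x - of_nat j * ?b (j + 1) x) * p' i x"
        unfolding pderiv_bump[OF smooth_differentiable[OF p]] of_real_mult p'e by simp
      also have "a * ((u - n * v) * q) + w = (a * q) * u + ((- n * a * q) * v + w)" for a u n v q w :: complex
        by (simp add: algebra_simps)
      finally show "pderivs [i] (\<lambda>x. g x * ?b j x) x = (g x * p' i x) * ?b (j + 2) x +
          ((- of_nat j * g x * p' i x) * ?b (j + 1) x + pderivs [i] g x * ?b j x)" .
    qed
    moreover have "(\<lambda>x. (g x * p' i x) * ?b (j + 2) x + ((- of_nat j * g x * p' i x) * ?b (j + 1) x + pderivs [i] g x * ?b j x)) \<in> bump_alg p" for i
      by (intro bump_alg.add bump_alg.base smooth_mult smooth_const smooth_pderiv base p's)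
    ultimately have "pderivs [i] (\<lambda>x. g x * ?b j x) \<in> bump_alg p" for i by (simp only:)
    moreover have "(\<lambda>x. g x * ?b j x) differentiable (at x)" for x
      by (intro differentiable_mult smooth_differentiable base d)
    ultimately show ?case by blast
  next
    case (add f g)
    then have "pderivs [i] (\<lambda>x. f x + g x) = (\<lambda>x. pderivs [i] f x + pderivs [i] g x)" for i
      using pderiv_add by blast
    moreover have "(\<lambda>x. pderivs [i] f x + pderivs [i] g x) \<in> bump_alg p" for i
      by (intro bump_alg.add) (use add in auto)
    ultimately show ?case using add by (auto intro: differentiable_add)
  qed
  have "(\<lambda>x. 1 * ?b k x) \<in> bump_alg p" by (intro bump_alg.base smooth_const)
  then have "?b k \<in> bump_alg p" by (simp only: mult_1)
  then show ?thesis by (rule smooth_coinduct) (use * in auto)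
qed

section \<open>Integration by parts and weak derivatives\<close>

text \<open>Lebesgue measurable functions are measurable for the completion of
  \<open>lborel\<close>; real and imaginary part are corrected on a null set separately. Being 0
  outside S, the representative turns integrals over S into integrals over the whole space.\<close>

lemma borel_representative:
  fixes f :: "'a::euclidean_space \<Rightarrow> complex"
  assumes S [measurable]: "S \<in> sets borel" and f: "f \<in> borel_measurable (lebesgue_on S)"
  obtains g where "g \<in> borel_measurable borel" "\<And>x. x \<notin> S \<Longrightarrow> g x = 0" "AE x in lebesgue_on S. f x = g x"
proof -
  have SL: "S \<in> sets lebesgue" using S by simp
  have F: "(\<lambda>x. if x \<in> S then f x else 0) \<in> borel_measurable (completion lborel)"
    using f borel_measurable_if[OF SL] by blast
  have "(\<lambda>x. Re (if x \<in> S then f x else 0)) \<in> borel_measurable (completion lborel)"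
    "(\<lambda>x. Im (if x \<in> S then f x else 0)) \<in> borel_measurable (completion lborel)"
    using F by (auto intro: measurable_compose[OF F borel_measurable_Re] measurable_compose[OF F borel_measurable_Im])
  from this[THEN completion_ex_borel_measurable_real]
  obtain u v where u: "u \<in> borel_measurable lborel" "AE x in lborel. Re (if x \<in> S then f x else 0) = u x"
    and v: "v \<in> borel_measurable lborel" "AE x in lborel. Im (if x \<in> S then f x else 0) = v x"
    by blast
  define g where "g x = indicator S x *\<^sub>R Complex (u x) (v x)" for x
  have [measurable]: "u \<in> borel_measurable borel" "v \<in> borel_measurable borel" using u v by auto
  have "(\<lambda>x. indicator S x *\<^sub>R (complex_of_real (u x) + \<i> * complex_of_real (v x))) \<in> borel_measurable borel"
    by measurable
  then have g1: "g \<in> borel_measurable borel" by (simp add: g_def[abs_def] Complex_eq)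
  have "AE x in lborel. x \<in> S \<longrightarrow> f x = g x"
    using u(2) v(2) by eventually_elim (auto simp: g_def complex_eq_iff)
  then have "AE x in lebesgue_on S. f x = g x"
    using SL by (simp add: AE_restrict_space_iff AE_completion)
  then show ?thesis using that[of g] g1 by (simp add: g_def)
qed

section \<open>From integrals over a set to integrals over the whole space\<close>

lemma AE_lebesgue_onI:
  assumes "S \<in> sets borel" "AE x in lborel. x \<in> S \<longrightarrow> P x" shows "AE x in lebesgue_on S. P x"
  using assms by (simp add: AE_restrict_space_iff AE_completion)

lemma
  fixes f :: "'a::euclidean_space \<Rightarrow> 'b::euclidean_space"
  assumes S: "S \<in> sets borel" and f: "f \<in> borel_measurable borel"
  shows integral_lebesgue_on_borel: "(LINT x|lebesgue_on S. f x) = (LINT x|lborel. indicator S x *\<^sub>R f x)"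
    and integrable_lebesgue_on_borel: "integrable (lebesgue_on S) f \<longleftrightarrow> integrable lborel (\<lambda>x. indicator S x *\<^sub>R f x)"
proof -
  have m: "(\<lambda>x. indicator S x *\<^sub>R f x) \<in> borel_measurable lborel" using S f by simp
  show "(LINT x|lebesgue_on S. f x) = (LINT x|lborel. indicator S x *\<^sub>R f x)"
    using S m by (subst integral_restrict_space) (simp_all add: integral_completion)
  show "integrable (lebesgue_on S) f \<longleftrightarrow> integrable lborel (\<lambda>x. indicator S x *\<^sub>R f x)"
    using S m by (subst integrable_restrict_space) (simp_all add: integrable_completion)
qed

lemma borel_measurable_lebesgue_on:
  "f \<in> borel_measurable borel \<Longrightarrow> f \<in> borel_measurable (lebesgue_on S)"
  by (intro measurable_restrict_space1 measurable_completion) simp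

text \<open>Boxes are an intersection-stable generator of the Borel sets, so Dynkin's argument
  extends the vanishing of the integral to all Borel sets, and an integrable function with that
  property is 0 almost everywhere.\<close>

lemma AE_zero_if_box_integrals_zero:
  fixes f :: "'a::euclidean_space \<Rightarrow> complex"
  assumes f: "integrable lborel f" and box0: "\<And>a b. (LINT x|lborel. indicator (box a b) x *\<^sub>R f x) = 0"
  shows "AE x in lborel. f x = 0"
proof (rule sigma_finite_measure.density_zero[OF sigma_finite_lborel])
  have [measurable]: "f \<in> borel_measurable borel" using f by auto
  have ind: "integrable lborel (\<lambda>x. indicator A x *\<^sub>R f x)" if "A \<in> sets borel" for A
    using that f by (intro integrable_mult_indicator) auto
  \<comment> \<open>The complement step of the induction needs the integral over the whole space,
    which is the limit over growing boxes.\<close>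
  have uni: "(LINT x|lborel. f x) = 0"
  proof -
    have "(\<lambda>n. LINT x|lborel. indicator (box (- real n *\<^sub>R One) (real n *\<^sub>R One)) x *\<^sub>R f x) \<longlonglongrightarrow> (LINT x|lborel. f x)"
    proof (rule integral_dominated_convergence[where w = "\<lambda>x. norm (f x)"])
      show "AE x in lborel. (\<lambda>n. indicator (box (- real n *\<^sub>R One) (real n *\<^sub>R One)) x *\<^sub>R f x) \<longlonglongrightarrow> f x"
      proof (rule AE_I2, rule tendsto_eventually, rule eventually_sequentiallyI)
        fix x :: 'a and n :: nat assume n: "nat \<lceil>norm x + 1\<rceil> \<le> n"
        then have "norm x < real n" by linarith
        then have "\<bar>x \<bullet> i\<bar> < real n" if "i \<in> Basis" for i
          using Basis_le_norm[OF that, of x] by linarith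
        then have "x \<in> box (- real n *\<^sub>R One) (real n *\<^sub>R One)"
          by (auto simp: mem_box abs_less_iff) (metis minus_less_iff)
        then show "indicator (box (- real n *\<^sub>R One) (real n *\<^sub>R One)) x *\<^sub>R f x = f x" by simp
      qed
    qed (use f in \<open>auto split: split_indicator\<close>)
    then show ?thesis using box0 by (simp add: LIMSEQ_const_iff)
  qed
  fix A :: "'a set" assume "A \<in> sets lborel"
  then have A: "A \<in> sigma_sets UNIV (range (\<lambda>(a, b). box a b))"
    by (simp add: borel_eq_box)
  have 1: "Int_stable (range (\<lambda>(a, b). box a b :: 'a set))"
    unfolding Int_stable_def by (auto simp: box_Int_box)
  have 2: "range (\<lambda>(a, b). box a b :: 'a set) \<subseteq> Pow UNIV" by simp
  from 1 2 A have "(LINT x|lborel. indicator A x *\<^sub>R f x) = 0"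
  proof (induction rule: sigma_sets_induct_disjoint)
    case (basic A)
    then obtain a b where "A = box a b" by auto
    then show ?case by (simp only: box0)
  next
    case (compl A)
    then have "A \<in> sets borel" unfolding borel_eq_box by simp
    have "(LINT x|lborel. indicator (UNIV - A) x *\<^sub>R f x) = (LINT x|lborel. f x - indicator A x *\<^sub>R f x)"
      by (intro Bochner_Integration.integral_cong) (auto split: split_indicator)
    also have "\<dots> = 0" using f ind[OF \<open>A \<in> sets borel\<close>] uni compl by simp
    finally show ?case .
  next
    case (union A)
    then have A [measurable]: "A i \<in> sets borel" for i unfolding borel_eq_box by auto
    have "(\<lambda>n. LINT x|lborel. indicator (\<Union>i<n. A i) x *\<^sub>R f x) \<longlonglongrightarrow> (LINT x|lborel. indicator (\<Union>i. A i) x *\<^sub>R f x)"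
    proof (rule integral_dominated_convergence[where w = "\<lambda>x. norm (f x)"])
      show "AE x in lborel. (\<lambda>n. indicator (\<Union>i<n. A i) x *\<^sub>R f x) \<longlonglongrightarrow> indicator (\<Union>i. A i) x *\<^sub>R f x"
        by (intro AE_I2 tendsto_scaleR LIMSEQ_indicator_UN tendsto_const)
    qed (use f in \<open>auto split: split_indicator\<close>)
    moreover have "(LINT x|lborel. indicator (\<Union>i<n. A i) x *\<^sub>R f x) = 0" for n
    proof -
      have "(LINT x|lborel. indicator (\<Union>i<n. A i) x *\<^sub>R f x) = (LINT x|lborel. (\<Sum>i<n. indicator (A i) x *\<^sub>R f x))"
      proof (intro Bochner_Integration.integral_cong refl)
        fix x
        have "disjoint_family_on A {..<n}" using union(1) by (auto simp: disjoint_family_on_def)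
        then have "indicator (\<Union>i<n. A i) x = (\<Sum>i<n. indicator (A i) x :: real)"
          by (rule indicator_UN_disjoint[OF finite_lessThan])
        then show "indicator (\<Union>i<n. A i) x *\<^sub>R f x = (\<Sum>i<n. indicator (A i) x *\<^sub>R f x)"
          by (simp add: scaleR_sum_left)
      qed
      also have "\<dots> = 0" using ind[OF A] union(3) by (subst Bochner_Integration.integral_sum) auto
      finally show ?thesis .
    qed
    ultimately show ?case by (simp add: LIMSEQ_const_iff)
  qed simp
  then show "set_lebesgue_integral lborel A f = 0" by (simp add: set_lebesgue_integral_def)
qed (rule f)

section \<open>Smooth functions of bounded support\<close>

lemma bounded_if_bounded_support:
  fixes f :: "real^'n \<Rightarrow> complex"
  assumes "smooth f" "bounded {x. f x \<noteq> 0}"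
  obtains B where "0 \<le> B" "\<And>x. norm (f x) \<le> B"
proof -
  obtain R where R: "{x. f x \<noteq> 0} \<subseteq> cball 0 R" using bounded_subset_ballD[OF assms(2), of 0] ball_subset_cball by (meson order_trans)
  have "compact (f ` cball 0 R)"
    by (intro compact_continuous_image smooth_continuous_on assms compact_cball)
  then obtain B where B: "\<forall>y\<in>f ` cball 0 R. norm y \<le> B" using compact_imp_bounded bounded_iff by blast
  have "norm (f x) \<le> max B 0" for x
    using B R by (cases "f x = 0") (force simp: le_max_iff_disj)+
  then show ?thesis using that[of "max B 0"] by auto
qed

lemma pderiv_support: "{x. pderivs [i] f x \<noteq> 0} \<subseteq> closure {x. f x \<noteq> 0}"
proof
  fix x assume x: "x \<in> {x. pderivs [i] f x \<noteq> 0}"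
  show "x \<in> closure {x. f x \<noteq> 0}"
  proof (rule ccontr)
    assume "x \<notin> closure {x. f x \<noteq> 0}"
    then have "x \<in> - closure {x. f x \<noteq> 0}" "open (- closure {x. f x \<noteq> 0})" by auto
    have "((\<lambda>x. 0) has_derivative (\<lambda>h. 0)) (at x)" by simp
    then have "(f has_derivative (\<lambda>h. 0)) (at x)"
    proof (rule has_derivative_transform_within_open)
      fix y assume "y \<in> - closure {x. f x \<noteq> 0}"
      then have "y \<notin> {x. f x \<noteq> 0}" using closure_subset[of "{x. f x \<noteq> 0}"] by blast
      then show "0 = f y" by simp
    qed fact+
    then have "pderivs [i] f x = 0" by (rule pderiv_eqI)
    then show False using x by simp
  qed
qed

lemma bounded_pderiv_support:
  "bounded {x. f x \<noteq> 0} \<Longrightarrow> bounded {x. pderivs [i] f x \<noteq> 0}"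
  using pderiv_support bounded_subset bounded_closure by metis

lemma integrable_smooth:
  fixes f :: "real^'n \<Rightarrow> complex"
  assumes f: "smooth f" and b: "bounded {x. f x \<noteq> 0}"
  shows "integrable lborel f"
proof -
  obtain R where R: "{x. f x \<noteq> 0} \<subseteq> cball 0 R" using bounded_subset_ballD[OF b, of 0] ball_subset_cball by (meson order_trans)
  obtain B where B: "0 \<le> B" "\<And>x. norm (f x) \<le> B" using bounded_if_bounded_support[OF f b] by blast
  show ?thesis
  proof (rule Bochner_Integration.integrable_bound)
    show "integrable lborel (\<lambda>x. B * indicator (cball 0 R) x :: real)"
      by (intro integrable_mult_right integrable_real_indicator) (auto intro: emeasure_bounded_finite[unfolded infinity_ennreal_def])
    show "AE x in lborel. norm (f x) \<le> norm (B * indicator (cball 0 R) x)"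
      using R B by (intro AE_I2) (auto split: split_indicator)
  qed (use f in auto)
qed

text \<open>Mean value inequality along a coordinate direction; it dominates the difference
  quotients in \<open>integral_pderiv_eq_0\<close>.\<close>

lemma pderiv_increment_bound:
  fixes f :: "real^'n \<Rightarrow> complex"
  assumes f: "smooth f" and B: "\<And>x. norm (pderivs [i] f x) \<le> B" and t: "0 \<le> t"
  shows "norm (f (x + t *\<^sub>R axis i 1) - f x) \<le> B * t"
proof -
  have d: "((\<lambda>s. f (x + s *\<^sub>R axis i 1)) has_derivative (\<lambda>h. h *\<^sub>R pderivs [i] f (x + s *\<^sub>R axis i 1))) (at s)" for s
  proof -
    have 1: "((\<lambda>s. x + s *\<^sub>R axis i 1) has_derivative (\<lambda>h. h *\<^sub>R axis i 1)) (at s)"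
      by (auto intro!: derivative_eq_intros)
    have "(\<Sum>j\<in>UNIV. (h *\<^sub>R axis i 1 :: real^'n) $ j *\<^sub>R pderivs [j] f y) = h *\<^sub>R pderivs [i] f y" for h y
    proof -
      have "(\<Sum>j\<in>UNIV. (h *\<^sub>R axis i 1 :: real^'n) $ j *\<^sub>R pderivs [j] f y) = (\<Sum>j\<in>UNIV. if j = i then h *\<^sub>R pderivs [j] f y else 0)"
        by (intro sum.cong refl) (simp add: axis_def)
      then show ?thesis by simp
    qed
    with has_derivative_compose[OF 1 smooth_has_derivative[OF f]] show ?thesis by simp
  qed
  have "norm ((\<lambda>s. f (x + s *\<^sub>R axis i 1)) t - (\<lambda>s. f (x + s *\<^sub>R axis i 1)) 0) \<le> B * norm (t - 0)"
  proof (rule differentiable_bound[of UNIV])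
    show "onorm (\<lambda>h. h *\<^sub>R pderivs [i] f (x + s *\<^sub>R axis i 1)) \<le> B" for s
      by (rule onorm_le) (use mult_right_mono[OF B abs_ge_zero] in \<open>simp add: mult.commute del: pderivs.simps\<close>)
  qed (use d in \<open>auto intro: has_derivative_at_withinI\<close>)
  then show ?thesis using t by simp
qed

lemma integral_translate:
  fixes f :: "'a::euclidean_space \<Rightarrow> complex"
  assumes "f \<in> borel_measurable borel"
  shows "(LINT x|lborel. f (x + c)) = (LINT x|lborel. f x)"
proof -
  have "(LINT x|lborel. f x) = (LINT x|distr lborel borel ((+) c). f x)" by (simp add: lborel_distr_plus)
  also have "\<dots> = (LINT x|lborel. f (c + x))" by (rule integral_distr) (use assms in auto)
  finally show ?thesis by (simp add: add.commute)
qed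

text \<open>Difference quotients integrate to \<open>0\<close> by translation invariance, and they converge dominatedly.\<close>

lemma integral_pderiv_eq_0:
  fixes f :: "real^'n \<Rightarrow> complex"
  assumes f: "smooth f" and b: "bounded {x. f x \<noteq> 0}"
  shows "(LINT x|lborel. pderivs [i] f x) = 0"
proof -
  let ?e = "axis i 1 :: real^'n"
  define t where "t k = 1 / real (Suc k)" for k
  have t: "0 < t k" "t k \<le> 1" for k by (auto simp: t_def)
  have t0: "t \<longlonglongrightarrow> 0" unfolding t_def using LIMSEQ_inverse_real_of_nat by (simp add: inverse_eq_divide)
  define D where "D k x = (1 / t k) *\<^sub>R (f (x + t k *\<^sub>R ?e) - f x)" for k x
  obtain R where R: "{x. f x \<noteq> 0} \<subseteq> cball 0 R" using bounded_subset_ballD[OF b, of 0] ball_subset_cball by (meson order_trans)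
  obtain B where B: "0 \<le> B" "\<And>x. norm (pderivs [i] f x) \<le> B"
    using bounded_if_bounded_support[OF smooth_pderiv[OF f] bounded_pderiv_support[OF b]] by blast
  have [measurable]: "f \<in> borel_measurable borel" using f by auto
  have int: "integrable lborel (\<lambda>x. f (x + c))" for c
    using integrable_smooth[OF f b] integrable_distr[of "(+) c" lborel borel f]
    by (simp add: lborel_distr_plus add.commute)
  have "(LINT x|lborel. D k x) = 0" for k
    unfolding D_def using int[of "t k *\<^sub>R ?e"] integrable_smooth[OF f b] by (simp add: integral_translate)
  moreover have "(\<lambda>k. LINT x|lborel. D k x) \<longlonglongrightarrow> (LINT x|lborel. pderivs [i] f x)"
  \<comment> \<open>The radius is enlarged by 1 because the shifts \<open>t k\<close> are at most 1:
    outside the larger ball both values in the difference quotient are 0.\<close>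
  proof (rule integral_dominated_convergence[where w = "\<lambda>x. B * indicator (cball 0 (R + 1)) x"])
    show "integrable lborel (\<lambda>x. B * indicator (cball 0 (R + 1)) x :: real)"
      by (intro integrable_mult_right integrable_real_indicator) (auto intro: emeasure_bounded_finite[unfolded infinity_ennreal_def])
    show "pderivs [i] f \<in> borel_measurable lborel" using smooth_pderiv[OF f] by auto
    show "D k \<in> borel_measurable lborel" for k unfolding D_def[abs_def] by measurable
    show "AE x in lborel. norm (D k x) \<le> B * indicator (cball 0 (R + 1)) x" for k
    proof (rule AE_I2)
      fix x
      show "norm (D k x) \<le> B * indicator (cball 0 (R + 1)) x"
      proof (cases "x \<in> cball 0 (R + 1)")
        case True
        have "norm (D k x) = (1 / t k) * norm (f (x + t k *\<^sub>R ?e) - f x)" using t[of k] by (simp add: D_def)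
        also have "\<dots> \<le> (1 / t k) * (B * t k)"
          by (intro mult_left_mono pderiv_increment_bound f B) (use t[of k] in auto)
        also have "\<dots> = B" using t[of k] by simp
        finally show ?thesis using True by simp
      next
        case False
        have "norm x \<le> norm (x + t k *\<^sub>R ?e) + norm (t k *\<^sub>R ?e)"
          by (metis add_diff_cancel_right' norm_triangle_ineq4)
        moreover have "norm (t k *\<^sub>R ?e) \<le> 1" using t[of k] by (simp add: norm_axis_1)
        ultimately have "x \<notin> cball 0 R" "x + t k *\<^sub>R ?e \<notin> cball 0 R" using False by auto
        then have "f x = 0" "f (x + t k *\<^sub>R ?e) = 0" using R by blast+
        then show ?thesis using B by (simp add: D_def)
      qed
    qed
    show "AE x in lborel. (\<lambda>k. D k x) \<longlonglongrightarrow> pderivs [i] f x"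
    proof (rule AE_I2)
      fix x
      have "((\<lambda>s. f (x + s *\<^sub>R ?e)) has_derivative (\<lambda>h. frechet_derivative f (at x) (h *\<^sub>R ?e))) (at 0)"
      proof (rule has_derivative_compose[of "\<lambda>s. x + s *\<^sub>R ?e" "\<lambda>h. h *\<^sub>R ?e" 0 UNIV f])
        show "((\<lambda>s. x + s *\<^sub>R ?e) has_derivative (\<lambda>h. h *\<^sub>R ?e)) (at 0)"
          by (auto intro!: derivative_eq_intros)
      qed (use smooth_differentiable[OF f] in \<open>simp add: frechet_derivative_works\<close>)
      moreover have "frechet_derivative f (at x) (h *\<^sub>R ?e) = h *\<^sub>R pderivs [i] f x" for h
        using linear_scale[OF linear_frechet_derivative[OF smooth_differentiable[OF f]]] by simp
      ultimately have "((\<lambda>s. f (x + s *\<^sub>R ?e)) has_derivative (\<lambda>h. h *\<^sub>R pderivs [i] f x)) (at 0)"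
        by simp
      then have "(\<lambda>s. norm (f (x + s *\<^sub>R ?e) - f x - s *\<^sub>R pderivs [i] f x) / norm s) \<midarrow>0\<rightarrow> 0"
        by (simp add: has_derivative_at)
      then have "(\<lambda>s. norm ((1 / s) *\<^sub>R (f (x + s *\<^sub>R ?e) - f x) - pderivs [i] f x)) \<midarrow>0\<rightarrow> 0"
      proof (rule Lim_transform_eventually)
        have "norm (f (x + s *\<^sub>R ?e) - f x - s *\<^sub>R pderivs [i] f x) / norm s =
            norm ((1 / s) *\<^sub>R (f (x + s *\<^sub>R ?e) - f x) - pderivs [i] f x)" if "s \<noteq> 0" for s
        proof -
          have "(1 / s) *\<^sub>R (f (x + s *\<^sub>R ?e) - f x) - pderivs [i] f x = (1 / s) *\<^sub>R (f (x + s *\<^sub>R ?e) - f x - s *\<^sub>R pderivs [i] f x)"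
            using that by (simp add: scaleR_diff_right del: pderivs.simps)
          then show ?thesis by (simp del: pderivs.simps)
        qed
        then show "\<forall>\<^sub>F s in at 0. norm (f (x + s *\<^sub>R ?e) - f x - s *\<^sub>R pderivs [i] f x) / norm s =
            norm ((1 / s) *\<^sub>R (f (x + s *\<^sub>R ?e) - f x) - pderivs [i] f x)"
          by (auto simp: eventually_at_filter simp del: pderivs.simps)
      qed
      then have "((\<lambda>s. (1 / s) *\<^sub>R (f (x + s *\<^sub>R ?e) - f x)) \<longlongrightarrow> pderivs [i] f x) (at 0)"
        by (rule LIM_zero_cancel[OF tendsto_norm_zero_cancel])
      moreover have "filterlim t (at 0) sequentially"
        unfolding filterlim_at using t0 t(1) by (intro conjI always_eventually allI) (simp_all add: less_imp_neq[symmetric])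
      ultimately show "(\<lambda>k. D k x) \<longlonglongrightarrow> pderivs [i] f x"
        unfolding D_def by (rule filterlim_compose)
    qed
  qed
  ultimately show ?thesis by (simp add: LIMSEQ_const_iff)
qed

lemma L2_iff: "f \<in> L2 S \<longleftrightarrow> square_integrable (lebesgue_on S) f"
  for f :: "'a::euclidean_space \<Rightarrow> 'b::euclidean_space"
  by (simp add: L2_def square_integrable_def)

lemma L2_norm_sq: "(L2_norm S f)\<^sup>2 = sqnorm (lebesgue_on S) f"
  for f :: "'a::euclidean_space \<Rightarrow> 'b::euclidean_space"
  by (simp add: L2_norm_def sqnorm_def)

lemma finite_measure_lebesgue_on:
  assumes "bounded S" "S \<in> sets borel" shows "finite_measure (lebesgue_on S)"
proof
  have "emeasure (lebesgue_on S) (space (lebesgue_on S)) = emeasure lborel S"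
    using assms by (simp add: emeasure_restrict_space)
  then show "emeasure (lebesgue_on S) (space (lebesgue_on S)) \<noteq> \<infinity>"
    using emeasure_bounded_finite[OF assms(1)] by simp
qed

lemma integrable_if_square_integrable:
  assumes "finite_measure M" "square_integrable M f" shows "integrable M f"
proof -
  interpret finite_measure M by fact
  have "integrable M (\<lambda>x. norm (f x))"
  proof (rule square_integrable_imp_integrable)
    show "integrable M (\<lambda>x. (norm (f x))\<^sup>2)" by (rule square_integrable_integrable[OF assms(2)])
  qed (use square_integrable_measurable[OF assms(2)] in measurable)
  then show ?thesis using assms(2) by (simp add: integrable_norm_iff square_integrable_measurable)
qed

lemma square_integrable_continuous:
  fixes f :: "'a::euclidean_space \<Rightarrow> 'b::euclidean_space"
  assumes S: "bounded S" "S \<in> sets borel" and f: "continuous_on UNIV f"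
  shows "square_integrable (lebesgue_on S) f"
proof -
  interpret finite_measure "lebesgue_on S" by (rule finite_measure_lebesgue_on[OF S])
  have "compact (f ` closure S)"
    using S f by (intro compact_continuous_image continuous_on_subset[OF f]) (auto simp: compact_closure)
  then obtain B where B: "\<And>x. x \<in> closure S \<Longrightarrow> norm (f x) \<le> B"
    using compact_imp_bounded[of "f ` closure S"] by (auto simp: bounded_iff)
  have m: "f \<in> borel_measurable (lebesgue_on S)"
    by (intro borel_measurable_lebesgue_on borel_measurable_continuous_onI f)
  have "integrable (lebesgue_on S) (\<lambda>x. (norm (f x))\<^sup>2)"
  proof (rule integrable_const_bound[of _ "B\<^sup>2"])
    show "AE x in lebesgue_on S. norm ((norm (f x))\<^sup>2) \<le> B\<^sup>2"
    proof (rule AE_I2)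
      fix x assume "x \<in> space (lebesgue_on S)"
      then have "norm (f x) \<le> B" using B closure_subset[of S] by auto
      then show "norm ((norm (f x))\<^sup>2) \<le> B\<^sup>2" by (simp add: power_mono)
    qed
  qed (use m in measurable)
  then show ?thesis using m by (simp add: square_integrable_def)
qed

lemma square_integrable_smooth:
  "bounded S \<Longrightarrow> open S \<Longrightarrow> smooth f \<Longrightarrow> square_integrable (lebesgue_on S) f"
  by (intro square_integrable_continuous smooth_continuous_on) auto

section \<open>Test functions and the fundamental lemma of the calculus of variations\<close>

lemma test_functionD:
  assumes "\<phi> \<in> test_functions S"
  shows "smooth \<phi>" "bounded {x. \<phi> x \<noteq> 0}" "\<phi> x \<noteq> 0 \<Longrightarrow> x \<in> S"
proof -
  show "smooth \<phi>" "bounded {x. \<phi> x \<noteq> 0}"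
    using assms bounded_subset[OF compact_imp_bounded closure_subset] unfolding test_functions_def by auto
  show "x \<in> S" if "\<phi> x \<noteq> 0"
    using assms that closure_subset[of "{x. \<phi> x \<noteq> 0}"] unfolding test_functions_def by blast
qed

lemma test_function_pderiv:
  assumes "\<phi> \<in> test_functions S" shows "pderivs [i] \<phi> \<in> test_functions S"
proof -
  have sub: "closure {x. pderivs [i] \<phi> x \<noteq> 0} \<subseteq> closure {x. \<phi> x \<noteq> 0}"
    by (rule closure_minimal[OF pderiv_support closed_closure])
  have "compact (closure {x. pderivs [i] \<phi> x \<noteq> 0})"
    using assms compact_Int_closed[of "closure {x. \<phi> x \<noteq> 0}" "closure {x. pderivs [i] \<phi> x \<noteq> 0}"] sub
    by (simp add: test_functions_def Int_absorb1 del: pderivs.simps)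
  then show ?thesis
    using assms sub smooth_pderiv unfolding test_functions_def by blast
qed

text \<open>The shift by -1 in the arguments keeps the support at distance 1/(k+1) from the faces of
  the box, hence compact inside it. As k grows these products tend to the indicator of the box, see
  \<open>box_bump_tendsto\<close>.\<close>

lemma box_bump_test_function:
  fixes a b :: "real^'n"
  assumes S: "box a b \<subseteq> S"
  shows "(\<lambda>x. \<Prod>i\<in>UNIV. complex_of_real (bump 0 (real (Suc k) * (x $ i - a $ i) - 1) * bump 0 (real (Suc k) * (b $ i - x $ i) - 1)))
     \<in> test_functions S" (is "?\<phi> \<in> _")
proof -
  let ?p = "\<lambda>i x. complex_of_real (real (Suc k)) * complex_of_real (x $ i) + complex_of_real (- real (Suc k) * a $ i - 1)"
  let ?q = "\<lambda>i x. complex_of_real (- real (Suc k)) * complex_of_real (x $ i) + complex_of_real (real (Suc k) * b $ i - 1)"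
  have "smooth (\<lambda>x. \<Prod>i\<in>UNIV. complex_of_real (bump 0 (Re (?p i x))) * complex_of_real (bump 0 (Re (?q i x))))"
    by (intro smooth_prod smooth_mult smooth_bump smooth_add smooth_const smooth_coord)
  moreover have "?\<phi> = (\<lambda>x. \<Prod>i\<in>UNIV. complex_of_real (bump 0 (Re (?p i x))) * complex_of_real (bump 0 (Re (?q i x))))"
    by (simp add: algebra_simps)
  ultimately have sm: "smooth ?\<phi>" by (simp only:)
  let ?s = "\<chi> i. 1 / real (Suc k)"
  have sub: "closure {x. ?\<phi> x \<noteq> 0} \<subseteq> cbox (a + ?s) (b - ?s)"
  proof (rule closure_minimal[OF _ closed_cbox], rule subsetI)
    fix x assume "x \<in> {x. ?\<phi> x \<noteq> 0}"
    then have "bump 0 (real (Suc k) * (x $ i - a $ i) - 1) \<noteq> 0" "bump 0 (real (Suc k) * (b $ i - x $ i) - 1) \<noteq> 0" for i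
      by (auto simp del: of_nat_Suc)
    then have "0 < real (Suc k) * (x $ i - a $ i) - 1" "0 < real (Suc k) * (b $ i - x $ i) - 1" for i
      using bump_nonpos not_le by blast+
    then have "a $ i + 1 / real (Suc k) \<le> x $ i" "x $ i \<le> b $ i - 1 / real (Suc k)" for i
      by (simp_all add: field_simps del: of_nat_Suc) (simp_all add: less_imp_le algebra_simps)
    then show "x \<in> cbox (a + ?s) (b - ?s)" by (simp add: mem_box_cart)
  qed
  moreover have "cbox (a + ?s) (b - ?s) \<subseteq> box a b"
  proof
    fix x assume x: "x \<in> cbox (a + ?s) (b - ?s)"
    have "a $ i < x $ i \<and> x $ i < b $ i" for i
    proof -
      have "a $ i + 1 / real (Suc k) \<le> x $ i" "x $ i \<le> b $ i - 1 / real (Suc k)" "0 < 1 / real (Suc k)"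
        using x by (auto simp: mem_box_cart)
      then show ?thesis by argo
    qed
    then show "x \<in> box a b" by (simp add: mem_box_cart)
  qed
  moreover have "compact (closure {x. ?\<phi> x \<noteq> 0})"
    by (rule compact_closure[THEN iffD2, OF bounded_subset[OF bounded_cbox order_trans[OF closure_subset sub]]])
  ultimately show ?thesis unfolding test_functions_def using sm S by blast
qed

lemma bump_tendsto_1: "0 < t \<Longrightarrow> (\<lambda>k. bump 0 (real (Suc k) * t - 1)) \<longlonglongrightarrow> 1"
proof -
  assume t: "0 < t"
  have "filterlim (\<lambda>k. real (Suc k) * t - 1) at_top sequentially"
    unfolding filterlim_at_top
  proof (intro allI eventually_sequentiallyI)
    fix Z :: real and k assume "nat \<lceil>(Z + 1) / t\<rceil> \<le> k"
    then have "(Z + 1) / t \<le> real (Suc k)" by linarith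
    then show "Z \<le> real (Suc k) * t - 1" using t by (simp add: pos_divide_le_eq del: of_nat_Suc)
  qed
  then have "(\<lambda>k. exp (- inverse (real (Suc k) * t - 1))) \<longlonglongrightarrow> exp (- 0)"
    by (intro tendsto_intros tendsto_inverse_0_at_top)
  moreover have "\<forall>\<^sub>F k in sequentially. exp (- inverse (real (Suc k) * t - 1)) = bump 0 (real (Suc k) * t - 1)"
    using filterlim_at_top_dense[THEN iffD1, rule_format, of "\<lambda>k. real (Suc k) * t - 1" sequentially 0]
      \<open>filterlim (\<lambda>k. real (Suc k) * t - 1) at_top sequentially\<close>
    by (auto elim!: eventually_mono simp: bump_def inverse_eq_divide)
  ultimately show ?thesis by (auto intro: Lim_transform_eventually)
qed

lemma box_bump_tendsto:
  fixes a b x :: "real^'n"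
  shows "(\<lambda>k. \<Prod>i\<in>UNIV. complex_of_real (bump 0 (real (Suc k) * (x $ i - a $ i) - 1) * bump 0 (real (Suc k) * (b $ i - x $ i) - 1)))
     \<longlonglongrightarrow> indicator (box a b) x"
proof (cases "x \<in> box a b")
  case True
  then have "(\<lambda>k. \<Prod>i\<in>(UNIV::'n set). complex_of_real (bump 0 (real (Suc k) * (x $ i - a $ i) - 1) * bump 0 (real (Suc k) * (b $ i - x $ i) - 1)))
     \<longlonglongrightarrow> (\<Prod>i\<in>(UNIV::'n set). complex_of_real (1 * 1))"
    by (intro tendsto_prod tendsto_of_real tendsto_mult bump_tendsto_1) (auto simp: mem_box_cart)
  then show ?thesis using True by simp
next
  case False
  then obtain i where "x $ i \<le> a $ i \<or> b $ i \<le> x $ i" by (auto simp: mem_box_cart not_less)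
  then have "bump 0 (real (Suc k) * (x $ i - a $ i) - 1) * bump 0 (real (Suc k) * (b $ i - x $ i) - 1) = 0" for k
  proof
    assume "x $ i \<le> a $ i"
    then have "real (Suc k) * (x $ i - a $ i) \<le> 0" by (simp add: mult_le_0_iff)
    then show ?thesis by (simp add: bump_nonpos del: of_nat_Suc)
  next
    assume "b $ i \<le> x $ i"
    then have "real (Suc k) * (b $ i - x $ i) \<le> 0" by (simp add: mult_le_0_iff)
    then show ?thesis by (simp add: bump_nonpos del: of_nat_Suc)
  qed
  then have "(\<Prod>i\<in>UNIV. complex_of_real (bump 0 (real (Suc k) * (x $ i - a $ i) - 1) * bump 0 (real (Suc k) * (b $ i - x $ i) - 1))) = 0" for k
    by (intro prod_zero) (auto simp del: of_nat_Suc of_real_mult intro!: exI[of _ i])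
  moreover have "indicator (box a b) x = (0::complex)" using False by simp
  ultimately show ?thesis by (simp only: tendsto_const)
qed

text \<open>Products of bumps approximate the indicator of a box in S and are bounded by 1, so the
  integrals of g over all boxes in S vanish. An open set is a countable union of such boxes, and
  each is treated by \<open>AE_zero_if_box_integrals_zero\<close>.\<close>

lemma AE_zero_if_test_integrals_zero:
  fixes g :: "real^'n \<Rightarrow> complex"
  assumes S: "open S" "bounded S" and g: "square_integrable (lebesgue_on S) g"
    and z: "\<And>\<phi>. \<phi> \<in> test_functions S \<Longrightarrow> (LINT x|lebesgue_on S. g x * \<phi> x) = 0"
  shows "AE x in lebesgue_on S. g x = 0"
proof -
  have Sb: "S \<in> sets borel" using S by simp
  obtain G where G [measurable]: "G \<in> borel_measurable borel" and G0: "\<And>x. x \<notin> S \<Longrightarrow> G x = 0"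
    and Gg: "AE x in lebesgue_on S. g x = G x"
    using borel_representative[OF Sb square_integrable_measurable[OF g]] by blast
  have gi: "integrable (lebesgue_on S) g"
    by (rule integrable_if_square_integrable[OF finite_measure_lebesgue_on[OF S(2) Sb] g])
  have Gm: "G \<in> borel_measurable (lebesgue_on S)" by (rule borel_measurable_lebesgue_on[OF G])
  have "integrable (lebesgue_on S) G"
    using gi Gg Gm g by (subst integrable_cong_AE[where g = g]) auto
  moreover have ind: "indicator S x *\<^sub>R G x = G x" for x using G0 by (auto split: split_indicator)
  ultimately have Gi: "integrable lborel G"
    using integrable_lebesgue_on_borel[OF Sb G] by simp
  have box0: "(LINT x|lborel. indicator (box a b) x *\<^sub>R G x) = 0" if sub: "box a b \<subseteq> S" for a b
  proof -
    let ?\<phi> = "\<lambda>k x. \<Prod>i\<in>UNIV. complex_of_real (bump 0 (real (Suc k) * (x $ i - a $ i) - 1) * bump 0 (real (Suc k) * (b $ i - x $ i) - 1))"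
    have \<phi>: "?\<phi> k \<in> test_functions S" for k by (rule box_bump_test_function[OF sub])
    have \<phi>m [measurable]: "?\<phi> k \<in> borel_measurable borel" for k
      by (rule smooth_borel[OF test_functionD(1)[OF \<phi>]])
    have "(LINT x|lborel. G x * ?\<phi> k x) = 0" for k
    proof -
      have "0 = (LINT x|lebesgue_on S. g x * ?\<phi> k x)" using z[OF \<phi>] by simp
      also have "\<dots> = (LINT x|lebesgue_on S. G x * ?\<phi> k x)"
        by (rule integral_cong_AE)
          (use Gg Gm square_integrable_measurable[OF g] borel_measurable_lebesgue_on[OF \<phi>m] in \<open>auto intro!: borel_measurable_times\<close>)
      also have "\<dots> = (LINT x|lborel. indicator S x *\<^sub>R (G x * ?\<phi> k x))"
        by (rule integral_lebesgue_on_borel[OF Sb]) measurable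
      also have "\<dots> = (LINT x|lborel. G x * ?\<phi> k x)"
        by (intro Bochner_Integration.integral_cong) (use G0 in \<open>auto split: split_indicator\<close>)
      finally show ?thesis by simp
    qed
    moreover have "(\<lambda>k. LINT x|lborel. G x * ?\<phi> k x) \<longlonglongrightarrow> (LINT x|lborel. G x * indicator (box a b) x)"
    proof (rule integral_dominated_convergence[where w = "\<lambda>x. norm (G x)"])
      show "AE x in lborel. (\<lambda>k. G x * ?\<phi> k x) \<longlonglongrightarrow> G x * indicator (box a b) x"
        by (intro AE_I2 tendsto_mult tendsto_const box_bump_tendsto)
      show "AE x in lborel. norm (G x * ?\<phi> k x) \<le> norm (G x)" for k
      proof (rule AE_I2)
        fix x
        have "norm (?\<phi> k x) \<le> (\<Prod>i\<in>(UNIV::'n set). 1)"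
          unfolding prod_norm[symmetric]
          by (intro prod_mono conjI norm_ge_zero)
            (simp only: norm_of_real abs_mult abs_of_nonneg[OF bump_nonneg] mult_le_one[OF bump_0_le_1 bump_nonneg bump_0_le_1])
        then show "norm (G x * ?\<phi> k x) \<le> norm (G x)"
          unfolding norm_mult prod.neutral_const by (rule mult_left_le[OF _ norm_ge_zero])
      qed
      have "(\<lambda>x. G x * ?\<phi> k x) \<in> borel_measurable borel" for k
        by (intro borel_measurable_times G \<phi>m)
      then show "(\<lambda>x. G x * ?\<phi> k x) \<in> borel_measurable lborel" for k by (simp del: of_nat_Suc)
    qed (use Gi in auto)
    ultimately have "(LINT x|lborel. G x * indicator (box a b) x) = 0" by (simp add: LIMSEQ_const_iff)
    moreover have "(LINT x|lborel. G x * indicator (box a b) x) = (LINT x|lborel. indicator (box a b) x *\<^sub>R G x)"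
      by (intro Bochner_Integration.integral_cong) (auto split: split_indicator)
    ultimately show ?thesis by simp
  qed
  \<comment> \<open>The criterion quantifies over all boxes, while only those inside S are under
    control; restricting to a fixed box in S helps because an intersection of boxes is a
    box.\<close>
  have box_AE: "AE x in lborel. x \<in> box c d \<longrightarrow> G x = 0" if sub: "box c d \<subseteq> S" for c d
  proof -
    have "AE x in lborel. indicator (box c d) x *\<^sub>R G x = 0"
    proof (rule AE_zero_if_box_integrals_zero)
      show "integrable lborel (\<lambda>x. indicator (box c d) x *\<^sub>R G x)"
        using Gi by (intro integrable_mult_indicator) auto
      fix a b
      obtain a' b' where ab: "box a b \<inter> box c d = box a' b'" using box_Int_box by blast
      have "(LINT x|lborel. indicator (box a b) x *\<^sub>R indicator (box c d) x *\<^sub>R G x) = (LINT x|lborel. indicator (box a' b') x *\<^sub>R G x)"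
        unfolding ab[symmetric] by (intro Bochner_Integration.integral_cong) (auto split: split_indicator)
      also have "\<dots> = 0" by (rule box0) (use sub ab in blast)
      finally show "(LINT x|lborel. indicator (box a b) x *\<^sub>R indicator (box c d) x *\<^sub>R G x) = 0" .
    qed
    then show ?thesis by eventually_elim (simp split: split_indicator_asm)
  qed
  obtain D where D: "countable D" "D \<subseteq> Pow S" "\<And>X. X \<in> D \<Longrightarrow> \<exists>a b. X = box a b" "\<Union>D = S"
    using open_countable_Union_open_box[OF S(1)] by blast
  have "AE x in lborel. \<forall>X\<in>D. x \<in> X \<longrightarrow> G x = 0"
    unfolding AE_ball_countable[OF D(1)]
  proof
    fix X assume X: "X \<in> D"
    then obtain a b where "X = box a b" using D(3) by blast
    then show "AE x in lborel. x \<in> X \<longrightarrow> G x = 0" using box_AE[of a b] D(2) X by auto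
  qed
  then have "AE x in lborel. x \<in> S \<longrightarrow> G x = 0"
    by eventually_elim (use D(4) in blast)
  then have "AE x in lebesgue_on S. G x = 0" by (rule AE_lebesgue_onI[OF Sb])
  with Gg show ?thesis by eventually_elim simp
qed

section \<open>Weak derivatives and the Sobolev norm\<close>

lemma test_square_integrable:
  assumes "open S" "bounded S" "\<phi> \<in> test_functions S"
  shows "square_integrable (lebesgue_on S) \<phi>"
  using assms by (intro square_integrable_smooth test_functionD(1))

lemma pderivs_test_functions:
  "\<phi> \<in> test_functions S \<Longrightarrow> pderivs is \<phi> \<in> test_functions S"
proof (induction "is")
  case (Cons i "is")
  then show ?case using test_function_pderiv[of "pderivs is \<phi>" S i] by simp
qed simp

lemma weak_deriv_unique:
  assumes S: "open S" "bounded S" and g: "g \<in> L2 S" "h \<in> L2 S"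
    and w: "weak_deriv S is f g" "weak_deriv S is f h"
  shows "AE x in lebesgue_on S. g x = h x"
proof -
  have "AE x in lebesgue_on S. g x - h x = 0"
  proof (rule AE_zero_if_test_integrals_zero[OF S])
    show "square_integrable (lebesgue_on S) (\<lambda>x. g x - h x)" using g by (auto simp: L2_iff)
    fix \<phi> assume \<phi>: "\<phi> \<in> test_functions S"
    have "(- 1) ^ length is * (LINT x|lebesgue_on S. g x * \<phi> x) = (- 1) ^ length is * (LINT x|lebesgue_on S. h x * \<phi> x)"
      by (rule trans[OF sym[OF bspec[OF w(1)[unfolded weak_deriv_def] \<phi>]] bspec[OF w(2)[unfolded weak_deriv_def] \<phi>]])
    then have "(LINT x|lebesgue_on S. g x * \<phi> x) = (LINT x|lebesgue_on S. h x * \<phi> x)" by simp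
    moreover have "(LINT x|lebesgue_on S. (g x - h x) * \<phi> x) = (LINT x|lebesgue_on S. g x * \<phi> x) - (LINT x|lebesgue_on S. h x * \<phi> x)"
      unfolding left_diff_distrib using g test_square_integrable[OF S \<phi>]
      by (intro Bochner_Integration.integral_diff integrable_mult_complex) (auto simp: L2_iff)
    ultimately show "(LINT x|lebesgue_on S. (g x - h x) * \<phi> x) = 0" by simp
  qed
  then show ?thesis by simp
qed

lemma weak_deriv_diff:
  assumes S: "open S" "bounded S" and L2: "f \<in> L2 S" "g \<in> L2 S" "f' \<in> L2 S" "g' \<in> L2 S"
    and w: "weak_deriv S is f f'" "weak_deriv S is g g'"
  shows "weak_deriv S is (\<lambda>x. f x - g x) (\<lambda>x. f' x - g' x)"
  unfolding weak_deriv_def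
proof
  fix \<phi> assume \<phi>: "\<phi> \<in> test_functions S"
  note ts = test_square_integrable[OF S]
  have "(LINT x|lebesgue_on S. (f x - g x) * pderivs is \<phi> x) = (LINT x|lebesgue_on S. f x * pderivs is \<phi> x) - (LINT x|lebesgue_on S. g x * pderivs is \<phi> x)"
    unfolding left_diff_distrib using L2 ts[OF pderivs_test_functions[OF \<phi>]]
    by (intro Bochner_Integration.integral_diff integrable_mult_complex) (auto simp: L2_iff)
  moreover have "(LINT x|lebesgue_on S. (f' x - g' x) * \<phi> x) = (LINT x|lebesgue_on S. f' x * \<phi> x) - (LINT x|lebesgue_on S. g' x * \<phi> x)"
    unfolding left_diff_distrib using L2 ts[OF \<phi>]
    by (intro Bochner_Integration.integral_diff integrable_mult_complex) (auto simp: L2_iff)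
  ultimately show "(LINT x|lebesgue_on S. (f x - g x) * pderivs is \<phi> x) = (- 1) ^ length is * (LINT x|lebesgue_on S. (f' x - g' x) * \<phi> x)"
    using w \<phi> unfolding weak_deriv_def by (simp add: right_diff_distrib)
qed

text \<open>For a fixed test function both sides of the defining identity are continuous in the
  square mean.\<close>

lemma weak_deriv_limit:
  assumes S: "open S" "bounded S"
    and L2: "\<And>k. f k \<in> L2 S" "\<And>k. f' k \<in> L2 S" "g \<in> L2 S" "g' \<in> L2 S"
    and w: "\<And>k. weak_deriv S is (f k) (f' k)"
    and lim: "(\<lambda>k. sqnorm (lebesgue_on S) (\<lambda>x. f k x - g x)) \<longlonglongrightarrow> 0"
      "(\<lambda>k. sqnorm (lebesgue_on S) (\<lambda>x. f' k x - g' x)) \<longlonglongrightarrow> 0"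
  shows "weak_deriv S is g g'"
  unfolding weak_deriv_def
proof
  fix \<phi> assume \<phi>: "\<phi> \<in> test_functions S"
  note ts = test_square_integrable[OF S]
  have 1: "(\<lambda>k. LINT x|lebesgue_on S. f k x * pderivs is \<phi> x) \<longlonglongrightarrow> (LINT x|lebesgue_on S. g x * pderivs is \<phi> x)"
    by (rule L2_tendsto_integral_mult) (use L2 lim ts[OF pderivs_test_functions[OF \<phi>]] in \<open>auto simp: L2_iff\<close>)
  have "(\<lambda>k. LINT x|lebesgue_on S. f' k x * \<phi> x) \<longlonglongrightarrow> (LINT x|lebesgue_on S. g' x * \<phi> x)"
    by (rule L2_tendsto_integral_mult) (use L2 lim ts[OF \<phi>] in \<open>auto simp: L2_iff\<close>)
  then have 2: "(\<lambda>k. (- 1) ^ length is * (LINT x|lebesgue_on S. f' k x * \<phi> x)) \<longlonglongrightarrow> (- 1) ^ length is * (LINT x|lebesgue_on S. g' x * \<phi> x)"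
    by (intro tendsto_mult tendsto_const)
  have "(LINT x|lebesgue_on S. f k x * pderivs is \<phi> x) = (- 1) ^ length is * (LINT x|lebesgue_on S. f' k x * \<phi> x)" for k
    using w \<phi> unfolding weak_deriv_def by blast
  then show "(LINT x|lebesgue_on S. g x * pderivs is \<phi> x) = (- 1) ^ length is * (LINT x|lebesgue_on S. g' x * \<phi> x)"
    by (intro LIMSEQ_unique[OF 1]) (simp only: 2)
qed

lemma weak_deriv_Nil: "weak_deriv S [] f f"
  by (simp add: weak_deriv_def)

text \<open>The product of f with a test function has bounded support, so its derivative integrates
  to 0 by \<open>integral_pderiv_eq_0\<close>; the product rule turns this into the defining
  identity.\<close>

lemma weak_deriv_smooth:
  assumes S: "open S" and f: "smooth f"
  shows "weak_deriv S [i] f (pderivs [i] f)"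
  unfolding weak_deriv_def
proof
  fix \<phi> assume \<phi>: "\<phi> \<in> test_functions S"
  have Sb: "S \<in> sets borel" using S by simp
  have supp: "(LINT x|lebesgue_on S. u x * \<psi> x) = (LINT x|lborel. u x * \<psi> x)" if "smooth u" "\<psi> \<in> test_functions S" for u \<psi>
  proof -
    have "(\<lambda>x. u x * \<psi> x) \<in> borel_measurable borel"
      using that test_functionD(1) by (intro smooth_borel smooth_mult) auto
    from integral_lebesgue_on_borel[OF Sb this]
    have "(LINT x|lebesgue_on S. u x * \<psi> x) = (LINT x|lborel. indicator S x *\<^sub>R (u x * \<psi> x))" .
    also have "\<dots> = (LINT x|lborel. u x * \<psi> x)"
      using test_functionD(3)[OF that(2)] by (intro Bochner_Integration.integral_cong) (auto split: split_indicator)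
    finally show ?thesis .
  qed
  have int: "integrable lborel (\<lambda>x. u x * \<psi> x)" if "smooth u" "\<psi> \<in> test_functions S" for u \<psi>
  proof (rule integrable_smooth)
    show "bounded {x. u x * \<psi> x \<noteq> 0}" by (rule bounded_subset[OF test_functionD(2)[OF that(2)]]) auto
  qed (use that test_functionD(1) in auto)
  have "(LINT x|lborel. pderivs [i] (\<lambda>x. f x * \<phi> x) x) = 0"
  proof (rule integral_pderiv_eq_0)
    show "bounded {x. f x * \<phi> x \<noteq> 0}" by (rule bounded_subset[OF test_functionD(2)[OF \<phi>]]) auto
  qed (use f test_functionD(1)[OF \<phi>] in auto)
  moreover have "pderivs [i] (\<lambda>x. f x * \<phi> x) x = f x * pderivs [i] \<phi> x + pderivs [i] f x * \<phi> x" for x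
    by (intro pderiv_mult smooth_differentiable f test_functionD(1)[OF \<phi>])
  ultimately have "(LINT x|lborel. f x * pderivs [i] \<phi> x + pderivs [i] f x * \<phi> x) = 0" by (simp only:)
  then have "(LINT x|lborel. f x * pderivs [i] \<phi> x) + (LINT x|lborel. pderivs [i] f x * \<phi> x) = 0"
    by (subst (asm) Bochner_Integration.integral_add[OF int[OF f test_function_pderiv[OF \<phi>]] int[OF smooth_pderiv[OF f] \<phi>]])
  then show "(LINT x|lebesgue_on S. f x * pderivs [i] \<phi> x) = (- 1) ^ length [i] * (LINT x|lebesgue_on S. pderivs [i] f x * \<phi> x)"
    unfolding supp[OF f test_function_pderiv[OF \<phi>]] supp[OF smooth_pderiv[OF f] \<phi>]
    by (simp add: eq_neg_iff_add_eq_0 del: pderivs.simps)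
qed

text \<open>\<open>sobolev_norm\<close> selects a weak derivative by choice; uniqueness almost
  everywhere allows any known one to be used in its place.\<close>

lemma sqnorm_SOME_weak_deriv:
  assumes S: "open S" "bounded S" and g: "g \<in> L2 S" "weak_deriv S is f g"
  shows "(L2_norm S (SOME g. g \<in> L2 S \<and> weak_deriv S is f g))\<^sup>2 = sqnorm (lebesgue_on S) g"
proof -
  define h where "h = (SOME g. g \<in> L2 S \<and> weak_deriv S is f g)"
  have h: "h \<in> L2 S \<and> weak_deriv S is f h" unfolding h_def by (rule someI[of _ g]) (use g in auto)
  then have "AE x in lebesgue_on S. h x = g x" using weak_deriv_unique[OF S] g by blast
  then have "sqnorm (lebesgue_on S) h = sqnorm (lebesgue_on S) g"
    using h g by (intro sqnorm_cong_AE) (auto simp: L2_iff square_integrable_measurable)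
  then show ?thesis by (simp add: L2_norm_sq h_def)
qed

lemma sobolev_norm_0:
  assumes "open S" "bounded S" "f \<in> L2 S"
  shows "(sobolev_norm 0 S f)\<^sup>2 = sqnorm (lebesgue_on S) f"
proof -
  have "{is::'a list. length is \<le> 0} = {[]}" by auto
  then show ?thesis
    using sqnorm_SOME_weak_deriv[OF assms weak_deriv_Nil] by (simp add: sobolev_norm_def)
qed

lemma sobolev_norm_1:
  fixes f :: "real^'n \<Rightarrow> complex"
  assumes S: "open S" "bounded S" and f: "f \<in> L2 S"
    and g: "\<And>i. g i \<in> L2 S" "\<And>i. weak_deriv S [i] f (g i)"
  shows "(sobolev_norm 1 S f)\<^sup>2 = sqnorm (lebesgue_on S) f + (\<Sum>i\<in>UNIV. sqnorm (lebesgue_on S) (g i))"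
proof -
  let ?N = "\<lambda>is. (L2_norm S (SOME g. g \<in> L2 S \<and> weak_deriv S is f g))\<^sup>2"
  have "is \<in> insert [] (range (\<lambda>i. [i]))" if "length is \<le> 1" for "is" :: "'n list"
    using that by (cases "is") auto
  then have "{is::'n list. length is \<le> 1} = insert [] (range (\<lambda>i. [i]))" by auto
  then have "(\<Sum>is | length is \<le> 1. ?N is) = (\<Sum>is\<in>insert [] (range (\<lambda>i. [i])). ?N is)" by simp
  also have "\<dots> = ?N [] + (\<Sum>is\<in>range (\<lambda>i. [i]). ?N is)" by (rule sum.insert) auto
  also have "(\<Sum>is\<in>range (\<lambda>i. [i]). ?N is) = (\<Sum>i\<in>UNIV. ?N [i])"
    by (subst sum.reindex) (auto intro: injI)
  finally have "(\<Sum>is | length is \<le> 1. ?N is) = sqnorm (lebesgue_on S) f + (\<Sum>i\<in>UNIV. sqnorm (lebesgue_on S) (g i))"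
    using sqnorm_SOME_weak_deriv[OF S f weak_deriv_Nil] sqnorm_SOME_weak_deriv[OF S g] by simp
  moreover have "0 \<le> (\<Sum>is | length is \<le> 1. ?N is)" by (intro sum_nonneg) auto
  ultimately show ?thesis unfolding sobolev_norm_def by simp
qed

section \<open>Fourier series in the square mean\<close>

text \<open>The exponential is cut to the open interval so that Fourier series on an interval become
  statements about \<open>lborel\<close>, and then about products with it.\<close>

definition harmonic :: "real \<Rightarrow> int \<Rightarrow> real \<Rightarrow> complex" where
  "harmonic l n s = indicator {0<..<l} s * exp (2 * pi * \<i> * of_int n * s / l)"

lemma harmonic_measurable [measurable]: "harmonic l n \<in> borel_measurable borel"
  unfolding harmonic_def[abs_def] by measurable

lemma harmonic_outside: "s \<notin> {0<..<l} \<Longrightarrow> harmonic l n s = 0"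
  by (simp add: harmonic_def)

lemma exp_circle_cnj: "cnj (exp (2 * pi * \<i> * of_int n * of_real s / of_real l)) = exp (2 * pi * \<i> * of_int (- n) * of_real s / of_real l)"
  by (simp add: exp_cnj)

lemma norm_exp_circle: "norm (exp (2 * pi * \<i> * of_int n * of_real s / of_real l)) = 1"
proof -
  have "exp (2 * pi * \<i> * of_int n * of_real s / of_real l) = exp (\<i> * of_real (2 * pi * of_int n * s / l))"
    by (simp add: field_simps)
  then show ?thesis by (simp only: norm_exp_i_times)
qed

lemma norm_harmonic: "norm (harmonic l n s) = indicator {0<..<l} s"
  by (simp add: harmonic_def norm_mult norm_exp_circle split: split_indicator)

lemma integrable_bounded_interval:
  fixes f :: "real \<Rightarrow> 'a::euclidean_space"
  assumes "f \<in> borel_measurable borel" "\<And>s. norm (f s) \<le> B" "\<And>s. s \<notin> {0<..<l} \<Longrightarrow> f s = 0"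
  shows "integrable lborel f"
proof (rule Bochner_Integration.integrable_bound)
  show "integrable lborel (\<lambda>s. B * indicator {0<..<l} s :: real)"
    by (intro integrable_mult_right integrable_real_indicator) (auto intro: emeasure_bounded_finite[unfolded infinity_ennreal_def])
  show "AE s in lborel. norm (f s) \<le> norm (B * indicator {0<..<l} s)"
  proof (rule AE_I2)
    fix s
    show "norm (f s) \<le> norm (B * indicator {0<..<l} s)"
      using assms(2,3)[of s] by (cases "s \<in> {0<..<l}") auto
  qed
qed (use assms in simp)

lemma square_integrable_harmonic: "square_integrable lborel (harmonic l n)"
  unfolding square_integrable_def
proof
  show "integrable lborel (\<lambda>s. (norm (harmonic l n s))\<^sup>2)"
    by (rule integrable_bounded_interval[of _ 1 l]) (auto simp: norm_harmonic split: split_indicator)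
qed simp

lemma integral_exp_circle:
  assumes "0 < l" "n \<noteq> 0"
  shows "(LINT s|lborel. harmonic l n s) = 0"
proof -
  define c where "c = 2 * pi * \<i> * of_int n / l"
  have c: "c \<noteq> 0" using assms by (simp add: c_def)
  have "((\<lambda>s. exp (c * of_real s)) has_integral exp (c * of_real l) / c - exp (c * of_real 0) / c) {0..l}"
  proof (rule fundamental_theorem_of_calculus)
    fix s
    have "((\<lambda>z. exp (c * z) / c) has_field_derivative exp (c * of_real s)) (at (of_real s))"
      using c by (auto intro!: derivative_eq_intros)
    from has_vector_derivative_real_field[OF this]
    show "((\<lambda>s. exp (c * of_real s) / c) has_vector_derivative exp (c * of_real s)) (at s within {0..l})"
      by (simp add: o_def)
  qed (use assms in simp)
  moreover have "exp (c * of_real l) = 1"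
    using assms unfolding exp_eq_1 by (auto simp: c_def intro!: exI[of _ n])
  ultimately have hi: "((\<lambda>s. exp (c * of_real s)) has_integral 0) {0..l}" by simp
  have int: "integrable lborel (harmonic l n)"
    by (rule integrable_bounded_interval[of _ 1 l]) (auto simp: norm_harmonic harmonic_outside split: split_indicator)
  have "(harmonic l n has_integral (LINT s|lborel. harmonic l n s)) UNIV"
    by (rule has_integral_integral_lborel[OF int])
  moreover have "(harmonic l n has_integral 0) UNIV"
  proof -
    have "((\<lambda>s. if s \<in> {0<..<l} then exp (c * of_real s) else 0) has_integral 0) UNIV"
      unfolding has_integral_restrict_UNIV using hi by (simp add: has_integral_Icc_iff_Ioo)
    moreover have "(if s \<in> {0<..<l} then exp (c * of_real s) else 0) = harmonic l n s" for s
      by (simp add: harmonic_def c_def)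
    ultimately show ?thesis by (simp only:)
  qed
  ultimately show ?thesis using has_integral_unique by blast
qed

lemma harmonic_mult_cnj: "harmonic l m s * cnj (harmonic l n s) = harmonic l (m - n) s"
proof -
  have "exp (2 * pi * \<i> * of_int m * of_real s / of_real l) * exp (2 * pi * \<i> * of_int (- n) * of_real s / of_real l)
    = exp (2 * pi * \<i> * of_int (m - n) * of_real s / of_real l)"
    unfolding exp_add[symmetric] by (simp add: algebra_simps diff_divide_distrib)
  then show ?thesis
    unfolding harmonic_def complex_cnj_mult exp_circle_cnj by (auto split: split_indicator)
qed

lemma harmonic_orthogonal:
  assumes "0 < l"
  shows "(LINT s|lborel. harmonic l m s * cnj (harmonic l n s)) = (if m = n then of_real l else 0)"
proof (cases "m = n")
  case True
  have "(LINT s|lborel. harmonic l 0 s) = (LINT s|lborel. of_real (indicator {0<..<l} s))"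
    by (intro Bochner_Integration.integral_cong) (auto simp: harmonic_def split: split_indicator)
  also have "\<dots> = of_real (LINT s|lborel. indicator {0<..<l} s)" by (rule integral_complex_of_real)
  also have "(LINT s|lborel. indicator {0<..<l} s) = l" using assms by simp
  finally show ?thesis using True by (simp add: harmonic_mult_cnj)
next
  case False
  then show ?thesis using integral_exp_circle[OF assms, of "m - n"] by (simp add: harmonic_mult_cnj)
qed

text \<open>The division by l reflects that the harmonics have squared norm l; this is the origin of
  the factor l in Bessel's inequality and in all later coefficient sums.\<close>

definition fcoeff :: "real \<Rightarrow> int \<Rightarrow> (real \<Rightarrow> complex) \<Rightarrow> complex" where
  "fcoeff l n g = (LINT s|lborel. g s * cnj (harmonic l n s)) / l"

definition trig_sum :: "real \<Rightarrow> nat \<Rightarrow> (int \<Rightarrow> complex) \<Rightarrow> real \<Rightarrow> complex" where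
  "trig_sum l N a s = (\<Sum>n\<in>{- int N..int N}. a n * harmonic l n s)"

lemma square_integrable_trig_sum: "square_integrable lborel (trig_sum l N a)"
  unfolding trig_sum_def[abs_def]
  by (intro square_integrable_sum square_integrable_cmult square_integrable_harmonic)

lemma integral_trig_sum_cnj:
  assumes "0 < l" "n \<in> {- int N..int N}"
  shows "(LINT s|lborel. trig_sum l N a s * cnj (harmonic l n s)) = l * a n"
proof -
  have "(LINT s|lborel. trig_sum l N a s * cnj (harmonic l n s)) =
      (LINT s|lborel. (\<Sum>m\<in>{- int N..int N}. a m * (harmonic l m s * cnj (harmonic l n s))))"
    by (simp add: trig_sum_def sum_distrib_right mult.assoc)
  also have "\<dots> = (\<Sum>m\<in>{- int N..int N}. a m * (LINT s|lborel. harmonic l m s * cnj (harmonic l n s)))"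
    by (subst Bochner_Integration.integral_sum)
      (intro integrable_mult_right integrable_mult_complex square_integrable_cnj square_integrable_harmonic, simp)
  also have "\<dots> = (\<Sum>m\<in>{- int N..int N}. if m = n then a m * l else 0)"
    by (intro sum.cong refl) (simp add: harmonic_orthogonal[OF assms(1)])
  also have "\<dots> = l * a n" using assms(2) by (simp add: mult.commute)
  finally show ?thesis .
qed

lemma inner_complex_eq: "x \<bullet> y = Re (x * cnj y)" for x y :: complex
  by (simp add: inner_complex_def)

lemma integral_inner_complex:
  fixes f g :: "'a \<Rightarrow> complex"
  assumes "square_integrable M f" "square_integrable M g"
  shows "(LINT x|M. f x \<bullet> g x) = Re (LINT x|M. f x * cnj (g x))"
  unfolding inner_complex_eq
  by (rule integral_Re) (intro integrable_mult_complex square_integrable_cnj assms)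

lemma integral_inner_trig_sum:
  assumes "square_integrable lborel g"  "0 < l"
  shows "(LINT s|lborel. g s \<bullet> trig_sum l N a s) = (\<Sum>n\<in>{- int N..int N}. l * Re (fcoeff l n g * cnj (a n)))"
proof -
  have "(LINT s|lborel. g s * cnj (trig_sum l N a s)) = (LINT s|lborel. (\<Sum>n\<in>{- int N..int N}. cnj (a n) * (g s * cnj (harmonic l n s))))"
    by (simp add: trig_sum_def sum_distrib_left algebra_simps)
  also have "\<dots> = (\<Sum>n\<in>{- int N..int N}. cnj (a n) * (LINT s|lborel. g s * cnj (harmonic l n s)))"
    by (subst Bochner_Integration.integral_sum)
      (intro integrable_mult_right integrable_mult_complex square_integrable_cnj square_integrable_harmonic assms, simp)
  also have "\<dots> = (\<Sum>n\<in>{- int N..int N}. l * (fcoeff l n g * cnj (a n)))"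
    using assms(2) by (intro sum.cong refl) (simp add: fcoeff_def)
  finally show ?thesis
    by (simp add: integral_inner_complex[OF assms(1) square_integrable_trig_sum])
qed

lemma sqnorm_trig_sum:
  assumes "0 < l" shows "sqnorm lborel (trig_sum l N a) = (\<Sum>n\<in>{- int N..int N}. l * (norm (a n))\<^sup>2)"
proof -
  have "sqnorm lborel (trig_sum l N a) = (LINT s|lborel. trig_sum l N a s \<bullet> trig_sum l N a s)"
    by (simp add: sqnorm_def power2_norm_eq_inner)
  also have "\<dots> = (\<Sum>n\<in>{- int N..int N}. l * Re (fcoeff l n (trig_sum l N a) * cnj (a n)))"
    by (rule integral_inner_trig_sum[OF square_integrable_trig_sum assms])
  also have "\<dots> = (\<Sum>n\<in>{- int N..int N}. l * (norm (a n))\<^sup>2)"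
  proof (intro sum.cong refl)
    fix n assume "n \<in> {- int N..int N}"
    then have "fcoeff l n (trig_sum l N a) = a n" using assms by (simp add: fcoeff_def integral_trig_sum_cnj)
    then show "l * Re (fcoeff l n (trig_sum l N a) * cnj (a n)) = l * (norm (a n))\<^sup>2"
      by (simp add: cmod_power2) (simp add: power2_eq_square)
  qed
  finally show ?thesis .
qed

text \<open>Completing the square in the coefficients a. Bessel's inequality (a the Fourier
  coefficients), best approximation, and uniqueness of the coefficients are all read off this
  identity.\<close>

lemma sqnorm_diff_trig_sum:
  assumes g: "square_integrable lborel g" and l: "0 < l"
  shows "sqnorm lborel (\<lambda>s. g s - trig_sum l N a s) = sqnorm lborel g
    - (\<Sum>n\<in>{- int N..int N}. l * (norm (fcoeff l n g))\<^sup>2) + (\<Sum>n\<in>{- int N..int N}. l * (norm (a n - fcoeff l n g))\<^sup>2)"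
proof -
  have "sqnorm lborel (\<lambda>s. g s + - trig_sum l N a s) = sqnorm lborel g + 2 * (LINT s|lborel. g s \<bullet> - trig_sum l N a s) + sqnorm lborel (\<lambda>s. - trig_sum l N a s)"
    by (rule sqnorm_add_expand[OF g square_integrable_uminus[OF square_integrable_trig_sum]])
  also have "(LINT s|lborel. g s \<bullet> - trig_sum l N a s) = - (LINT s|lborel. g s \<bullet> trig_sum l N a s)"
    unfolding inner_minus_right by (rule integral_minus)
  finally have "sqnorm lborel (\<lambda>s. g s - trig_sum l N a s) = sqnorm lborel g
      + (\<Sum>n\<in>{- int N..int N}. l * (norm (a n))\<^sup>2 - 2 * (l * Re (fcoeff l n g * cnj (a n))))"
    unfolding integral_inner_trig_sum[OF g l] sqnorm_uminus sqnorm_trig_sum[OF l]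
    by (simp add: sum_subtractf sum_distrib_left)
  also have "(\<Sum>n\<in>{- int N..int N}. l * (norm (a n))\<^sup>2 - 2 * (l * Re (fcoeff l n g * cnj (a n)))) =
      (\<Sum>n\<in>{- int N..int N}. l * (norm (a n - fcoeff l n g))\<^sup>2 - l * (norm (fcoeff l n g))\<^sup>2)"
    by (intro sum.cong refl) (simp add: cmod_power2, simp add: power2_eq_square algebra_simps)
  finally show ?thesis by (simp add: sum_subtractf)
qed

lemma Bessel:
  assumes g: "square_integrable lborel g" and l: "0 < l"
  shows "(\<Sum>n\<in>{- int N..int N}. l * (norm (fcoeff l n g))\<^sup>2) \<le> sqnorm lborel g"
  using sqnorm_diff_trig_sum[OF g l, of N "\<lambda>n. fcoeff l n g"] sqnorm_nonneg[of lborel "\<lambda>s. g s - trig_sum l N (\<lambda>n. fcoeff l n g) s"]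
  by simp

text \<open>Trigonometric polynomials on the whole line in the angle, not cut to an interval. The
  inductive form makes the closure under products, demanded by Stone-Weierstrass, an easy
  induction.\<close>

inductive trig_poly :: "(real \<Rightarrow> complex) \<Rightarrow> bool" where
  base: "trig_poly (\<lambda>t. a * exp (\<i> * of_int n * of_real t))"
| add: "trig_poly f \<Longrightarrow> trig_poly g \<Longrightarrow> trig_poly (\<lambda>t. f t + g t)"

lemma trig_poly_mult_base: "trig_poly f \<Longrightarrow> trig_poly (\<lambda>t. a * exp (\<i> * of_int n * of_real t) * f t)"
proof (induction rule: trig_poly.induct)
  case (base b m)
  have "(\<lambda>t. a * exp (\<i> * of_int n * of_real t) * (b * exp (\<i> * of_int m * of_real t))) = (\<lambda>t. (a * b) * exp (\<i> * of_int (n + m) * of_real t))"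
    by (simp add: algebra_simps exp_add)
  then show ?case by (simp only: trig_poly.base)
next
  case (add f g)
  from trig_poly.add[OF add.IH] show ?case by (simp only: distrib_left)
qed

lemma trig_poly_mult: "trig_poly f \<Longrightarrow> trig_poly g \<Longrightarrow> trig_poly (\<lambda>t. f t * g t)"
proof (induction rule: trig_poly.induct)
  case (base a n)
  then show ?case by (rule trig_poly_mult_base)
next
  case (add f h)
  from trig_poly.add[OF add.IH] add.prems show ?case by (simp only: distrib_right)
qed

text \<open>Stone-Weierstrass on the unit circle, for the real functions whose pullback under
  \<open>cis\<close> is a trigonometric polynomial: they form an algebra with constants, and the
  real and imaginary parts separate points.\<close>

lemma trig_poly_dense:
  fixes f :: "complex \<Rightarrow> real"
  assumes f: "continuous_on (sphere 0 1) f" and e: "0 < e"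
  shows "\<exists>g. trig_poly g \<and> (\<forall>t. norm (complex_of_real (f (cis t)) - g t) < e)"
proof -
  define P where "P h \<longleftrightarrow> continuous_on (sphere 0 1) h \<and> (\<exists>g. trig_poly g \<and> (\<forall>t. complex_of_real (h (cis t)) = g t))" for h :: "complex \<Rightarrow> real"
  have cis_half: "complex_of_real (cos t) = (1/2) * exp (\<i> * of_int 1 * of_real t) + (1/2) * exp (\<i> * of_int (-1) * of_real t)"
    "complex_of_real (sin t) = (- \<i>/2) * exp (\<i> * of_int 1 * of_real t) + (\<i>/2) * exp (\<i> * of_int (-1) * of_real t)" for t
    by (auto simp: complex_eq_iff Re_exp Im_exp)
  have "\<exists>h. P h \<and> (\<forall>x\<in>sphere 0 1. \<bar>f x - h x\<bar> < e)"
  proof (rule Stone_Weierstrass_HOL[of "sphere 0 1" P])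
    show "P (\<lambda>x. c)" for c
      unfolding P_def using trig_poly.base[of "of_real c" 0] by (auto intro!: exI[of _ "\<lambda>t. of_real c"])
    show "P (\<lambda>x. h1 x + h2 x)" if "P h1 \<and> P h2" for h1 h2
    proof -
      from that obtain g1 where g1: "trig_poly g1" "\<forall>t. complex_of_real (h1 (cis t)) = g1 t" unfolding P_def by blast
      from that obtain g2 where g2: "trig_poly g2" "\<forall>t. complex_of_real (h2 (cis t)) = g2 t" unfolding P_def by blast
      then show ?thesis using that trig_poly.add[OF g1(1) g2(1)] g1(2) g2(2) unfolding P_def
        by (auto intro!: continuous_on_add exI[of _ "\<lambda>t. g1 t + g2 t"])
    qed
    show "P (\<lambda>x. h1 x * h2 x)" if "P h1 \<and> P h2" for h1 h2
    proof -
      from that obtain g1 where g1: "trig_poly g1" "\<forall>t. complex_of_real (h1 (cis t)) = g1 t" unfolding P_def by blast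
      from that obtain g2 where g2: "trig_poly g2" "\<forall>t. complex_of_real (h2 (cis t)) = g2 t" unfolding P_def by blast
      then show ?thesis using that trig_poly_mult[OF g1(1) g2(1)] g1(2) g2(2) unfolding P_def
        by (auto intro!: continuous_on_mult exI[of _ "\<lambda>t. g1 t * g2 t"])
    qed
    show "\<exists>h. P h \<and> h x \<noteq> h y" if "x \<in> sphere 0 1 \<and> y \<in> sphere 0 1 \<and> x \<noteq> y" for x y
    proof -
      have "P Re" unfolding P_def
      proof (intro conjI exI allI)
        show "complex_of_real (Re (cis t)) = (1/2) * exp (\<i> * of_int 1 * of_real t) + (1/2) * exp (\<i> * of_int (-1) * of_real t)" for t
          using cis_half(1) by simp
      qed (intro continuous_intros trig_poly.intros)+
      moreover have "P Im" unfolding P_def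
      proof (intro conjI exI allI)
        show "complex_of_real (Im (cis t)) = (- \<i>/2) * exp (\<i> * of_int 1 * of_real t) + (\<i>/2) * exp (\<i> * of_int (-1) * of_real t)" for t
          using cis_half(2) by simp
      qed (intro continuous_intros trig_poly.intros)+
      ultimately show ?thesis using that complex_eq_iff by blast
    qed
  qed (use f e in \<open>auto simp: P_def\<close>)
  then obtain h where h: "P h" "\<forall>x\<in>sphere 0 1. \<bar>f x - h x\<bar> < e" by blast
  then obtain g where g: "trig_poly g" "\<And>t. complex_of_real (h (cis t)) = g t" unfolding P_def by blast
  have "norm (complex_of_real (f (cis t)) - g t) < e" for t
  proof -
    have "norm (complex_of_real (f (cis t)) - g t) = \<bar>f (cis t) - h (cis t)\<bar>"
      unfolding g(2)[symmetric] of_real_diff[symmetric] norm_of_real by simp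
    then show ?thesis using h(2) by simp
  qed
  then show ?thesis using g(1) by blast
qed

text \<open>Orthogonality to the harmonics passes to trigonometric polynomials and from there, by
  uniform approximation, to every continuous function on the circle. Uniform approximation is the
  right notion because w is merely integrable.\<close>

lemma integral_circle_function_zero:
  assumes l: "0 < l" and w: "integrable lborel w" and w0: "\<And>s. s \<notin> {0<..<l} \<Longrightarrow> w s = 0"
    and orth: "\<And>n. (LINT s|lborel. w s * cnj (harmonic l n s)) = 0"
    and f: "continuous_on (sphere 0 1) f"
  shows "(LINT s|lborel. w s * complex_of_real (f (cis (2 * pi * s / l)))) = 0"
proof -
  have [measurable]: "w \<in> borel_measurable borel" using w by auto
  have trig: "integrable lborel (\<lambda>s. w s * g (2 * pi * s / l)) \<and> (LINT s|lborel. w s * g (2 * pi * s / l)) = 0"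
    if "trig_poly g" for g
    using that
  proof induction
    case (base a n)
    have eq: "w s * (a * exp (\<i> * of_int n * of_real (2 * pi * s / l))) = a * (w s * cnj (harmonic l (- n) s))" for s
    proof (cases "s \<in> {0<..<l}")
      case True
      have "exp (\<i> * of_int n * of_real (2 * pi * s / l)) = cnj (harmonic l (- n) s)"
        using True unfolding harmonic_def complex_cnj_mult exp_circle_cnj by (simp add: algebra_simps)
      then show ?thesis by simp
    qed (simp add: w0)
    have "integrable lborel (\<lambda>s. w s * cnj (harmonic l (- n) s))"
      by (rule Bochner_Integration.integrable_bound[OF w])
        (auto simp: norm_mult norm_harmonic split: split_indicator)
    then show ?case unfolding eq using orth by simp
  next
    case (add g h)
    then show ?case by (simp add: distrib_left)
  qed
  let ?I = "LINT s|lborel. w s * complex_of_real (f (cis (2 * pi * s / l)))"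
  have cis_m: "continuous_on UNIV (\<lambda>s. cis (2 * pi * s / l))"
    unfolding cis_conv_exp by (intro continuous_intros) (use l in auto)
  have fc: "continuous_on UNIV (\<lambda>s. f (cis (2 * pi * s / l)))"
    by (rule continuous_on_compose2[OF f cis_m]) auto
  have [measurable]: "(\<lambda>s. f (cis (2 * pi * s / l))) \<in> borel_measurable borel"
    by (rule borel_measurable_continuous_onI[OF fc])
  have "compact (f ` sphere 0 1)" by (intro compact_continuous_image f compact_sphere)
  then obtain B where B: "\<And>z. z \<in> sphere 0 1 \<Longrightarrow> \<bar>f z\<bar> \<le> B"
    using compact_imp_bounded bounded_iff by (metis imageI real_norm_def)
  have fint: "integrable lborel (\<lambda>s. w s * complex_of_real (f (cis (2 * pi * s / l))))"
  proof (rule Bochner_Integration.integrable_bound)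
    show "integrable lborel (\<lambda>s. of_real B * w s)" using w by (rule integrable_mult_right)
    show "AE s in lborel. norm (w s * complex_of_real (f (cis (2 * pi * s / l)))) \<le> norm (of_real B * w s)"
    proof (rule AE_I2)
      fix s
      have "\<bar>f (cis (2 * pi * s / l))\<bar> \<le> \<bar>B\<bar>" using B[of "cis (2 * pi * s / l)"] by simp
      from mult_right_mono[OF this norm_ge_zero[of "w s"]]
      show "norm (w s * complex_of_real (f (cis (2 * pi * s / l)))) \<le> norm (of_real B * w s)"
        by (simp add: norm_mult mult.commute)
    qed
  qed simp
  have "norm ?I \<le> e * (LINT s|lborel. norm (w s))" if e: "0 < e" for e
  proof -
    obtain g where g: "trig_poly g" "\<forall>t. norm (complex_of_real (f (cis t)) - g t) < e"
      using trig_poly_dense[OF f e] by blast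
    note gi = conjunct1[OF trig[OF g(1)]]
    have "?I = (LINT s|lborel. w s * complex_of_real (f (cis (2 * pi * s / l))) - w s * g (2 * pi * s / l))"
      using trig[OF g(1)] by (subst Bochner_Integration.integral_diff[OF fint gi]) simp
    also have "norm \<dots> \<le> (LINT s|lborel. e * norm (w s))"
    proof (rule integral_norm_bound[THEN order_trans], rule integral_mono)
      show "norm (w s * complex_of_real (f (cis (2 * pi * s / l))) - w s * g (2 * pi * s / l)) \<le> e * norm (w s)" for s
        using g(2) unfolding right_diff_distrib[symmetric] norm_mult
        by (metis mult.commute mult_left_mono norm_ge_zero less_imp_le)
      show "integrable lborel (\<lambda>s. norm (w s * complex_of_real (f (cis (2 * pi * s / l))) - w s * g (2 * pi * s / l)))"
        by (intro integrable_norm Bochner_Integration.integrable_diff fint gi)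
    qed (use w in auto)
    finally show ?thesis by simp
  qed
  then have "norm ?I \<le> 0 + e" if "0 < e" for e
  proof -
    define W where "W = (LINT s|lborel. norm (w s))"
    have "0 \<le> W" by (simp add: W_def)
    \<comment> \<open>W + 1 instead of W, since the integral of |w| may be 0.\<close>
    then have "0 < e / (W + 1)" using that by simp
    then have "norm ?I \<le> e / (W + 1) * W"
      unfolding W_def by (rule \<open>\<And>e. 0 < e \<Longrightarrow> norm ?I \<le> e * (LINT s|lborel. norm (w s))\<close>)
    also have "\<dots> \<le> e" using that \<open>0 \<le> W\<close> by (simp add: field_simps)
    finally show ?thesis by simp
  qed
  then have "norm ?I \<le> 0" by (rule field_le_epsilon)
  then show ?thesis by simp
qed

text \<open>The asymmetry of the bounds matters: the endpoints 0 and l are sent to the same point of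
  the circle, but that point has no preimage in the open interval. With l = 2 \<pi> the lemma also
  serves the polar angle.\<close>

lemma cis_period_inj:
  assumes "0 < s" "s < l" "0 \<le> t" "t \<le> l" "cis (2 * pi * s / l) = cis (2 * pi * t / l)"
  shows "s = t"
proof -
  have l: "0 < l" using assms by simp
  have "sin (2 * pi * s / l) = sin (2 * pi * t / l) \<and> cos (2 * pi * s / l) = cos (2 * pi * t / l)"
    using assms(5) by (simp add: complex_eq_iff)
  then obtain n :: int where n: "2 * pi * s / l = 2 * pi * t / l + 2 * pi * n"
    unfolding sin_cos_eq_iff by blast
  have "2 * pi * s = (2 * pi * t / l + 2 * pi * n) * l"
    using n l by (simp add: nonzero_divide_eq_eq[symmetric] del: times_divide_eq_left)
  also have "\<dots> = 2 * pi * (t + n * l)" using l by (simp add: field_simps)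
  finally have st: "s = t + n * l" by simp
  have "n = 0"
  proof (rule ccontr)
    assume "n \<noteq> 0"
    then consider "1 \<le> n" | "n \<le> -1" by linarith
    then show False
    proof cases
      case 1
      then have "1 * l \<le> real_of_int n * l" using l by (intro mult_right_mono) auto
      then show False using st assms(2,3) by linarith
    next
      case 2
      then have "real_of_int n * l \<le> (-1) * l" using l by (intro mult_right_mono) auto
      then show False using st assms(1,4) by linarith
    qed
  qed
  then show ?thesis using st by simp
qed

text \<open>On the interval the indicator of a subinterval is a pointwise limit of functions min 1
  (k d), where d is the distance on the circle to the complementary arc; these are continuous and
  bounded by 1. So the integrals of w over all intervals vanish.\<close>

lemma harmonic_complete_zero:
  assumes l: "0 < l" and w: "integrable lborel w" and w0: "\<And>s. s \<notin> {0<..<l} \<Longrightarrow> w s = 0"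
    and orth: "\<And>n. (LINT s|lborel. w s * cnj (harmonic l n s)) = 0"
  shows "AE s in lborel. w s = 0"
proof (rule AE_zero_if_box_integrals_zero[OF w])
  fix a b :: real
  have [measurable]: "w \<in> borel_measurable borel" using w by auto
  define a' b' where "a' = max a 0" and "b' = min b l"
  have ind: "indicator (box a b) s *\<^sub>R w s = indicator {a'<..<b'} s *\<^sub>R w s" for s
    using w0[of s] by (cases "s \<in> {0<..<l}") (auto simp: a'_def b'_def box_real split: split_indicator)
  show "(LINT s|lborel. indicator (box a b) s *\<^sub>R w s) = 0"
  proof (cases "a' < b'")
    case False
    then show ?thesis unfolding ind by simp
  next
    case True
    have ab: "0 \<le> a'" "b' \<le> l" by (auto simp: a'_def b'_def)
    let ?c = "\<lambda>s. cis (2 * pi * s / l)"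
    \<comment> \<open>The closed pieces contain 0 and l, so C is nonempty; this matters because
      \<open>infdist\<close> to the empty set is 0 by convention.\<close>
    define C where "C = ?c ` ({0..a'} \<union> {b'..l})"
    have cc: "continuous_on T ?c" for T
      unfolding cis_conv_exp by (intro continuous_intros) (use l in auto)
    have C: "closed C" "C \<noteq> {}" unfolding C_def using ab
      by (auto intro!: compact_imp_closed compact_continuous_image[OF cc] compact_Un)
    define G where "G k z = min 1 (real k * infdist z C)" for k and z :: complex
    have "(\<lambda>k. LINT s|lborel. w s * complex_of_real (G k (?c s))) \<longlonglongrightarrow> (LINT s|lborel. w s * complex_of_real (indicator {a'<..<b'} s))"
    proof (rule integral_dominated_convergence[where w = "\<lambda>s. norm (w s)"])
      have "continuous_on UNIV (\<lambda>s. G k (?c s))" for k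
        unfolding G_def by (intro continuous_intros cc)
      then have [measurable]: "(\<lambda>s. G k (?c s)) \<in> borel_measurable borel" for k
        by (rule borel_measurable_continuous_onI)
      show "(\<lambda>s. w s * complex_of_real (G k (?c s))) \<in> borel_measurable lborel" for k
        by measurable
      have "0 \<le> G k z" "G k z \<le> 1" for k z by (auto simp: G_def infdist_nonneg)
      then show "AE s in lborel. norm (w s * complex_of_real (G k (?c s))) \<le> norm (w s)" for k
        by (intro AE_I2) (simp add: norm_mult mult_left_le)
      show "AE s in lborel. (\<lambda>k. w s * complex_of_real (G k (?c s))) \<longlonglongrightarrow> w s * complex_of_real (indicator {a'<..<b'} s)"
      proof (rule AE_I2)
        fix s
        show "(\<lambda>k. w s * complex_of_real (G k (?c s))) \<longlonglongrightarrow> w s * complex_of_real (indicator {a'<..<b'} s)"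
        proof (cases "s \<in> {0<..<l}")
          case s: True
          have "(\<lambda>k. G k (?c s)) \<longlonglongrightarrow> indicator {a'<..<b'} s"
          proof (cases "s \<in> {a'<..<b'}")
            case True
            have "?c s \<notin> C"
            proof
              assume "?c s \<in> C"
              then obtain t where t: "t \<in> {0..a'} \<union> {b'..l}" "?c s = ?c t" unfolding C_def by blast
              have "s = t" by (rule cis_period_inj[of s l t]) (use s t ab True in auto)
              then show False using t True by auto
            qed
            then have d: "0 < infdist (?c s) C"
              using C infdist_nonneg[of "?c s" C] in_closed_iff_infdist_zero[OF C] by fastforce
            have "\<forall>\<^sub>F k in sequentially. G k (?c s) = 1"
            proof (rule eventually_sequentiallyI)
              fix k assume "nat \<lceil>1 / infdist (?c s) C\<rceil> \<le> k"
              then have "1 / infdist (?c s) C \<le> real k" by linarith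
              then show "G k (?c s) = 1" using d by (simp add: G_def pos_divide_le_eq)
            qed
            then show ?thesis using True by (simp add: tendsto_eventually)
          next
            case False
            then have "?c s \<in> C" unfolding C_def using s by auto
            then show ?thesis using False by (simp add: G_def)
          qed
          then show ?thesis by (intro tendsto_mult tendsto_const tendsto_of_real)
        qed (simp add: w0)
      qed
    qed (use w in auto)
    moreover have "(LINT s|lborel. w s * complex_of_real (G k (?c s))) = 0" for k
      by (rule integral_circle_function_zero[OF l w w0 orth]) (auto simp: G_def intro!: continuous_intros)
    ultimately have "(LINT s|lborel. w s * complex_of_real (indicator {a'<..<b'} s)) = 0" by (simp add: LIMSEQ_const_iff)
    moreover have "w s * complex_of_real (indicator {a'<..<b'} s) = indicator (box a b) s *\<^sub>R w s" for s
      unfolding ind by (simp split: split_indicator)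
    ultimately show ?thesis by simp
  qed
qed

lemma trig_sum_extend:
  assumes "N \<le> M"
  shows "trig_sum l N a = trig_sum l M (\<lambda>n. if n \<in> {- int N..int N} then a n else 0)"
proof
  fix s
  have "trig_sum l M (\<lambda>n. if n \<in> {- int N..int N} then a n else 0) s = (\<Sum>n\<in>{- int N..int N}. (if n \<in> {- int N..int N} then a n else 0) * harmonic l n s)"
    unfolding trig_sum_def using assms by (intro sum.mono_neutral_right) auto
  then show "trig_sum l N a s = trig_sum l M (\<lambda>n. if n \<in> {- int N..int N} then a n else 0) s"
    by (simp add: trig_sum_def)
qed

lemma trig_sum_add: "trig_sum l N a s + trig_sum l N b s = trig_sum l N (\<lambda>n. a n + b n) s"
  by (simp add: trig_sum_def sum.distrib distrib_right)

text \<open>The Fourier sum of degree M is the closest among all sums of degree at most M, and the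
  sum of degree N is one of these after padding with zero coefficients.\<close>

lemma sqnorm_fourier_antimono:
  assumes "square_integrable lborel g" "0 < l" "N \<le> M"
  shows "sqnorm lborel (\<lambda>s. g s - trig_sum l M (\<lambda>n. fcoeff l n g) s) \<le> sqnorm lborel (\<lambda>s. g s - trig_sum l N a s)"
  unfolding trig_sum_extend[OF assms(3), of l a] sqnorm_diff_trig_sum[OF assms(1,2)]
  using assms(2) by (simp add: sum_nonneg)

text \<open>Projection onto the closure of the trigonometric sums leaves a remainder orthogonal to
  all harmonics, which is 0 on the interval by completeness. Hence some trigonometric sum is close
  to g, and best approximation transfers this to all later Fourier sums.\<close>

theorem fourier_L2_convergence:
  assumes l: "0 < l" and g: "square_integrable lborel g" and g0: "\<And>s. s \<notin> {0<..<l} \<Longrightarrow> g s = 0"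
  shows "(\<lambda>N. sqnorm lborel (\<lambda>s. g s - trig_sum l N (\<lambda>n. fcoeff l n g) s)) \<longlonglongrightarrow> 0"
proof -
  define T where "T = {trig_sum l N a | N a. True}"
  obtain p h where p: "\<And>k. p k \<in> T" and h: "square_integrable lborel h"
    and lim: "(\<lambda>k. sqnorm lborel (\<lambda>s. p k s - h s)) \<longlonglongrightarrow> 0"
    and orth: "\<And>q. q \<in> T \<Longrightarrow> (LINT s|lborel. (g s - h s) \<bullet> q s) = 0"
  proof (rule L2_projection[OF g, of T])
    show "square_integrable lborel q" if "q \<in> T" for q
      using that by (auto simp: T_def intro: square_integrable_trig_sum)
    have "(\<lambda>s. 0) = trig_sum l 0 (\<lambda>n. 0)" by (auto simp: trig_sum_def)
    then show "(\<lambda>s. 0) \<in> T" unfolding T_def by blast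
    show "(\<lambda>s. q s + r s) \<in> T" if qr: "q \<in> T" "r \<in> T" for q r
    proof -
      obtain N a M b where q: "q = trig_sum l N a" and r: "r = trig_sum l M b" using qr unfolding T_def by blast
      define a' b' where "a' n = (if n \<in> {- int N..int N} then a n else 0)" and "b' n = (if n \<in> {- int M..int M} then b n else 0)" for n
      have "q = trig_sum l (max N M) a'" "r = trig_sum l (max N M) b'"
        unfolding q r a'_def[abs_def] b'_def[abs_def] by (rule trig_sum_extend, simp)+
      then have "(\<lambda>s. q s + r s) = trig_sum l (max N M) (\<lambda>n. a' n + b' n)" using trig_sum_add by blast
      then show ?thesis unfolding T_def by blast
    qed
    show "(\<lambda>s. c *\<^sub>R q s) \<in> T" if q: "q \<in> T" for c q
    proof -
      obtain N a where q: "q = trig_sum l N a" using q unfolding T_def by blast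
      have "(\<lambda>s. c *\<^sub>R q s) = trig_sum l N (\<lambda>n. c *\<^sub>R a n)"
        unfolding q by (auto simp: trig_sum_def scaleR_sum_right)
      then show ?thesis unfolding T_def by blast
    qed
  qed blast
  have hm [measurable]: "h \<in> borel_measurable borel" "g \<in> borel_measurable borel"
    using square_integrable_measurable[OF h] square_integrable_measurable[OF g] by simp_all
  \<comment> \<open>The projection h is not known to vanish outside the interval, so the remainder
    is cut off before completeness is applied; the cut does not alter the integrals against the
    harmonics.\<close>
  define w where "w s = indicator {0<..<l} s *\<^sub>R (g s - h s)" for s
  have gh: "square_integrable lborel (\<lambda>s. g s - h s)" using g h by auto
  have ws: "square_integrable lborel w"
  proof (rule square_integrable_bound[OF gh, of _ 1])
    show "w \<in> borel_measurable lborel" unfolding w_def[abs_def] by measurable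
  qed (auto simp: w_def split: split_indicator)
  have "AE s in lborel. w s = 0"
  proof (rule harmonic_complete_zero[OF l])
    show "integrable lborel w"
    proof (rule Bochner_Integration.integrable_bound)
      show "integrable lborel (\<lambda>s. norm (harmonic l 0 s) * norm (g s - h s))"
        by (rule integrable_norm_mult[OF square_integrable_harmonic gh])
    qed (use square_integrable_measurable[OF ws] in \<open>auto simp: w_def norm_harmonic split: split_indicator\<close>)
    show "w s = 0" if "s \<notin> {0<..<l}" for s using that by (simp add: w_def)
    fix n
    define \<alpha> where "\<alpha> = (LINT s|lborel. (g s - h s) * cnj (harmonic l n s))"
    \<comment> \<open>The projection is orthogonal for the real inner product only. Since T contains
      all complex multiples c of the harmonic, c = 1 and c = \<i> recover the complex
      identity.\<close>
    have *: "Re (\<alpha> * cnj c) = 0" for c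
    proof -
      have one: "trig_sum l N (\<lambda>m. if m = n then c else 0) s = c * harmonic l n s" if "N = nat \<bar>n\<bar>" for N s
      proof -
        have "trig_sum l N (\<lambda>m. if m = n then c else 0) s = (\<Sum>m\<in>{- int N..int N}. if m = n then c * harmonic l m s else 0)"
          unfolding trig_sum_def by (intro sum.cong) auto
        moreover have "n \<in> {- int N..int N}" using that by auto
        ultimately show ?thesis by simp
      qed
      have "trig_sum l (nat \<bar>n\<bar>) (\<lambda>m. if m = n then c else 0) \<in> T" unfolding T_def by blast
      from orth[OF this] have "(LINT s|lborel. (g s - h s) \<bullet> (c * harmonic l n s)) = 0" by (simp only: one)
      then have "Re (LINT s|lborel. (g s - h s) * cnj (c * harmonic l n s)) = 0"
        by (subst (asm) integral_inner_complex[OF gh]) (auto intro: square_integrable_cmult square_integrable_harmonic)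
      moreover have "(LINT s|lborel. (g s - h s) * cnj (c * harmonic l n s)) = (LINT s|lborel. ((g s - h s) * cnj (harmonic l n s)) * cnj c)"
        by (intro Bochner_Integration.integral_cong) (auto simp: mult_ac)
      moreover have "\<dots> = \<alpha> * cnj c" unfolding \<alpha>_def
        by (rule integral_mult_left_zero)
      ultimately show ?thesis by (simp only:)
    qed
    from *[of 1] *[of \<i>] have "\<alpha> = 0" by (simp add: complex_eq_iff)
    moreover have "w s * cnj (harmonic l n s) = (g s - h s) * cnj (harmonic l n s)" for s
      by (simp add: w_def harmonic_def split: split_indicator)
    ultimately show "(LINT s|lborel. w s * cnj (harmonic l n s)) = 0" by (simp only: \<alpha>_def)
  qed
  then have eq: "AE s in lborel. g s = indicator {0<..<l} s *\<^sub>R h s"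
    by eventually_elim (use g0 in \<open>auto simp: w_def split: split_indicator_asm split_indicator\<close>)
  have psi: "square_integrable lborel (p k)" for k using p[of k] by (auto simp: T_def intro: square_integrable_trig_sum)
  have le: "sqnorm lborel (\<lambda>s. g s - p k s) \<le> sqnorm lborel (\<lambda>s. p k s - h s)" for k
  proof -
    have p0: "s \<notin> {0<..<l} \<Longrightarrow> p k s = 0" for s using p[of k] by (auto simp: T_def trig_sum_def harmonic_outside)
    show ?thesis unfolding sqnorm_def
    proof (rule integral_mono_AE)
      show "AE s in lborel. (norm (g s - p k s))\<^sup>2 \<le> (norm (p k s - h s))\<^sup>2"
        using eq by eventually_elim (use p0 in \<open>auto simp: norm_minus_commute split: split_indicator\<close>)
    qed (use g h psi in \<open>auto intro!: square_integrable_integrable\<close>)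
  qed
  show ?thesis
  proof (rule LIMSEQ_I)
    fix e :: real assume "0 < e"
    then obtain k where "norm (sqnorm lborel (\<lambda>s. p k s - h s) - 0) < e"
      using LIMSEQ_D[OF lim \<open>0 < e\<close>] by blast
    then have "sqnorm lborel (\<lambda>s. p k s - h s) < e" by simp
    moreover obtain N a where "p k = trig_sum l N a" using p[of k] unfolding T_def by blast
    ultimately have N: "sqnorm lborel (\<lambda>s. g s - trig_sum l N a s) < e" using le[of k] by simp
    have "norm (sqnorm lborel (\<lambda>s. g s - trig_sum l M (\<lambda>n. fcoeff l n g) s) - 0) < e" if "N \<le> M" for M
      using sqnorm_fourier_antimono[OF g l that, of a] N by simp
    then show "\<exists>no. \<forall>n\<ge>no. norm (sqnorm lborel (\<lambda>s. g s - trig_sum l n (\<lambda>n. fcoeff l n g) s) - 0) < e" by blast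
  qed
qed

section \<open>Fourier series in the second variable of a product\<close>

lemma fcoeff_measurable:
  fixes f :: "'x \<times> real \<Rightarrow> complex"
  assumes [measurable]: "f \<in> borel_measurable (M \<Otimes>\<^sub>M lborel)"
  shows "(\<lambda>x. fcoeff l n (\<lambda>s. f (x, s))) \<in> borel_measurable M"
proof -
  have "(\<lambda>(x, s). f (x, s) * cnj (harmonic l n s)) \<in> borel_measurable (M \<Otimes>\<^sub>M lborel)" by measurable
  from sigma_finite_measure.borel_measurable_lebesgue_integral[OF sigma_finite_lborel this]
  have "(\<lambda>x. LINT s|lborel. f (x, s) * cnj (harmonic l n s)) \<in> borel_measurable M" by simp
  then show ?thesis unfolding fcoeff_def by measurable
qed

context
  fixes M :: "'x measure" and l :: real
  assumes sigma_finite: "sigma_finite_measure M" and l: "0 < l"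
begin

interpretation pair_sigma_finite M lborel
  by (intro pair_sigma_finite.intro sigma_finite sigma_finite_lborel)

lemma square_integrable_tensor:
  assumes c: "square_integrable M c"
  shows "square_integrable (M \<Otimes>\<^sub>M lborel) (\<lambda>z. c (fst z) * harmonic l n (snd z))"
proof -
  have [measurable]: "c \<in> borel_measurable M" using c by auto
  have m: "(\<lambda>z. c (fst z) * harmonic l n (snd z)) \<in> borel_measurable (M \<Otimes>\<^sub>M lborel)" by measurable
  have "integrable (M \<Otimes>\<^sub>M lborel) (\<lambda>z. (norm (c (fst z) * harmonic l n (snd z)))\<^sup>2)"
  proof (rule Fubini_integrable)
    have "(LINT s|lborel. norm ((norm (c (fst (x, s)) * harmonic l n (snd (x, s))))\<^sup>2)) = (norm (c x))\<^sup>2 * sqnorm lborel (harmonic l n)" for x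
      by (simp add: norm_mult power_mult_distrib sqnorm_def)
    then show "integrable M (\<lambda>x. LINT s|lborel. norm ((norm (c (fst (x, s)) * harmonic l n (snd (x, s))))\<^sup>2))"
      using square_integrable_integrable[OF c] by simp
    show "AE x in M. integrable lborel (\<lambda>s. (norm (c (fst (x, s)) * harmonic l n (snd (x, s))))\<^sup>2)"
      using square_integrable_integrable[OF square_integrable_harmonic] by (simp add: norm_mult power_mult_distrib)
  qed (use m in measurable)
  then show ?thesis using m by (simp add: square_integrable_def)
qed

lemma square_integrable_pair_trig_sum:
  assumes "\<And>n. square_integrable M (c n)"
  shows "square_integrable (M \<Otimes>\<^sub>M lborel) (\<lambda>z. trig_sum l N (\<lambda>n. c n (fst z)) (snd z))"
  unfolding trig_sum_def by (intro square_integrable_sum square_integrable_tensor assms)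

lemma
  fixes f :: "'x \<times> real \<Rightarrow> complex"
  assumes f: "square_integrable (M \<Otimes>\<^sub>M lborel) f"
  shows AE_square_integrable_section: "AE x in M. square_integrable lborel (\<lambda>s. f (x, s))"
    and integrable_sqnorm_section: "integrable M (\<lambda>x. sqnorm lborel (\<lambda>s. f (x, s)))"
    and sqnorm_pair: "sqnorm (M \<Otimes>\<^sub>M lborel) f = (LINT x|M. sqnorm lborel (\<lambda>s. f (x, s)))"
proof -
  have [measurable]: "f \<in> borel_measurable (M \<Otimes>\<^sub>M lborel)" using f by auto
  have i: "integrable (M \<Otimes>\<^sub>M lborel) (\<lambda>z. (norm (f z))\<^sup>2)" by (rule square_integrable_integrable[OF f])
  show "AE x in M. square_integrable lborel (\<lambda>s. f (x, s))"
    using AE_integrable_fst'[OF i] AE_space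
    by eventually_elim (simp add: square_integrable_def)
  show "integrable M (\<lambda>x. sqnorm lborel (\<lambda>s. f (x, s)))"
    unfolding sqnorm_def by (rule integrable_fst'[OF i])
  show "sqnorm (M \<Otimes>\<^sub>M lborel) f = (LINT x|M. sqnorm lborel (\<lambda>s. f (x, s)))"
    unfolding sqnorm_def by (rule integral_fst'[OF i, symmetric])
qed

lemma
  fixes f :: "'x \<times> real \<Rightarrow> complex"
  assumes f: "square_integrable (M \<Otimes>\<^sub>M lborel) f"
  shows square_integrable_fcoeff: "square_integrable M (\<lambda>x. fcoeff l n (\<lambda>s. f (x, s)))"
    and Bessel_pair: "(\<Sum>n\<in>{- int N..int N}. l * sqnorm M (\<lambda>x. fcoeff l n (\<lambda>s. f (x, s)))) \<le> sqnorm (M \<Otimes>\<^sub>M lborel) f"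
proof -
  have m: "(\<lambda>x. fcoeff l n (\<lambda>s. f (x, s))) \<in> borel_measurable M" for n
    using f by (intro fcoeff_measurable) auto
  have bes: "AE x in M. (\<Sum>n\<in>{- int N..int N}. l * (norm (fcoeff l n (\<lambda>s. f (x, s))))\<^sup>2) \<le> sqnorm lborel (\<lambda>s. f (x, s))" for N
    using AE_square_integrable_section[OF f] by eventually_elim (rule Bessel[OF _ l])
  have si: "square_integrable M (\<lambda>x. fcoeff l n (\<lambda>s. f (x, s)))" for n
    unfolding square_integrable_def
  proof
    show "integrable M (\<lambda>x. (norm (fcoeff l n (\<lambda>s. f (x, s))))\<^sup>2)"
    proof (rule Bochner_Integration.integrable_bound)
      show "integrable M (\<lambda>x. sqnorm lborel (\<lambda>s. f (x, s)) / l)"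
        using integrable_sqnorm_section[OF f] by (rule integrable_divide)
      show "AE x in M. norm ((norm (fcoeff l n (\<lambda>s. f (x, s))))\<^sup>2) \<le> norm (sqnorm lborel (\<lambda>s. f (x, s)) / l)"
        using bes[of "nat \<bar>n\<bar>"]
      proof eventually_elim
        case (elim x)
        have "l * (norm (fcoeff l n (\<lambda>s. f (x, s))))\<^sup>2 \<le> (\<Sum>n\<in>{- int (nat \<bar>n\<bar>)..int (nat \<bar>n\<bar>)}. l * (norm (fcoeff l n (\<lambda>s. f (x, s))))\<^sup>2)"
          using l by (intro member_le_sum[of n _ "\<lambda>n. l * (norm (fcoeff l n (\<lambda>s. f (x, s))))\<^sup>2"]) auto
        with elim have "l * (norm (fcoeff l n (\<lambda>s. f (x, s))))\<^sup>2 \<le> sqnorm lborel (\<lambda>s. f (x, s))" by linarith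
        then show ?case using l by (simp add: pos_le_divide_eq mult.commute)
      qed
    qed (use m in measurable)
  qed (rule m)
  then show "square_integrable M (\<lambda>x. fcoeff l n (\<lambda>s. f (x, s)))" .
  have "(\<Sum>n\<in>{- int N..int N}. l * sqnorm M (\<lambda>x. fcoeff l n (\<lambda>s. f (x, s)))) = (LINT x|M. (\<Sum>n\<in>{- int N..int N}. l * (norm (fcoeff l n (\<lambda>s. f (x, s))))\<^sup>2))"
    unfolding sqnorm_def using square_integrable_integrable[OF si]
    by (subst Bochner_Integration.integral_sum) auto
  also have "\<dots> \<le> (LINT x|M. sqnorm lborel (\<lambda>s. f (x, s)))"
    by (intro integral_mono_AE bes integrable_sqnorm_section f Bochner_Integration.integrable_sum integrable_mult_right
        square_integrable_integrable si)
  finally show "(\<Sum>n\<in>{- int N..int N}. l * sqnorm M (\<lambda>x. fcoeff l n (\<lambda>s. f (x, s)))) \<le> sqnorm (M \<Otimes>\<^sub>M lborel) f"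
    by (simp only: sqnorm_pair[OF f])
qed

text \<open>The Fourier sums converge on almost every fibre. The squared error there is at most the
  squared norm of the fibre, which is integrable and dominates.\<close>

theorem fourier_pair_convergence:
  fixes f :: "'x \<times> real \<Rightarrow> complex"
  assumes f: "square_integrable (M \<Otimes>\<^sub>M lborel) f" and f0: "\<And>x s. s \<notin> {0<..<l} \<Longrightarrow> f (x, s) = 0"
  shows "(\<lambda>N. sqnorm (M \<Otimes>\<^sub>M lborel) (\<lambda>z. f z - trig_sum l N (\<lambda>n. fcoeff l n (\<lambda>s. f (fst z, s))) (snd z))) \<longlonglongrightarrow> 0"
proof -
  let ?d = "\<lambda>N z. f z - trig_sum l N (\<lambda>n. fcoeff l n (\<lambda>s. f (fst z, s))) (snd z)"
  have d: "square_integrable (M \<Otimes>\<^sub>M lborel) (?d N)" for N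
    by (intro square_integrable_diff f square_integrable_pair_trig_sum square_integrable_fcoeff)
  have "(\<lambda>N. LINT x|M. sqnorm lborel (\<lambda>s. ?d N (x, s))) \<longlonglongrightarrow> (LINT x|M. 0)"
  proof (rule integral_dominated_convergence[where w = "\<lambda>x. sqnorm lborel (\<lambda>s. f (x, s))"])
    show "integrable M (\<lambda>x. sqnorm lborel (\<lambda>s. f (x, s)))" by (rule integrable_sqnorm_section[OF f])
    show "(\<lambda>x. sqnorm lborel (\<lambda>s. ?d N (x, s))) \<in> borel_measurable M" for N
      using integrable_sqnorm_section[OF d] by (rule borel_measurable_integrable)
    show "AE x in M. (\<lambda>N. sqnorm lborel (\<lambda>s. ?d N (x, s))) \<longlonglongrightarrow> 0"
      using AE_square_integrable_section[OF f]
      by eventually_elim (use fourier_L2_convergence[OF l] f0 in simp)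
    show "AE x in M. norm (sqnorm lborel (\<lambda>s. ?d N (x, s))) \<le> sqnorm lborel (\<lambda>s. f (x, s))" for N
      using AE_square_integrable_section[OF f]
    proof eventually_elim
      case (elim x)
      have "0 \<le> (\<Sum>n\<in>{- int N..int N}. l * (norm (fcoeff l n (\<lambda>s. f (x, s))))\<^sup>2)"
        using l by (intro sum_nonneg) auto
      then show ?case
        using sqnorm_diff_trig_sum[OF elim l, of N "\<lambda>n. fcoeff l n (\<lambda>s. f (x, s))"]
          sqnorm_nonneg[of lborel "\<lambda>s. ?d N (x, s)"] by simp
    qed
  qed simp
  then show ?thesis by (simp add: sqnorm_pair[OF d])
qed

text \<open>On almost every fibre, completing the square and Bessel's inequality bound l times the
  squared defect of the n-th coefficient by the squared error of any sum that contains mode n.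
  Integrate over the fibres and let N grow.\<close>

lemma fourier_pair_unique:
  fixes f :: "'x \<times> real \<Rightarrow> complex"
  assumes f: "square_integrable (M \<Otimes>\<^sub>M lborel) f" and c: "\<And>n. square_integrable M (c n)"
    and lim: "(\<lambda>N. sqnorm (M \<Otimes>\<^sub>M lborel) (\<lambda>z. f z - trig_sum l N (\<lambda>n. c n (fst z)) (snd z))) \<longlonglongrightarrow> 0"
  shows "AE x in M. c n x = fcoeff l n (\<lambda>s. f (x, s))"
proof -
  let ?d = "\<lambda>N z. f z - trig_sum l N (\<lambda>n. c n (fst z)) (snd z)"
  let ?e = "\<lambda>x. c n x - fcoeff l n (\<lambda>s. f (x, s))"
  have d: "square_integrable (M \<Otimes>\<^sub>M lborel) (?d N)" for N
    by (intro square_integrable_diff f square_integrable_pair_trig_sum c)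
  have e: "square_integrable M ?e" by (intro square_integrable_diff c square_integrable_fcoeff f)
  have le: "l * sqnorm M ?e \<le> sqnorm (M \<Otimes>\<^sub>M lborel) (?d N)" if "nat \<bar>n\<bar> \<le> N" for N
  proof -
    have "l * sqnorm M ?e = (LINT x|M. l * (norm (?e x))\<^sup>2)" by (simp add: sqnorm_def)
    also have "\<dots> \<le> (LINT x|M. sqnorm lborel (\<lambda>s. ?d N (x, s)))"
    proof (rule integral_mono_AE)
      show "AE x in M. l * (norm (?e x))\<^sup>2 \<le> sqnorm lborel (\<lambda>s. ?d N (x, s))"
        using AE_square_integrable_section[OF f]
      proof eventually_elim
        case (elim x)
        have "l * (norm (?e x))\<^sup>2 \<le> (\<Sum>n\<in>{- int N..int N}. l * (norm (c n x - fcoeff l n (\<lambda>s. f (x, s))))\<^sup>2)"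
          using l that by (intro member_le_sum[of n _ "\<lambda>n. l * (norm (c n x - fcoeff l n (\<lambda>s. f (x, s))))\<^sup>2"]) auto
        moreover have "(\<Sum>n\<in>{- int N..int N}. l * (norm (fcoeff l n (\<lambda>s. f (x, s))))\<^sup>2) \<le> sqnorm lborel (\<lambda>s. f (x, s))"
          by (rule Bessel[OF elim l])
        ultimately show ?case using sqnorm_diff_trig_sum[OF elim l, of N "\<lambda>n. c n x"] by simp
      qed
    qed (intro integrable_mult_right square_integrable_integrable e integrable_sqnorm_section d)+
    finally show ?thesis by (simp only: sqnorm_pair[OF d])
  qed
  have "l * sqnorm M ?e \<le> 0"
    by (rule LIMSEQ_le_const[OF lim]) (use le in blast)
  then have "sqnorm M ?e = 0" using l sqnorm_nonneg[of M ?e] by (simp add: mult_le_0_iff)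
  from sqnorm_eq_0_AE[OF e this] show ?thesis by simp
qed

end

section \<open>Fourier coefficients on the cylinder\<close>

text \<open>\<open>join\<close> and \<open>horiz\<close> trade \<open>real^3\<close> for a product
  of the plane with the vertical axis, the form in which Fubini's theorem applies.\<close>

definition join :: "(real^2) \<times> real \<Rightarrow> real^3" where
  "join z = vector [fst z $ 1, fst z $ 2, snd z]"

lemma join_nth [simp]: "join z $ 1 = fst z $ 1" "join z $ 2 = fst z $ 2" "join z $ 3 = snd z"
  by (simp_all add: join_def)

lemma horiz_nth [simp]: "horiz a $ 1 = a $ 1" "horiz a $ 2 = a $ 2"
  by (simp_all add: horiz_def)

lemma horiz_join [simp]: "horiz (join z) = fst z"
  by (simp add: vec_eq_iff forall_2)

lemma join_horiz [simp]: "join (horiz a, a $ 3) = a"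
  by (simp add: vec_eq_iff forall_3)

lemma join_eq: "join z = fst z $ 1 *\<^sub>R axis 1 1 + fst z $ 2 *\<^sub>R axis 2 1 + snd z *\<^sub>R axis 3 1"
  by (simp add: vec_eq_iff forall_3 axis_def)

lemma horiz_eq: "horiz a = a $ 1 *\<^sub>R axis 1 1 + a $ 2 *\<^sub>R axis 2 1"
  by (simp add: vec_eq_iff forall_2 axis_def)

lemma bounded_linear_join: "bounded_linear join"
  unfolding join_eq[abs_def]
  by (intro bounded_linear_add bounded_linear_scaleR_left[THEN bounded_linear_compose] bounded_linear_snd
      bounded_linear_compose[OF bounded_linear_vec_nth bounded_linear_fst])

lemma bounded_linear_horiz: "bounded_linear horiz"
  unfolding horiz_eq[abs_def]
  by (intro bounded_linear_add bounded_linear_scaleR_left[THEN bounded_linear_compose] bounded_linear_vec_nth)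

lemma continuous_on_join [continuous_intros]: "continuous_on T f \<Longrightarrow> continuous_on T (\<lambda>x. join (f x))"
  using bounded_linear.continuous_on[OF bounded_linear_join] by blast

lemma continuous_on_horiz [continuous_intros]: "continuous_on T f \<Longrightarrow> continuous_on T (\<lambda>x. horiz (f x))"
  using bounded_linear.continuous_on[OF bounded_linear_horiz] by blast

lemma join_measurable [measurable]: "join \<in> borel_measurable borel"
  by (intro borel_measurable_continuous_onI continuous_intros)

lemma horiz_measurable [measurable]: "horiz \<in> borel_measurable borel"
  by (intro borel_measurable_continuous_onI continuous_intros)

lemma prod_Basis_vec: "(\<Prod>b\<in>Basis. (x::real^'n) \<bullet> b) = (\<Prod>i\<in>UNIV. x $ i)"
proof -
  have B: "(Basis :: (real^'n) set) = range (\<lambda>i. axis i 1)" by (auto simp: Basis_vec_def)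
  have "inj (\<lambda>i. axis i 1 :: real^'n)" by (auto simp: inj_def axis_eq_axis)
  then show ?thesis unfolding B by (subst prod.reindex) (simp_all add: inner_axis)
qed

lemma emeasure_lborel_box_cart:
  fixes a b :: "real^'n"
  assumes "\<And>i. a $ i \<le> b $ i"
  shows "emeasure lborel (box a b) = ennreal (\<Prod>i\<in>UNIV. b $ i - a $ i)"
proof -
  have "emeasure lborel (box a b) = ennreal (\<Prod>k\<in>Basis. (b - a) \<bullet> k)"
    by (rule emeasure_lborel_box) (use assms in \<open>auto simp: Basis_vec_def inner_axis\<close>)
  then show ?thesis by (simp add: prod_Basis_vec)
qed

text \<open>Lebesgue measure is determined by its values on boxes, and the preimage of a box is a
  planar box times an interval.\<close>

lemma lborel_join: "distr (lborel \<Otimes>\<^sub>M lborel) borel join = lborel"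
proof (rule lborel_eqI[symmetric])
  fix l u :: "real^3"
  assume le: "\<And>b. b \<in> Basis \<Longrightarrow> l \<bullet> b \<le> u \<bullet> b"
  have lu: "l $ i \<le> u $ i" for i using le[of "axis i 1"] by (simp add: inner_axis axis_in_Basis_iff)
  have pre: "join -` box l u = box (horiz l) (horiz u) \<times> {l $ 3<..<u $ 3}"
    by (auto simp: mem_box_cart forall_3 forall_2)
  have "emeasure (distr (lborel \<Otimes>\<^sub>M lborel) borel join) (box l u) = emeasure (lborel \<Otimes>\<^sub>M lborel) (join -` box l u \<inter> space (lborel \<Otimes>\<^sub>M lborel))"
    by (rule emeasure_distr) (auto simp: lborel_prod)
  also have "\<dots> = emeasure (lborel \<Otimes>\<^sub>M lborel) (box (horiz l) (horiz u) \<times> {l $ 3<..<u $ 3})"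
    by (simp add: pre space_pair_measure)
  also have "\<dots> = emeasure lborel (box (horiz l) (horiz u)) * emeasure lborel {l $ 3<..<u $ 3}"
    by (rule lborel.emeasure_pair_measure_Times) auto
  also have "emeasure lborel (box (horiz l) (horiz u)) = ennreal (\<Prod>i\<in>UNIV. horiz u $ i - horiz l $ i)"
    by (rule emeasure_lborel_box_cart) (metis (full_types) exhaust_2 horiz_nth lu)
  also have "(\<Prod>i\<in>(UNIV::2 set). horiz u $ i - horiz l $ i) = (u $ 1 - l $ 1) * (u $ 2 - l $ 2)"
    by (simp add: UNIV_2)
  also have "emeasure lborel {l $ 3<..<u $ 3} = ennreal (u $ 3 - l $ 3)" using lu by simp
  also have "ennreal ((u $ 1 - l $ 1) * (u $ 2 - l $ 2)) * ennreal (u $ 3 - l $ 3) = ennreal (\<Prod>i\<in>UNIV. (u - l) $ i)"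
  proof -
    have "(\<Prod>i\<in>UNIV. (u - l) $ i) = ((u $ 1 - l $ 1) * (u $ 2 - l $ 2)) * (u $ 3 - l $ 3)"
      unfolding UNIV_3 by simp
    then show ?thesis using ennreal_mult''[of "u $ 3 - l $ 3" "(u $ 1 - l $ 1) * (u $ 2 - l $ 2)"] lu[of 3] by simp
  qed
  finally show "emeasure (distr (lborel \<Otimes>\<^sub>M lborel) borel join) (box l u) = (\<Prod>b\<in>Basis. (u - l) \<bullet> b)"
    by (simp only: prod_Basis_vec)
qed (simp only: sets_distr)

lemma
  fixes g :: "real^3 \<Rightarrow> 'b::euclidean_space"
  assumes g: "g \<in> borel_measurable borel"
  shows integral_join: "(LINT a|lborel. g a) = (LINT z|(lborel \<Otimes>\<^sub>M lborel). g (join z))"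
    and integrable_join: "integrable lborel g \<longleftrightarrow> integrable (lborel \<Otimes>\<^sub>M lborel) (\<lambda>z. g (join z))"
proof -
  have m: "join \<in> (lborel \<Otimes>\<^sub>M lborel) \<rightarrow>\<^sub>M borel" by (simp add: lborel_prod)
  show "(LINT a|lborel. g a) = (LINT z|(lborel \<Otimes>\<^sub>M lborel). g (join z))"
    using integral_distr[OF m g] by (simp only: lborel_join)
  show "integrable lborel g \<longleftrightarrow> integrable (lborel \<Otimes>\<^sub>M lborel) (\<lambda>z. g (join z))"
    using integrable_distr_eq[OF m g] by (simp only: lborel_join)
qed

text \<open>The preimage of a planar null set N is N times the line; its measure is 0 times
  infinity, which is 0 for \<open>ennreal\<close>.\<close>

lemma AE_horiz:
  assumes "AE x in lborel. P x" shows "AE a in lborel. P (horiz a)"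
proof -
  obtain N where N: "N \<in> null_sets lborel" "{x. \<not> P x} \<subseteq> N"
    using assms by (auto simp: eventually_ae_filter)
  have Nb: "N \<in> sets borel" using N(1) by auto
  have "emeasure lborel (horiz -` N) = emeasure (distr (lborel \<Otimes>\<^sub>M lborel) borel join) (horiz -` N)"
    by (simp only: lborel_join)
  also have "\<dots> = emeasure (lborel \<Otimes>\<^sub>M lborel) (join -` (horiz -` N) \<inter> space (lborel \<Otimes>\<^sub>M lborel))"
    using measurable_sets[OF horiz_measurable Nb] by (intro emeasure_distr) (auto simp: lborel_prod)
  also have "join -` (horiz -` N) \<inter> space (lborel \<Otimes>\<^sub>M lborel) = N \<times> (UNIV :: real set)"
    by (auto simp: space_pair_measure)
  also have "emeasure (lborel \<Otimes>\<^sub>M lborel) (N \<times> (UNIV :: real set)) = emeasure lborel N * emeasure lborel (UNIV :: real set)"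
    using Nb by (intro lborel.emeasure_pair_measure_Times) auto
  also have "\<dots> = 0" using N(1) by (simp add: null_setsD1)
  finally have "horiz -` N \<in> null_sets lborel"
    using measurable_sets[OF horiz_measurable Nb] by (simp add: null_setsI)
  then show ?thesis using N(2) by (intro AE_I'[of "horiz -` N"]) auto
qed

section \<open>Disc and cylinder, and their passage to the product\<close>

lemma mem_cyl: "a \<in> cyl \<kappa> l \<longleftrightarrow> horiz a \<in> disc \<kappa> \<and> a $ 3 \<in> {0<..<l}"
  by (simp add: cyl_def)

lemma open_disc: "open (disc \<kappa>)"
  unfolding disc_def by (intro open_Collect_less continuous_intros)

lemma norm_disc: "x \<in> disc \<kappa> \<longleftrightarrow> (norm x)\<^sup>2 < \<kappa>\<^sup>2" for x :: "real^2"
  by (simp add: disc_def norm_vec_def L2_set_def sum_2)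

lemma disc_subset_cball: "disc \<kappa> \<subseteq> cball 0 \<bar>\<kappa>\<bar>"
proof
  fix x :: "real^2" assume "x \<in> disc \<kappa>"
  then show "x \<in> cball 0 \<bar>\<kappa>\<bar>" using abs_le_square_iff[of "norm x" \<kappa>] by (simp add: norm_disc)
qed

lemma bounded_disc: "bounded (disc \<kappa>)"
  by (rule bounded_subset[OF bounded_cball disc_subset_cball])

lemma open_cyl: "open (cyl \<kappa> l)"
proof -
  have "cyl \<kappa> l = horiz -` disc \<kappa> \<inter> {a. 0 < a $ 3} \<inter> {a. a $ 3 < l}" by (auto simp: cyl_def)
  moreover have "open (horiz -` disc \<kappa>)"
    by (rule open_vimage[OF open_disc]) (intro continuous_intros)
  ultimately show ?thesis
    by (auto intro!: open_Int open_Collect_less continuous_intros)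
qed

lemma bounded_cyl: "bounded (cyl \<kappa> l)"
proof -
  have "cyl \<kappa> l \<subseteq> join ` (cball 0 \<bar>\<kappa>\<bar> \<times> {0..l})"
  proof
    fix a assume a: "a \<in> cyl \<kappa> l"
    have "(horiz a, a $ 3) \<in> cball 0 \<bar>\<kappa>\<bar> \<times> {0..l}" using a disc_subset_cball[of \<kappa>] by (auto simp: cyl_def)
    then show "a \<in> join ` (cball 0 \<bar>\<kappa>\<bar> \<times> {0..l})" using join_horiz[of a] by (metis image_eqI)
  qed
  moreover have "compact (join ` (cball 0 \<bar>\<kappa>\<bar> \<times> {0..l}))"
    by (intro compact_continuous_image compact_Times continuous_intros) auto
  ultimately show ?thesis by (blast intro: bounded_subset compact_imp_bounded)
qed

abbreviation Lcyl :: "real \<Rightarrow> real \<Rightarrow> (real^3) measure" where "Lcyl \<kappa> l \<equiv> lebesgue_on (cyl \<kappa> l)"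
abbreviation Ldisc :: "real \<Rightarrow> (real^2) measure" where "Ldisc \<kappa> \<equiv> lebesgue_on (disc \<kappa>)"

lemma cyl_borel: "cyl \<kappa> l \<in> sets borel" and disc_borel: "disc \<kappa> \<in> sets borel"
  using open_cyl open_disc by auto

lemma
  fixes F :: "'a::euclidean_space \<Rightarrow> 'b::euclidean_space"
  assumes S: "S \<in> sets borel" and F: "F \<in> borel_measurable borel"
  shows square_integrable_lebesgue_on: "square_integrable (lebesgue_on S) F \<longleftrightarrow> square_integrable lborel (\<lambda>x. indicator S x *\<^sub>R F x)"
    and sqnorm_lebesgue_on: "sqnorm (lebesgue_on S) F = sqnorm lborel (\<lambda>x. indicator S x *\<^sub>R F x)"
proof -
  have m: "(\<lambda>x. (norm (F x))\<^sup>2) \<in> borel_measurable borel" using F by measurable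
  have eq: "(norm (indicator S x *\<^sub>R F x))\<^sup>2 = indicator S x *\<^sub>R (norm (F x))\<^sup>2" for x
    by (simp split: split_indicator)
  have "(\<lambda>x. indicator S x *\<^sub>R F x) \<in> borel_measurable lborel" using S F by simp
  then show "square_integrable (lebesgue_on S) F \<longleftrightarrow> square_integrable lborel (\<lambda>x. indicator S x *\<^sub>R F x)"
    unfolding square_integrable_def eq using integrable_lebesgue_on_borel[OF S m] borel_measurable_lebesgue_on[OF F] by simp
  show "sqnorm (lebesgue_on S) F = sqnorm lborel (\<lambda>x. indicator S x *\<^sub>R F x)"
    unfolding sqnorm_def eq by (rule integral_lebesgue_on_borel[OF S m])
qed

text \<open>Extension by zero, carried to the product, so that the theorems on product measures
  apply. The two indicators agree with those in \<open>harmonic\<close> and pass through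
  \<open>fcoeff\<close>, see \<open>fcoeff_lift\<close>.\<close>

definition lift :: "real \<Rightarrow> real \<Rightarrow> (real^3 \<Rightarrow> complex) \<Rightarrow> (real^2) \<times> real \<Rightarrow> complex" where
  "lift \<kappa> l F z = indicator (disc \<kappa>) (fst z) * indicator {0<..<l} (snd z) * F (join z)"

lemma lift_eq: "lift \<kappa> l F z = indicator (cyl \<kappa> l) (join z) *\<^sub>R F (join z)"
  by (simp add: lift_def mem_cyl indicator_def)

lemma lift_measurable [measurable]:
  assumes "F \<in> borel_measurable borel" shows "lift \<kappa> l F \<in> borel_measurable (lborel \<Otimes>\<^sub>M lborel)"
proof -
  have "lift \<kappa> l F \<in> borel_measurable borel"
    unfolding lift_eq[abs_def] using assms cyl_borel by measurable
  then show ?thesis by (simp add: lborel_prod)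
qed

lemma
  assumes F: "F \<in> borel_measurable borel"
  shows square_integrable_lift: "square_integrable (Lcyl \<kappa> l) F \<longleftrightarrow> square_integrable (lborel \<Otimes>\<^sub>M lborel) (lift \<kappa> l F)"
    and sqnorm_lift: "sqnorm (Lcyl \<kappa> l) F = sqnorm (lborel \<Otimes>\<^sub>M lborel) (lift \<kappa> l F)"
proof -
  have m: "(\<lambda>a. indicator (cyl \<kappa> l) a *\<^sub>R F a) \<in> borel_measurable borel" using F cyl_borel by measurable
  then have m2: "(\<lambda>a. (norm (indicator (cyl \<kappa> l) a *\<^sub>R F a))\<^sup>2) \<in> borel_measurable borel" by measurable
  show "square_integrable (Lcyl \<kappa> l) F \<longleftrightarrow> square_integrable (lborel \<Otimes>\<^sub>M lborel) (lift \<kappa> l F)"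
    unfolding square_integrable_lebesgue_on[OF cyl_borel F]
    using lift_measurable[OF F, of \<kappa> l] m integrable_join[OF m2]
    by (simp only: square_integrable_def lift_eq measurable_lborel1) simp
  show "sqnorm (Lcyl \<kappa> l) F = sqnorm (lborel \<Otimes>\<^sub>M lborel) (lift \<kappa> l F)"
    unfolding sqnorm_lebesgue_on[OF cyl_borel F] unfolding sqnorm_def integral_join[OF m2] lift_eq ..
qed

text \<open>Not cut down to the disc: for smooth F this is a smooth function on the whole plane
  (\<open>smooth_coef\<close>), which gives sense to its derivatives and to its values on the
  boundary circle.\<close>

definition coef :: "real \<Rightarrow> int \<Rightarrow> (real^3 \<Rightarrow> complex) \<Rightarrow> real^2 \<Rightarrow> complex" where
  "coef l n F x = fcoeff l n (\<lambda>s. F (join (x, s)))"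

lemma fcoeff_lift: "fcoeff l n (\<lambda>s. lift \<kappa> l F (x, s)) = indicator (disc \<kappa>) x *\<^sub>R coef l n F x"
proof -
  have "lift \<kappa> l F (x, s) * cnj (harmonic l n s) = indicator (disc \<kappa>) x * (F (join (x, s)) * cnj (harmonic l n s))" for s
    by (simp add: lift_def harmonic_def split: split_indicator)
  then show ?thesis unfolding fcoeff_def coef_def by (simp only:) (simp split: split_indicator)
qed

lemma coef_measurable [measurable]:
  assumes "F \<in> borel_measurable borel" shows "coef l n F \<in> borel_measurable borel"
proof -
  have "(\<lambda>z. F (join z)) \<in> borel_measurable (lborel \<Otimes>\<^sub>M lborel)"
    unfolding lborel_prod using assms by simp
  from fcoeff_measurable[OF this] show ?thesis by (simp add: coef_def[abs_def])
qed

lemma fourier_mode_measurable [measurable]: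
  assumes [measurable]: "c \<in> borel_measurable borel" shows "fourier_mode l n c \<in> borel_measurable borel"
proof -
  have "continuous_on UNIV (\<lambda>a::real^3. exp (2 * pi * \<i> * of_int n * (a $ 3) / l))"
    by (cases "l = 0") (auto intro!: continuous_intros)
  then have [measurable]: "(\<lambda>a::real^3. exp (2 * pi * \<i> * of_int n * (a $ 3) / l)) \<in> borel_measurable borel"
    by (rule borel_measurable_continuous_onI)
  show ?thesis unfolding fourier_mode_def[abs_def] by measurable
qed

lemma lift_fourier_mode:
  "lift \<kappa> l (fourier_mode l n c) z = (indicator (disc \<kappa>) (fst z) *\<^sub>R c (fst z)) * harmonic l n (snd z)"
  by (simp add: lift_def fourier_mode_def harmonic_def split: split_indicator)

lemma lift_diff: "lift \<kappa> l (\<lambda>a. F a - G a) z = lift \<kappa> l F z - lift \<kappa> l G z"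
  by (simp add: lift_def right_diff_distrib)

lemma lift_fourier_sum: "lift \<kappa> l (\<lambda>a. \<Sum>n\<in>{- int N..int N}. fourier_mode l n (c n) a) z
   = trig_sum l N (\<lambda>n. indicator (disc \<kappa>) (fst z) *\<^sub>R c n (fst z)) (snd z)"
proof -
  have "lift \<kappa> l (\<lambda>a. \<Sum>n\<in>{- int N..int N}. fourier_mode l n (c n) a) z = (\<Sum>n\<in>{- int N..int N}. lift \<kappa> l (fourier_mode l n (c n)) z)"
    by (simp add: lift_def sum_distrib_left)
  then show ?thesis by (simp add: lift_fourier_mode trig_sum_def)
qed

section \<open>Convergence, uniqueness and continuity of the coefficients on the cylinder\<close>

context
  fixes \<kappa> l :: real
  assumes l: "0 < l"
begin

lemma
  assumes F: "F \<in> borel_measurable borel" "square_integrable (Lcyl \<kappa> l) F"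
  shows square_integrable_coef: "square_integrable (Ldisc \<kappa>) (coef l n F)"
    and Bessel_cyl: "(\<Sum>n\<in>{- int N..int N}. l * sqnorm (Ldisc \<kappa>) (coef l n F)) \<le> sqnorm (Lcyl \<kappa> l) F"
    and fourier_cyl_convergence: "(\<lambda>N. sqnorm (Lcyl \<kappa> l) (\<lambda>a. F a - (\<Sum>n\<in>{- int N..int N}. fourier_mode l n (coef l n F) a))) \<longlonglongrightarrow> 0"
proof -
  have L: "square_integrable (lborel \<Otimes>\<^sub>M lborel) (lift \<kappa> l F)" using F square_integrable_lift by blast
  note cm = coef_measurable[OF F(1)]
  note sf = sigma_finite_lborel
  have si: "square_integrable lborel (\<lambda>x. indicator (disc \<kappa>) x *\<^sub>R coef l n F x)" for n
    using square_integrable_fcoeff[OF sf l L] by (simp only: fcoeff_lift)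
  then show "square_integrable (Ldisc \<kappa>) (coef l n F)"
    using square_integrable_lebesgue_on[OF disc_borel cm] by blast
  show "(\<Sum>n\<in>{- int N..int N}. l * sqnorm (Ldisc \<kappa>) (coef l n F)) \<le> sqnorm (Lcyl \<kappa> l) F"
    using Bessel_pair[OF sf l L, of N] by (simp only: fcoeff_lift sqnorm_lebesgue_on[OF disc_borel cm] sqnorm_lift[OF F(1)])
  have "(\<lambda>a. F a - (\<Sum>n\<in>{- int N..int N}. fourier_mode l n (coef l n F) a)) \<in> borel_measurable borel" for N
    using F(1) by measurable
  note eq = sqnorm_lift[OF this]
  have "lift \<kappa> l F (x, s) = 0" if "s \<notin> {0<..<l}" for x s using that by (simp add: lift_def)
  from fourier_pair_convergence[OF sf l L this]
  show "(\<lambda>N. sqnorm (Lcyl \<kappa> l) (\<lambda>a. F a - (\<Sum>n\<in>{- int N..int N}. fourier_mode l n (coef l n F) a))) \<longlonglongrightarrow> 0"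
    unfolding eq lift_diff[abs_def] lift_fourier_sum fcoeff_lift by simp
qed

lemma
  assumes c: "c \<in> borel_measurable borel" "square_integrable (Ldisc \<kappa>) c"
  shows square_integrable_fourier_mode_borel: "square_integrable (Lcyl \<kappa> l) (fourier_mode l n c)"
    and sqnorm_fourier_mode_borel: "sqnorm (Lcyl \<kappa> l) (fourier_mode l n c) = l * sqnorm (Ldisc \<kappa>) c"
proof -
  have c': "square_integrable lborel (\<lambda>x. indicator (disc \<kappa>) x *\<^sub>R c x)"
    using c square_integrable_lebesgue_on[OF disc_borel] by blast
  note m = fourier_mode_measurable[OF c(1)]
  have L: "square_integrable (lborel \<Otimes>\<^sub>M lborel) (lift \<kappa> l (fourier_mode l n c))"
    unfolding lift_fourier_mode[abs_def] by (rule square_integrable_tensor[OF sigma_finite_lborel l c'])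
  then show "square_integrable (Lcyl \<kappa> l) (fourier_mode l n c)" using square_integrable_lift[OF m] by blast
  have h: "sqnorm lborel (harmonic l n) = l"
  proof -
    have "sqnorm lborel (harmonic l n) = (LINT s|lborel. indicator {0<..<l} s)"
      unfolding sqnorm_def norm_harmonic by (intro Bochner_Integration.integral_cong) (auto split: split_indicator)
    then show ?thesis using l by simp
  qed
  have "sqnorm lborel (\<lambda>s. lift \<kappa> l (fourier_mode l n c) (x, s)) = l * (norm (indicator (disc \<kappa>) x *\<^sub>R c x))\<^sup>2" for x
    unfolding lift_fourier_mode fst_conv snd_conv sqnorm_cmult h by simp
  then show "sqnorm (Lcyl \<kappa> l) (fourier_mode l n c) = l * sqnorm (Ldisc \<kappa>) c"
    unfolding sqnorm_lift[OF m] sqnorm_pair[OF sigma_finite_lborel l L] sqnorm_lebesgue_on[OF disc_borel c(1)]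
    by (simp add: sqnorm_def)
qed

lemma AE_cyl_horiz:
  assumes "AE x in Ldisc \<kappa>. P x" shows "AE a in Lcyl \<kappa> l. P (horiz a)"
proof -
  have "AE x in completion lborel. x \<in> disc \<kappa> \<longrightarrow> P x"
    by (rule AE_restrict_space_iff[of "disc \<kappa>" lebesgue P, THEN iffD1, OF _ assms])
      (use disc_borel in simp)
  then have "AE x in lborel. x \<in> disc \<kappa> \<longrightarrow> P x" by (simp add: AE_completion_iff)
  from AE_horiz[OF this] have "AE a in lborel. a \<in> cyl \<kappa> l \<longrightarrow> P (horiz a)"
    by eventually_elim (simp add: mem_cyl)
  then show ?thesis by (rule AE_lebesgue_onI[OF cyl_borel])
qed

lemma fourier_coef_unique:
  assumes F: "F \<in> borel_measurable borel" "square_integrable (Lcyl \<kappa> l) F"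
    and c: "\<And>n. c n \<in> borel_measurable borel" "\<And>n. square_integrable (Ldisc \<kappa>) (c n)"
    and lim: "(\<lambda>N. sqnorm (Lcyl \<kappa> l) (\<lambda>a. F a - (\<Sum>n\<in>{- int N..int N}. fourier_mode l n (c n) a))) \<longlonglongrightarrow> 0"
  shows "AE x in Ldisc \<kappa>. c n x = coef l n F x"
proof -
  have L: "square_integrable (lborel \<Otimes>\<^sub>M lborel) (lift \<kappa> l F)" using F square_integrable_lift by blast
  have c': "square_integrable lborel (\<lambda>x. indicator (disc \<kappa>) x *\<^sub>R c n x)" for n
    using c square_integrable_lebesgue_on[OF disc_borel] by blast
  have "(\<lambda>a. F a - (\<Sum>n\<in>{- int N..int N}. fourier_mode l n (c n) a)) \<in> borel_measurable borel" for N
    using F(1) c(1) by measurable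
  note eq = sqnorm_lift[OF this]
  have "(\<lambda>N. sqnorm (lborel \<Otimes>\<^sub>M lborel) (\<lambda>z. lift \<kappa> l F z - trig_sum l N (\<lambda>n. indicator (disc \<kappa>) (fst z) *\<^sub>R c n (fst z)) (snd z))) \<longlonglongrightarrow> 0"
    using lim unfolding eq lift_diff[abs_def] lift_fourier_sum .
  from fourier_pair_unique[OF sigma_finite_lborel l L c' this, of n]
  have "AE x in lborel. indicator (disc \<kappa>) x *\<^sub>R c n x = indicator (disc \<kappa>) x *\<^sub>R coef l n F x"
    by (simp only: fcoeff_lift)
  then have "AE x in lborel. x \<in> disc \<kappa> \<longrightarrow> c n x = coef l n F x"
    by eventually_elim (auto simp: indicator_def)
  then show ?thesis by (rule AE_lebesgue_onI[OF disc_borel])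
qed

text \<open>Linearity is claimed almost everywhere only: on an exceptional fibre an integral in
  \<open>fcoeff\<close> may fail to exist and then takes the default value 0.\<close>

lemma coef_diff_AE:
  assumes F: "F \<in> borel_measurable borel" "square_integrable (Lcyl \<kappa> l) F"
    and G: "G \<in> borel_measurable borel" "square_integrable (Lcyl \<kappa> l) G"
  shows "AE x in Ldisc \<kappa>. coef l n (\<lambda>a. F a - G a) x = coef l n F x - coef l n G x"
proof (rule AE_lebesgue_onI[OF disc_borel])
  have L: "square_integrable (lborel \<Otimes>\<^sub>M lborel) (lift \<kappa> l F)" "square_integrable (lborel \<Otimes>\<^sub>M lborel) (lift \<kappa> l G)"
    using F G square_integrable_lift by blast+
  show "AE x in lborel. x \<in> disc \<kappa> \<longrightarrow> coef l n (\<lambda>a. F a - G a) x = coef l n F x - coef l n G x"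
    using AE_square_integrable_section[OF sigma_finite_lborel l L(1)] AE_square_integrable_section[OF sigma_finite_lborel l L(2)]
  proof eventually_elim
    case (elim x)
    have "fcoeff l n (\<lambda>s. lift \<kappa> l F (x, s) - lift \<kappa> l G (x, s)) = fcoeff l n (\<lambda>s. lift \<kappa> l F (x, s)) - fcoeff l n (\<lambda>s. lift \<kappa> l G (x, s))"
      unfolding fcoeff_def left_diff_distrib
      unfolding Bochner_Integration.integral_diff[OF
          integrable_mult_complex[OF elim(1) square_integrable_cnj[OF square_integrable_harmonic]]
          integrable_mult_complex[OF elim(2) square_integrable_cnj[OF square_integrable_harmonic]]]
      by (rule diff_divide_distrib)
    then have "fcoeff l n (\<lambda>s. lift \<kappa> l (\<lambda>a. F a - G a) (x, s)) = fcoeff l n (\<lambda>s. lift \<kappa> l F (x, s)) - fcoeff l n (\<lambda>s. lift \<kappa> l G (x, s))"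
      by (simp only: lift_diff)
    then show ?case unfolding fcoeff_lift by (auto simp: indicator_def)
  qed
qed

text \<open>One term of Bessel's sum for F - G.\<close>

lemma sqnorm_coef_diff_le:
  assumes F: "F \<in> borel_measurable borel" "square_integrable (Lcyl \<kappa> l) F"
    and G: "G \<in> borel_measurable borel" "square_integrable (Lcyl \<kappa> l) G"
  shows "l * sqnorm (Ldisc \<kappa>) (\<lambda>x. coef l n F x - coef l n G x) \<le> sqnorm (Lcyl \<kappa> l) (\<lambda>a. F a - G a)"
proof -
  let ?H = "\<lambda>a. F a - G a"
  have H: "?H \<in> borel_measurable borel" "square_integrable (Lcyl \<kappa> l) ?H" using F G by auto
  have "sqnorm (Ldisc \<kappa>) (\<lambda>x. coef l n F x - coef l n G x) = sqnorm (Ldisc \<kappa>) (coef l n ?H)"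
    by (rule sqnorm_cong_AE)
      (use coef_diff_AE[OF F G, of n] square_integrable_coef[OF F] square_integrable_coef[OF G] square_integrable_coef[OF H] in auto)
  then have "l * sqnorm (Ldisc \<kappa>) (\<lambda>x. coef l n F x - coef l n G x) = l * sqnorm (Ldisc \<kappa>) (coef l n ?H)" by simp
  also have "\<dots> \<le> (\<Sum>n\<in>{- int (nat \<bar>n\<bar>)..int (nat \<bar>n\<bar>)}. l * sqnorm (Ldisc \<kappa>) (coef l n ?H))"
    using l by (intro member_le_sum[of n _ "\<lambda>n. l * sqnorm (Ldisc \<kappa>) (coef l n ?H)"]) auto
  also have "\<dots> \<le> sqnorm (Lcyl \<kappa> l) ?H" by (rule Bessel_cyl[OF H])
  finally show ?thesis .
qed

lemma coef_tendsto:
  assumes F: "\<And>j. F j \<in> borel_measurable borel" "\<And>j. square_integrable (Lcyl \<kappa> l) (F j)"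
    and G: "G \<in> borel_measurable borel" "square_integrable (Lcyl \<kappa> l) G"
    and lim: "(\<lambda>j. sqnorm (Lcyl \<kappa> l) (\<lambda>a. F j a - G a)) \<longlonglongrightarrow> 0"
  shows "(\<lambda>j. sqnorm (Ldisc \<kappa>) (\<lambda>x. coef l n (F j) x - coef l n G x)) \<longlonglongrightarrow> 0"
proof (rule tendsto_sandwich[OF _ _ tendsto_const])
  show "(\<lambda>j. sqnorm (Lcyl \<kappa> l) (\<lambda>a. F j a - G a) / l) \<longlonglongrightarrow> 0"
    using tendsto_divide[OF lim tendsto_const, of l] l by simp
  have "sqnorm (Ldisc \<kappa>) (\<lambda>x. coef l n (F j) x - coef l n G x) \<le> sqnorm (Lcyl \<kappa> l) (\<lambda>a. F j a - G a) / l" for j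
    using sqnorm_coef_diff_le[OF F G, of n] l by (simp add: pos_le_divide_eq mult.commute)
  then show "\<forall>\<^sub>F j in sequentially. sqnorm (Ldisc \<kappa>) (\<lambda>x. coef l n (F j) x - coef l n G x) \<le> sqnorm (Lcyl \<kappa> l) (\<lambda>a. F j a - G a) / l"
    by simp
qed (rule always_eventually, rule allI, rule sqnorm_nonneg)

end

section \<open>Differentiating the coefficients of smooth functions\<close>

definition emb :: "2 \<Rightarrow> 3" where "emb i = (if i = 1 then 1 else 2)"

lemma emb_simps [simp]: "emb 1 = 1" "emb 2 = 2"
  by (simp_all add: emb_def)

lemma sum_join_derivative:
  fixes g :: "3 \<Rightarrow> complex"
  shows "(\<Sum>k\<in>UNIV. join (h, 0) $ k *\<^sub>R g k) = (\<Sum>i\<in>UNIV. h $ i *\<^sub>R g (emb i))"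
  by (simp add: sum_3 sum_2)

lemma has_derivative_join_fst:
  assumes "smooth \<phi>"
  shows "((\<lambda>x. \<phi> (join (x, s))) has_derivative (\<lambda>h. \<Sum>i\<in>UNIV. h $ i *\<^sub>R pderivs [emb i] \<phi> (join (x, s)))) (at x)"
proof -
  have "((\<lambda>x. (x, s)) has_derivative (\<lambda>h. (h, 0))) (at x)" by (auto intro!: derivative_eq_intros)
  from bounded_linear.has_derivative[OF bounded_linear_join this]
  have "((\<lambda>x. join (x, s)) has_derivative (\<lambda>h. join (h, 0))) (at x)" .
  from has_derivative_compose[OF this smooth_has_derivative[OF assms]]
  show ?thesis by (simp only: sum_join_derivative)
qed

lemma has_vector_derivative_join_snd:
  assumes "smooth \<phi>"
  shows "((\<lambda>s. \<phi> (join (x, s))) has_vector_derivative pderivs [3] \<phi> (join (x, s))) (at s)"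
proof -
  have "((\<lambda>s. (x, s)) has_derivative (\<lambda>h. (0, h))) (at s)" by (auto intro!: derivative_eq_intros)
  from bounded_linear.has_derivative[OF bounded_linear_join this]
  have "((\<lambda>s. join (x, s)) has_derivative (\<lambda>h. join (0, h))) (at s)" .
  from has_derivative_compose[OF this smooth_has_derivative[OF assms]]
  show ?thesis by (simp add: sum_3 has_vector_derivative_def del: pderivs.simps)
qed

text \<open>Bridge from the Lebesgue integral in \<open>fcoeff\<close> to the gauge integral on the
  closed interval, where Leibniz' rule and the fundamental theorem of calculus are stated.\<close>

lemma has_integral_harmonic:
  fixes g :: "real \<Rightarrow> complex"
  assumes l: "0 < l" and g: "continuous_on UNIV g"
  shows "((\<lambda>s. g s * exp (2 * pi * \<i> * of_int (- n) * s / l)) has_integral l * fcoeff l n g) {0..l}"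
proof -
  have [measurable]: "g \<in> borel_measurable borel" by (rule borel_measurable_continuous_onI[OF g])
  have "compact (g ` {0..l})" by (intro compact_continuous_image continuous_on_subset[OF g]) auto
  then obtain B where B: "\<And>s. s \<in> {0..l} \<Longrightarrow> norm (g s) \<le> B"
    using compact_imp_bounded bounded_iff by (metis imageI)
  have "integrable lborel (\<lambda>s. g s * cnj (harmonic l n s))"
  proof (rule integrable_bounded_interval[of _ "max B 0" l])
    show "norm (g s * cnj (harmonic l n s)) \<le> max B 0" for s
      using B[of s] by (auto simp: norm_mult norm_harmonic le_max_iff_disj split: split_indicator)
  qed (auto simp: harmonic_outside)
  from has_integral_integral_lborel[OF this]
  have "((\<lambda>s. g s * cnj (harmonic l n s)) has_integral l * fcoeff l n g) UNIV"
    using l by (simp add: fcoeff_def)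
  moreover have "g s * cnj (harmonic l n s) = (if s \<in> {0<..<l} then g s * exp (2 * pi * \<i> * of_int (- n) * s / l) else 0)" for s
    unfolding harmonic_def complex_cnj_mult exp_circle_cnj by simp
  ultimately have "((\<lambda>s. if s \<in> {0<..<l} then g s * exp (2 * pi * \<i> * of_int (- n) * s / l) else 0) has_integral l * fcoeff l n g) UNIV"
    by (simp only:)
  then show ?thesis unfolding has_integral_restrict_UNIV has_integral_Icc_iff_Ioo .
qed

lemma continuous_section: "smooth \<phi> \<Longrightarrow> continuous_on T (\<lambda>s. \<phi> (join (x, s)))"
  by (rule continuous_on_compose2[OF smooth_continuous_on[of \<phi> UNIV]]) (auto intro!: continuous_intros)

lemma continuous_exp_circle: "continuous_on T (\<lambda>s::real. exp (2 * pi * \<i> * of_int n * s / l))"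
  by (cases "l = 0") (auto intro!: continuous_intros)

lemma coef_smooth:
  assumes l: "0 < l" and \<phi>: "smooth \<phi>"
  shows "coef l n \<phi> x = integral {0..l} (\<lambda>s. \<phi> (join (x, s)) * exp (2 * pi * \<i> * of_int (- n) * s / l)) / l"
proof -
  have "((\<lambda>s. \<phi> (join (x, s)) * exp (2 * pi * \<i> * of_int (- n) * s / l)) has_integral l * coef l n \<phi> x) {0..l}"
    unfolding coef_def by (rule has_integral_harmonic[OF l continuous_section[OF \<phi>]])
  from integral_unique[OF this] l show ?thesis by simp
qed

text \<open>Differentiation under the integral sign. Leibniz' rule wants the derivative as a
  continuous family of bounded linear maps, hence the packaging \<open>fx\<close>.\<close>

lemma has_derivative_coef:
  assumes l: "0 < l" and \<phi>: "smooth \<phi>"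
  shows "(coef l n \<phi> has_derivative (\<lambda>h. \<Sum>i\<in>UNIV. h $ i *\<^sub>R coef l n (pderivs [emb i] \<phi>) x)) (at x)"
proof -
  define E where "E s = exp (2 * pi * \<i> * of_int (- n) * of_real s / of_real l)" for s
  define B where "B i = Blinfun (\<lambda>h::real^2. h $ i)" for i
  have B: "blinfun_apply (B i) h = h $ i" for i h
    unfolding B_def by (simp add: bounded_linear_Blinfun_apply bounded_linear_vec_nth)
  define fx where "fx x s = (\<Sum>i\<in>UNIV. blinfun_scaleR_left (pderivs [emb i] \<phi> (join (x, s)) * E s) o\<^sub>L B i)" for x s
  have fx: "blinfun_apply (fx x s) h = (\<Sum>i\<in>UNIV. h $ i *\<^sub>R (pderivs [emb i] \<phi> (join (x, s)) * E s))" for x s h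
    by (simp add: fx_def blinfun.sum_left B del: pderivs.simps)
  have Ec: "continuous_on T E" for T unfolding E_def[abs_def] by (rule continuous_exp_circle)
  have cont: "continuous_on (UNIV \<times> cbox 0 l) (\<lambda>(x, s). fx x s)"
  proof -
    have "continuous_on (UNIV \<times> cbox 0 l) (\<lambda>z. E (snd z))"
      by (rule continuous_on_compose2[OF Ec[of UNIV]]) (auto intro: continuous_intros)
    moreover have "continuous_on (UNIV \<times> cbox 0 l) (\<lambda>z. pderivs [emb i] \<phi> (join z))" for i
      by (rule continuous_on_compose2[OF smooth_continuous_on[OF smooth_pderiv[OF \<phi>], of UNIV]]) (auto intro!: continuous_intros)
    ultimately have "continuous_on (UNIV \<times> cbox 0 l) (\<lambda>z. \<Sum>i\<in>UNIV. blinfun_scaleR_left (pderivs [emb i] \<phi> (join z) * E (snd z)) o\<^sub>L B i)"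
      by (intro continuous_on_sum bounded_bilinear.continuous_on[OF bounded_bilinear_blinfun_compose]
          bounded_linear.continuous_on[OF bounded_linear_blinfun_scaleR_left] continuous_on_mult continuous_on_const)
    then show ?thesis by (simp add: fx_def[abs_def] case_prod_beta' del: pderivs.simps)
  qed
  have "((\<lambda>x. integral (cbox 0 l) (\<lambda>s. \<phi> (join (x, s)) * E s)) has_derivative blinfun_apply (integral (cbox 0 l) (fx x))) (at x within UNIV)"
  proof (rule leibniz_rule[OF _ _ cont])
    show "((\<lambda>x. \<phi> (join (x, s)) * E s) has_derivative blinfun_apply (fx x s)) (at x within UNIV)" for x s
      by (rule has_derivative_eq_rhs[OF has_derivative_mult_left[OF has_derivative_join_fst[OF \<phi>]]])
        (simp add: fun_eq_iff fx sum_distrib_right del: pderivs.simps)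
    show "(\<lambda>s. \<phi> (join (x, s)) * E s) integrable_on cbox 0 l" for x
      by (intro integrable_continuous continuous_on_mult continuous_section \<phi> Ec)
  qed auto
  then have "((\<lambda>x. integral (cbox 0 l) (\<lambda>s. \<phi> (join (x, s)) * E s)) has_derivative blinfun_apply (integral (cbox 0 l) (fx x))) (at x)" by simp
  moreover have "blinfun_apply (integral (cbox 0 l) (fx x)) h = (\<Sum>i\<in>UNIV. h $ i *\<^sub>R (l * coef l n (pderivs [emb i] \<phi>) x))" for h
  proof -
    have "continuous_on (cbox 0 l) (fx x)"
    proof -
      have "continuous_on (cbox 0 l) (\<lambda>s. (x, s))" by (intro continuous_intros)
      from continuous_on_compose2[OF cont this] show ?thesis by auto
    qed
    then have "fx x integrable_on cbox 0 l" by (rule integrable_continuous)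
    from integral_linear[OF this blinfun.bounded_linear_left[of h]]
    have "blinfun_apply (integral (cbox 0 l) (fx x)) h = integral (cbox 0 l) (\<lambda>s. blinfun_apply (fx x s) h)"
      by (simp add: o_def)
    also have "\<dots> = integral (cbox 0 l) (\<lambda>s. \<Sum>i\<in>UNIV. h $ i *\<^sub>R (pderivs [emb i] \<phi> (join (x, s)) * E s))"
      by (simp only: fx)
    also have "\<dots> = (\<Sum>i\<in>UNIV. h $ i *\<^sub>R (l * coef l n (pderivs [emb i] \<phi>) x))"
    proof (rule integral_unique, rule has_integral_sum)
      fix i
      have "((\<lambda>s. pderivs [emb i] \<phi> (join (x, s)) * E s) has_integral l * coef l n (pderivs [emb i] \<phi>) x) (cbox 0 l)"
        unfolding E_def coef_def cbox_interval
        by (rule has_integral_harmonic[OF l continuous_section[OF smooth_pderiv[OF \<phi>]]])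
      then show "((\<lambda>s. h $ i *\<^sub>R (pderivs [emb i] \<phi> (join (x, s)) * E s)) has_integral h $ i *\<^sub>R (l * coef l n (pderivs [emb i] \<phi>) x)) (cbox 0 l)"
        by (rule has_integral_cmul)
    qed simp
    finally show ?thesis .
  qed
  then have "blinfun_apply (integral (cbox 0 l) (fx x)) = (\<lambda>h. \<Sum>i\<in>UNIV. h $ i *\<^sub>R (l * coef l n (pderivs [emb i] \<phi>) x))"
    by (rule ext)
  ultimately have "((\<lambda>x. integral (cbox 0 l) (\<lambda>s. \<phi> (join (x, s)) * E s)) has_derivative (\<lambda>h. \<Sum>i\<in>UNIV. h $ i *\<^sub>R (l * coef l n (pderivs [emb i] \<phi>) x))) (at x)"
    by (simp only:)
  from has_derivative_mult_left[OF this, of "1 / complex_of_real l"]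
  show ?thesis
    using l by (simp add: coef_smooth[OF l \<phi>, abs_def] E_def sum_divide_distrib scaleR_conv_of_real del: pderivs.simps)
qed

lemma pderiv_coef:
  assumes l: "0 < l" and \<phi>: "smooth \<phi>"
  shows "pderivs [i] (coef l n \<phi>) = coef l n (pderivs [emb i] \<phi>)"
proof
  fix x
  have "pderivs [i] (coef l n \<phi>) x = (\<Sum>j\<in>UNIV. (axis i 1 :: real^2) $ j *\<^sub>R coef l n (pderivs [emb j] \<phi>) x)"
    by (rule pderiv_eqI[OF has_derivative_coef[OF l \<phi>]])
  also have "\<dots> = (\<Sum>j\<in>UNIV. if j = i then coef l n (pderivs [emb j] \<phi>) x else 0)"
    by (intro sum.cong refl) (simp add: axis_def)
  finally show "pderivs [i] (coef l n \<phi>) x = coef l n (pderivs [emb i] \<phi>) x" by simp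
qed

lemma smooth_coef:
  assumes l: "0 < l" and \<phi>: "smooth \<phi>"
  shows "smooth (coef l n \<phi>)"
proof (rule smooth_coinduct[of _ "coef l n ` Collect smooth"])
  fix f and x :: "real^2" assume "f \<in> coef l n ` Collect smooth"
  then obtain \<psi> where "smooth \<psi>" "f = coef l n \<psi>" by blast
  then show "f differentiable (at x)" using has_derivative_coef[OF l] unfolding differentiable_def by blast
next
  fix f :: "real^2 \<Rightarrow> complex" and i assume "f \<in> coef l n ` Collect smooth"
  then obtain \<psi> where "smooth \<psi>" "f = coef l n \<psi>" by blast
  then show "pderivs [i] f \<in> coef l n ` Collect smooth" using pderiv_coef[OF l] smooth_pderiv by blast
qed (use \<phi> in simp)

text \<open>Integration by parts over one period. The exponential is 1 at both ends, so the boundary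
  term is the plain jump of \<phi>, the same for every n.\<close>

lemma coef_pderiv_3:
  assumes l: "0 < l" and \<phi>: "smooth \<phi>"
  shows "coef l n (pderivs [3] \<phi>) x = (\<phi> (join (x, l)) - \<phi> (join (x, 0))) / l + (2 * pi * \<i> * of_int n / l) * coef l n \<phi> x"
proof -
  define E where "E s = exp (2 * pi * \<i> * of_int (- n) * of_real s / of_real l)" for s
  define c where "c = 2 * pi * \<i> * of_int (- n) / l"
  have E1: "E 0 = 1" "E l = 1"
  proof -
    show "E l = 1" using l unfolding E_def exp_eq_1 by (auto intro!: exI[of _ "- n"])
  qed (simp add: E_def)
  have Ed: "(E has_vector_derivative c * E s) (at s)" for s
  proof -
    have "((\<lambda>z. exp (c * z)) has_field_derivative c * exp (c * of_real s)) (at (of_real s))"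
      by (auto intro!: derivative_eq_intros)
    from has_vector_derivative_real_field[OF this]
    show ?thesis by (simp add: o_def E_def[abs_def] c_def)
  qed
  have 1: "((\<lambda>s. \<phi> (join (x, s)) * (c * E s) + pderivs [3] \<phi> (join (x, s)) * E s) has_integral \<phi> (join (x, l)) * E l - \<phi> (join (x, 0)) * E 0) {0..l}"
  proof (rule fundamental_theorem_of_calculus)
    fix s
    show "((\<lambda>s. \<phi> (join (x, s)) * E s) has_vector_derivative \<phi> (join (x, s)) * (c * E s) + pderivs [3] \<phi> (join (x, s)) * E s) (at s within {0..l})"
      by (rule has_vector_derivative_at_within[OF has_vector_derivative_mult[OF has_vector_derivative_join_snd[OF \<phi>] Ed]])
  qed (use l in simp)
  have 2: "((\<lambda>s. c * (\<phi> (join (x, s)) * E s)) has_integral c * (l * coef l n \<phi> x)) {0..l}"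
    unfolding E_def coef_def by (intro has_integral_mult_right has_integral_harmonic l continuous_section \<phi>)
  have 3: "((\<lambda>s. pderivs [3] \<phi> (join (x, s)) * E s) has_integral l * coef l n (pderivs [3] \<phi>) x) {0..l}"
    unfolding E_def coef_def by (intro has_integral_harmonic l continuous_section smooth_pderiv \<phi>)
  have "c * (\<phi> (join (x, s)) * E s) = \<phi> (join (x, s)) * (c * E s)" for s by simp
  with has_integral_add[OF 2 3]
  have "((\<lambda>s. \<phi> (join (x, s)) * (c * E s) + pderivs [3] \<phi> (join (x, s)) * E s) has_integral
      c * (l * coef l n \<phi> x) + l * coef l n (pderivs [3] \<phi>) x) {0..l}" by (simp only:)
  from has_integral_unique[OF 1 this]
  have "\<phi> (join (x, l)) - \<phi> (join (x, 0)) = c * (l * coef l n \<phi> x) + l * coef l n (pderivs [3] \<phi>) x"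
    by (simp add: E1 del: pderivs.simps)
  then have "coef l n (pderivs [3] \<phi>) x = ((\<phi> (join (x, l)) - \<phi> (join (x, 0))) - c * (l * coef l n \<phi> x)) / l"
    using l by (simp del: pderivs.simps)
  also have "\<dots> = (\<phi> (join (x, l)) - \<phi> (join (x, 0))) / l - c * coef l n \<phi> x"
    using l by (simp add: diff_divide_distrib)
  finally show ?thesis by (simp add: c_def del: pderivs.simps)
qed

section \<open>Polar coordinates and the inequalities of Poincare and Hardy\<close>

definition circ :: "real \<Rightarrow> real \<Rightarrow> real^2" where
  "circ r \<theta> = vector [r * cos \<theta>, r * sin \<theta>]"

lemma circ_nth [simp]: "circ r \<theta> $ 1 = r * cos \<theta>" "circ r \<theta> $ 2 = r * sin \<theta>"
  by (simp_all add: circ_def)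

lemma circ_eq: "circ r \<theta> = (r * cos \<theta>) *\<^sub>R axis 1 1 + (r * sin \<theta>) *\<^sub>R axis 2 1"
  by (simp add: vec_eq_iff forall_2 axis_def)

lemma norm_sq_2: "(norm (x::real^2))\<^sup>2 = (x $ 1)\<^sup>2 + (x $ 2)\<^sup>2"
  by (simp add: norm_vec_def L2_set_def sum_2)

lemma norm_circ: "norm (circ r \<theta>) = \<bar>r\<bar>"
proof -
  have "(norm (circ r \<theta>))\<^sup>2 = r\<^sup>2 * ((cos \<theta>)\<^sup>2 + (sin \<theta>)\<^sup>2)"
    by (simp only: norm_sq_2 circ_nth power_mult_distrib distrib_left)
  also have "\<dots> = \<bar>r\<bar>\<^sup>2" by simp
  finally show ?thesis by (metis abs_ge_zero norm_ge_zero power2_eq_imp_eq)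
qed

lemma circ_scaleR: "circ r \<theta> = r *\<^sub>R circ 1 \<theta>"
  by (simp add: vec_eq_iff forall_2)

text \<open>The order is swapped on purpose: with the angle as first component, Fubini puts the
  integral over the radius inside.\<close>

definition pair_vec :: "real \<times> real \<Rightarrow> real^2" where
  "pair_vec z = vector [snd z, fst z]"

lemma pair_vec_nth [simp]: "pair_vec z $ 1 = snd z" "pair_vec z $ 2 = fst z"
  by (simp_all add: pair_vec_def)

lemma pair_vec_measurable [measurable]: "pair_vec \<in> borel_measurable borel"
proof -
  have "pair_vec z = snd z *\<^sub>R axis 1 1 + fst z *\<^sub>R axis 2 1" for z
    by (simp add: vec_eq_iff forall_2 axis_def)
  then have *: "pair_vec = (\<lambda>z. snd z *\<^sub>R axis 1 1 + fst z *\<^sub>R axis 2 1)" by (rule ext)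
  show ?thesis by (subst *) (intro borel_measurable_continuous_onI continuous_intros)
qed

lemma lborel_pair_vec: "distr (lborel \<Otimes>\<^sub>M lborel) borel pair_vec = lborel"
proof (rule lborel_eqI[symmetric])
  fix l u :: "real^2"
  assume le: "\<And>b. b \<in> Basis \<Longrightarrow> l \<bullet> b \<le> u \<bullet> b"
  have lu: "l $ i \<le> u $ i" for i using le[of "axis i 1"] by (simp add: inner_axis axis_in_Basis_iff)
  have pre: "pair_vec -` box l u = {l $ 2<..<u $ 2} \<times> {l $ 1<..<u $ 1}"
    by (auto simp: mem_box_cart forall_2)
  have "emeasure (distr (lborel \<Otimes>\<^sub>M lborel) borel pair_vec) (box l u) = emeasure (lborel \<Otimes>\<^sub>M lborel) (pair_vec -` box l u \<inter> space (lborel \<Otimes>\<^sub>M lborel))"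
    by (rule emeasure_distr) (auto simp: lborel_prod)
  also have "\<dots> = emeasure (lborel \<Otimes>\<^sub>M lborel) ({l $ 2<..<u $ 2} \<times> {l $ 1<..<u $ 1})"
    by (simp add: pre space_pair_measure)
  also have "\<dots> = emeasure lborel {l $ 2<..<u $ 2} * emeasure lborel {l $ 1<..<u $ 1}"
    by (rule lborel.emeasure_pair_measure_Times) auto
  also have "\<dots> = ennreal (u $ 2 - l $ 2) * ennreal (u $ 1 - l $ 1)" using lu by simp
  also have "\<dots> = ennreal (\<Prod>i\<in>UNIV. (u - l) $ i)"
  proof -
    have "(\<Prod>i\<in>UNIV. (u - l) $ i) = (u $ 2 - l $ 2) * (u $ 1 - l $ 1)"
      unfolding UNIV_2 by simp
    then show ?thesis using ennreal_mult''[of "u $ 1 - l $ 1" "u $ 2 - l $ 2"] lu[of 1] by simp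
  qed
  finally show "emeasure (distr (lborel \<Otimes>\<^sub>M lborel) borel pair_vec) (box l u) = (\<Prod>b\<in>Basis. (u - l) \<bullet> b)"
    by (simp only: prod_Basis_vec)
qed (simp only: sets_distr)

lemma has_derivative_polar:
  fixes p :: "real^2"
  shows "((\<lambda>p. circ (p $ 1) (p $ 2)) has_derivative
    (\<lambda>h. (h $ 1 * cos (p $ 2) - p $ 1 * sin (p $ 2) * h $ 2) *\<^sub>R axis 1 1 + (h $ 1 * sin (p $ 2) + p $ 1 * cos (p $ 2) * h $ 2) *\<^sub>R axis 2 1)) (at p within T)"
proof -
  have n: "((\<lambda>p::real^2. p $ i) has_derivative (\<lambda>h. h $ i)) (at p within T)" for i
    by (rule bounded_linear_imp_has_derivative[OF bounded_linear_vec_nth])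
  have c: "((\<lambda>p::real^2. cos (p $ 2)) has_derivative (\<lambda>h. h $ 2 * - sin (p $ 2))) (at p within T)"
    by (rule has_derivative_cos[OF n])
  have s: "((\<lambda>p::real^2. sin (p $ 2)) has_derivative (\<lambda>h. h $ 2 * cos (p $ 2))) (at p within T)"
    by (rule has_derivative_sin[OF n])
  show ?thesis unfolding circ_eq
    by (rule has_derivative_eq_rhs[OF has_derivative_add[OF has_derivative_scaleR_left[OF has_derivative_mult[OF n c]]
          has_derivative_scaleR_left[OF has_derivative_mult[OF n s]]]])
      (simp add: fun_eq_iff algebra_simps)
qed

lemma det_polar:
  fixes p :: "real^2"
  shows "det (matrix (\<lambda>h::real^2. (h $ 1 * cos (p $ 2) - p $ 1 * sin (p $ 2) * h $ 2) *\<^sub>R axis 1 1 + (h $ 1 * sin (p $ 2) + p $ 1 * cos (p $ 2) * h $ 2) *\<^sub>R axis 2 1 :: real^2)) = p $ 1"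
proof -
  have "det (matrix (\<lambda>h::real^2. (h $ 1 * cos (p $ 2) - p $ 1 * sin (p $ 2) * h $ 2) *\<^sub>R axis 1 1 + (h $ 1 * sin (p $ 2) + p $ 1 * cos (p $ 2) * h $ 2) *\<^sub>R axis 2 1 :: real^2))
     = p $ 1 * (cos (p $ 2) * cos (p $ 2)) + p $ 1 * (sin (p $ 2) * sin (p $ 2))"
    by (simp add: det_2 matrix_def axis_def algebra_simps)
  also have "\<dots> = p $ 1 * ((cos (p $ 2))\<^sup>2 + (sin (p $ 2))\<^sup>2)"
    by (simp only: power2_eq_square distrib_left)
  finally show ?thesis by simp
qed

text \<open>Open ranges for radius and angle give an open domain on which the map is injective; the
  price is that the image misses the half-line of angle 0 together with the origin.\<close>

lemma polar_image:
  assumes "0 < \<kappa>"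
  shows "(\<lambda>p::real^2. circ (p $ 1) (p $ 2)) ` {p. 0 < p $ 1 \<and> p $ 1 < \<kappa> \<and> 0 < p $ 2 \<and> p $ 2 < 2 * pi} = disc \<kappa> - {x. x $ 2 = 0 \<and> 0 \<le> x $ 1}"
    (is "?g ` ?S = _")
proof (intro equalityI subsetI)
  fix x assume "x \<in> ?g ` ?S"
  then obtain p :: "real^2" where p: "0 < p $ 1" "p $ 1 < \<kappa>" "0 < p $ 2" "p $ 2 < 2 * pi" "x = circ (p $ 1) (p $ 2)" by auto
  have "x \<in> disc \<kappa>" using p by (simp add: norm_disc norm_circ power_strict_mono)
  moreover have "\<not> (x $ 2 = 0 \<and> 0 \<le> x $ 1)"
  proof
    assume a: "x $ 2 = 0 \<and> 0 \<le> x $ 1"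
    then have "sin (p $ 2) = 0" "0 \<le> cos (p $ 2)" using p by (auto simp: zero_le_mult_iff)
    then have "cos (p $ 2) = 1" using sin_cos_squared_add[of "p $ 2"] by (auto simp: power2_eq_1_iff)
    then have "cis (2 * pi * (p $ 2) / (2 * pi)) = cis (2 * pi * 0 / (2 * pi))"
      using \<open>sin (p $ 2) = 0\<close> by (simp add: complex_eq_iff)
    then have "p $ 2 = 0" by (intro cis_period_inj[of "p $ 2" "2 * pi" 0]) (use p in auto)
    then show False using p by simp
  qed
  ultimately show "x \<in> disc \<kappa> - {x. x $ 2 = 0 \<and> 0 \<le> x $ 1}" by simp
next
  fix x assume x: "x \<in> disc \<kappa> - {x. x $ 2 = 0 \<and> 0 \<le> x $ 1}"
  define r where "r = norm x"
  have "x \<noteq> 0" using x by auto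
  then have r: "0 < r" by (simp add: r_def)
  have rk: "r < \<kappa>" using x assms by (auto simp: norm_disc r_def power2_less_imp_less)
  have "(x $ 1 / r)\<^sup>2 + (x $ 2 / r)\<^sup>2 = 1"
    using r by (simp add: power_divide norm_sq_2[symmetric] r_def flip: add_divide_distrib)
  then obtain \<theta> where \<theta>: "0 \<le> \<theta>" "\<theta> < 2 * pi" "x $ 1 / r = cos \<theta>" "x $ 2 / r = sin \<theta>"
    using sincos_total_2pi by metis
  then have xe: "x $ 1 = r * cos \<theta>" "x $ 2 = r * sin \<theta>" using r by (auto simp: field_simps)
  have "\<theta> \<noteq> 0" using x xe r by auto
  then have "0 < \<theta>" using \<theta> by simp
  define p :: "real^2" where "p = vector [r, \<theta>]"
  have "x = ?g p" using xe by (simp add: p_def vec_eq_iff forall_2)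
  moreover have "p \<in> ?S" using r rk \<open>0 < \<theta>\<close> \<theta> by (simp add: p_def)
  ultimately show "x \<in> ?g ` ?S" by blast
qed

lemma polar_inj:
  "inj_on (\<lambda>p::real^2. circ (p $ 1) (p $ 2)) {p. 0 < p $ 1 \<and> p $ 1 < \<kappa> \<and> 0 < p $ 2 \<and> p $ 2 < 2 * pi}"
proof (rule inj_onI)
  fix p q :: "real^2"
  assume p: "p \<in> {p. 0 < p $ 1 \<and> p $ 1 < \<kappa> \<and> 0 < p $ 2 \<and> p $ 2 < 2 * pi}"
    and q: "q \<in> {p. 0 < p $ 1 \<and> p $ 1 < \<kappa> \<and> 0 < p $ 2 \<and> p $ 2 < 2 * pi}"
    and eq: "circ (p $ 1) (p $ 2) = circ (q $ 1) (q $ 2)"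
  from arg_cong[OF eq, of norm] p q have 1: "p $ 1 = q $ 1" by (simp add: norm_circ)
  have "circ (p $ 1) (p $ 2) $ 1 = circ (q $ 1) (q $ 2) $ 1" "circ (p $ 1) (p $ 2) $ 2 = circ (q $ 1) (q $ 2) $ 2"
    using eq by simp_all
  then have "cis (2 * pi * (p $ 2) / (2 * pi)) = cis (2 * pi * (q $ 2) / (2 * pi))"
    using p 1 by (simp add: complex_eq_iff)
  then have "p $ 2 = q $ 2" by (intro cis_period_inj[of "p $ 2" "2 * pi" "q $ 2"]) (use p q in auto)
  with 1 show "p = q" by (simp add: vec_eq_iff forall_2)
qed

text \<open>Change of variables on the slit disc with Jacobian r, then Fubini. Boundedness of G and
  of its support provides the integrability that both require.\<close>

lemma polar_integral:
  fixes G :: "real^2 \<Rightarrow> real"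
  assumes \<kappa>: "0 < \<kappa>" and G [measurable]: "G \<in> borel_measurable borel" and bound: "\<And>x. \<bar>G x\<bar> \<le> B"
    and supp: "\<And>x. x \<notin> disc \<kappa> \<Longrightarrow> G x = 0"
  shows "(LINT x|lborel. G x) = (LINT \<theta>|lborel. indicator {0<..<2 * pi} \<theta> * (LINT r|lborel. indicator {0<..<\<kappa>} r * (r * G (circ r \<theta>))))"
proof -
  let ?g = "\<lambda>p::real^2. circ (p $ 1) (p $ 2)"
  define S where "S = {p::real^2. 0 < p $ 1 \<and> p $ 1 < \<kappa> \<and> 0 < p $ 2 \<and> p $ 2 < 2 * pi}"
  define D where "D = disc \<kappa> - {x. x $ 2 = 0 \<and> 0 \<le> x $ 1}"
  let ?d = "\<lambda>p h. (h $ 1 * cos (p $ 2) - p $ 1 * sin (p $ 2) * h $ 2) *\<^sub>R axis 1 1 + (h $ 1 * sin (p $ 2) + p $ 1 * cos (p $ 2) * h $ 2) *\<^sub>R axis 2 1 :: real^2"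
  have gS: "?g ` S = D" unfolding S_def D_def by (rule polar_image[OF \<kappa>])
  have "open S" unfolding S_def by (intro open_Collect_conj open_Collect_less continuous_intros)
  then have Sb [measurable]: "S \<in> sets borel" by simp
  have "closed {x::real^2. x $ 2 = 0 \<and> 0 \<le> x $ 1}"
    by (intro closed_Collect_conj closed_Collect_eq closed_Collect_le continuous_intros)
  then have Db [measurable]: "D \<in> sets borel" unfolding D_def using disc_borel by (intro sets.Diff) auto
  have circm [measurable]: "?g \<in> borel_measurable borel"
    unfolding circ_eq by (intro borel_measurable_continuous_onI continuous_intros)
  have Fm: "(\<lambda>p. indicator S p *\<^sub>R (\<bar>p $ 1\<bar> * G (?g p))) \<in> borel_measurable borel" by measurable
  have pm: "pair_vec \<in> lborel \<Otimes>\<^sub>M lborel \<rightarrow>\<^sub>M borel" by (simp add: lborel_prod)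
  have B0: "0 \<le> B" using bound[of 0] by linarith
  have Gi: "integrable lborel G"
  proof (rule Bochner_Integration.integrable_bound)
    show "integrable lborel (\<lambda>x. B * indicator (disc \<kappa>) x :: real)"
      using disc_borel by (intro integrable_mult_right integrable_real_indicator)
        (auto intro: emeasure_bounded_finite[OF bounded_disc, unfolded infinity_ennreal_def])
    show "AE x in lborel. norm (G x) \<le> norm (B * indicator (disc \<kappa>) x)"
      using bound supp B0 by (intro AE_I2) (auto split: split_indicator)
  qed simp
  have "integrable lborel (\<lambda>x. indicator D x *\<^sub>R G x)" using Gi by (intro integrable_mult_indicator) auto
  then have GD: "G absolutely_integrable_on D"
    unfolding set_integrable_def by (subst integrable_completion) auto
  \<comment> \<open>The change-of-variables theorem is applied to a vector-valued integrand, so the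
    real G is wrapped into \<open>real^1\<close> by \<open>vec\<close>.\<close>
  have "(\<lambda>p. \<bar>det (matrix (?d p))\<bar> *\<^sub>R vec (G (?g p)) :: real^1) absolutely_integrable_on S \<and>
      integral S (\<lambda>p. \<bar>det (matrix (?d p))\<bar> *\<^sub>R vec (G (?g p)) :: real^1) = vec (integral D G)"
  proof (subst has_absolute_integral_change_of_variables[where g = ?g and f = "\<lambda>x. vec (G x)"])
    show "S \<in> sets lebesgue" using Sb by simp
    show "(?g has_derivative ?d p) (at p within S)" for p by (rule has_derivative_polar)
    show "inj_on ?g S" unfolding S_def by (rule polar_inj)
    show "(\<lambda>x. vec (G x) :: real^1) absolutely_integrable_on ?g ` S \<and> integral (?g ` S) (\<lambda>x. vec (G x) :: real^1) = vec (integral D G)"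
      unfolding gS absolutely_integrable_on_1_iff integral_on_1_eq using GD by simp
  qed
  then have A: "(\<lambda>p. \<bar>p $ 1\<bar> * G (?g p)) absolutely_integrable_on S"
    and I: "integral S (\<lambda>p. \<bar>p $ 1\<bar> * G (?g p)) = integral D G"
    unfolding absolutely_integrable_on_1_iff integral_on_1_eq det_polar by (simp_all add: vec_eq_iff)
  \<comment> \<open>The slit lies in the line where the second coordinate is 0, a null set.\<close>
  have "(LINT x|lborel. G x) = (LINT x|lborel. indicator D x *\<^sub>R G x)"
  proof (rule integral_cong_AE)
    have "{x::real^2. axis 2 1 \<bullet> x = 0} \<in> null_sets lebesgue"
      using negligible_hyperplane[of "axis 2 1 :: real^2" 0] by (simp add: negligible_iff_null_sets axis_eq_0_iff)
    moreover have "{x::real^2. axis 2 1 \<bullet> x = 0} \<in> sets borel"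
      by (intro borel_closed closed_Collect_eq continuous_intros)
    ultimately have "{x::real^2. axis 2 1 \<bullet> x = 0} \<in> null_sets lborel"
      by (metis emeasure_completion main_part_sets null_sets_def mem_Collect_eq sets_lborel null_sets_completion_iff)
    from AE_not_in[OF this] show "AE x in lborel. G x = indicator D x *\<^sub>R G x"
      by eventually_elim (use supp in \<open>auto simp: D_def inner_axis' split: split_indicator\<close>)
  qed simp_all
  also have "\<dots> = (LINT x|lebesgue. indicator D x *\<^sub>R G x)" by (subst integral_completion) simp_all
  also have "\<dots> = integral D G"
    using set_lebesgue_integral_eq_integral(2)[OF GD] by (simp add: set_lebesgue_integral_def)
  also have "\<dots> = (LINT p|lebesgue. indicator S p *\<^sub>R (\<bar>p $ 1\<bar> * G (?g p)))"
    unfolding I[symmetric] using set_lebesgue_integral_eq_integral(2)[OF A] by (simp add: set_lebesgue_integral_def)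
  also have "\<dots> = (LINT p|lborel. indicator S p *\<^sub>R (\<bar>p $ 1\<bar> * G (?g p)))"
    by (subst integral_completion) simp_all
  also have "\<dots> = (LINT z|(lborel \<Otimes>\<^sub>M lborel). indicator S (pair_vec z) *\<^sub>R (\<bar>snd z\<bar> * G (circ (snd z) (fst z))))"
  proof -
    have "(LINT p|distr (lborel \<Otimes>\<^sub>M lborel) borel pair_vec. indicator S p *\<^sub>R (\<bar>p $ 1\<bar> * G (?g p))) =
        (LINT z|(lborel \<Otimes>\<^sub>M lborel). indicator S (pair_vec z) *\<^sub>R (\<bar>pair_vec z $ 1\<bar> * G (?g (pair_vec z))))"
      by (rule integral_distr[OF pm Fm])
    then show ?thesis by (simp only: lborel_pair_vec pair_vec_nth)
  qed
  also have "\<dots> = (LINT \<theta>|lborel. (LINT r|lborel. indicator S (pair_vec (\<theta>, r)) *\<^sub>R (\<bar>r\<bar> * G (circ r \<theta>))))"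
  proof -
    have "integrable lborel (\<lambda>p. indicator S p *\<^sub>R (\<bar>p $ 1\<bar> * G (?g p)))"
      using A unfolding set_integrable_def by (subst (asm) integrable_completion) simp_all
    then have "integrable (lborel \<Otimes>\<^sub>M lborel) (\<lambda>z. indicator S (pair_vec z) *\<^sub>R (\<bar>snd z\<bar> * G (circ (snd z) (fst z))))"
      using integrable_distr_eq[OF pm Fm] by (simp only: lborel_pair_vec pair_vec_nth)
    from lborel_pair.integral_fst'[OF this] show ?thesis by simp
  qed
  also have "\<dots> = (LINT \<theta>|lborel. indicator {0<..<2 * pi} \<theta> * (LINT r|lborel. indicator {0<..<\<kappa>} r * (r * G (circ r \<theta>))))"
  proof (intro Bochner_Integration.integral_cong refl)
    fix \<theta>
    have "indicator S (pair_vec (\<theta>, r)) *\<^sub>R (\<bar>r\<bar> * G (circ r \<theta>)) = indicator {0<..<2 * pi} \<theta> * (indicator {0<..<\<kappa>} r * (r * G (circ r \<theta>)))" for r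
      by (auto simp: S_def split: split_indicator)
    then show "(LINT r|lborel. indicator S (pair_vec (\<theta>, r)) *\<^sub>R (\<bar>r\<bar> * G (circ r \<theta>))) = indicator {0<..<2 * pi} \<theta> * (LINT r|lborel. indicator {0<..<\<kappa>} r * (r * G (circ r \<theta>)))"
      by (simp only: integral_mult_right_zero)
  qed
  finally show ?thesis .
qed

text \<open>In polar coordinates \<open>r (2 u + r \<partial>\<^sub>r u) = \<partial>\<^sub>r (r\<^sup>2 u)\<close>: this is the divergence theorem on the disc
  for the field \<open>x u(x)\<close>.\<close>

lemma disc_divergence_identity:
  fixes u :: "real^2 \<Rightarrow> real"
  assumes \<kappa>: "0 < \<kappa>" and u: "\<And>x. x \<in> cball 0 \<kappa> \<Longrightarrow> (u has_derivative u' x) (at x)"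
    and cont: "continuous_on (cball 0 \<kappa>) (\<lambda>x. u' x x)"
  shows "(LINT x|Ldisc \<kappa>. 2 * u x + u' x x) = (LINT \<theta>|lborel. indicator {0<..<2 * pi} \<theta> * (\<kappa>\<^sup>2 * u (circ \<kappa> \<theta>)))"
    and "integrable (Ldisc \<kappa>) (\<lambda>x. 2 * u x + u' x x)"
proof -
  let ?w = "\<lambda>x. 2 * u x + u' x x"
  have uc: "continuous_on (cball 0 \<kappa>) u"
    using u by (intro continuous_at_imp_continuous_on ballI) (blast intro: has_derivative_continuous)
  have wc: "continuous_on (cball 0 \<kappa>) ?w" by (intro continuous_intros uc cont)
  have dsub: "disc \<kappa> \<subseteq> cball 0 \<kappa>" using disc_subset_cball[of \<kappa>] \<kappa> by simp
  define G where "G x = indicator (disc \<kappa>) x *\<^sub>R ?w x" for x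
  have Gm [measurable]: "G \<in> borel_measurable borel"
    unfolding G_def[abs_def] by (intro borel_measurable_continuous_on_indicator disc_borel continuous_on_subset[OF wc] dsub)
  have "compact (?w ` cball 0 \<kappa>)" by (intro compact_continuous_image wc compact_cball)
  then obtain B where "\<forall>y\<in>?w ` cball 0 \<kappa>. norm y \<le> B"
    using compact_imp_bounded bounded_iff by blast
  then have B: "\<And>x. x \<in> cball 0 \<kappa> \<Longrightarrow> \<bar>?w x\<bar> \<le> B" by simp
  have B0: "0 \<le> B" using B[of 0] \<kappa> by force
  have Gb: "\<bar>G x\<bar> \<le> B" for x using B[of x] B0 dsub by (auto simp: G_def split: split_indicator)
  interpret finite_measure "Ldisc \<kappa>" by (rule finite_measure_lebesgue_on[OF bounded_disc disc_borel])
  have Gi: "integrable (Ldisc \<kappa>) G"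
    by (rule integrable_const_bound[of _ B]) (use Gb borel_measurable_lebesgue_on[OF Gm] in auto)
  have eq: "integrable (Ldisc \<kappa>) ?w \<longleftrightarrow> integrable (Ldisc \<kappa>) G" "(LINT x|Ldisc \<kappa>. ?w x) = (LINT x|Ldisc \<kappa>. G x)"
    by (rule Bochner_Integration.integrable_cong, auto simp: G_def)
      (rule Bochner_Integration.integral_cong, auto simp: G_def)
  show "integrable (Ldisc \<kappa>) ?w" using eq Gi by blast
  have "(LINT x|Ldisc \<kappa>. ?w x) = (LINT x|lborel. indicator (disc \<kappa>) x *\<^sub>R G x)"
    unfolding eq(2) by (rule integral_lebesgue_on_borel[OF disc_borel Gm])
  also have "\<dots> = (LINT x|lborel. G x)"
    by (intro Bochner_Integration.integral_cong) (auto simp: G_def split: split_indicator)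
  also have "\<dots> = (LINT \<theta>|lborel. indicator {0<..<2 * pi} \<theta> * (LINT r|lborel. indicator {0<..<\<kappa>} r * (r * G (circ r \<theta>))))"
    by (rule polar_integral[OF \<kappa> Gm Gb]) (simp add: G_def)
  also have "\<dots> = (LINT \<theta>|lborel. indicator {0<..<2 * pi} \<theta> * (\<kappa>\<^sup>2 * u (circ \<kappa> \<theta>)))"
  proof (intro Bochner_Integration.integral_cong refl arg_cong2[where f = "(*)"])
    fix \<theta>
    have circ_in: "r \<in> {0..\<kappa>} \<Longrightarrow> circ r \<theta> \<in> cball 0 \<kappa>" for r by (simp add: norm_circ)
    have cc: "continuous_on {0..\<kappa>} (\<lambda>r. circ r \<theta>)" unfolding circ_eq by (intro continuous_intros)
    have f: "continuous_on {0..\<kappa>} (\<lambda>r. r * ?w (circ r \<theta>))"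
      by (intro continuous_intros continuous_on_compose2[OF wc cc]) (use circ_in in auto)
    have m: "(\<lambda>r. indicator {0..\<kappa>} r *\<^sub>R (r * ?w (circ r \<theta>))) \<in> borel_measurable borel"
      by (rule borel_measurable_continuous_on_indicator[OF _ f]) simp
    have m2: "(\<lambda>r. indicator {0<..<\<kappa>} r *\<^sub>R (r * ?w (circ r \<theta>))) \<in> borel_measurable borel"
      by (rule borel_measurable_continuous_on_indicator[OF _ continuous_on_subset[OF f]]) auto
    have e: "indicator {0<..<\<kappa>} r * (r * G (circ r \<theta>)) = indicator {0<..<\<kappa>} r *\<^sub>R (r * ?w (circ r \<theta>))" for r
      using \<kappa> by (auto simp: G_def norm_disc norm_circ power_strict_mono split: split_indicator)
    have "(LINT r|lborel. indicator {0<..<\<kappa>} r * (r * G (circ r \<theta>))) = (LINT r|lborel. indicator {0..\<kappa>} r *\<^sub>R (r * ?w (circ r \<theta>)))"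
      unfolding e
    proof (rule integral_cong_AE)
      show "AE r in lborel. indicator {0<..<\<kappa>} r *\<^sub>R (r * ?w (circ r \<theta>)) = indicator {0..\<kappa>} r *\<^sub>R (r * ?w (circ r \<theta>))"
        using AE_lborel_singleton[of 0] AE_lborel_singleton[of \<kappa>]
        by eventually_elim (auto split: split_indicator)
    qed (use m m2 in simp_all)
    \<comment> \<open>The factor r^2 of the primitive kills the contribution of the origin; only the
      boundary circle remains.\<close>
    also have "\<dots> = \<kappa>\<^sup>2 * u (circ \<kappa> \<theta>) - 0\<^sup>2 * u (circ 0 \<theta>)"
    proof (rule integral_FTC_Icc[OF _ _ f])
      fix r assume r: "0 \<le> r" "r \<le> \<kappa>"
      let ?x = "circ r \<theta>"
      have "((\<lambda>r. circ r \<theta>) has_derivative (\<lambda>h. h *\<^sub>R circ 1 \<theta>)) (at r)"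
      proof -
        have eq: "(\<lambda>r. circ r \<theta>) = (\<lambda>r. r *\<^sub>R circ 1 \<theta>)" by (rule ext, rule circ_scaleR)
        show ?thesis by (subst eq) (auto intro!: derivative_eq_intros)
      qed
      from has_derivative_compose[OF this u[OF circ_in]] r
      have "((\<lambda>r. u (circ r \<theta>)) has_derivative (\<lambda>h. u' ?x (h *\<^sub>R circ 1 \<theta>))) (at r)" by simp
      moreover have lin: "linear (u' ?x)" using u[OF circ_in, of r] r has_derivative_linear by auto
      have "u' ?x (h *\<^sub>R circ 1 \<theta>) = u' ?x (circ 1 \<theta>) * h" for h
        using linear_scale[OF lin, of h "circ 1 \<theta>"] by simp
      with calculation have "((\<lambda>r. u (circ r \<theta>)) has_real_derivative u' ?x (circ 1 \<theta>)) (at r)"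
        by (simp add: has_field_derivative_def)
      then have "((\<lambda>r. r\<^sup>2 * u (circ r \<theta>)) has_real_derivative 2 * r * u ?x + u' ?x (circ 1 \<theta>) * r\<^sup>2) (at r)"
        by (auto intro!: derivative_eq_intros)
      moreover have "2 * r * u ?x + u' ?x (circ 1 \<theta>) * r\<^sup>2 = r * ?w ?x"
      proof -
        have "u' ?x ?x = r * u' ?x (circ 1 \<theta>)"
          using linear_scale[OF lin, of r "circ 1 \<theta>"] by (simp add: circ_scaleR[symmetric])
        then show ?thesis by (simp add: power2_eq_square algebra_simps)
      qed
      ultimately show "((\<lambda>r. r\<^sup>2 * u (circ r \<theta>)) has_vector_derivative r * ?w ?x) (at r within {0..\<kappa>})"
        by (simp add: has_real_derivative_iff_has_vector_derivative has_vector_derivative_at_within)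
    qed (use \<kappa> in simp)
    finally show "(LINT r|lborel. indicator {0<..<\<kappa>} r * (r * G (circ r \<theta>))) = \<kappa>\<^sup>2 * u (circ \<kappa> \<theta>)" by simp
  qed
  finally show "(LINT x|Ldisc \<kappa>. ?w x) = (LINT \<theta>|lborel. indicator {0<..<2 * pi} \<theta> * (\<kappa>\<^sup>2 * u (circ \<kappa> \<theta>)))" .
qed

section \<open>Poincare and Hardy on the disc\<close>

lemma integrable_Ldisc_continuous:
  fixes w :: "real^2 \<Rightarrow> real"
  assumes \<kappa>: "0 < \<kappa>" and w: "continuous_on (cball 0 \<kappa>) w"
  shows "integrable (Ldisc \<kappa>) w"
proof -
  have dsub: "disc \<kappa> \<subseteq> cball 0 \<kappa>" using disc_subset_cball[of \<kappa>] \<kappa> by simp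
  have "compact (w ` cball 0 \<kappa>)" by (intro compact_continuous_image w compact_cball)
  then obtain B where "\<forall>y\<in>w ` cball 0 \<kappa>. norm y \<le> B"
    using compact_imp_bounded bounded_iff by blast
  then have B: "\<And>x. x \<in> cball 0 \<kappa> \<Longrightarrow> \<bar>w x\<bar> \<le> B" by simp
  interpret finite_measure "Ldisc \<kappa>" by (rule finite_measure_lebesgue_on[OF bounded_disc disc_borel])
  have m: "(\<lambda>x. indicator (disc \<kappa>) x *\<^sub>R w x) \<in> borel_measurable borel"
    by (intro borel_measurable_continuous_on_indicator disc_borel continuous_on_subset[OF w] dsub)
  have "integrable (Ldisc \<kappa>) (\<lambda>x. indicator (disc \<kappa>) x *\<^sub>R w x)"
  proof (rule integrable_const_bound[of _ B])
    show "AE x in Ldisc \<kappa>. norm (indicator (disc \<kappa>) x *\<^sub>R w x) \<le> B"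
      by (rule AE_I2) (use B dsub in auto)
  qed (use borel_measurable_lebesgue_on[OF m] in simp)
  then show ?thesis
    by (rule Bochner_Integration.integrable_cong[THEN iffD1, rotated 2]) auto
qed

definition dirderiv :: "(real^2 \<Rightarrow> complex) \<Rightarrow> real^2 \<Rightarrow> real^2 \<Rightarrow> complex" where
  "dirderiv f x h = (\<Sum>i\<in>UNIV. h $ i *\<^sub>R pderivs [i] f x)"

lemma norm_dirderiv_sq_le: "(norm (dirderiv f x x))\<^sup>2 \<le> (norm x)\<^sup>2 * (\<Sum>i\<in>UNIV. (norm (pderivs [i] f x))\<^sup>2)"
proof -
  have "norm (dirderiv f x x) \<le> \<bar>x $ 1\<bar> * norm (pderivs [1] f x) + \<bar>x $ 2\<bar> * norm (pderivs [2] f x)"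
    unfolding dirderiv_def sum_2 by (rule order_trans[OF norm_triangle_ineq]) (simp del: pderivs.simps)
  then have "(norm (dirderiv f x x))\<^sup>2 \<le> (\<bar>x $ 1\<bar> * norm (pderivs [1] f x) + \<bar>x $ 2\<bar> * norm (pderivs [2] f x))\<^sup>2"
    by (rule power_mono) simp
  also have "\<dots> \<le> ((x $ 1)\<^sup>2 + (x $ 2)\<^sup>2) * ((norm (pderivs [1] f x))\<^sup>2 + (norm (pderivs [2] f x))\<^sup>2)"
  proof -
    have "(a * p + b * q)\<^sup>2 \<le> (a\<^sup>2 + b\<^sup>2) * (p\<^sup>2 + q\<^sup>2)" for a b p q :: real
      using zero_le_power2[of "a * q - b * p"] by (simp add: power2_eq_square algebra_simps)
    from this[of "\<bar>x $ 1\<bar>" _ "\<bar>x $ 2\<bar>"] show ?thesis by simp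
  qed
  finally show ?thesis by (simp add: norm_sq_2 sum_2 del: pderivs.simps)
qed

lemma has_derivative_norm_sq:
  assumes "smooth f"
  shows "((\<lambda>x. (norm (f x))\<^sup>2) has_derivative (\<lambda>h. 2 * (f x \<bullet> dirderiv f x h))) (at x)"
proof -
  have "(f has_derivative dirderiv f x) (at x)"
    using smooth_has_derivative[OF assms] by (simp add: dirderiv_def[abs_def])
  from has_derivative_inner[OF this this] show ?thesis
    unfolding power2_norm_eq_inner by (rule has_derivative_eq_rhs) (simp add: inner_commute fun_eq_iff)
qed

lemma continuous_on_dirderiv:
  assumes "smooth f" shows "continuous_on T (\<lambda>x. dirderiv f x x)"
  unfolding dirderiv_def
  by (intro continuous_on_sum continuous_on_scaleR smooth_continuous_on smooth_pderiv assms continuous_intros)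

text \<open>Cauchy-Schwarz followed by Young's inequality with weight t. The weight is left free:
  Poincare takes t = 1, Hardy the quotient of |x|^2 by the distance weight.\<close>

lemma inner_dirderiv_ge:
  assumes "0 < t"
  shows "- (t * (norm (f x))\<^sup>2 + (norm x)\<^sup>2 / t * (\<Sum>i\<in>UNIV. (norm (pderivs [i] f x))\<^sup>2)) \<le> 2 * (f x \<bullet> dirderiv f x x)"
proof -
  let ?g = "\<Sum>i\<in>UNIV. (norm (pderivs [i] f x))\<^sup>2"
  have "2 * \<bar>f x \<bullet> dirderiv f x x\<bar> \<le> 2 * (norm (f x) * norm (dirderiv f x x))"
    using Cauchy_Schwarz_ineq2[of "f x" "dirderiv f x x"] by simp
  also have "\<dots> \<le> t * (norm (f x))\<^sup>2 + (norm (dirderiv f x x))\<^sup>2 / t"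
  proof -
    have "0 \<le> (t * a - b)\<^sup>2 / t" for a b :: real using assms by simp
    then have "2 * (a * b) \<le> t * a\<^sup>2 + b\<^sup>2 / t" for a b :: real
      using assms by (simp add: power2_diff field_simps power2_eq_square)
    then show ?thesis .
  qed
  also have "(norm (dirderiv f x x))\<^sup>2 / t \<le> (norm x)\<^sup>2 * ?g / t"
    using norm_dirderiv_sq_le assms by (intro divide_right_mono) auto
  finally show ?thesis by (simp del: pderivs.simps add: abs_le_iff)
qed

lemma sqnorm_pderiv_sum:
  assumes "0 < \<kappa>" "smooth f"
  shows "integrable (Ldisc \<kappa>) (\<lambda>x. \<Sum>i\<in>UNIV. (norm (pderivs [i] f x))\<^sup>2)"
    and "(LINT x|Ldisc \<kappa>. (\<Sum>i\<in>UNIV. (norm (pderivs [i] f x))\<^sup>2)) = (\<Sum>i\<in>UNIV. sqnorm (Ldisc \<kappa>) (pderivs [i] f))"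
proof -
  have i: "integrable (Ldisc \<kappa>) (\<lambda>x. (norm (pderivs [i] f x))\<^sup>2)" for i
    by (intro square_integrable_integrable square_integrable_smooth bounded_disc open_disc smooth_pderiv assms)
  then show "integrable (Ldisc \<kappa>) (\<lambda>x. \<Sum>i\<in>UNIV. (norm (pderivs [i] f x))\<^sup>2)"
    by (rule Bochner_Integration.integrable_sum)
  show "(LINT x|Ldisc \<kappa>. (\<Sum>i\<in>UNIV. (norm (pderivs [i] f x))\<^sup>2)) = (\<Sum>i\<in>UNIV. sqnorm (Ldisc \<kappa>) (pderivs [i] f))"
    unfolding sqnorm_def by (rule Bochner_Integration.integral_sum) (rule i)
qed

text \<open>The divergence identity for u = |f|^2 has no boundary term. Of the two copies of |f|^2
  in it, Young's inequality with t = 1 uses up one and leaves the other bounded by |x|^2 times the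
  squared gradient.\<close>

lemma Poincare_disc:
  assumes \<kappa>: "0 < \<kappa>" and f: "smooth f" and zero: "\<And>x. norm x = \<kappa> \<Longrightarrow> f x = 0"
  shows "sqnorm (Ldisc \<kappa>) f \<le> \<kappa>\<^sup>2 * (\<Sum>i\<in>UNIV. sqnorm (Ldisc \<kappa>) (pderivs [i] f))"
proof -
  let ?g = "\<lambda>x. \<Sum>i\<in>UNIV. (norm (pderivs [i] f x))\<^sup>2"
  let ?I = "\<lambda>x. 2 * (norm (f x))\<^sup>2 + 2 * (f x \<bullet> dirderiv f x x)"
  have c: "continuous_on (cball 0 \<kappa>) (\<lambda>x. 2 * (f x \<bullet> dirderiv f x x))"
    by (intro continuous_intros smooth_continuous_on continuous_on_dirderiv f)
  note id = disc_divergence_identity[OF \<kappa> has_derivative_norm_sq[OF f] c]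
  have "(LINT \<theta>|lborel. indicator {0<..<2 * pi} \<theta> * (\<kappa>\<^sup>2 * (norm (f (circ \<kappa> \<theta>)))\<^sup>2)) = 0"
    using zero \<kappa> by (simp add: norm_circ)
  then have 0: "(LINT x|Ldisc \<kappa>. ?I x) = 0" using id(1) by simp
  have si: "integrable (Ldisc \<kappa>) (\<lambda>x. (norm (f x))\<^sup>2)"
    by (intro square_integrable_integrable square_integrable_smooth bounded_disc open_disc f)
  have "sqnorm (Ldisc \<kappa>) f \<le> (LINT x|Ldisc \<kappa>. ?I x + \<kappa>\<^sup>2 * ?g x)"
    unfolding sqnorm_def
  proof (rule integral_mono[OF si])
    show "integrable (Ldisc \<kappa>) (\<lambda>x. ?I x + \<kappa>\<^sup>2 * ?g x)"
      by (intro Bochner_Integration.integrable_add integrable_mult_right id(2) sqnorm_pderiv_sum \<kappa> f)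
    fix x assume "x \<in> space (Ldisc \<kappa>)"
    then have "(norm x)\<^sup>2 \<le> \<kappa>\<^sup>2" by (simp add: norm_disc)
    moreover have "0 \<le> ?g x" by (intro sum_nonneg) simp
    ultimately have "(norm x)\<^sup>2 * ?g x \<le> \<kappa>\<^sup>2 * ?g x" by (rule mult_right_mono)
    then show "(norm (f x))\<^sup>2 \<le> ?I x + \<kappa>\<^sup>2 * ?g x"
      using inner_dirderiv_ge[of 1 f x] by (simp del: pderivs.simps)
  qed
  also have "\<dots> = (LINT x|Ldisc \<kappa>. ?I x) + \<kappa>\<^sup>2 * (LINT x|Ldisc \<kappa>. ?g x)"
  proof -
    have "integrable (Ldisc \<kappa>) (\<lambda>x. \<kappa>\<^sup>2 * ?g x)" by (intro integrable_mult_right sqnorm_pderiv_sum \<kappa> f)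
    from Bochner_Integration.integral_add[OF id(2) this] show ?thesis by (simp only: integral_mult_right_zero)
  qed
  finally show ?thesis unfolding 0 sqnorm_pderiv_sum[OF \<kappa> f] by simp
qed

text \<open>The case \<open>u = \<bar>f\<bar>\<^sup>2 / (\<kappa>\<^sup>2 - \<bar>x\<bar>\<^sup>2 + \<eta>)\<close> of the identity; \<open>\<eta>\<close> keeps the weight finite on the circle,
  where \<open>f\<close> is only small.\<close>

lemma Hardy_disc:
  assumes \<kappa>: "0 < \<kappa>" and \<eta>: "0 < \<eta>" and f: "smooth f"
  shows "(LINT x|Ldisc \<kappa>. (norm x)\<^sup>2 * (norm (f x))\<^sup>2 / (\<kappa>\<^sup>2 - (norm x)\<^sup>2 + \<eta>)\<^sup>2)
    \<le> \<kappa>\<^sup>2 / \<eta> * (LINT \<theta>|lborel. indicator {0<..<2 * pi} \<theta> * (norm (f (circ \<kappa> \<theta>)))\<^sup>2) + (\<Sum>i\<in>UNIV. sqnorm (Ldisc \<kappa>) (pderivs [i] f))"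
proof -
  let ?g = "\<lambda>x. \<Sum>i\<in>UNIV. (norm (pderivs [i] f x))\<^sup>2"
  define D where "D x = \<kappa>\<^sup>2 - (norm x)\<^sup>2 + \<eta>" for x :: "real^2"
  have D: "0 < D x" if "x \<in> cball 0 \<kappa>" for x
  proof -
    have "(norm x)\<^sup>2 \<le> \<kappa>\<^sup>2" using that by (intro power_mono) auto
    then show ?thesis using \<eta> by (simp add: D_def)
  qed
  have Dd: "(D has_derivative (\<lambda>h. - (2 * (x \<bullet> h)))) (at x)" for x
    unfolding D_def[abs_def] power2_norm_eq_inner
    by (auto intro!: derivative_eq_intros simp: inner_commute fun_eq_iff)
  define u' where "u' x h = (2 * (f x \<bullet> dirderiv f x h) * D x - (norm (f x))\<^sup>2 * - (2 * (x \<bullet> h))) / (D x * D x)" for x h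
  have Dc: "continuous_on (cball 0 \<kappa>) D" unfolding D_def[abs_def] by (intro continuous_intros)
  have c: "continuous_on (cball 0 \<kappa>) (\<lambda>x. u' x x)"
    unfolding u'_def
    by (intro continuous_on_divide continuous_on_diff continuous_on_mult continuous_on_inner continuous_on_minus continuous_on_power continuous_on_norm
        continuous_on_const continuous_on_id smooth_continuous_on continuous_on_dirderiv f Dc ballI) (use D in force)
  have d: "((\<lambda>x. (norm (f x))\<^sup>2 / D x) has_derivative u' x) (at x)" if "x \<in> cball 0 \<kappa>" for x
    unfolding u'_def[abs_def]
    by (rule has_derivative_divide'[OF has_derivative_norm_sq[OF f] Dd]) (use D[OF that] in simp)
  note id = disc_divergence_identity[OF \<kappa> d c]
  let ?I = "\<lambda>x. 2 * ((norm (f x))\<^sup>2 / D x) + u' x x"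
  have "(LINT x|Ldisc \<kappa>. (norm x)\<^sup>2 * (norm (f x))\<^sup>2 / (D x)\<^sup>2) \<le> (LINT x|Ldisc \<kappa>. ?I x + ?g x)"
  proof (rule integral_mono)
    show "integrable (Ldisc \<kappa>) (\<lambda>x. (norm x)\<^sup>2 * (norm (f x))\<^sup>2 / (D x)\<^sup>2)"
      by (rule integrable_Ldisc_continuous[OF \<kappa>])
        (intro continuous_on_divide continuous_on_mult continuous_on_power continuous_on_norm continuous_on_id smooth_continuous_on f Dc ballI, use D in force)
    show "integrable (Ldisc \<kappa>) (\<lambda>x. ?I x + ?g x)"
      by (intro Bochner_Integration.integrable_add id(2) sqnorm_pderiv_sum \<kappa> f)
    fix x assume "x \<in> space (Ldisc \<kappa>)"
    then have "x \<in> cball 0 \<kappa>" using disc_subset_cball[of \<kappa>] \<kappa> by auto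
    from D[OF this] have Dx: "0 < D x" .
    have "0 \<le> ?I x - (norm x)\<^sup>2 * (norm (f x))\<^sup>2 / (D x)\<^sup>2 + ?g x"
    proof (cases "x = 0")
      case True
      then show ?thesis using Dx by (auto simp: u'_def dirderiv_def sum_nonneg simp del: pderivs.simps intro!: add_nonneg_nonneg)
    next
      case False
      let ?a = "(norm (f x))\<^sup>2" and ?r = "(norm x)\<^sup>2" and ?b = "2 * (f x \<bullet> dirderiv f x x)"
      have r: "0 < ?r" using False by simp
      \<comment> \<open>The weight |x|^2 / D is chosen so that, after division by D, the gradient
        has coefficient 1 and just one of the two copies of |x|^2 |f|^2 / D^2 in
        \<open>u' x x\<close> is spent. At the origin it would be 0, hence the case
        distinction.\<close>
      have "- (?r / D x * ?a + ?r / (?r / D x) * ?g x) \<le> ?b"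
        using inner_dirderiv_ge[of "?r / D x" f x] r Dx by (simp del: pderivs.simps)
      then have "- (?r / D x * ?a + D x * ?g x) \<le> ?b" using False Dx by (simp del: pderivs.simps)
      moreover have "- (r * a / D\<^sup>2 + g) \<le> b / D" if "- (r / D * a + D * g) \<le> b" "0 < D" for r a D g b :: real
        using divide_right_mono[OF that(1) less_imp_le[OF that(2)]] that(2) by (simp add: field_simps power2_eq_square)
      ultimately have "- (?r * ?a / (D x)\<^sup>2 + ?g x) \<le> ?b / D x" using Dx by blast
      moreover have "u' x x = ?b / D x + 2 * (?r * ?a / (D x)\<^sup>2)"
      proof -
        have "(b * D - a * - (2 * r)) / (D * D) = b / D + 2 * (r * a / D\<^sup>2)" if "0 < D" for a b r D :: real
          using that by (simp add: field_simps power2_eq_square)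
        from this[OF Dx] show ?thesis unfolding u'_def power2_norm_eq_inner[symmetric] .
      qed
      moreover have "0 \<le> 2 * (?a / D x)" using Dx by simp
      ultimately show ?thesis by linarith
    qed
    then show "(norm x)\<^sup>2 * (norm (f x))\<^sup>2 / (D x)\<^sup>2 \<le> ?I x + ?g x" by linarith
  qed
  also have "\<dots> = (LINT x|Ldisc \<kappa>. ?I x) + (LINT x|Ldisc \<kappa>. ?g x)"
    by (intro Bochner_Integration.integral_add id(2) sqnorm_pderiv_sum \<kappa> f)
  also have "(LINT x|Ldisc \<kappa>. ?I x) = (LINT \<theta>|lborel. indicator {0<..<2 * pi} \<theta> * (\<kappa>\<^sup>2 * ((norm (f (circ \<kappa> \<theta>)))\<^sup>2 / D (circ \<kappa> \<theta>))))"
    by (rule id(1))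
  \<comment> \<open>On the circle D equals \<eta>, whence the factor in front of the boundary
    integral.\<close>
  also have "\<dots> = (LINT \<theta>|lborel. \<kappa>\<^sup>2 / \<eta> * (indicator {0<..<2 * pi} \<theta> * (norm (f (circ \<kappa> \<theta>)))\<^sup>2))"
    by (intro Bochner_Integration.integral_cong refl) (simp add: D_def norm_circ)
  also have "\<dots> = \<kappa>\<^sup>2 / \<eta> * (LINT \<theta>|lborel. indicator {0<..<2 * pi} \<theta> * (norm (f (circ \<kappa> \<theta>)))\<^sup>2)"
    by (rule integral_mult_right_zero)
  finally show ?thesis by (simp only: D_def sqnorm_pderiv_sum(2)[OF \<kappa> f])
qed

text \<open>\<kappa>^2 - |x|^2 stands in for the distance to the circle because it is a polynomial,
  smooth at the origin as well. The shift by -1 makes the function 0 where this quantity is at most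
  \<epsilon>.\<close>

definition cutoff :: "real \<Rightarrow> real \<Rightarrow> real^2 \<Rightarrow> complex" where
  "cutoff \<kappa> \<epsilon> x = complex_of_real (bump 0 ((\<kappa>\<^sup>2 - (norm x)\<^sup>2) / \<epsilon> - 1))"

text \<open>\<open>bump 2\<close> is the derivative of \<open>bump 0\<close>. The quadratic Taylor
  bound for exp(1/t) gives \<open>bump 2 t\<close> \<le> 2 / (2 t^2 + 2 t + 1), and both estimates
  follow. In the cutoff, t + 1 is (\<kappa>^2 - |x|^2) / \<epsilon>: the first estimate becomes
  uniform in \<epsilon>, the second decays with \<epsilon>.\<close>

lemma bump_2_bound:
  assumes "0 < t" shows "(t + 1) * bump 2 t \<le> 2" "(t + 1) * bump 2 t \<le> 4 / (t + 1)"
proof -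
  have "1 + 1 / t + (1 / t)\<^sup>2 / 2 \<le> exp (1 / t)" by (rule exp_lower_Taylor_quadratic) (use assms in simp)
  then have "exp (- (1 / t)) \<le> 1 / (1 + 1 / t + (1 / t)\<^sup>2 / 2)"
    unfolding exp_minus using assms by (simp add: inverse_eq_divide) (intro divide_left_mono mult_pos_pos add_pos_nonneg, auto)
  then have "exp (- (1 / t)) / t\<^sup>2 \<le> 1 / (1 + 1 / t + (1 / t)\<^sup>2 / 2) / t\<^sup>2"
    by (rule divide_right_mono) simp
  then have "bump 2 t \<le> 1 / (1 + 1 / t + (1 / t)\<^sup>2 / 2) / t\<^sup>2"
    unfolding bump_def using assms by (simp only: if_True)
  also have "\<dots> = 1 / ((1 + 1 / t + (1 / t)\<^sup>2 / 2) * t\<^sup>2)" by simp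
  also have "(1 + 1 / t + (1 / t)\<^sup>2 / 2) * t\<^sup>2 = (2 * t\<^sup>2 + 2 * t + 1) / 2"
    using assms by (simp add: field_simps power2_eq_square)
  also have "1 / ((2 * t\<^sup>2 + 2 * t + 1) / 2) = 2 / (2 * t\<^sup>2 + 2 * t + 1)" by simp
  finally have b: "bump 2 t \<le> 2 / (2 * t\<^sup>2 + 2 * t + 1)" .
  have p: "0 < 2 * t\<^sup>2 + 2 * t + 1" using assms by (simp add: add_pos_pos)
  from mult_left_mono[OF b, of "t + 1"] assms
  have c: "(t + 1) * bump 2 t \<le> (t + 1) * (2 / (2 * t\<^sup>2 + 2 * t + 1))" by simp
  also have "\<dots> \<le> 2" using p assms by (simp add: divide_le_eq)
  finally show "(t + 1) * bump 2 t \<le> 2" .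
  have "(t + 1) * (2 / (2 * t\<^sup>2 + 2 * t + 1)) \<le> 4 / (t + 1)"
    using p assms by (simp add: frac_le_eq divide_le_0_iff field_simps power2_eq_square)
  with c show "(t + 1) * bump 2 t \<le> 4 / (t + 1)" by linarith
qed

context
  fixes \<kappa> \<epsilon> :: real
  assumes \<epsilon>: "0 < \<epsilon>"
begin

lemma cutoff_eq:
  "cutoff \<kappa> \<epsilon> = (\<lambda>x. complex_of_real (bump 0 (Re (complex_of_real (\<kappa>\<^sup>2 / \<epsilon> - 1) +
      complex_of_real (- 1 / \<epsilon>) * (complex_of_real (x $ 1) * complex_of_real (x $ 1) + complex_of_real (x $ 2) * complex_of_real (x $ 2))))))"
  by (rule ext) (unfold cutoff_def norm_sq_2, rule arg_cong[where f = "\<lambda>t. complex_of_real (bump 0 t)"],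
      simp add: power2_eq_square diff_divide_distrib add_divide_distrib)

lemma smooth_cutoff: "smooth (cutoff \<kappa> \<epsilon>)"
  unfolding cutoff_eq by (intro smooth_bump smooth_add smooth_mult smooth_const smooth_coord)

lemma pderiv_cutoff:
  "pderivs [i] (cutoff \<kappa> \<epsilon>) x = complex_of_real (bump 2 ((\<kappa>\<^sup>2 - (norm x)\<^sup>2) / \<epsilon> - 1) * (- (2 * x $ i) / \<epsilon>))"
proof -
  let ?p = "\<lambda>x::real^2. complex_of_real (\<kappa>\<^sup>2 / \<epsilon> - 1) +
      complex_of_real (- 1 / \<epsilon>) * (complex_of_real (x $ 1) * complex_of_real (x $ 1) + complex_of_real (x $ 2) * complex_of_real (x $ 2))"
  have sm: "smooth ?p" "smooth (\<lambda>x::real^2. complex_of_real (x $ j) * complex_of_real (x $ j))"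
    "smooth (\<lambda>x::real^2. complex_of_real (x $ 1) * complex_of_real (x $ 1) + complex_of_real (x $ 2) * complex_of_real (x $ 2))" for j
    by (intro smooth_add smooth_mult smooth_const smooth_coord)+
  note df = smooth_differentiable
  have sq: "pderivs [i] (\<lambda>x::real^2. complex_of_real (x $ j) * complex_of_real (x $ j)) x = (if i = j then 2 * complex_of_real (x $ j) else 0)" for j
    by (subst pderiv_mult) (auto intro!: df smooth_coord simp: pderiv_coord simp del: pderivs.simps)
  have "pderivs [i] (\<lambda>x::real^2. complex_of_real (x $ 1) * complex_of_real (x $ 1) + complex_of_real (x $ 2) * complex_of_real (x $ 2)) x = 2 * complex_of_real (x $ i)"
    using exhaust_2[of i] by (subst pderiv_add[OF df[OF sm(2)] df[OF sm(2)]]) (auto simp: sq simp del: pderivs.simps)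
  then have "pderivs [i] ?p x = complex_of_real (- 1 / \<epsilon>) * (2 * complex_of_real (x $ i))"
    by (subst pderiv_add[OF df[OF smooth_const] df[OF smooth_mult[OF smooth_const sm(3)]]],
        subst pderiv_mult[OF df[OF smooth_const] df[OF sm(3)]]) (simp del: pderivs.simps add: pderiv_const)
  then have "Re (pderivs [i] ?p x) = - (2 * x $ i) / \<epsilon>" by simp
  moreover have "Re (?p x) = (\<kappa>\<^sup>2 - (norm x)\<^sup>2) / \<epsilon> - 1"
    unfolding norm_sq_2 by (simp add: power2_eq_square diff_divide_distrib add_divide_distrib)
  ultimately show ?thesis
    unfolding cutoff_eq pderiv_bump[OF df[OF sm(1)]] by (simp only: of_nat_0 mult_zero_left diff_zero add_0)
qed

lemma norm_cutoff_le: "norm (cutoff \<kappa> \<epsilon> x) \<le> 1"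
  by (simp add: cutoff_def bump_0_le_1)

lemma cutoff_support: "closure {x. cutoff \<kappa> \<epsilon> x \<noteq> 0} \<subseteq> disc \<kappa>"
proof -
  have "closure {x. cutoff \<kappa> \<epsilon> x \<noteq> 0} \<subseteq> {x. (norm x)\<^sup>2 \<le> \<kappa>\<^sup>2 - \<epsilon>}"
  proof (rule closure_minimal)
    show "closed {x::real^2. (norm x)\<^sup>2 \<le> \<kappa>\<^sup>2 - \<epsilon>}" by (intro closed_Collect_le continuous_intros)
    show "{x. cutoff \<kappa> \<epsilon> x \<noteq> 0} \<subseteq> {x. (norm x)\<^sup>2 \<le> \<kappa>\<^sup>2 - \<epsilon>}"
    proof
      fix x assume "x \<in> {x. cutoff \<kappa> \<epsilon> x \<noteq> 0}"
      then have "bump 0 ((\<kappa>\<^sup>2 - (norm x)\<^sup>2) / \<epsilon> - 1) \<noteq> 0" by (simp add: cutoff_def)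
      then have "0 < (\<kappa>\<^sup>2 - (norm x)\<^sup>2) / \<epsilon> - 1" using bump_nonpos not_le by blast
      then show "x \<in> {x. (norm x)\<^sup>2 \<le> \<kappa>\<^sup>2 - \<epsilon>}" using \<epsilon> by (simp add: field_simps)
    qed
  qed
  then show ?thesis using \<epsilon> by (force simp: norm_disc)
qed

text \<open>Two bounds for one dominated convergence: the first is free of \<epsilon> and has the
  weight of Hardy's inequality, the second tends to 0 with \<epsilon> at each point of the
  disc.\<close>

lemma norm_pderiv_cutoff_le:
  assumes "x \<in> disc \<kappa>"
  shows "norm (pderivs [i] (cutoff \<kappa> \<epsilon>) x) \<le> 4 * (norm x / (\<kappa>\<^sup>2 - (norm x)\<^sup>2))"
    and "norm (pderivs [i] (cutoff \<kappa> \<epsilon>) x) \<le> 8 * norm x * \<epsilon> / (\<kappa>\<^sup>2 - (norm x)\<^sup>2)\<^sup>2"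
proof -
  define d where "d = \<kappa>\<^sup>2 - (norm x)\<^sup>2"
  have d: "0 < d" using assms by (simp add: d_def norm_disc)
  let ?t = "d / \<epsilon> - 1"
  have n: "norm (pderivs [i] (cutoff \<kappa> \<epsilon>) x) = bump 2 ?t / \<epsilon> * (2 * \<bar>x $ i\<bar>)"
    unfolding pderiv_cutoff norm_of_real using \<epsilon> by (simp add: abs_mult d_def)
  have xi: "\<bar>x $ i\<bar> \<le> norm x" by (rule component_le_norm_cart)
  have te: "bump 2 ?t / \<epsilon> = (?t + 1) * bump 2 ?t / d" using d \<epsilon> by (simp add: field_simps)
  have b1: "bump 2 ?t / \<epsilon> \<le> 2 / d" and b2: "bump 2 ?t / \<epsilon> \<le> 4 * \<epsilon> / d\<^sup>2"
  proof -
    show "bump 2 ?t / \<epsilon> \<le> 2 / d"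
    proof (cases "0 < ?t")
      case True
      show ?thesis unfolding te using bump_2_bound(1)[OF True] d by (intro divide_right_mono) auto
    qed (use d bump_nonpos[of ?t] in simp)
    show "bump 2 ?t / \<epsilon> \<le> 4 * \<epsilon> / d\<^sup>2"
    proof (cases "0 < ?t")
      case True
      have "bump 2 ?t / \<epsilon> \<le> 4 / (?t + 1) / d"
        unfolding te using bump_2_bound(2)[OF True] d by (intro divide_right_mono) auto
      then show ?thesis using d \<epsilon> by (simp add: power2_eq_square)
    qed (use d \<epsilon> bump_nonpos[of ?t] in simp)
  qed
  have "norm (pderivs [i] (cutoff \<kappa> \<epsilon>) x) \<le> 2 / d * (2 * norm x)"
    unfolding n using b1 xi d \<epsilon> by (intro mult_mono) auto
  then show "norm (pderivs [i] (cutoff \<kappa> \<epsilon>) x) \<le> 4 * (norm x / (\<kappa>\<^sup>2 - (norm x)\<^sup>2))"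
    by (simp add: d_def mult.assoc)
  have "norm (pderivs [i] (cutoff \<kappa> \<epsilon>) x) \<le> 4 * \<epsilon> / d\<^sup>2 * (2 * norm x)"
    unfolding n using b2 xi d \<epsilon> by (intro mult_mono) auto
  then show "norm (pderivs [i] (cutoff \<kappa> \<epsilon>) x) \<le> 8 * norm x * \<epsilon> / (\<kappa>\<^sup>2 - (norm x)\<^sup>2)\<^sup>2"
    by (simp add: d_def mult.assoc mult.commute mult.left_commute)
qed

end

lemma cutoff_tendsto:
  assumes "x \<in> disc \<kappa>" shows "(\<lambda>k. cutoff \<kappa> (1 / Suc k) x) \<longlonglongrightarrow> 1"
proof -
  have "cutoff \<kappa> (1 / Suc k) x = complex_of_real (bump 0 (real (Suc k) * (\<kappa>\<^sup>2 - (norm x)\<^sup>2) - 1))" for k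
    by (simp add: cutoff_def mult.commute)
  moreover have "(\<lambda>k. complex_of_real (bump 0 (real (Suc k) * (\<kappa>\<^sup>2 - (norm x)\<^sup>2) - 1))) \<longlonglongrightarrow> complex_of_real 1"
    by (intro tendsto_of_real bump_tendsto_1) (use assms in \<open>simp add: norm_disc\<close>)
  ultimately show ?thesis by simp
qed

section \<open>Fourier modes and the lateral surface\<close>

text \<open>Completeness of Lebesgue measure: changes on a null set preserve measurability.\<close>

lemma measurable_lebesgue_on_cong_AE:
  fixes f g :: "'a::euclidean_space \<Rightarrow> 'b::euclidean_space"
  assumes S: "S \<in> sets borel" and g: "g \<in> borel_measurable (lebesgue_on S)" and ae: "AE x in lebesgue_on S. f x = g x"
  shows "f \<in> borel_measurable (lebesgue_on S)"
proof -
  have SL: "S \<in> sets lebesgue" using S by simp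
  have "(\<lambda>x. if x \<in> S then g x else 0) \<in> borel_measurable lebesgue"
    using g borel_measurable_if[OF SL] by blast
  moreover have "AE x in lebesgue. x \<in> S \<longrightarrow> f x = g x"
    by (rule AE_restrict_space_iff[of S lebesgue "\<lambda>x. f x = g x", THEN iffD1, OF _ ae]) (use S in simp)
  then have "AE x in lebesgue. (if x \<in> S then g x else 0) = (if x \<in> S then f x else 0)"
    by eventually_elim simp
  ultimately have "(\<lambda>x. if x \<in> S then f x else 0) \<in> borel_measurable lebesgue"
    by (rule borel_measurable_AE)
  then show ?thesis using borel_measurable_if[OF SL] by blast
qed

section \<open>Fourier modes with a smooth coefficient\<close>

lemma pderiv_horiz:
  assumes f: "smooth f"
  shows "pderivs [emb i] (\<lambda>a. f (horiz a)) = (\<lambda>a. pderivs [i] f (horiz a))"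
    and "pderivs [3] (\<lambda>a. f (horiz a)) = (\<lambda>a. 0)"
    and "(\<lambda>a. f (horiz a)) differentiable (at a)"
proof -
  have "(horiz has_derivative horiz) (at a)" for a
    by (rule bounded_linear_imp_has_derivative[OF bounded_linear_horiz])
  from has_derivative_compose[OF this smooth_has_derivative[OF f]]
  have d: "((\<lambda>a. f (horiz a)) has_derivative (\<lambda>h. \<Sum>j\<in>UNIV. horiz h $ j *\<^sub>R pderivs [j] f (horiz a))) (at a)" for a .
  show "pderivs [emb i] (\<lambda>a. f (horiz a)) = (\<lambda>a. pderivs [i] f (horiz a))"
    by (rule ext, subst pderiv_eqI[OF d])
      (use exhaust_2[of i] in \<open>auto simp: sum_2 axis_def simp del: pderivs.simps\<close>)
  show "pderivs [3] (\<lambda>a. f (horiz a)) = (\<lambda>a. 0)"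
    by (rule ext, subst pderiv_eqI[OF d]) (simp add: sum_2 axis_def del: pderivs.simps)
  show "(\<lambda>a. f (horiz a)) differentiable (at a)" using d unfolding differentiable_def by blast
qed

lemma exhaust_emb: "k = 3 \<or> (\<exists>i. k = emb i)" for k :: 3
  using exhaust_3[of k] emb_simps by metis

lemma smooth_horiz [intro]:
  assumes "smooth f" shows "smooth (\<lambda>a. f (horiz a))"
proof (rule smooth_coinduct[of _ "insert (\<lambda>a. 0) ((\<lambda>f a. f (horiz a)) ` Collect smooth)"])
  fix g :: "real^3 \<Rightarrow> complex" and a :: "real^3"
  assume "g \<in> insert (\<lambda>a. 0) ((\<lambda>f a. f (horiz a)) ` Collect smooth)"
  then show "g differentiable (at a)" using pderiv_horiz(3) by auto
next
  fix g :: "real^3 \<Rightarrow> complex" and k :: 3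
  assume "g \<in> insert (\<lambda>a. 0) ((\<lambda>f a. f (horiz a)) ` Collect smooth)"
  then consider "g = (\<lambda>a. 0)" | f where "smooth f" "g = (\<lambda>a. f (horiz a))" by auto
  then show "pderivs [k] g \<in> insert (\<lambda>a. 0) ((\<lambda>f a. f (horiz a)) ` Collect smooth)"
  proof cases
    case 2
    show ?thesis using exhaust_emb[of k]
    proof
      assume "k = 3"
      then have "pderivs [k] g = (\<lambda>a. 0)" using pderiv_horiz(2)[OF 2(1)] 2(2) by simp
      then show ?thesis by (simp del: pderivs.simps)
    next
      assume "\<exists>i. k = emb i"
      then obtain i where "k = emb i" by blast
      then have "pderivs [k] g = (\<lambda>a. pderivs [i] f (horiz a))" using pderiv_horiz(1)[OF 2(1)] 2(2) by simp
      then show ?thesis using smooth_pderiv[OF 2(1)] by blast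
    qed
  qed (simp del: pderivs.simps)
qed (use assms in simp)

text \<open>The factor by which the vertical derivative acts on the n-th mode.\<close>

definition mode_factor :: "real \<Rightarrow> int \<Rightarrow> complex" where
  "mode_factor l n = 2 * pi * \<i> * of_int n / l"

lemma fourier_mode_eq: "fourier_mode l n f = (\<lambda>a. f (horiz a) * exp (mode_factor l n * complex_of_real (a $ 3)))"
  by (rule ext) (simp add: fourier_mode_def mode_factor_def)

lemma smooth_mode_exp: "smooth (\<lambda>a::real^3. exp (c * complex_of_real (a $ 3)))"
  by (intro smooth_exp smooth_mult smooth_const smooth_coord)

lemma smooth_fourier_mode [intro]: "smooth f \<Longrightarrow> smooth (fourier_mode l n f)"
  unfolding fourier_mode_eq by (intro smooth_mult smooth_horiz smooth_mode_exp)

text \<open>The coefficient of the k-th partial derivative of a mode, which is again a mode of the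
  same order, see \<open>pderiv_fourier_mode\<close>.\<close>

definition mode_grad :: "real \<Rightarrow> int \<Rightarrow> (real^2 \<Rightarrow> complex) \<Rightarrow> 3 \<Rightarrow> real^2 \<Rightarrow> complex" where
  "mode_grad l n f k = (if k = 3 then (\<lambda>x. mode_factor l n * f x) else pderivs [if k = 1 then 1 else 2] f)"

lemma mode_grad_simps: "mode_grad l n f (emb i) = pderivs [i] f" "mode_grad l n f 3 = (\<lambda>x. mode_factor l n * f x)"
  using exhaust_2[of i] by (auto simp: mode_grad_def simp del: pderivs.simps)

lemma pderiv_fourier_mode:
  assumes f: "smooth f" shows "pderivs [k] (fourier_mode l n f) = fourier_mode l n (mode_grad l n f k)"
proof
  fix a :: "real^3"
  let ?c = "mode_factor l n" and ?z = "\<lambda>a::real^3. complex_of_real (a $ 3)"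
  have "pderivs [k] (\<lambda>a. exp (?c * ?z a)) a = exp (?c * ?z a) * pderivs [k] (\<lambda>a. ?c * ?z a) a"
    by (intro pderiv_exp smooth_differentiable smooth_mult smooth_const smooth_coord)
  also have "pderivs [k] (\<lambda>a. ?c * ?z a) a = ?c * of_bool (k = 3)"
    by (subst pderiv_mult[OF smooth_differentiable[OF smooth_const] smooth_differentiable[OF smooth_coord]])
      (simp add: pderiv_coord pderiv_const del: pderivs.simps)
  finally have E: "pderivs [k] (\<lambda>a. exp (?c * ?z a)) a = exp (?c * ?z a) * (?c * of_bool (k = 3))" .
  have F: "pderivs [k] (fourier_mode l n f) a = f (horiz a) * (exp (?c * ?z a) * (?c * of_bool (k = 3))) + pderivs [k] (\<lambda>a. f (horiz a)) a * exp (?c * ?z a)"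
    unfolding fourier_mode_eq E[symmetric]
    by (rule pderiv_mult[OF smooth_differentiable[OF smooth_horiz[OF f]] smooth_differentiable[OF smooth_mode_exp]])
  show "pderivs [k] (fourier_mode l n f) a = fourier_mode l n (mode_grad l n f k) a"
    using exhaust_emb[of k]
  proof
    assume "k = 3"
    then show ?thesis unfolding F by (simp add: pderiv_horiz(2)[OF f] mode_grad_simps fourier_mode_eq del: pderivs.simps)
  next
    assume "\<exists>i. k = emb i"
    then obtain i where i: "k = emb i" by blast
    then have "k \<noteq> 3" by (simp add: emb_def)
    moreover have "pderivs [k] (\<lambda>a. f (horiz a)) = (\<lambda>a. pderivs [i] f (horiz a))" "mode_grad l n f k = pderivs [i] f"
      unfolding i by (rule pderiv_horiz(1)[OF f], rule mode_grad_simps(1))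
    ultimately show ?thesis unfolding F by (simp add: fourier_mode_eq del: pderivs.simps)
  qed
qed

lemma fourier_mode_periodic:
  assumes "l \<noteq> 0" shows "fourier_mode l n f (a + axis 3 l) = fourier_mode l n f a"
proof -
  have h: "horiz (a + axis 3 l) = horiz a" by (simp add: vec_eq_iff forall_2 axis_def)
  have "exp (mode_factor l n * complex_of_real l) = 1"
    using assms unfolding exp_eq_1 by (auto simp: mode_factor_def intro!: exI[of _ n])
  then show ?thesis unfolding fourier_mode_eq h by (simp add: axis_def distrib_left exp_add)
qed

lemma cnj_periodic_test_function:
  assumes "\<phi> \<in> periodic_test_functions \<kappa> l" shows "(\<lambda>a. cnj (\<phi> a)) \<in> periodic_test_functions \<kappa> l"
  using assms by (auto simp: periodic_test_functions_def)

text \<open>A mode is periodic whatever its coefficient is, and the support of the cutoff stays away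
  from the circle. So an arbitrary smooth f yields an admissible test function.\<close>

lemma cutoff_mode_test_function:
  assumes f: "smooth f" and "0 < \<epsilon>" "l \<noteq> 0"
  shows "fourier_mode l n (\<lambda>x. f x * cutoff \<kappa> \<epsilon> x) \<in> periodic_test_functions \<kappa> l"
proof -
  have "closure {a. fourier_mode l n (\<lambda>x. f x * cutoff \<kappa> \<epsilon> x) a \<noteq> 0} \<subseteq> horiz -` closure {x. cutoff \<kappa> \<epsilon> x \<noteq> 0}"
  proof (rule closure_minimal)
    show "closed (horiz -` closure {x. cutoff \<kappa> \<epsilon> x \<noteq> 0})"
      by (rule closed_vimage[OF closed_closure]) (intro continuous_intros)
    show "{a. fourier_mode l n (\<lambda>x. f x * cutoff \<kappa> \<epsilon> x) a \<noteq> 0} \<subseteq> horiz -` closure {x. cutoff \<kappa> \<epsilon> x \<noteq> 0}"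
      using closure_subset[of "{x. cutoff \<kappa> \<epsilon> x \<noteq> 0}"] by (auto simp: fourier_mode_eq)
  qed
  also have "\<dots> \<subseteq> {a. horiz a \<in> disc \<kappa>}" using cutoff_support[OF assms(2)] by auto
  finally show ?thesis
    using smooth_fourier_mode[OF smooth_mult[OF f smooth_cutoff[OF assms(2)]]] fourier_mode_periodic[OF assms(3)]
    by (simp add: periodic_test_functions_def)
qed

lemma fourier_mode_diff: "fourier_mode l n f a - fourier_mode l n g a = fourier_mode l n (\<lambda>x. f x - g x) a"
  by (simp add: fourier_mode_def left_diff_distrib)

text \<open>Forming the n-th mode multiplies the squared norm by l, so convergence of coefficients
  on the disc is convergence of modes on the cylinder.\<close>

lemma mode_limit:
  assumes l: "0 < l" and w: "square_integrable (Lcyl \<kappa> l) w"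
    and F: "\<And>j. F j \<in> borel_measurable borel" "\<And>j. square_integrable (Ldisc \<kappa>) (F j)"
    and G: "G \<in> borel_measurable borel" "square_integrable (Ldisc \<kappa>) G"
    and lim: "(\<lambda>j. sqnorm (Ldisc \<kappa>) (\<lambda>x. F j x - G x)) \<longlonglongrightarrow> 0"
  shows "(\<lambda>j. LINT a|Lcyl \<kappa> l. w a * cnj (fourier_mode l n (F j) a)) \<longlonglongrightarrow> (LINT a|Lcyl \<kappa> l. w a * cnj (fourier_mode l n G a))"
proof -
  note fm = square_integrable_fourier_mode_borel[OF l]
  have "sqnorm (Lcyl \<kappa> l) (\<lambda>a. cnj (fourier_mode l n (F j) a) - cnj (fourier_mode l n G a)) = l * sqnorm (Ldisc \<kappa>) (\<lambda>x. F j x - G x)" for j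
  proof -
    have "sqnorm (Lcyl \<kappa> l) (\<lambda>a. cnj (fourier_mode l n (F j) a) - cnj (fourier_mode l n G a)) = sqnorm (Lcyl \<kappa> l) (fourier_mode l n (\<lambda>x. F j x - G x))"
      unfolding sqnorm_def complex_cnj_diff[symmetric] complex_mod_cnj fourier_mode_diff ..
    also have "\<dots> = l * sqnorm (Ldisc \<kappa>) (\<lambda>x. F j x - G x)"
      by (rule sqnorm_fourier_mode_borel[OF l]) (use F G in auto)
    finally show ?thesis .
  qed
  then have "(\<lambda>j. sqnorm (Lcyl \<kappa> l) (\<lambda>a. cnj (fourier_mode l n (F j) a) - cnj (fourier_mode l n G a))) \<longlonglongrightarrow> 0"
    using tendsto_mult_right_zero[OF lim, of l] by simp
  from L2_tendsto_integral_mult[OF square_integrable_cnj[OF fm[OF F]] square_integrable_cnj[OF fm[OF G]] w this]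
  show ?thesis by (simp only: mult.commute)
qed

lemma sqnorm_mult_bounded_le:
  fixes f b :: "'a \<Rightarrow> complex"
  assumes f: "square_integrable M f" and b: "b \<in> borel_measurable M" "\<And>x. x \<in> space M \<Longrightarrow> norm (b x) \<le> B"
  shows "sqnorm M (\<lambda>x. f x * b x) \<le> B\<^sup>2 * sqnorm M f"
proof -
  have "sqnorm M (\<lambda>x. f x * b x) \<le> (LINT x|M. B\<^sup>2 * (norm (f x))\<^sup>2)"
    unfolding sqnorm_def
  proof (rule integral_mono)
    have "square_integrable M (\<lambda>x. f x * b x)"
      by (rule square_integrable_mult_bounded[OF f b(1), of B]) (use b(2) in auto)
    then show "integrable M (\<lambda>x. (norm (f x * b x))\<^sup>2)" by (rule square_integrable_integrable)
    show "integrable M (\<lambda>x. B\<^sup>2 * (norm (f x))\<^sup>2)" by (intro integrable_mult_right square_integrable_integrable f)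
    fix x assume "x \<in> space M"
    then have "norm (f x * b x) \<le> B * norm (f x)"
      using mult_right_mono[OF b(2)[of x] norm_ge_zero[of "f x"]] by (simp add: norm_mult mult.commute)
    from power_mono[OF this norm_ge_zero, of 2] show "(norm (f x * b x))\<^sup>2 \<le> B\<^sup>2 * (norm (f x))\<^sup>2"
      by (simp add: power_mult_distrib)
  qed
  then show ?thesis by (simp add: sqnorm_def)
qed

lemma sqnorm_mult_bounded_tendsto:
  fixes f :: "nat \<Rightarrow> 'a \<Rightarrow> complex"
  assumes f: "\<And>j. square_integrable M (f j)" "square_integrable M g"
    and b: "b \<in> borel_measurable M" "\<And>x. x \<in> space M \<Longrightarrow> norm (b x) \<le> B"
    and lim: "(\<lambda>j. sqnorm M (\<lambda>x. f j x - g x)) \<longlonglongrightarrow> 0"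
  shows "(\<lambda>j. sqnorm M (\<lambda>x. f j x * b x - g x * b x)) \<longlonglongrightarrow> 0"
proof (rule tendsto_sandwich[OF _ _ tendsto_const])
  show "(\<lambda>j. B\<^sup>2 * sqnorm M (\<lambda>x. f j x - g x)) \<longlonglongrightarrow> 0" by (rule tendsto_mult_right_zero[OF lim])
  have "sqnorm M (\<lambda>x. f j x * b x - g x * b x) \<le> B\<^sup>2 * sqnorm M (\<lambda>x. f j x - g x)" for j
    unfolding left_diff_distrib[symmetric] by (rule sqnorm_mult_bounded_le[OF square_integrable_diff[OF f(1) f(2)] b])
  then show "\<forall>\<^sub>F j in sequentially. sqnorm M (\<lambda>x. f j x * b x - g x * b x) \<le> B\<^sup>2 * sqnorm M (\<lambda>x. f j x - g x)" by simp
qed (rule always_eventually, rule allI, rule sqnorm_nonneg)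

text \<open>The order of the limits is essential. With \<eta> fixed the boundary term of
  \<open>Hardy_disc\<close> carries the large factor \<kappa>^2 / \<eta> but vanishes as j grows;
  what remains is the bound K, free of \<eta>, and only then \<eta> tends to 0.\<close>

lemma Hardy_limit:
  assumes \<kappa>: "0 < \<kappa>" and f: "\<And>j. smooth (f j)" and c: "square_integrable (Ldisc \<kappa>) c"
    and lim: "(\<lambda>j. sqnorm (Ldisc \<kappa>) (\<lambda>x. f j x - c x)) \<longlonglongrightarrow> 0"
    and grad: "(\<lambda>j. \<Sum>i\<in>UNIV. sqnorm (Ldisc \<kappa>) (pderivs [i] (f j))) \<longlonglongrightarrow> K"
    and bd: "(\<lambda>j. LINT \<theta>|lborel. indicator {0<..<2 * pi} \<theta> * (norm (f j (circ \<kappa> \<theta>)))\<^sup>2) \<longlonglongrightarrow> 0"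
  shows "square_integrable (Ldisc \<kappa>) (\<lambda>x. c x * complex_of_real (norm x / (\<kappa>\<^sup>2 - (norm x)\<^sup>2)))"
proof -
  let ?b = "\<lambda>\<eta> x. complex_of_real (norm x / (\<kappa>\<^sup>2 - (norm x)\<^sup>2 + \<eta>))"
  have fs: "square_integrable (Ldisc \<kappa>) (f j)" for j
    by (intro square_integrable_smooth bounded_disc open_disc f)
  have bm: "(\<lambda>x::real^2. ?b \<eta> x) \<in> borel_measurable (Ldisc \<kappa>)" for \<eta>
    by (rule borel_measurable_lebesgue_on) measurable
  have bb: "norm (?b \<eta> x) \<le> \<kappa> / \<eta>" if "x \<in> space (Ldisc \<kappa>)" "0 < \<eta>" for \<eta> x
  proof -
    have "norm x \<le> \<kappa>" "0 < \<kappa>\<^sup>2 - (norm x)\<^sup>2"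
      using that disc_subset_cball[of \<kappa>] \<kappa> by (auto simp: norm_disc)
    then have *: "norm x / (\<kappa>\<^sup>2 - (norm x)\<^sup>2 + \<eta>) \<le> \<kappa> / \<eta>" "0 \<le> norm x / (\<kappa>\<^sup>2 - (norm x)\<^sup>2 + \<eta>)"
      using that \<kappa> by (auto intro!: frac_le)
    then show ?thesis unfolding norm_of_real abs_of_nonneg[OF *(2)] by simp
  qed
  have le: "sqnorm (Ldisc \<kappa>) (\<lambda>x. c x * ?b \<eta> x) \<le> K" if \<eta>: "0 < \<eta>" for \<eta>
  proof (rule LIMSEQ_le)
    show "(\<lambda>j. sqnorm (Ldisc \<kappa>) (\<lambda>x. f j x * ?b \<eta> x)) \<longlonglongrightarrow> sqnorm (Ldisc \<kappa>) (\<lambda>x. c x * ?b \<eta> x)"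
    proof (rule L2_tendsto_sqnorm)
      show "(\<lambda>j. sqnorm (Ldisc \<kappa>) (\<lambda>x. f j x * ?b \<eta> x - c x * ?b \<eta> x)) \<longlonglongrightarrow> 0"
        by (rule sqnorm_mult_bounded_tendsto[OF fs c bm bb[OF _ \<eta>] lim])
      show "square_integrable (Ldisc \<kappa>) (\<lambda>x. f j x * ?b \<eta> x)" for j
        by (rule square_integrable_mult_bounded[OF fs bm AE_I2[OF bb[OF _ \<eta>]]])
      show "square_integrable (Ldisc \<kappa>) (\<lambda>x. c x * ?b \<eta> x)"
        by (rule square_integrable_mult_bounded[OF c bm AE_I2[OF bb[OF _ \<eta>]]])
    qed
    show "(\<lambda>j. \<kappa>\<^sup>2 / \<eta> * (LINT \<theta>|lborel. indicator {0<..<2 * pi} \<theta> * (norm (f j (circ \<kappa> \<theta>)))\<^sup>2) + (\<Sum>i\<in>UNIV. sqnorm (Ldisc \<kappa>) (pderivs [i] (f j)))) \<longlonglongrightarrow> K"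
      using tendsto_add[OF tendsto_mult_right_zero[OF bd, of "\<kappa>\<^sup>2 / \<eta>"] grad] by (simp only: add_0)
    have "sqnorm (Ldisc \<kappa>) (\<lambda>x. f j x * ?b \<eta> x) = (LINT x|Ldisc \<kappa>. (norm x)\<^sup>2 * (norm (f j x))\<^sup>2 / (\<kappa>\<^sup>2 - (norm x)\<^sup>2 + \<eta>)\<^sup>2)" for j
      unfolding sqnorm_def norm_mult norm_of_real power_mult_distrib power2_abs power_divide
      by (intro Bochner_Integration.integral_cong refl) simp
    then show "\<exists>N. \<forall>j\<ge>N. sqnorm (Ldisc \<kappa>) (\<lambda>x. f j x * ?b \<eta> x) \<le> \<kappa>\<^sup>2 / \<eta> * (LINT \<theta>|lborel. indicator {0<..<2 * pi} \<theta> * (norm (f j (circ \<kappa> \<theta>)))\<^sup>2) + (\<Sum>i\<in>UNIV. sqnorm (Ldisc \<kappa>) (pderivs [i] (f j)))"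
      using Hardy_disc[OF \<kappa> \<eta> f] by (simp only:) blast
  qed
  \<comment> \<open>For \<eta> = 0 the weight is unbounded and no dominating function is at hand;
    Fatou's lemma along \<eta> = 1/(m+1) does the passage.\<close>
  let ?h = "\<lambda>x. c x * complex_of_real (norm x / (\<kappa>\<^sup>2 - (norm x)\<^sup>2))"
  have hm: "?h \<in> borel_measurable (Ldisc \<kappa>)"
    using c bm[of 0] by (intro borel_measurable_times) auto
  have "(\<integral>\<^sup>+x. ennreal ((norm (?h x))\<^sup>2) \<partial>Ldisc \<kappa>) = (\<integral>\<^sup>+x. liminf (\<lambda>m. ennreal ((norm (c x * ?b (1 / real (Suc m)) x))\<^sup>2)) \<partial>Ldisc \<kappa>)"
  proof (rule nn_integral_cong)
    fix x assume "x \<in> space (Ldisc \<kappa>)"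
    then have d: "0 < \<kappa>\<^sup>2 - (norm x)\<^sup>2" by (simp add: norm_disc)
    have t: "(\<lambda>m. 1 / real (Suc m)) \<longlonglongrightarrow> 0" using LIMSEQ_inverse_real_of_nat by (simp add: inverse_eq_divide)
    have "(\<lambda>m. ennreal ((norm (c x * ?b (1 / real (Suc m)) x))\<^sup>2)) \<longlonglongrightarrow> ennreal ((norm (c x * ?b 0 x))\<^sup>2)"
      by (intro tendsto_intros t) (use d in auto)
    from lim_imp_Liminf[OF trivial_limit_sequentially this]
    show "ennreal ((norm (?h x))\<^sup>2) = liminf (\<lambda>m. ennreal ((norm (c x * ?b (1 / real (Suc m)) x))\<^sup>2))" by simp
  qed
  also have "\<dots> \<le> liminf (\<lambda>m. \<integral>\<^sup>+x. ennreal ((norm (c x * ?b (1 / real (Suc m)) x))\<^sup>2) \<partial>Ldisc \<kappa>)"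
  proof (rule nn_integral_liminf)
    have "(\<lambda>x. c x * ?b \<eta> x) \<in> borel_measurable (Ldisc \<kappa>)" for \<eta>
      by (intro borel_measurable_times bm square_integrable_measurable[OF c])
    then show "(\<lambda>x. ennreal ((norm (c x * ?b (1 / real (Suc m)) x))\<^sup>2)) \<in> borel_measurable (Ldisc \<kappa>)" for m
      by measurable
  qed
  also have "\<dots> \<le> liminf (\<lambda>m. ennreal K)"
  proof (rule Liminf_mono, rule always_eventually, rule allI)
    fix m
    have si: "square_integrable (Ldisc \<kappa>) (\<lambda>x. c x * ?b (1 / real (Suc m)) x)"
      by (rule square_integrable_mult_bounded[OF c bm AE_I2[OF bb]]) auto
    have "(\<integral>\<^sup>+x. ennreal ((norm (c x * ?b (1 / real (Suc m)) x))\<^sup>2) \<partial>Ldisc \<kappa>) = ennreal (sqnorm (Ldisc \<kappa>) (\<lambda>x. c x * ?b (1 / real (Suc m)) x))"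
      unfolding sqnorm_def by (rule nn_integral_eq_integral[OF square_integrable_integrable[OF si]]) simp
    also have "\<dots> \<le> ennreal K" by (intro ennreal_leI le) simp
    finally show "(\<integral>\<^sup>+x. ennreal ((norm (c x * ?b (1 / real (Suc m)) x))\<^sup>2) \<partial>Ldisc \<kappa>) \<le> ennreal K" .
  qed
  also have "\<dots> < \<infinity>" by (simp add: Liminf_const)
  finally have fin: "(\<integral>\<^sup>+x. ennreal ((norm (?h x))\<^sup>2) \<partial>Ldisc \<kappa>) < \<infinity>" .
  have "integrable (Ldisc \<kappa>) (\<lambda>x. (norm (?h x))\<^sup>2)"
  proof (rule integrableI_bounded)
    show "(\<lambda>x. (norm (?h x))\<^sup>2) \<in> borel_measurable (Ldisc \<kappa>)"
      by (intro borel_measurable_power measurable_compose[OF hm borel_measurable_norm])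
  qed (use fin in simp)
  then show ?thesis using hm by (simp add: square_integrable_def)
qed

section \<open>Integrals over the lateral surface and Poincare on the cylinder\<close>

lemma SF_param_eq: "SF_param \<kappa> z = join (circ \<kappa> (fst z), snd z)"
  by (cases z) (simp add: SF_param_def vec_eq_iff forall_3)

text \<open>As h is nonnegative, the computation is done with the nonnegative integral and carried
  over by \<open>enn2real\<close>, so that integrability never has to be discussed.\<close>

lemma SF_integral:
  fixes h :: "real^3 \<Rightarrow> real"
  assumes \<kappa>: "0 < \<kappa>" and h: "h \<in> borel_measurable borel" "\<And>a. 0 \<le> h a"
  shows "(LINT a|SF_measure \<kappa> l. h a) = \<kappa> * (LINT z|(lborel \<Otimes>\<^sub>M lborel). indicator ({0..<2 * pi} \<times> {0..l}) z * h (join (circ \<kappa> (fst z), snd z)))"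
proof -
  let ?R = "{0..<2 * pi} \<times> {0..l}"
  have R: "?R \<in> sets borel" by (intro borel_Times) auto
  have "continuous_on UNIV (\<lambda>z::real \<times> real. join (circ \<kappa> (fst z), snd z))"
    unfolding circ_eq by (intro continuous_intros)
  then have Sm: "SF_param \<kappa> \<in> borel_measurable borel"
    using borel_measurable_continuous_onI by (simp add: SF_param_eq[abs_def])
  have hS: "(\<lambda>z. h (SF_param \<kappa> z)) \<in> borel_measurable borel" by (rule measurable_compose[OF Sm h(1)])
  have Sm': "SF_param \<kappa> \<in> borel_measurable (restrict_space lborel ?R)"
    by (rule measurable_restrict_space1) (use Sm in simp)
  have hm': "h \<in> borel_measurable (SF_measure \<kappa> l)"
    unfolding SF_measure_def using h(1) by (simp cong: measurable_cong_sets)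
  have "(\<integral>\<^sup>+a. ennreal (h a) \<partial>SF_measure \<kappa> l) = ennreal \<kappa> * (\<integral>\<^sup>+z. ennreal (h (SF_param \<kappa> z)) \<partial>restrict_space lborel ?R)"
    unfolding SF_measure_def using h(1) Sm' by (subst nn_integral_scale_measure, simp) (subst nn_integral_distr, simp_all)
  also have "(\<integral>\<^sup>+z. ennreal (h (SF_param \<kappa> z)) \<partial>restrict_space lborel ?R) = (\<integral>\<^sup>+z. ennreal (h (SF_param \<kappa> z)) * indicator ?R z \<partial>lborel)"
    using R by (subst nn_integral_restrict_space) simp_all
  also have "\<dots> = (\<integral>\<^sup>+z. ennreal (indicator ?R z * h (SF_param \<kappa> z)) \<partial>lborel)"
    by (intro nn_integral_cong) (simp split: split_indicator)
  finally have eq: "(\<integral>\<^sup>+a. ennreal (h a) \<partial>SF_measure \<kappa> l) = ennreal \<kappa> * (\<integral>\<^sup>+z. ennreal (indicator ?R z * h (SF_param \<kappa> z)) \<partial>lborel)" .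
  have "(LINT a|SF_measure \<kappa> l. h a) = enn2real (\<integral>\<^sup>+a. ennreal (h a) \<partial>SF_measure \<kappa> l)"
    by (rule integral_eq_nn_integral[OF hm']) (use h(2) in simp)
  also have "\<dots> = \<kappa> * enn2real (\<integral>\<^sup>+z. ennreal (indicator ?R z * h (SF_param \<kappa> z)) \<partial>lborel)"
    unfolding eq enn2real_mult using \<kappa> by simp
  also have "enn2real (\<integral>\<^sup>+z. ennreal (indicator ?R z * h (SF_param \<kappa> z)) \<partial>lborel) = (LINT z|lborel. indicator ?R z * h (SF_param \<kappa> z))"
    by (rule integral_eq_nn_integral[symmetric]) (use hS R h(2) in \<open>auto\<close>)
  finally show ?thesis by (simp only: SF_param_eq lborel_prod)
qed

text \<open>One term of Bessel's inequality on each vertical line of the lateral surface, integrated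
  over the angle; \<kappa> is the area element. It carries smallness of the boundary values of
  \<phi> over to each coefficient on the circle.\<close>

lemma circle_coef_le:
  assumes \<kappa>: "0 < \<kappa>" and l: "0 < l" and \<phi>: "smooth \<phi>"
  shows "(LINT \<theta>|lborel. indicator {0<..<2 * pi} \<theta> * (norm (coef l n \<phi> (circ \<kappa> \<theta>)))\<^sup>2) \<le> (LINT a|SF_measure \<kappa> l. (norm (\<phi> a))\<^sup>2) / (l * \<kappa>)"
proof -
  let ?R = "{0..<2 * pi} \<times> {0..l}"
  let ?H = "\<lambda>z. indicator ?R z * (norm (\<phi> (join (circ \<kappa> (fst z), snd z))))\<^sup>2"
  have Pc: "continuous_on T (\<lambda>z::real \<times> real. join (circ \<kappa> (fst z), snd z))" for T
    unfolding circ_eq by (intro continuous_intros)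
  have Hc: "continuous_on T (\<lambda>z. (norm (\<phi> (join (circ \<kappa> (fst z), snd z))))\<^sup>2)" for T
    by (intro continuous_on_power continuous_on_norm continuous_on_compose2[OF smooth_continuous_on[OF \<phi>, of UNIV] Pc]) auto
  have R: "?R \<in> sets borel" by (intro borel_Times) auto
  have Hm: "?H \<in> borel_measurable borel"
    using R borel_measurable_continuous_onI[OF Hc] by measurable
  have "compact ((\<lambda>z. (norm (\<phi> (join (circ \<kappa> (fst z), snd z))))\<^sup>2) ` ({0..2 * pi} \<times> {0..l}))"
    by (intro compact_continuous_image Hc compact_Times) auto
  then obtain B where "\<forall>y\<in>(\<lambda>z. (norm (\<phi> (join (circ \<kappa> (fst z), snd z))))\<^sup>2) ` ({0..2 * pi} \<times> {0..l}). norm y \<le> B"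
    using compact_imp_bounded bounded_iff by blast
  then have B: "(norm (\<phi> (join (circ \<kappa> \<theta>, s))))\<^sup>2 \<le> B" if "\<theta> \<in> {0..2 * pi}" "s \<in> {0..l}" for \<theta> s
    using that by fastforce
  have Hi: "integrable (lborel \<Otimes>\<^sub>M lborel) ?H"
    unfolding lborel_prod
  proof (rule Bochner_Integration.integrable_bound)
    have "bounded ?R" by (rule bounded_subset[of "{0..2 * pi} \<times> {0..l}"]) (auto intro: bounded_Times)
    then show "integrable lborel (\<lambda>z. B * indicator ?R z :: real)"
      using R by (intro integrable_mult_right integrable_real_indicator)
        (auto intro: emeasure_bounded_finite[unfolded infinity_ennreal_def])
    show "AE z in lborel. norm (?H z) \<le> norm (B * indicator ?R z)"
    proof (rule AE_I2)
      fix z :: "real \<times> real"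
      show "norm (?H z) \<le> norm (B * indicator ?R z)"
        using B[of "fst z" "snd z"] by (cases z) (auto split: split_indicator)
    qed
  qed (use Hm in simp)
  have sm: "smooth (coef l n \<phi>)" by (rule smooth_coef[OF l \<phi>])
  have cc: "continuous_on T (\<lambda>\<theta>. (norm (coef l n \<phi> (circ \<kappa> \<theta>)))\<^sup>2)" for T
    by (intro continuous_on_power continuous_on_norm continuous_on_compose2[OF smooth_continuous_on[OF sm, of UNIV]])
      (auto simp: circ_eq intro!: continuous_intros)
  have "(LINT \<theta>|lborel. indicator {0<..<2 * pi} \<theta> * (norm (coef l n \<phi> (circ \<kappa> \<theta>)))\<^sup>2) \<le> (LINT \<theta>|lborel. (LINT s|lborel. ?H (\<theta>, s)) / l)"
  proof (rule integral_mono)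
    show "integrable lborel (\<lambda>\<theta>. (LINT s|lborel. ?H (\<theta>, s)) / l)"
      using lborel_pair.integrable_fst'[OF Hi] by (rule integrable_divide)
    have "compact ((\<lambda>\<theta>. (norm (coef l n \<phi> (circ \<kappa> \<theta>)))\<^sup>2) ` {0..2 * pi})"
      by (intro compact_continuous_image cc) auto
    then obtain C where "\<forall>y\<in>(\<lambda>\<theta>. (norm (coef l n \<phi> (circ \<kappa> \<theta>)))\<^sup>2) ` {0..2 * pi}. norm y \<le> C"
      using compact_imp_bounded bounded_iff by blast
    then have C: "(norm (coef l n \<phi> (circ \<kappa> \<theta>)))\<^sup>2 \<le> C" if "\<theta> \<in> {0..2 * pi}" for \<theta>
      using that by fastforce
    show "integrable lborel (\<lambda>\<theta>. indicator {0<..<2 * pi} \<theta> * (norm (coef l n \<phi> (circ \<kappa> \<theta>)))\<^sup>2)"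
    proof (rule integrable_bounded_interval[of _ "max C 0" "2 * pi"])
      show "(\<lambda>\<theta>. indicator {0<..<2 * pi} \<theta> * (norm (coef l n \<phi> (circ \<kappa> \<theta>)))\<^sup>2) \<in> borel_measurable borel"
        using borel_measurable_continuous_onI[OF cc] by measurable
      show "norm (indicator {0<..<2 * pi} \<theta> * (norm (coef l n \<phi> (circ \<kappa> \<theta>)))\<^sup>2) \<le> max C 0" for \<theta>
        using C[of \<theta>] by (auto simp: le_max_iff_disj split: split_indicator)
    qed simp
    fix \<theta>
    show "indicator {0<..<2 * pi} \<theta> * (norm (coef l n \<phi> (circ \<kappa> \<theta>)))\<^sup>2 \<le> (LINT s|lborel. ?H (\<theta>, s)) / l"
    proof (cases "\<theta> \<in> {0<..<2 * pi}")
      case True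
      define g where "g s = indicator {0<..<l} s * \<phi> (join (circ \<kappa> \<theta>, s))" for s
      have gm: "g \<in> borel_measurable borel"
        unfolding g_def[abs_def] using borel_measurable_continuous_onI[OF continuous_section[OF \<phi>]] by measurable
      have gb: "(norm (g s))\<^sup>2 \<le> ?H (\<theta>, s)" for s
        using True by (auto simp: g_def split: split_indicator)
      have gi: "integrable lborel (\<lambda>s. (norm (g s))\<^sup>2)"
      proof (rule integrable_bounded_interval[of _ "max B 0" l])
        show "(\<lambda>s. (norm (g s))\<^sup>2) \<in> borel_measurable borel" using gm by measurable
      qed (use B[of \<theta>] True in \<open>auto simp: g_def le_max_iff_disj split: split_indicator\<close>)
      have gs: "square_integrable lborel g" using gm gi by (simp add: square_integrable_def)
      have "fcoeff l n g = coef l n \<phi> (circ \<kappa> \<theta>)"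
        unfolding fcoeff_def coef_def g_def
        by (intro arg_cong2[where f = "(/)"] Bochner_Integration.integral_cong refl) (simp add: harmonic_def split: split_indicator)
      then have "l * (norm (coef l n \<phi> (circ \<kappa> \<theta>)))\<^sup>2 \<le> (\<Sum>n\<in>{- int (nat \<bar>n\<bar>)..int (nat \<bar>n\<bar>)}. l * (norm (fcoeff l n g))\<^sup>2)"
      proof -
        have "n \<in> {- int (nat \<bar>n\<bar>)..int (nat \<bar>n\<bar>)}" by auto
        from member_le_sum[OF this, of "\<lambda>n. l * (norm (fcoeff l n g))\<^sup>2"] l \<open>fcoeff l n g = coef l n \<phi> (circ \<kappa> \<theta>)\<close>
        show ?thesis by simp
      qed
      also have "\<dots> \<le> sqnorm lborel g" by (rule Bessel[OF gs l])
      also have "\<dots> \<le> (LINT s|lborel. ?H (\<theta>, s))"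
        unfolding sqnorm_def
      proof (rule integral_mono[OF gi _ gb])
        have sm: "(\<lambda>s. ?H (\<theta>, s)) \<in> borel_measurable borel"
          by (rule measurable_compose[OF _ Hm]) (intro borel_measurable_continuous_onI continuous_intros)
        show "integrable lborel (\<lambda>s. ?H (\<theta>, s))"
        proof (rule Bochner_Integration.integrable_bound)
          show "integrable lborel (\<lambda>s. B * indicator {0..l} s :: real)"
            using l by (intro integrable_mult_right integrable_real_indicator) auto
          show "AE s in lborel. norm (?H (\<theta>, s)) \<le> norm (B * indicator {0..l} s)"
          proof (rule AE_I2)
            fix s
            show "norm (?H (\<theta>, s)) \<le> norm (B * indicator {0..l} s)"
              using B[of \<theta> s] True by (auto split: split_indicator)
          qed
        qed (use sm in simp)
      qed
      finally show ?thesis using True l by (simp add: pos_le_divide_eq mult.commute)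
    next
      case False
      have "0 \<le> (LINT s|lborel. ?H (\<theta>, s))" by (rule Bochner_Integration.integral_nonneg) simp
      then show ?thesis using False l by simp
    qed
  qed
  also have "\<dots> = (LINT z|(lborel \<Otimes>\<^sub>M lborel). ?H z) / l"
    using lborel_pair.integral_fst'[OF Hi] by simp
  also have "\<dots> = (LINT a|SF_measure \<kappa> l. (norm (\<phi> a))\<^sup>2) / (l * \<kappa>)"
    using \<kappa> by (subst SF_integral[OF \<kappa>]) (use \<phi> in \<open>simp_all add: field_simps\<close>)
  finally show ?thesis .
qed

text \<open>\<open>Poincare_disc\<close> for every coefficient, which vanishes on the circle
  together with \<phi> and commutes with horizontal derivatives. Summation over the modes uses
  Parseval on the left and Bessel on the right.\<close>

lemma Poincare_cyl:
  assumes \<kappa>: "0 < \<kappa>" and l: "0 < l" and \<phi>: "smooth \<phi>" and zero: "\<And>a. norm (horiz a) = \<kappa> \<Longrightarrow> \<phi> a = 0"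
  shows "sqnorm (Lcyl \<kappa> l) \<phi> \<le> \<kappa>\<^sup>2 * (\<Sum>i\<in>UNIV. sqnorm (Lcyl \<kappa> l) (pderivs [emb i] \<phi>))"
proof -
  note si = square_integrable_smooth[OF bounded_cyl open_cyl]
  have b: "\<phi> \<in> borel_measurable borel" "pderivs [k] \<phi> \<in> borel_measurable borel" for k
    using \<phi> smooth_pderiv[OF \<phi>] by auto
  let ?S = "\<lambda>N a. \<Sum>n\<in>{- int N..int N}. fourier_mode l n (coef l n \<phi>) a"
  have cs: "coef l n \<phi> \<in> borel_measurable borel" "square_integrable (Ldisc \<kappa>) (coef l n \<phi>)" for n
    using coef_measurable[OF b(1)] square_integrable_coef[OF l b(1) si[OF \<phi>]] by auto
  have Sm: "?S N \<in> borel_measurable borel" for N using cs(1) by measurable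
  have Ss: "square_integrable (Lcyl \<kappa> l) (?S N)" for N
    by (intro square_integrable_sum square_integrable_fourier_mode_borel l cs)
  \<comment> \<open>Parseval for a partial sum: the harmonics are orthogonal on each fibre.\<close>
  have Sn: "sqnorm (Lcyl \<kappa> l) (?S N) = (\<Sum>n\<in>{- int N..int N}. l * sqnorm (Ldisc \<kappa>) (coef l n \<phi>))" for N
  proof -
    let ?c = "\<lambda>n x. indicator (disc \<kappa>) x *\<^sub>R coef l n \<phi> x"
    have c': "square_integrable lborel (?c n)" for n
      using cs square_integrable_lebesgue_on[OF disc_borel] by blast
    have "sqnorm (Lcyl \<kappa> l) (?S N) = sqnorm (lborel \<Otimes>\<^sub>M lborel) (\<lambda>z. trig_sum l N (\<lambda>n. ?c n (fst z)) (snd z))"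
      unfolding sqnorm_lift[OF Sm] lift_fourier_sum[abs_def] ..
    also have "\<dots> = (LINT x|lborel. sqnorm lborel (trig_sum l N (\<lambda>n. ?c n x)))"
      by (subst sqnorm_pair[OF sigma_finite_lborel l square_integrable_pair_trig_sum[OF sigma_finite_lborel l c']]) simp
    also have "\<dots> = (\<Sum>n\<in>{- int N..int N}. l * sqnorm lborel (?c n))"
      unfolding sqnorm_trig_sum[OF l] unfolding sqnorm_def
      by (subst Bochner_Integration.integral_sum) (intro integrable_mult_right square_integrable_integrable c', simp)
    finally show ?thesis by (simp only: sqnorm_lebesgue_on[OF disc_borel cs(1)])
  qed
  have lim: "(\<lambda>N. sqnorm (Lcyl \<kappa> l) (?S N)) \<longlonglongrightarrow> sqnorm (Lcyl \<kappa> l) \<phi>"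
    by (rule L2_tendsto_sqnorm[OF Ss si[OF \<phi>]])
      (use fourier_cyl_convergence[OF l b(1) si[OF \<phi>]] in \<open>simp only: sqnorm_minus_commute[of _ "?S _"]\<close>)
  have z: "coef l n \<phi> x = 0" if "norm x = \<kappa>" for n x
    using zero that by (simp add: coef_def fcoeff_def)
  have "sqnorm (Lcyl \<kappa> l) (?S N) \<le> \<kappa>\<^sup>2 * (\<Sum>i\<in>UNIV. sqnorm (Lcyl \<kappa> l) (pderivs [emb i] \<phi>))" for N
  proof -
    have "sqnorm (Lcyl \<kappa> l) (?S N) \<le> (\<Sum>n\<in>{- int N..int N}. l * (\<kappa>\<^sup>2 * (\<Sum>i\<in>UNIV. sqnorm (Ldisc \<kappa>) (coef l n (pderivs [emb i] \<phi>)))))"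
      unfolding Sn
    proof (intro sum_mono mult_left_mono)
      fix n
      show "sqnorm (Ldisc \<kappa>) (coef l n \<phi>) \<le> \<kappa>\<^sup>2 * (\<Sum>i\<in>UNIV. sqnorm (Ldisc \<kappa>) (coef l n (pderivs [emb i] \<phi>)))"
        using Poincare_disc[OF \<kappa> smooth_coef[OF l \<phi>] z] by (simp only: pderiv_coef[OF l \<phi>])
    qed (use l in simp)
    also have "\<dots> = \<kappa>\<^sup>2 * (\<Sum>i\<in>UNIV. \<Sum>n\<in>{- int N..int N}. l * sqnorm (Ldisc \<kappa>) (coef l n (pderivs [emb i] \<phi>)))"
      unfolding sum_distrib_left by (subst sum.swap) (simp only: mult.left_commute)
    also have "\<dots> \<le> \<kappa>\<^sup>2 * (\<Sum>i\<in>UNIV. sqnorm (Lcyl \<kappa> l) (pderivs [emb i] \<phi>))"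
      by (intro mult_left_mono sum_mono Bessel_cyl l b si smooth_pderiv \<phi>) simp
    finally show ?thesis .
  qed
  then show ?thesis by (intro LIMSEQ_le_const2[OF lim]) blast
qed

lemma sqnorm_add_tendsto:
  assumes "\<And>j. square_integrable M (f j)" "\<And>j. square_integrable M (g j)"
    and "(\<lambda>j. sqnorm M (f j)) \<longlonglongrightarrow> 0" "(\<lambda>j. sqnorm M (g j)) \<longlonglongrightarrow> 0"
  shows "(\<lambda>j. sqnorm M (\<lambda>x. f j x + g j x)) \<longlonglongrightarrow> 0"
proof (rule tendsto_sandwich[OF _ _ tendsto_const])
  show "(\<lambda>j. 2 * sqnorm M (f j) + 2 * sqnorm M (g j)) \<longlonglongrightarrow> 0"
    using tendsto_add[OF tendsto_mult_right_zero[OF assms(3), of 2] tendsto_mult_right_zero[OF assms(4), of 2]] by simp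
  show "\<forall>\<^sub>F j in sequentially. sqnorm M (\<lambda>x. f j x + g j x) \<le> 2 * sqnorm M (f j) + 2 * sqnorm M (g j)"
    by (intro always_eventually allI sqnorm_add_le assms)
qed (rule always_eventually, rule allI, rule sqnorm_nonneg)

lemma sqnorm_dominated_tendsto:
  fixes h :: "nat \<Rightarrow> 'a \<Rightarrow> complex" and w :: "'a \<Rightarrow> complex"
  assumes h: "\<And>m. h m \<in> borel_measurable M" and w: "square_integrable M w"
    and le: "\<And>m x. x \<in> space M \<Longrightarrow> norm (h m x) \<le> norm (w x)"
    and lim: "\<And>x. x \<in> space M \<Longrightarrow> (\<lambda>m. h m x) \<longlonglongrightarrow> 0"
  shows "(\<lambda>m. sqnorm M (h m)) \<longlonglongrightarrow> 0" and "square_integrable M (h m)"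
proof -
  have "(\<lambda>m. LINT x|M. (norm (h m x))\<^sup>2) \<longlonglongrightarrow> (LINT x|M. 0)"
  proof (rule integral_dominated_convergence[where w = "\<lambda>x. (norm (w x))\<^sup>2"])
    show "integrable M (\<lambda>x. (norm (w x))\<^sup>2)" by (rule square_integrable_integrable[OF w])
    show "(\<lambda>x. (norm (h m x))\<^sup>2) \<in> borel_measurable M" for m
      by (intro borel_measurable_power measurable_compose[OF h borel_measurable_norm])
    show "AE x in M. (\<lambda>m. (norm (h m x))\<^sup>2) \<longlonglongrightarrow> 0"
    proof (rule AE_I2)
      fix x assume "x \<in> space M"
      from tendsto_power[OF tendsto_norm_zero[OF lim[OF this]], of 2]
      show "(\<lambda>m. (norm (h m x))\<^sup>2) \<longlonglongrightarrow> 0" by simp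
    qed
    show "AE x in M. norm ((norm (h m x))\<^sup>2) \<le> (norm (w x))\<^sup>2" for m
      by (rule AE_I2) (simp add: le power_mono)
  qed simp
  then show "(\<lambda>m. sqnorm M (h m)) \<longlonglongrightarrow> 0" by (simp add: sqnorm_def)
  show "square_integrable M (h m)"
    by (rule square_integrable_bound[OF w h, where C = 1]) (use le in auto)
qed

text \<open>The mode-\<open>n\<close> part of the gradient of a function with Fourier coefficient \<open>c\<close> annihilates
  solenoidal fields when \<open>c\<close> has trace \<open>0\<close>: cut off near the circle, where Hardy's inequality bounds the
  error term \<open>c \<nabla>\<chi>\<close>.\<close>

lemma mode_orthogonality:
  assumes \<kappa>: "0 < \<kappa>" and l: "0 < l"
    and u: "\<And>k. square_integrable (Lcyl \<kappa> l) (\<lambda>a. u a $ k)" "divergence_free \<kappa> l u"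
    and f: "\<And>j. smooth (f j)"
    and c: "c \<in> borel_measurable borel" "square_integrable (Ldisc \<kappa>) c"
    and d: "\<And>i. d i \<in> borel_measurable borel" "\<And>i. square_integrable (Ldisc \<kappa>) (d i)"
    and fc: "(\<lambda>j. sqnorm (Ldisc \<kappa>) (\<lambda>x. f j x - c x)) \<longlonglongrightarrow> 0"
    and fd: "\<And>i. (\<lambda>j. sqnorm (Ldisc \<kappa>) (\<lambda>x. pderivs [i] (f j) x - d i x)) \<longlonglongrightarrow> 0"
    and bd: "(\<lambda>j. LINT \<theta>|lborel. indicator {0<..<2 * pi} \<theta> * (norm (f j (circ \<kappa> \<theta>)))\<^sup>2) \<longlonglongrightarrow> 0"
  shows "(\<Sum>i\<in>UNIV. LINT a|Lcyl \<kappa> l. u a $ emb i * cnj (fourier_mode l n (d i) a))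
     + (LINT a|Lcyl \<kappa> l. u a $ 3 * cnj (fourier_mode l n (\<lambda>x. mode_factor l n * c x) a)) = 0"
proof -
  let ?T = "\<lambda>k F. LINT a|Lcyl \<kappa> l. u a $ k * cnj (fourier_mode l n F a)"
  let ?m = "mode_factor l n"
  have sD: "square_integrable (Ldisc \<kappa>) g" "g \<in> borel_measurable borel" if "smooth g" for g
    using square_integrable_smooth[OF bounded_disc open_disc that] smooth_borel[OF that] by auto
  \<comment> \<open>For a smooth, cut off coefficient the conjugated mode is a periodic test
    function, and the identity is \<open>divergence_free\<close> itself.\<close>
  have A: "(\<Sum>i\<in>UNIV. ?T (emb i) (pderivs [i] g)) + ?T 3 (\<lambda>x. ?m * g x) = 0"
    if g: "g = (\<lambda>x. h x * cutoff \<kappa> \<epsilon> x)" "smooth h" "0 < \<epsilon>" for g h \<epsilon>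
  proof -
    have gs: "smooth g" unfolding g(1) by (intro smooth_mult g smooth_cutoff)
    let ?\<Phi> = "\<lambda>a. cnj (fourier_mode l n g a)"
    have \<Phi>: "?\<Phi> \<in> periodic_test_functions \<kappa> l"
      unfolding g(1) by (intro cnj_periodic_test_function cutoff_mode_test_function g) (use l in simp)
    have pd: "pderivs [k] ?\<Phi> a = cnj (fourier_mode l n (mode_grad l n g k) a)" for k a
      unfolding pderiv_cnj[OF smooth_differentiable[OF smooth_fourier_mode[OF gs]]] pderiv_fourier_mode[OF gs] ..
    have mgs: "smooth (mode_grad l n g k)" for k
      using gs by (auto simp: mode_grad_def simp del: pderivs.simps intro: smooth_pderiv)
    have int: "integrable (Lcyl \<kappa> l) (\<lambda>a. u a $ k * cnj (fourier_mode l n (mode_grad l n g k) a))" for k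
      by (intro integrable_mult_complex u square_integrable_cnj square_integrable_fourier_mode_borel l sD mgs)
    have "(LINT a|Lcyl \<kappa> l. (\<Sum>k\<in>UNIV. u a $ k * pderivs [k] ?\<Phi> a)) = 0"
      using u(2) \<Phi> unfolding divergence_free_def by blast
    then have "(LINT a|Lcyl \<kappa> l. (\<Sum>k\<in>UNIV. u a $ k * cnj (fourier_mode l n (mode_grad l n g k) a))) = 0"
      by (simp only: pd)
    then have "(\<Sum>k\<in>UNIV. ?T k (mode_grad l n g k)) = 0"
      by (subst (asm) Bochner_Integration.integral_sum[OF int])
    then show ?thesis
      using mode_grad_simps(1)[of l n g 1] mode_grad_simps(1)[of l n g 2] mode_grad_simps(2)[of l n g]
      by (simp add: sum_3 sum_2 del: pderivs.simps)
  qed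
  \<comment> \<open>The product rule for c times the cutoff, with d in the place of the derivatives
    of c; \<open>H3\<close> is its vertical counterpart.\<close>
  define H where "H \<epsilon> i x = c x * pderivs [i] (cutoff \<kappa> \<epsilon>) x + d i x * cutoff \<kappa> \<epsilon> x" for \<epsilon> i x
  define H3 where "H3 \<epsilon> x = ?m * (c x * cutoff \<kappa> \<epsilon> x)" for \<epsilon> x
  have chi: "cutoff \<kappa> \<epsilon> \<in> borel_measurable borel" "pderivs [i] (cutoff \<kappa> \<epsilon>) \<in> borel_measurable borel" if "0 < \<epsilon>" for \<epsilon> i
    using sD(2) smooth_cutoff[OF that] smooth_pderiv by blast+
  note chiL = chi[THEN borel_measurable_lebesgue_on]
  have chib: "\<exists>B. \<forall>x. norm (pderivs [i] (cutoff \<kappa> \<epsilon>) x) \<le> B" if "0 < \<epsilon>" for \<epsilon> i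
  proof -
    have "bounded {x. cutoff \<kappa> \<epsilon> x \<noteq> 0}"
      by (rule bounded_subset[OF bounded_disc order_trans[OF closure_subset cutoff_support[OF that]]])
    from bounded_if_bounded_support[OF smooth_pderiv[OF smooth_cutoff[OF that]] bounded_pderiv_support[OF this]]
    show ?thesis by metis
  qed
  \<comment> \<open>First limit, in j with \<epsilon> fixed: the cutoff and its derivatives are
    bounded, so convergence of f j and of its derivatives suffices.\<close>
  have B: "(\<Sum>i\<in>UNIV. ?T (emb i) (H \<epsilon> i)) + ?T 3 (H3 \<epsilon>) = 0" if \<epsilon>: "0 < \<epsilon>" for \<epsilon>
  proof -
    note chi' = chi[OF \<epsilon>] and chiL' = chiL[OF \<epsilon>]
    let ?g = "\<lambda>j x. f j x * cutoff \<kappa> \<epsilon> x"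
    have gs: "smooth (?g j)" for j by (intro smooth_mult f smooth_cutoff \<epsilon>)
    have pdg: "pderivs [i] (?g j) x = f j x * pderivs [i] (cutoff \<kappa> \<epsilon>) x + pderivs [i] (f j) x * cutoff \<kappa> \<epsilon> x" for i j x
      by (rule pderiv_mult[OF smooth_differentiable[OF f] smooth_differentiable[OF smooth_cutoff[OF \<epsilon>]]])
    have c1: "(\<lambda>j. sqnorm (Ldisc \<kappa>) (\<lambda>x. f j x * cutoff \<kappa> \<epsilon> x - c x * cutoff \<kappa> \<epsilon> x)) \<longlonglongrightarrow> 0"
      by (rule sqnorm_mult_bounded_tendsto[OF sD(1)[OF f] c(2) chiL'(1) norm_cutoff_le[OF \<epsilon>] fc])
    have s1: "square_integrable (Ldisc \<kappa>) (\<lambda>x. c x * cutoff \<kappa> \<epsilon> x)"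
      by (rule square_integrable_mult_bounded[OF c(2) chiL'(1) AE_I2[OF norm_cutoff_le[OF \<epsilon>]]])
    have m3: "H3 \<epsilon> \<in> borel_measurable borel" unfolding H3_def[abs_def] using c(1) chi' by measurable
    have mi: "H \<epsilon> i \<in> borel_measurable borel" for i
      unfolding H_def[abs_def] using c(1) d(1)[of i] chi'(1) chi'(2)[of i] by measurable
    have "(\<lambda>j. ?T 3 (\<lambda>x. ?m * ?g j x)) \<longlonglongrightarrow> ?T 3 (H3 \<epsilon>)"
    proof (rule mode_limit[OF l u(1)])
      show "(\<lambda>x. ?m * ?g j x) \<in> borel_measurable borel" "square_integrable (Ldisc \<kappa>) (\<lambda>x. ?m * ?g j x)" for j
        using sD[OF smooth_mult[OF smooth_const gs[of j]], of ?m] by auto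
      show "H3 \<epsilon> \<in> borel_measurable borel" by (rule m3)
      show "square_integrable (Ldisc \<kappa>) (H3 \<epsilon>)" unfolding H3_def[abs_def] by (intro square_integrable_cmult s1)
      have "sqnorm (Ldisc \<kappa>) (\<lambda>x. ?m * ?g j x - H3 \<epsilon> x) = (norm ?m)\<^sup>2 * sqnorm (Ldisc \<kappa>) (\<lambda>x. f j x * cutoff \<kappa> \<epsilon> x - c x * cutoff \<kappa> \<epsilon> x)" for j
        unfolding H3_def right_diff_distrib[symmetric] by (rule sqnorm_cmult)
      then show "(\<lambda>j. sqnorm (Ldisc \<kappa>) (\<lambda>x. ?m * ?g j x - H3 \<epsilon> x)) \<longlonglongrightarrow> 0"
        using tendsto_mult_right_zero[OF c1, of "(norm ?m)\<^sup>2"] by (simp only:)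
    qed
    moreover have "(\<lambda>j. ?T (emb i) (pderivs [i] (?g j))) \<longlonglongrightarrow> ?T (emb i) (H \<epsilon> i)" for i
    proof (rule mode_limit[OF l u(1)])
      obtain Bi where Bi: "\<And>x. norm (pderivs [i] (cutoff \<kappa> \<epsilon>) x) \<le> Bi" using chib[OF \<epsilon>] by blast
      show "pderivs [i] (?g j) \<in> borel_measurable borel" "square_integrable (Ldisc \<kappa>) (pderivs [i] (?g j))" for j
        using sD[OF smooth_pderiv[OF gs[of j]]] by auto
      show "H \<epsilon> i \<in> borel_measurable borel" by (rule mi)
      have s2: "square_integrable (Ldisc \<kappa>) (\<lambda>x. c x * pderivs [i] (cutoff \<kappa> \<epsilon>) x)"
        by (rule square_integrable_mult_bounded[OF c(2) chiL'(2) AE_I2[OF Bi]])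
      have s3: "square_integrable (Ldisc \<kappa>) (\<lambda>x. d i x * cutoff \<kappa> \<epsilon> x)"
        by (rule square_integrable_mult_bounded[OF d(2) chiL'(1) AE_I2[OF norm_cutoff_le[OF \<epsilon>]]])
      show "square_integrable (Ldisc \<kappa>) (H \<epsilon> i)"
        unfolding H_def[abs_def] by (rule square_integrable_add[OF s2 s3])
      have c2: "(\<lambda>j. sqnorm (Ldisc \<kappa>) (\<lambda>x. f j x * pderivs [i] (cutoff \<kappa> \<epsilon>) x - c x * pderivs [i] (cutoff \<kappa> \<epsilon>) x)) \<longlonglongrightarrow> 0"
        by (rule sqnorm_mult_bounded_tendsto[OF sD(1)[OF f] c(2) chiL'(2) Bi fc])
      have c3: "(\<lambda>j. sqnorm (Ldisc \<kappa>) (\<lambda>x. pderivs [i] (f j) x * cutoff \<kappa> \<epsilon> x - d i x * cutoff \<kappa> \<epsilon> x)) \<longlonglongrightarrow> 0"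
        by (rule sqnorm_mult_bounded_tendsto[OF sD(1)[OF smooth_pderiv[OF f]] d(2) chiL'(1) norm_cutoff_le[OF \<epsilon>] fd])
      have "(\<lambda>j. sqnorm (Ldisc \<kappa>) (\<lambda>x. (f j x * pderivs [i] (cutoff \<kappa> \<epsilon>) x - c x * pderivs [i] (cutoff \<kappa> \<epsilon>) x)
          + (pderivs [i] (f j) x * cutoff \<kappa> \<epsilon> x - d i x * cutoff \<kappa> \<epsilon> x))) \<longlonglongrightarrow> 0"
      proof (rule sqnorm_add_tendsto[OF _ _ c2 c3])
        show "square_integrable (Ldisc \<kappa>) (\<lambda>x. f j x * pderivs [i] (cutoff \<kappa> \<epsilon>) x - c x * pderivs [i] (cutoff \<kappa> \<epsilon>) x)" for j
          by (rule square_integrable_diff[OF sD(1)[OF smooth_mult[OF f smooth_pderiv[OF smooth_cutoff[OF \<epsilon>]]]] s2])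
        show "square_integrable (Ldisc \<kappa>) (\<lambda>x. pderivs [i] (f j) x * cutoff \<kappa> \<epsilon> x - d i x * cutoff \<kappa> \<epsilon> x)" for j
          by (rule square_integrable_diff[OF sD(1)[OF smooth_mult[OF smooth_pderiv[OF f] smooth_cutoff[OF \<epsilon>]]] s3])
      qed
      then show "(\<lambda>j. sqnorm (Ldisc \<kappa>) (\<lambda>x. pderivs [i] (?g j) x - H \<epsilon> i x)) \<longlonglongrightarrow> 0"
        unfolding pdg H_def add_diff_add .
    qed
    ultimately have "(\<lambda>j. (\<Sum>i\<in>UNIV. ?T (emb i) (pderivs [i] (?g j))) + ?T 3 (\<lambda>x. ?m * ?g j x)) \<longlonglongrightarrow> (\<Sum>i\<in>UNIV. ?T (emb i) (H \<epsilon> i)) + ?T 3 (H3 \<epsilon>)"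
      by (intro tendsto_add tendsto_sum)
    then have "(\<lambda>j. 0) \<longlonglongrightarrow> (\<Sum>i\<in>UNIV. ?T (emb i) (H \<epsilon> i)) + ?T 3 (H3 \<epsilon>)"
      by (simp only: A[OF refl f \<epsilon>])
    then show ?thesis by (simp add: LIMSEQ_const_iff)
  qed
  \<comment> \<open>Second limit, removing the cutoff along \<epsilon> = 1/(m+1).\<close>
  define e where "e m = 1 / real (Suc m)" for m
  have e: "0 < e m" for m by (simp add: e_def)
  have e0: "e \<longlonglongrightarrow> 0" unfolding e_def[abs_def] using LIMSEQ_inverse_real_of_nat by (simp add: inverse_eq_divide)
  note mL = borel_measurable_lebesgue_on[OF c(1)] borel_measurable_lebesgue_on[OF d(1)]
  have cutoff1: "(\<lambda>m. sqnorm (Ldisc \<kappa>) (\<lambda>x. g x * (cutoff \<kappa> (e m) x - 1))) \<longlonglongrightarrow> 0"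
    and cutoff1s: "square_integrable (Ldisc \<kappa>) (\<lambda>x. g x * (cutoff \<kappa> (e m) x - 1))"
    if g: "g \<in> borel_measurable borel" "square_integrable (Ldisc \<kappa>) g" for g m
  proof -
    have 1: "(\<lambda>x. g x * (cutoff \<kappa> (e m) x - 1)) \<in> borel_measurable (Ldisc \<kappa>)" for m
      by (intro borel_measurable_times borel_measurable_diff borel_measurable_const chiL(1)[OF e] borel_measurable_lebesgue_on[OF g(1)])
    have 2: "norm (g x * (cutoff \<kappa> (e m) x - 1)) \<le> norm (2 * g x)" for m x
    proof -
      have "norm (cutoff \<kappa> (e m) x - 1) \<le> 2"
        using norm_triangle_ineq4[of "cutoff \<kappa> (e m) x" 1] norm_cutoff_le[OF e, of \<kappa> m x] by simp
      from mult_left_mono[OF this norm_ge_zero[of "g x"]] show ?thesis by (simp add: norm_mult)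
    qed
    have 3: "(\<lambda>m. g x * (cutoff \<kappa> (e m) x - 1)) \<longlonglongrightarrow> 0" if "x \<in> space (Ldisc \<kappa>)" for x
    proof -
      have "(\<lambda>m. g x * (cutoff \<kappa> (e m) x - 1)) \<longlonglongrightarrow> g x * (1 - 1)"
        unfolding e_def by (intro tendsto_intros cutoff_tendsto) (use that in simp)
      then show ?thesis by simp
    qed
    show "(\<lambda>m. sqnorm (Ldisc \<kappa>) (\<lambda>x. g x * (cutoff \<kappa> (e m) x - 1))) \<longlonglongrightarrow> 0"
      "square_integrable (Ldisc \<kappa>) (\<lambda>x. g x * (cutoff \<kappa> (e m) x - 1))"
      using sqnorm_dominated_tendsto[OF 1 square_integrable_cmult[OF g(2)] 2 3] by auto
  qed
  have grad: "(\<lambda>j. \<Sum>i\<in>UNIV. sqnorm (Ldisc \<kappa>) (pderivs [i] (f j))) \<longlonglongrightarrow> (\<Sum>i\<in>UNIV. sqnorm (Ldisc \<kappa>) (d i))"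
    by (intro tendsto_sum L2_tendsto_sqnorm sD(1) smooth_pderiv f d(2) fd)
  note hardy = Hardy_limit[OF \<kappa> f c(2) fc grad bd]
  \<comment> \<open>The critical term. The bound free of \<epsilon> makes 4 times the function of
    \<open>Hardy_limit\<close> a dominating function, and the other bound gives pointwise
    convergence to 0.\<close>
  have err1: "(\<lambda>m. sqnorm (Ldisc \<kappa>) (\<lambda>x. c x * pderivs [i] (cutoff \<kappa> (e m)) x)) \<longlonglongrightarrow> 0"
    and err1s: "square_integrable (Ldisc \<kappa>) (\<lambda>x. c x * pderivs [i] (cutoff \<kappa> (e m)) x)" for i m
  proof -
    have 1: "(\<lambda>x. c x * pderivs [i] (cutoff \<kappa> (e m)) x) \<in> borel_measurable (Ldisc \<kappa>)" for m
      by (intro borel_measurable_times chiL(2)[OF e] mL)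
    have 2: "norm (c x * pderivs [i] (cutoff \<kappa> (e m)) x) \<le> norm (4 * (c x * complex_of_real (norm x / (\<kappa>\<^sup>2 - (norm x)\<^sup>2))))"
      if "x \<in> space (Ldisc \<kappa>)" for m x
    proof -
      have x: "x \<in> disc \<kappa>" using that by simp
      then have "0 \<le> norm x / (\<kappa>\<^sup>2 - (norm x)\<^sup>2)" by (simp add: norm_disc)
      then have r: "norm (4 * (c x * complex_of_real (norm x / (\<kappa>\<^sup>2 - (norm x)\<^sup>2)))) = norm (c x) * (4 * (norm x / (\<kappa>\<^sup>2 - (norm x)\<^sup>2)))"
        by (simp only: norm_mult norm_of_real abs_of_nonneg) simp
      show ?thesis unfolding r norm_mult[of "c x" "pderivs [i] (cutoff \<kappa> (e m)) x"]
        by (rule mult_left_mono[OF norm_pderiv_cutoff_le(1)[OF e x] norm_ge_zero])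
    qed
    have 3: "(\<lambda>m. c x * pderivs [i] (cutoff \<kappa> (e m)) x) \<longlonglongrightarrow> 0" if "x \<in> space (Ldisc \<kappa>)" for x
    proof -
      have x: "x \<in> disc \<kappa>" using that by simp
      have "(\<lambda>m. norm (pderivs [i] (cutoff \<kappa> (e m)) x)) \<longlonglongrightarrow> 0"
      proof (rule tendsto_sandwich[OF _ _ tendsto_const])
        have "(\<lambda>m. 8 * norm x * e m / (\<kappa>\<^sup>2 - (norm x)\<^sup>2)\<^sup>2) \<longlonglongrightarrow> 8 * norm x * 0 / (\<kappa>\<^sup>2 - (norm x)\<^sup>2)\<^sup>2"
          by (intro tendsto_intros e0) (use x in \<open>simp add: norm_disc\<close>)
        then show "(\<lambda>m. 8 * norm x * e m / (\<kappa>\<^sup>2 - (norm x)\<^sup>2)\<^sup>2) \<longlonglongrightarrow> 0" by simp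
        show "\<forall>\<^sub>F m in sequentially. norm (pderivs [i] (cutoff \<kappa> (e m)) x) \<le> 8 * norm x * e m / (\<kappa>\<^sup>2 - (norm x)\<^sup>2)\<^sup>2"
          by (intro always_eventually allI norm_pderiv_cutoff_le(2) e x)
      qed (rule always_eventually, rule allI, rule norm_ge_zero)
      then have "(\<lambda>m. pderivs [i] (cutoff \<kappa> (e m)) x) \<longlonglongrightarrow> 0" by (rule tendsto_norm_zero_cancel)
      from tendsto_mult_right_zero[OF this] show ?thesis .
    qed
    show "(\<lambda>m. sqnorm (Ldisc \<kappa>) (\<lambda>x. c x * pderivs [i] (cutoff \<kappa> (e m)) x)) \<longlonglongrightarrow> 0"
      by (rule sqnorm_dominated_tendsto(1)[OF 1 square_integrable_cmult[OF hardy, of 4] 2 3])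
    show "square_integrable (Ldisc \<kappa>) (\<lambda>x. c x * pderivs [i] (cutoff \<kappa> (e m)) x)"
      by (rule sqnorm_dominated_tendsto(2)[OF 1 square_integrable_cmult[OF hardy, of 4] 2 3])
  qed
  have "(\<lambda>m. ?T (emb i) (H (e m) i)) \<longlonglongrightarrow> ?T (emb i) (d i)" for i
  proof (rule mode_limit[OF l u(1) _ _ d])
    show "H (e m) i \<in> borel_measurable borel" for m
      unfolding H_def[abs_def] using c(1) d(1)[of i] chi(1)[OF e] chi(2)[OF e, of i] by measurable
    have eq: "H (e m) i x - d i x = c x * pderivs [i] (cutoff \<kappa> (e m)) x + d i x * (cutoff \<kappa> (e m) x - 1)" for m x
      by (simp add: H_def right_diff_distrib del: pderivs.simps)
    show "(\<lambda>m. sqnorm (Ldisc \<kappa>) (\<lambda>x. H (e m) i x - d i x)) \<longlonglongrightarrow> 0"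
      unfolding eq by (rule sqnorm_add_tendsto[OF err1s cutoff1s[OF d] err1 cutoff1[OF d]])
    have "square_integrable (Ldisc \<kappa>) (\<lambda>x. (H (e m) i x - d i x) + d i x)" for m
      unfolding eq by (intro square_integrable_add err1s cutoff1s d)
    then show "square_integrable (Ldisc \<kappa>) (H (e m) i)" for m by simp
  qed
  moreover have "(\<lambda>m. ?T 3 (H3 (e m))) \<longlonglongrightarrow> ?T 3 (\<lambda>x. ?m * c x)"
  proof (rule mode_limit[OF l u(1)])
    show "H3 (e m) \<in> borel_measurable borel" for m
      unfolding H3_def[abs_def] using c(1) chi(1)[OF e] by measurable
    have eq: "H3 (e m) x - ?m * c x = ?m * (c x * (cutoff \<kappa> (e m) x - 1))" for m x
      by (simp add: H3_def algebra_simps)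
    show "(\<lambda>m. sqnorm (Ldisc \<kappa>) (\<lambda>x. H3 (e m) x - ?m * c x)) \<longlonglongrightarrow> 0"
      unfolding eq sqnorm_cmult by (rule tendsto_mult_right_zero[OF cutoff1[OF c]])
    have "square_integrable (Ldisc \<kappa>) (\<lambda>x. (H3 (e m) x - ?m * c x) + ?m * c x)" for m
      unfolding eq by (intro square_integrable_add square_integrable_cmult cutoff1s c)
    then show "square_integrable (Ldisc \<kappa>) (H3 (e m))" for m by simp
  qed (use c in auto)
  ultimately have "(\<lambda>m. (\<Sum>i\<in>UNIV. ?T (emb i) (H (e m) i)) + ?T 3 (H3 (e m))) \<longlonglongrightarrow> (\<Sum>i\<in>UNIV. ?T (emb i) (d i)) + ?T 3 (\<lambda>x. ?m * c x)"
    by (intro tendsto_add tendsto_sum)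
  then have "(\<lambda>m. 0) \<longlonglongrightarrow> (\<Sum>i\<in>UNIV. ?T (emb i) (d i)) + ?T 3 (\<lambda>x. ?m * c x)" by (simp only: B[OF e])
  then show ?thesis by (simp add: LIMSEQ_const_iff)
qed

section \<open>The periodic Sobolev spaces\<close>

lemma sobolev_0: "f \<in> sobolev 0 S \<longleftrightarrow> f \<in> L2 S"
proof
  assume f: "f \<in> L2 S"
  then have "\<exists>g\<in>L2 S. weak_deriv S [] f g" by (rule bexI[where x = f, rotated]) (rule weak_deriv_Nil)
  with f show "f \<in> sobolev 0 S" by (simp add: sobolev_def)
qed (simp add: sobolev_def)

lemma sobolev_1I:
  fixes f :: "real^'n \<Rightarrow> complex"
  assumes "f \<in> L2 S" "\<And>i. g i \<in> L2 S" "\<And>i. weak_deriv S [i] f (g i)"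
  shows "f \<in> sobolev 1 S"
  unfolding sobolev_def
proof (intro CollectI conjI allI impI)
  fix js :: "'n list"
  assume "length js \<le> 1"
  then consider "js = []" | i where "js = [i]" by (cases js) auto
  then show "\<exists>g\<in>L2 S. weak_deriv S js f g"
  proof cases
    case 1
    show ?thesis unfolding 1 by (rule bexI[where x = f], rule weak_deriv_Nil, rule assms(1))
  next
    case (2 i)
    show ?thesis unfolding 2 by (rule bexI[where x = "g i"], rule assms(3), rule assms(2))
  qed
qed (rule assms)

text \<open>Each finite set of integers lies in a symmetric range, and Bessel's inequality controls
  the sums over these.\<close>

lemma summable_on_int_bounded:
  fixes f :: "int \<Rightarrow> real"
  assumes "\<And>n. 0 \<le> f n" "\<And>N. (\<Sum>n\<in>{- int N..int N}. f n) \<le> C"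
  shows "f summable_on UNIV"
proof (rule nonneg_bdd_above_summable_on)
  show "bdd_above (sum f ` {F. F \<subseteq> UNIV \<and> finite F})"
  proof (rule bdd_aboveI2)
    fix F :: "int set"
    assume "F \<in> {F. F \<subseteq> UNIV \<and> finite F}"
    then have F: "finite F" by simp
    define m where "m = Max (abs ` insert 0 F)"
    define N where "N = nat m"
    have m: "\<bar>n\<bar> \<le> m" if "n \<in> insert 0 F" for n
      unfolding m_def by (intro Max_ge finite_imageI finite.insertI F imageI that)
    from m[of 0] have Nm: "int N = m" by (simp add: N_def)
    have N: "\<bar>n\<bar> \<le> int N" if "n \<in> F" for n
      unfolding Nm by (rule m) (simp add: that)
    have "F \<subseteq> {- int N..int N}"
    proof
      fix n assume "n \<in> F"
      from N[OF this] show "n \<in> {- int N..int N}" by (auto simp: abs_le_iff)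
    qed
    then have "sum f F \<le> (\<Sum>n\<in>{- int N..int N}. f n)"
      by (intro sum_mono2) (auto simp: assms)
    then show "sum f F \<le> C" using assms(2)[of N] by (rule order_trans)
  qed
qed (rule assms)

lemma summable_coef:
  assumes "0 < l" "F \<in> borel_measurable borel" "square_integrable (Lcyl \<kappa> l) F"
  shows "(\<lambda>n. l * sqnorm (Ldisc \<kappa>) (coef l n F)) summable_on UNIV"
  by (rule summable_on_int_bounded[OF _ Bessel_cyl[OF assms]]) (use assms(1) in simp)

section \<open>Fourier series of Lebesgue measurable representatives\<close>

lemma L2_norm_tendsto_0_iff:
  fixes f :: "nat \<Rightarrow> 'a::euclidean_space \<Rightarrow> 'b::euclidean_space"
  shows "(\<lambda>N. L2_norm S (f N)) \<longlonglongrightarrow> 0 \<longleftrightarrow> (\<lambda>N. sqnorm (lebesgue_on S) (f N)) \<longlonglongrightarrow> 0"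
proof
  assume "(\<lambda>N. L2_norm S (f N)) \<longlonglongrightarrow> 0"
  from tendsto_power[OF this, of 2] show "(\<lambda>N. sqnorm (lebesgue_on S) (f N)) \<longlonglongrightarrow> 0"
    by (simp add: L2_norm_sq)
next
  assume "(\<lambda>N. sqnorm (lebesgue_on S) (f N)) \<longlonglongrightarrow> 0"
  then show "(\<lambda>N. L2_norm S (f N)) \<longlonglongrightarrow> 0"
    by (simp only: L2_norm_sq[symmetric] tendsto_sq_zero)
qed

lemma L2_cyl_representative:
  fixes u :: "real^3 \<Rightarrow> complex"
  assumes "u \<in> L2 (cyl \<kappa> l)"
  obtains U where "U \<in> borel_measurable borel" "square_integrable (Lcyl \<kappa> l) U" "AE a in Lcyl \<kappa> l. u a = U a"
proof -
  have u: "square_integrable (Lcyl \<kappa> l) u" using assms by (simp add: L2_iff)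
  obtain U where U: "U \<in> borel_measurable borel" "AE a in Lcyl \<kappa> l. u a = U a"
    using borel_representative[OF cyl_borel square_integrable_measurable[OF u]] by metis
  have "square_integrable (Lcyl \<kappa> l) U"
    using square_integrable_cong_AE[OF square_integrable_measurable[OF u] borel_measurable_lebesgue_on[OF U(1)] U(2)] u by blast
  with U that show ?thesis by blast
qed

lemma sqnorm_partial_sum_cong:
  fixes u U S :: "real^3 \<Rightarrow> complex"
  assumes u: "u \<in> L2 (cyl \<kappa> l)" and U: "U \<in> borel_measurable borel" "AE a in Lcyl \<kappa> l. u a = U a"
    and S: "S \<in> borel_measurable (Lcyl \<kappa> l)"
  shows "sqnorm (Lcyl \<kappa> l) (\<lambda>a. u a - S a) = sqnorm (Lcyl \<kappa> l) (\<lambda>a. U a - S a)"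
proof (rule sqnorm_cong_AE)
  have "u \<in> borel_measurable (Lcyl \<kappa> l)" using u square_integrable_measurable by (auto simp: L2_iff)
  then show "(\<lambda>a. u a - S a) \<in> borel_measurable (Lcyl \<kappa> l)" using S by measurable
  show "(\<lambda>a. U a - S a) \<in> borel_measurable (Lcyl \<kappa> l)"
    using borel_measurable_lebesgue_on[OF U(1)] S by measurable
  show "AE a in Lcyl \<kappa> l. u a - S a = U a - S a" using U(2) by eventually_elim simp
qed

lemma fourier_series_L2_norm:
  assumes l: "0 < l" and u: "u \<in> L2 (cyl \<kappa> l)"
    and U: "U \<in> borel_measurable borel" "square_integrable (Lcyl \<kappa> l) U" "AE a in Lcyl \<kappa> l. u a = U a"
  shows "(\<lambda>N. L2_norm (cyl \<kappa> l) (\<lambda>a. u a - (\<Sum>n\<in>{- int N..int N}. fourier_mode l n (coef l n U) a))) \<longlonglongrightarrow> 0"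
proof -
  have "(\<lambda>a. \<Sum>n\<in>{- int N..int N}. fourier_mode l n (coef l n U) a) \<in> borel_measurable (Lcyl \<kappa> l)" for N
    by (intro borel_measurable_sum borel_measurable_lebesgue_on fourier_mode_measurable coef_measurable U)
  note eq = sqnorm_partial_sum_cong[OF u U(1,3) this]
  show ?thesis unfolding L2_norm_tendsto_0_iff eq by (rule fourier_cyl_convergence[OF l U(1,2)])
qed

text \<open>For k = 0 the only weight is 1 / \<open>l powi (-1)\<close> = l, and summability is then
  Bessel's inequality for the coefficients of a Borel representative.\<close>

lemma Hp_0:
  assumes l: "0 < l" and u: "u \<in> L2 (cyl \<kappa> l)"
  shows "u \<in> Hp 0 \<kappa> l"
proof -
  obtain U where U: "U \<in> borel_measurable borel" "square_integrable (Lcyl \<kappa> l) U" "AE a in Lcyl \<kappa> l. u a = U a"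
    using L2_cyl_representative[OF u] .
  have c: "coef l n U \<in> L2 (disc \<kappa>)" for n
    using square_integrable_coef[OF l U(1,2)] by (simp add: L2_iff)
  show ?thesis
    unfolding Hp_def sobolev_0
  proof (intro CollectI conjI exI[of _ "\<lambda>n. coef l n U"] allI u c fourier_series_L2_norm[OF l u U])
    have "(\<Sum>m\<le>0. (2 * pi * of_int n) ^ (2 * m) / l powi (2 * int m - 1) * (sobolev_norm (0 - m) (disc \<kappa>) (coef l n U))\<^sup>2)
      = l * sqnorm (Ldisc \<kappa>) (coef l n U)" for n
      by (simp add: sobolev_norm_0[OF open_disc bounded_disc c] power_int_minus divide_inverse mult.commute)
    then show "(\<lambda>n. \<Sum>m\<le>0. (2 * pi * real_of_int n) ^ (2 * m) / l powi (2 * int m - 1) * (sobolev_norm (0 - m) (disc \<kappa>) (coef l n U))\<^sup>2) summable_on UNIV"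
      using summable_coef[OF l U(1,2)] by (simp only:)
  qed
qed

section \<open>Gradients and periodic test functions\<close>

lemma square_integrable_vecI:
  fixes f :: "'a \<Rightarrow> complex^'n"
  assumes "\<And>k. square_integrable M (\<lambda>x. f x $ k)"
  shows "square_integrable M f"
    and "sqnorm M f = (\<Sum>k\<in>UNIV. sqnorm M (\<lambda>x. f x $ k))"
proof -
  have eq: "(norm (f x))\<^sup>2 = (\<Sum>k\<in>UNIV. (norm (f x $ k))\<^sup>2)" for x
    by (simp add: norm_vec_def L2_set_def sum_nonneg)
  have "(\<lambda>x. f x \<bullet> b) \<in> borel_measurable M" if "b \<in> Basis" for b
  proof -
    from that obtain k c where b: "b = axis k c" by (auto simp: Basis_vec_def)
    have "(\<lambda>x. f x $ k) \<in> borel_measurable M" using assms square_integrable_measurable by blast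
    then show ?thesis unfolding b inner_axis by measurable
  qed
  then have "f \<in> borel_measurable M" by (rule borel_measurable_euclidean_space[THEN iffD2, rule_format])
  then show "square_integrable M f"
    using assms unfolding square_integrable_def eq by (intro conjI Bochner_Integration.integrable_sum) auto
  show "sqnorm M f = (\<Sum>k\<in>UNIV. sqnorm M (\<lambda>x. f x $ k))"
    unfolding sqnorm_def eq by (rule Bochner_Integration.integral_sum) (rule square_integrable_integrable[OF assms])
qed

lemma sqnorm_vec_nth_le:
  fixes f :: "'a \<Rightarrow> complex^'n"
  assumes "square_integrable M f"
  shows "sqnorm M (\<lambda>x. f x $ k) \<le> sqnorm M f"
  unfolding sqnorm_def
proof (rule integral_mono)
  show "(norm (f x $ k))\<^sup>2 \<le> (norm (f x))\<^sup>2" for x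
    by (rule power_mono[OF Finite_Cartesian_Product.norm_nth_le norm_ge_zero])
qed (intro square_integrable_integrable square_integrable_vec_nth assms)+

definition gradient :: "(real^'n \<Rightarrow> complex) \<Rightarrow> real^'n \<Rightarrow> complex^'n" where
  "gradient f a = (\<chi> k. pderivs [k] f a)"

lemma gradient_nth [simp]: "gradient f a $ k = pderivs [k] f a"
  by (simp add: gradient_def del: pderivs.simps)

lemma square_integrable_gradient:
  assumes "open S" "bounded S" "smooth f"
  shows "square_integrable (lebesgue_on S) (gradient f)"
  by (rule square_integrable_vecI) (simp only: gradient_nth square_integrable_smooth[OF assms(2,1) smooth_pderiv[OF assms(3)]])

lemma gradient_add: "smooth f \<Longrightarrow> smooth g \<Longrightarrow> gradient (\<lambda>x. f x + g x) a = gradient f a + gradient g a"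
  by (simp add: vec_eq_iff pderiv_add smooth_differentiable del: pderivs.simps)

lemma gradient_cmult: "smooth f \<Longrightarrow> gradient (\<lambda>x. c * f x) a $ k = c * pderivs [k] f a"
  using pderiv_mult[of "\<lambda>x. c" a f k] by (simp add: smooth_differentiable del: pderivs.simps)

lemma periodic_test_functionD:
  assumes "\<phi> \<in> periodic_test_functions \<kappa> l"
  shows "smooth \<phi>" "\<phi> (a + axis 3 l) = \<phi> a" "horiz a \<notin> disc \<kappa> \<Longrightarrow> \<phi> a = 0"
proof -
  show "smooth \<phi>" "\<phi> (a + axis 3 l) = \<phi> a" using assms by (simp_all add: periodic_test_functions_def)
  show "\<phi> a = 0" if "horiz a \<notin> disc \<kappa>"
  proof (rule ccontr)
    assume "\<phi> a \<noteq> 0"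
    then have "a \<in> closure {a. \<phi> a \<noteq> 0}" by (intro subsetD[OF closure_subset]) simp
    then show False using assms that by (auto simp: periodic_test_functions_def)
  qed
qed

lemma periodic_test_function_add:
  assumes "\<phi> \<in> periodic_test_functions \<kappa> l" "\<psi> \<in> periodic_test_functions \<kappa> l"
  shows "(\<lambda>a. \<phi> a + \<psi> a) \<in> periodic_test_functions \<kappa> l"
proof -
  have "closure {a. \<phi> a + \<psi> a \<noteq> 0} \<subseteq> closure ({a. \<phi> a \<noteq> 0} \<union> {a. \<psi> a \<noteq> 0})"
    by (rule closure_mono) auto
  then show ?thesis
    using assms by (auto simp: periodic_test_functions_def closure_Un)
qed

lemma periodic_test_function_cmult:
  assumes "\<phi> \<in> periodic_test_functions \<kappa> l"
  shows "(\<lambda>a. c * \<phi> a) \<in> periodic_test_functions \<kappa> l"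
proof -
  have "closure {a. c * \<phi> a \<noteq> 0} \<subseteq> closure {a. \<phi> a \<noteq> 0}"
    by (rule closure_mono) auto
  then show ?thesis
    using assms by (auto simp: periodic_test_functions_def)
qed

lemma inner_vec_complex: "(u::complex^'n) \<bullet> v = Re (\<Sum>k\<in>UNIV. u $ k * cnj (v $ k))"
  by (simp add: inner_vec_def inner_complex_def)

lemma integral_inner_eq_Re:
  fixes u v :: "'a \<Rightarrow> complex^'n"
  assumes "square_integrable M u" "square_integrable M v"
  shows "(LINT a|M. u a \<bullet> v a) = Re (LINT a|M. (\<Sum>k\<in>UNIV. u a $ k * cnj (v a $ k)))"
  unfolding inner_vec_complex
  by (rule integral_Re) (intro Bochner_Integration.integrable_sum integrable_mult_complex square_integrable_vec_nth square_integrable_cnj assms)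

section \<open>The orthogonal complement of the solenoidal fields\<close>

lemma L2_orth_P0_approx:
  assumes l: "0 < l" and v: "v \<in> L2_orth (cyl \<kappa> l) (P0 \<kappa> l)"
  obtains \<phi> where "\<And>j. \<phi> j \<in> periodic_test_functions \<kappa> l"
    "(\<lambda>j. sqnorm (Lcyl \<kappa> l) (\<lambda>a. gradient (\<phi> j) a - v a)) \<longlonglongrightarrow> 0"
proof -
  let ?P = "periodic_test_functions \<kappa> l"
  note sg = square_integrable_gradient[OF open_cyl bounded_cyl periodic_test_functionD(1)]
  have vs: "square_integrable (Lcyl \<kappa> l) v" using v by (simp add: L2_orth_def L2_iff)
  have z: "(\<lambda>a. 0) \<in> ?P" by (simp add: periodic_test_functions_def)
  have G1: "square_integrable (Lcyl \<kappa> l) g" if "g \<in> gradient ` ?P" for g using that sg by blast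
  have G2: "(\<lambda>x. 0) \<in> gradient ` ?P"
  proof -
    have "(\<lambda>x. 0) = gradient (\<lambda>a::real^3. 0)"
      by (rule ext) (simp add: vec_eq_iff del: pderivs.simps)
    then show ?thesis using z by blast
  qed
  have G3: "(\<lambda>x. g x + h x) \<in> gradient ` ?P" if gh: "g \<in> gradient ` ?P" "h \<in> gradient ` ?P" for g h
  proof -
    obtain \<phi> \<psi> where e: "\<phi> \<in> ?P" "\<psi> \<in> ?P" "g = gradient \<phi>" "h = gradient \<psi>" using gh by blast
    have "(\<lambda>x. g x + h x) = gradient (\<lambda>a. \<phi> a + \<psi> a)"
      unfolding e by (rule ext) (rule gradient_add[symmetric], (rule periodic_test_functionD(1), rule e)+)
    then show ?thesis using periodic_test_function_add[OF e(1,2)] by blast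
  qed
  have G4: "(\<lambda>x. c *\<^sub>R g x) \<in> gradient ` ?P" if g: "g \<in> gradient ` ?P" for c g
  proof -
    obtain \<phi> where e: "\<phi> \<in> ?P" "g = gradient \<phi>" using g by blast
    have "(\<lambda>x. c *\<^sub>R g x) = gradient (\<lambda>a. complex_of_real c * \<phi> a)"
    proof
      fix a show "c *\<^sub>R g a = gradient (\<lambda>a. complex_of_real c * \<phi> a) a"
        unfolding e(2) vec_eq_iff gradient_cmult[OF periodic_test_functionD(1)[OF e(1)]]
          vector_scaleR_component gradient_nth by (simp add: scaleR_conv_of_real del: pderivs.simps)
    qed
    then show ?thesis using periodic_test_function_cmult[OF e(1)] by blast
  qed
  obtain g' g where g': "\<And>j. g' j \<in> gradient ` ?P" and g: "square_integrable (Lcyl \<kappa> l) g"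
    and lim: "(\<lambda>j. sqnorm (Lcyl \<kappa> l) (\<lambda>a. g' j a - g a)) \<longlonglongrightarrow> 0"
    and orth: "\<And>h. h \<in> gradient ` ?P \<Longrightarrow> (LINT a|Lcyl \<kappa> l. (v a - g a) \<bullet> h a) = 0"
  proof -
    show thesis
    proof (rule L2_projection[OF vs G1 G2 G3 G4])
      fix g' g
      assume 1: "\<And>k. g' k \<in> gradient ` ?P" and 2: "square_integrable (Lcyl \<kappa> l) g"
        and 3: "(\<lambda>k. sqnorm (Lcyl \<kappa> l) (\<lambda>x. g' k x - g x)) \<longlonglongrightarrow> 0"
        and 4: "\<And>h. h \<in> gradient ` ?P \<Longrightarrow> (LINT x|Lcyl \<kappa> l. (v x - g x) \<bullet> h x) = 0"
      show thesis by (rule that[OF 1 2 3 4])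
    qed
  qed
  define w where "w a = v a - g a" for a
  have w: "square_integrable (Lcyl \<kappa> l) w" unfolding w_def[abs_def] by (rule square_integrable_diff[OF vs g])
  have zero: "(LINT a|Lcyl \<kappa> l. (\<Sum>k\<in>UNIV. w a $ k * pderivs [k] \<phi> a)) = 0" (is "?I = 0") if \<phi>: "\<phi> \<in> ?P" for \<phi>
  proof -
    \<comment> \<open>The real inner product controls real parts only. Testing with c times the
      conjugate of \<phi> turns it into the pairing without conjugation of
      \<open>divergence_free\<close>, and c = 1, \<i> give both parts.\<close>
    have c: "Re (cnj c * ?I) = 0" for c
    proof -
      let ?\<psi> = "\<lambda>a. c * cnj (\<phi> a)"
      have \<psi>: "?\<psi> \<in> ?P" by (intro periodic_test_function_cmult cnj_periodic_test_function \<phi>)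
      have pd: "gradient ?\<psi> a $ k = c * cnj (pderivs [k] \<phi> a)" for a k
        unfolding gradient_cmult[OF smooth_cnj[OF periodic_test_functionD(1)[OF \<phi>]]]
          pderiv_cnj[OF smooth_differentiable[OF periodic_test_functionD(1)[OF \<phi>]]] ..
      have "(LINT a|Lcyl \<kappa> l. w a \<bullet> gradient ?\<psi> a) = 0" unfolding w_def by (rule orth[OF imageI[OF \<psi>]])
      then have "Re (LINT a|Lcyl \<kappa> l. (\<Sum>k\<in>UNIV. w a $ k * cnj (gradient ?\<psi> a $ k))) = 0"
        by (simp only: integral_inner_eq_Re[OF w sg[OF \<psi>]])
      moreover have "(\<Sum>k\<in>UNIV. w a $ k * cnj (gradient ?\<psi> a $ k)) = cnj c * (\<Sum>k\<in>UNIV. w a $ k * pderivs [k] \<phi> a)" for a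
        unfolding pd sum_distrib_left by (rule sum.cong) (simp_all add: mult_ac del: pderivs.simps)
      ultimately show ?thesis by (simp only: integral_mult_right_zero)
    qed
    show ?thesis using c[of 1] c[of \<i>] by (simp add: complex_eq_iff del: pderivs.simps)
  qed
  \<comment> \<open>Square integrability already yields membership of the components in
    \<open>Hp 0\<close>, so being divergence free is all that had to be checked.\<close>
  have "w \<in> P0 \<kappa> l"
    unfolding P0_def divergence_free_def
  proof (intro CollectI conjI allI ballI Hp_0[OF l])
    show "(\<lambda>a. w a $ i) \<in> L2 (cyl \<kappa> l)" for i unfolding L2_iff by (rule square_integrable_vec_nth[OF w])
  qed (rule zero)
  then have "L2_inner (cyl \<kappa> l) w v = 0" using v by (simp add: L2_orth_def)
  then have wv: "(LINT a|Lcyl \<kappa> l. w a \<bullet> v a) = 0"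
    unfolding integral_inner_eq_Re[OF w vs] L2_inner_def[symmetric] by simp
  have g's: "square_integrable (Lcyl \<kappa> l) (g' j)" for j by (rule G1[OF g'])
  have "(LINT a|Lcyl \<kappa> l. g' j a \<bullet> w a) = 0" for j
    using orth[OF g'[of j]] by (simp only: w_def inner_commute)
  with L2_tendsto_integral_inner[OF g's g w lim] have "(LINT a|Lcyl \<kappa> l. g a \<bullet> w a) = 0"
    by (simp add: LIMSEQ_const_iff)
  then have wg: "(LINT a|Lcyl \<kappa> l. w a \<bullet> g a) = 0" by (simp only: inner_commute)
  \<comment> \<open>w is orthogonal to v because w is solenoidal, and to g because g is a limit of
    gradients orthogonal to w; hence w is orthogonal to v - g, which is w.\<close>
  have "(LINT a|Lcyl \<kappa> l. w a \<bullet> w a) = (LINT a|Lcyl \<kappa> l. w a \<bullet> v a - w a \<bullet> g a)"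
    by (rule Bochner_Integration.integral_cong) (simp_all add: w_def inner_diff_right)
  also have "\<dots> = 0"
    by (subst Bochner_Integration.integral_diff) (simp_all add: wv wg integrable_inner w vs g)
  finally have "sqnorm (Lcyl \<kappa> l) w = 0" by (simp add: sqnorm_def dot_square_norm)
  from sqnorm_eq_0_AE[OF w this] have ae: "AE a in Lcyl \<kappa> l. g a = v a"
    by eventually_elim (simp add: w_def)
  have "\<exists>\<phi>. \<phi> \<in> ?P \<and> g' j = gradient \<phi>" for j using g'[of j] by (rule imageE) blast
  then obtain \<phi> where "\<forall>j. \<phi> j \<in> ?P \<and> g' j = gradient (\<phi> j)" using choice[of "\<lambda>j \<phi>. \<phi> \<in> ?P \<and> g' j = gradient \<phi>"] by blast
  then have \<phi>: "\<And>j. \<phi> j \<in> ?P" "\<And>j. g' j = gradient (\<phi> j)" by simp_all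
  have "sqnorm (Lcyl \<kappa> l) (\<lambda>a. g' j a - g a) = sqnorm (Lcyl \<kappa> l) (\<lambda>a. gradient (\<phi> j) a - v a)" for j
  proof (rule sqnorm_cong_AE)
    show "AE a in Lcyl \<kappa> l. g' j a - g a = gradient (\<phi> j) a - v a"
      using ae unfolding \<phi>(2) by eventually_elim simp
    show "(\<lambda>a. g' j a - g a) \<in> borel_measurable (Lcyl \<kappa> l)"
      by (rule square_integrable_measurable[OF square_integrable_diff[OF g's g]])
    show "(\<lambda>a. gradient (\<phi> j) a - v a) \<in> borel_measurable (Lcyl \<kappa> l)"
      by (rule square_integrable_measurable[OF square_integrable_diff[OF sg[OF \<phi>(1)] vs]])
  qed
  note eq = this
  show ?thesis by (rule that[of \<phi>, OF \<phi>(1) lim[unfolded eq]])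
qed

text \<open>Unpacks the convergence in \<open>has_trace_SF\<close>: the squared norm is a finite sum
  of nonnegative terms, each of which is squeezed by the sum.\<close>

lemma sobolev_norm_1_tendsto_iff:
  fixes f :: "real^'n \<Rightarrow> complex"
  assumes S: "open S" "bounded S" and f: "f \<in> L2 S"
    and g: "\<And>i. g i \<in> L2 S" "\<And>i. weak_deriv S [i] f (g i)" and \<phi>: "\<And>j. smooth (\<phi> j)"
  shows "(\<lambda>j. sobolev_norm 1 S (\<lambda>a. f a - \<phi> j a)) \<longlonglongrightarrow> 0 \<longleftrightarrow>
    (\<lambda>j. sqnorm (lebesgue_on S) (\<lambda>a. \<phi> j a - f a)) \<longlonglongrightarrow> 0 \<and>
    (\<forall>i. (\<lambda>j. sqnorm (lebesgue_on S) (\<lambda>a. pderivs [i] (\<phi> j) a - g i a)) \<longlonglongrightarrow> 0)"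
    (is "?L \<longleftrightarrow> (\<lambda>j. ?a j) \<longlonglongrightarrow> 0 \<and> (\<forall>i. (\<lambda>j. ?b i j) \<longlonglongrightarrow> 0)")
proof -
  have \<phi>L: "\<phi> j \<in> L2 S" "pderivs [i] (\<phi> j) \<in> L2 S" for i j
    unfolding L2_iff by (intro square_integrable_smooth S \<phi> smooth_pderiv)+
  have diff: "(\<lambda>a. f a - \<phi> j a) \<in> L2 S" "(\<lambda>a. g i a - pderivs [i] (\<phi> j) a) \<in> L2 S" for i j
    using f g(1) \<phi>L unfolding L2_iff by (intro square_integrable_diff; blast)+
  have w: "weak_deriv S [i] (\<lambda>a. f a - \<phi> j a) (\<lambda>a. g i a - pderivs [i] (\<phi> j) a)" for i j
    by (rule weak_deriv_diff[OF S f \<phi>L(1) g(1) \<phi>L(2) g(2) weak_deriv_smooth[OF S(1) \<phi>]])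
  have eq: "(sobolev_norm 1 S (\<lambda>a. f a - \<phi> j a))\<^sup>2 = ?a j + (\<Sum>i\<in>UNIV. ?b i j)" for j
    by (subst sobolev_norm_1[OF S diff(1) diff(2) w]) (simp only: sqnorm_minus_commute[of _ "\<phi> j"] sqnorm_minus_commute[of _ "pderivs _ (\<phi> j)"])
  have bn: "0 \<le> ?b i j" for i j by (rule sqnorm_nonneg)
  have an: "0 \<le> ?a j" for j by (rule sqnorm_nonneg)
  have sn: "0 \<le> (\<Sum>i\<in>UNIV. ?b i j)" for j by (rule sum_nonneg) (rule bn)
  have ba: "?a j \<le> ?a j + (\<Sum>i\<in>UNIV. ?b i j)" for j using sn[of j] by simp
  have bb: "?b i j \<le> ?a j + (\<Sum>i\<in>UNIV. ?b i j)" for i j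
    by (rule add_increasing[OF an member_le_sum]) (rule UNIV_I, rule bn, rule finite)
  show ?thesis
  proof
    assume ?L
    from tendsto_power[OF this, of 2] have l: "(\<lambda>j. ?a j + (\<Sum>i\<in>UNIV. ?b i j)) \<longlonglongrightarrow> 0"
      unfolding eq by (simp del: pderivs.simps)
    show "(\<lambda>j. ?a j) \<longlonglongrightarrow> 0 \<and> (\<forall>i. (\<lambda>j. ?b i j) \<longlonglongrightarrow> 0)"
      by (intro conjI allI tendsto_sandwich[OF _ _ tendsto_const l] always_eventually an bn ba bb)
  next
    assume r: "(\<lambda>j. ?a j) \<longlonglongrightarrow> 0 \<and> (\<forall>i. (\<lambda>j. ?b i j) \<longlonglongrightarrow> 0)"
    have "(\<lambda>j. ?a j + (\<Sum>i\<in>UNIV. ?b i j)) \<longlonglongrightarrow> 0 + (\<Sum>i\<in>(UNIV::'n set). 0)"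
      by (intro tendsto_add tendsto_sum r[THEN conjunct1] r[THEN conjunct2, rule_format])
    then have "(\<lambda>j. (sobolev_norm 1 S (\<lambda>a. f a - \<phi> j a))\<^sup>2) \<longlonglongrightarrow> 0"
      by (simp only: eq sum.neutral_const add_0)
    then show ?L by (rule tendsto_sq_zero)
  qed
qed

lemma join_add_axis: "join (x, 0) + axis 3 l = join (x, l)"
  by (simp add: vec_eq_iff forall_3 axis_def)

lemma norm_mode_factor_sq: "(norm (mode_factor l n))\<^sup>2 = (2 * pi * of_int n / l)\<^sup>2"
  by (simp add: mode_factor_def norm_mult norm_divide power_mult_distrib power_divide)

text \<open>The weight for m = 1 is (2 \<pi> n)^2 / l, that is l times the squared modulus of the
  mode factor. So the whole term is l times squared norms of coefficients of a function and of its
  derivatives, the form that Bessel's inequality controls.\<close>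

lemma Hp_1_term:
  assumes l: "0 < l" and c: "c \<in> L2 (disc \<kappa>)" and d: "\<And>i. d i \<in> L2 (disc \<kappa>)" "\<And>i. weak_deriv (disc \<kappa>) [i] c (d i)"
  shows "(\<Sum>m\<le>1. (2 * pi * of_int n) ^ (2 * m) / l powi (2 * int m - 1) * (sobolev_norm (1 - m) (disc \<kappa>) c)\<^sup>2)
    = l * sqnorm (Ldisc \<kappa>) c + (\<Sum>i\<in>UNIV. l * sqnorm (Ldisc \<kappa>) (d i)) + l * ((norm (mode_factor l n))\<^sup>2 * sqnorm (Ldisc \<kappa>) c)"
proof -
  have "{..1} = {0, 1::nat}" by auto
  then have "(\<Sum>m\<le>1. (2 * pi * of_int n) ^ (2 * m) / l powi (2 * int m - 1) * (sobolev_norm (1 - m) (disc \<kappa>) c)\<^sup>2)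
    = 1 / l powi (-1) * (sobolev_norm 1 (disc \<kappa>) c)\<^sup>2 + (2 * pi * of_int n)\<^sup>2 / l * (sobolev_norm 0 (disc \<kappa>) c)\<^sup>2"
    by simp
  also have "\<dots> = l * (sqnorm (Ldisc \<kappa>) c + (\<Sum>i\<in>UNIV. sqnorm (Ldisc \<kappa>) (d i))) + (2 * pi * of_int n)\<^sup>2 / l * sqnorm (Ldisc \<kappa>) c"
    unfolding sobolev_norm_1[OF open_disc bounded_disc c d] sobolev_norm_0[OF open_disc bounded_disc c]
    by (simp add: power_int_minus divide_inverse mult.commute)
  also have "(2 * pi * of_int n)\<^sup>2 / l * sqnorm (Ldisc \<kappa>) c = l * ((norm (mode_factor l n))\<^sup>2 * sqnorm (Ldisc \<kappa>) c)"
    unfolding norm_mode_factor_sq power_divide using l by (simp add: power2_eq_square)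
  finally show ?thesis unfolding distrib_left sum_distrib_left .
qed

lemma test_gradients_Cauchy:
  assumes \<kappa>: "0 < \<kappa>" and l: "0 < l" and \<phi>: "\<And>j. \<phi> j \<in> periodic_test_functions \<kappa> l"
    and v: "\<And>k. square_integrable (Lcyl \<kappa> l) (v k)"
    and lim: "\<And>k. (\<lambda>j. sqnorm (Lcyl \<kappa> l) (\<lambda>a. pderivs [k] (\<phi> j) a - v k a)) \<longlonglongrightarrow> 0"
  shows "\<exists>q. square_integrable (Lcyl \<kappa> l) q \<and> (\<lambda>j. sqnorm (Lcyl \<kappa> l) (\<lambda>a. \<phi> j a - q a)) \<longlonglongrightarrow> 0"
proof (rule Riesz_Fischer)
  note sm = periodic_test_functionD(1)[OF \<phi>]
  note si = square_integrable_smooth[OF bounded_cyl open_cyl]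
  show "square_integrable (Lcyl \<kappa> l) (\<phi> j)" for j by (rule si[OF sm])
  define E where "E k j = sqnorm (Lcyl \<kappa> l) (\<lambda>a. pderivs [k] (\<phi> j) a - v k a)" for k j
  \<comment> \<open>Poincare's bound for the difference of two test functions, split by comparing
    both with v; the factor 2 comes from \<open>sqnorm_diff_le\<close>.\<close>
  define D where "D j = \<kappa>\<^sup>2 * (\<Sum>i\<in>(UNIV::2 set). 2 * E (emb i) j)" for j
  have D: "D \<longlonglongrightarrow> \<kappa>\<^sup>2 * (\<Sum>i\<in>(UNIV::2 set). 2 * 0)"
    unfolding D_def[abs_def] E_def by (intro tendsto_mult tendsto_sum tendsto_const lim)
  have le: "sqnorm (Lcyl \<kappa> l) (\<lambda>a. \<phi> m a - \<phi> n a) \<le> D m + D n" for m n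
  proof -
    let ?\<psi> = "\<lambda>a. \<phi> m a + (-1) * \<phi> n a"
    have \<psi>: "?\<psi> \<in> periodic_test_functions \<kappa> l"
      by (intro periodic_test_function_add periodic_test_function_cmult \<phi>)
    have pd: "pderivs [k] ?\<psi> a = (pderivs [k] (\<phi> m) a - v k a) - (pderivs [k] (\<phi> n) a - v k a)" for k a
    proof -
      have "pderivs [k] ?\<psi> a = pderivs [k] (\<phi> m) a + pderivs [k] (\<lambda>a. (-1) * \<phi> n a) a"
        by (intro pderiv_add smooth_differentiable smooth_mult smooth_const sm)
      also have "pderivs [k] (\<lambda>a. (-1) * \<phi> n a) a = (-1) * pderivs [k] (\<phi> n) a"
        using gradient_cmult[OF sm[of n], of "-1" a k] by (simp only: gradient_nth)
      finally show ?thesis by (simp del: pderivs.simps)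
    qed
    have "sqnorm (Lcyl \<kappa> l) (\<lambda>a. \<phi> m a - \<phi> n a) = sqnorm (Lcyl \<kappa> l) ?\<psi>" by simp
    also have "\<dots> \<le> \<kappa>\<^sup>2 * (\<Sum>i\<in>UNIV. sqnorm (Lcyl \<kappa> l) (pderivs [emb i] ?\<psi>))"
    proof (rule Poincare_cyl[OF \<kappa> l periodic_test_functionD(1)[OF \<psi>]])
      show "?\<psi> a = 0" if "norm (horiz a) = \<kappa>" for a
        by (rule periodic_test_functionD(3)[OF \<psi>]) (simp add: norm_disc that)
    qed
    also have "\<dots> \<le> \<kappa>\<^sup>2 * (\<Sum>i\<in>UNIV. 2 * E (emb i) m + 2 * E (emb i) n)"
    proof (intro mult_left_mono sum_mono)
      fix i
      have "sqnorm (Lcyl \<kappa> l) (pderivs [emb i] ?\<psi>) = sqnorm (Lcyl \<kappa> l) (\<lambda>a. (pderivs [emb i] (\<phi> m) a - v (emb i) a) - (pderivs [emb i] (\<phi> n) a - v (emb i) a))"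
        by (rule arg_cong[where f = "sqnorm (Lcyl \<kappa> l)"]) (rule ext, rule pd)
      also have "\<dots> \<le> 2 * E (emb i) m + 2 * E (emb i) n"
        unfolding E_def by (intro sqnorm_diff_le square_integrable_diff si smooth_pderiv sm v)
      finally show "sqnorm (Lcyl \<kappa> l) (pderivs [emb i] ?\<psi>) \<le> 2 * E (emb i) m + 2 * E (emb i) n" .
    qed simp
    also have "\<dots> = D m + D n" unfolding D_def by (simp only: sum.distrib distrib_left)
    finally show ?thesis .
  qed
  fix e :: real assume "0 < e"
  have "\<forall>\<^sub>F j in sequentially. D j < e / 2"
    by (rule order_tendstoD(2)[OF D]) (use \<open>0 < e\<close> in simp)
  then obtain N where N: "\<And>j. j \<ge> N \<Longrightarrow> D j < e / 2" unfolding eventually_sequentially by blast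
  show "\<exists>N. \<forall>m\<ge>N. \<forall>n\<ge>N. sqnorm (Lcyl \<kappa> l) (\<lambda>a. \<phi> m a - \<phi> n a) < e"
  proof (intro exI allI impI)
    fix m n assume "N \<le> m" "N \<le> n"
    then show "sqnorm (Lcyl \<kappa> l) (\<lambda>a. \<phi> m a - \<phi> n a) < e"
      using le[of m n] N[of m] N[of n] by argo
  qed
qed

lemma sqnorm_diff_cong_AE:
  assumes f: "square_integrable M f" and g: "square_integrable M g" and h: "square_integrable M h" "AE x in M. g x = h x"
  shows "sqnorm M (\<lambda>x. f x - g x) = sqnorm M (\<lambda>x. f x - h x)"
proof (rule sqnorm_cong_AE)
  show "AE x in M. f x - g x = f x - h x" using h(2) by eventually_elim simp
qed (intro square_integrable_measurable square_integrable_diff f g h)+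

text \<open>Periodicity removes the jump in \<open>coef_pderiv_3\<close>.\<close>

lemma coef_pderiv_3_periodic:
  assumes "0 < l" "\<phi> \<in> periodic_test_functions \<kappa> l"
  shows "coef l n (pderivs [3] \<phi>) x = mode_factor l n * coef l n \<phi> x"
  using coef_pderiv_3[OF assms(1) periodic_test_functionD(1)[OF assms(2)]] periodic_test_functionD(2)[OF assms(2), of "join (x, 0)"]
  by (simp add: join_add_axis mode_factor_def del: pderivs.simps)

lemma SF_integral_test_function:
  assumes \<kappa>: "0 < \<kappa>" and \<phi>: "\<phi> \<in> periodic_test_functions \<kappa> l"
  shows "(LINT a|SF_measure \<kappa> l. (norm (\<phi> a))\<^sup>2) = 0"
proof -
  have z: "\<phi> (join (circ \<kappa> \<theta>, s)) = 0" for \<theta> s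
    by (rule periodic_test_functionD(3)[OF \<phi>]) (simp add: norm_disc norm_circ)
  have "(\<lambda>a. (norm (\<phi> a))\<^sup>2) \<in> borel_measurable borel"
    using smooth_borel[OF periodic_test_functionD(1)[OF \<phi>]] by measurable
  from SF_integral[OF \<kappa> this] show ?thesis by (simp add: z)
qed

text \<open>All that \<open>Hp 1\<close> demands of the coefficients of q is inherited from the test
  functions in the limit: weak derivatives, and the relation between vertical derivative and mode
  factor that turns the weights into Bessel sums. The test functions themselves witness the trace 0,
  since they vanish on the lateral surface.\<close>

lemma limit_of_test_gradients:
  assumes \<kappa>: "0 < \<kappa>" and l: "0 < l" and v: "square_integrable (Lcyl \<kappa> l) v"
    and \<phi>: "\<And>j. \<phi> j \<in> periodic_test_functions \<kappa> l"
    and lim: "(\<lambda>j. sqnorm (Lcyl \<kappa> l) (\<lambda>a. gradient (\<phi> j) a - v a)) \<longlonglongrightarrow> 0"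
  shows "\<exists>q\<in>H1p_zero \<kappa> l. is_weak_gradient (cyl \<kappa> l) q v"
proof -
  note sm = periodic_test_functionD(1)[OF \<phi>]
  note si = square_integrable_smooth[OF bounded_cyl open_cyl]
  have vk: "square_integrable (Lcyl \<kappa> l) (\<lambda>a. v a $ k)" for k by (rule square_integrable_vec_nth[OF v])
  have limk: "(\<lambda>j. sqnorm (Lcyl \<kappa> l) (\<lambda>a. pderivs [k] (\<phi> j) a - v a $ k)) \<longlonglongrightarrow> 0" for k
  proof (rule tendsto_sandwich[OF _ _ tendsto_const lim])
    have "sqnorm (Lcyl \<kappa> l) (\<lambda>a. pderivs [k] (\<phi> j) a - v a $ k) \<le> sqnorm (Lcyl \<kappa> l) (\<lambda>a. gradient (\<phi> j) a - v a)" for j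
      using sqnorm_vec_nth_le[OF square_integrable_diff[OF square_integrable_gradient[OF open_cyl bounded_cyl sm[of j]] v], of k]
      by (simp only: vector_minus_component gradient_nth)
    then show "\<forall>\<^sub>F j in sequentially. sqnorm (Lcyl \<kappa> l) (\<lambda>a. pderivs [k] (\<phi> j) a - v a $ k) \<le> sqnorm (Lcyl \<kappa> l) (\<lambda>a. gradient (\<phi> j) a - v a)"
      by (intro always_eventually allI)
  qed (rule always_eventually, rule allI, rule sqnorm_nonneg)
  obtain q0 where q0: "square_integrable (Lcyl \<kappa> l) q0" "(\<lambda>j. sqnorm (Lcyl \<kappa> l) (\<lambda>a. \<phi> j a - q0 a)) \<longlonglongrightarrow> 0"
    using test_gradients_Cauchy[OF \<kappa> l \<phi> vk limk] by blast
  obtain q where q: "q \<in> borel_measurable borel" "square_integrable (Lcyl \<kappa> l) q" "AE a in Lcyl \<kappa> l. q0 a = q a"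
    by (rule L2_cyl_representative[OF L2_iff[THEN iffD2, OF q0(1)]])
  have limq: "(\<lambda>j. sqnorm (Lcyl \<kappa> l) (\<lambda>a. \<phi> j a - q a)) \<longlonglongrightarrow> 0"
    using q0(2) unfolding sqnorm_diff_cong_AE[OF si[OF sm] q0(1) q(2,3)] .
  have "\<exists>V. V \<in> borel_measurable borel \<and> square_integrable (Lcyl \<kappa> l) V \<and> (AE a in Lcyl \<kappa> l. v a $ k = V a)" for k
    by (rule L2_cyl_representative[OF L2_iff[THEN iffD2, OF vk[of k]]]) blast
  then obtain V where V: "\<And>k. V k \<in> borel_measurable borel" "\<And>k. square_integrable (Lcyl \<kappa> l) (V k)" "\<And>k. AE a in Lcyl \<kappa> l. v a $ k = V k a"
    using choice[of "\<lambda>k V. V \<in> borel_measurable borel \<and> square_integrable (Lcyl \<kappa> l) V \<and> (AE a in Lcyl \<kappa> l. v a $ k = V a)"] by blast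
  have limV: "(\<lambda>j. sqnorm (Lcyl \<kappa> l) (\<lambda>a. pderivs [k] (\<phi> j) a - V k a)) \<longlonglongrightarrow> 0" for k
    using limk[of k] unfolding sqnorm_diff_cong_AE[OF si[OF smooth_pderiv[OF sm]] vk V(2,3)] .
  have qL: "q \<in> L2 (cyl \<kappa> l)" and vL: "v \<in> L2 (cyl \<kappa> l)" and vkL: "(\<lambda>a. v a $ k) \<in> L2 (cyl \<kappa> l)" for k
    unfolding L2_iff by (rule q v vk)+
  have wq: "weak_deriv (cyl \<kappa> l) [k] q (\<lambda>a. v a $ k)" for k
    by (rule weak_deriv_limit[OF open_cyl bounded_cyl _ _ qL vkL weak_deriv_smooth[OF open_cyl sm] limq limk])
      (unfold L2_iff, rule si[OF sm], rule si[OF smooth_pderiv[OF sm]])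
  have cf: "(\<lambda>j. sqnorm (Ldisc \<kappa>) (\<lambda>x. coef l n (\<phi> j) x - coef l n q x)) \<longlonglongrightarrow> 0" for n
    by (rule coef_tendsto[OF l smooth_borel[OF sm] si[OF sm] q(1,2) limq])
  have cV: "(\<lambda>j. sqnorm (Ldisc \<kappa>) (\<lambda>x. coef l n (pderivs [k] (\<phi> j)) x - coef l n (V k) x)) \<longlonglongrightarrow> 0" for n k
    by (rule coef_tendsto[OF l smooth_borel[OF smooth_pderiv[OF sm]] si[OF smooth_pderiv[OF sm]] V(1,2) limV])
  note cs = square_integrable_coef[OF l smooth_borel si, OF sm sm]
    square_integrable_coef[OF l smooth_borel si, OF smooth_pderiv[OF sm] smooth_pderiv[OF sm]]
  have cq: "square_integrable (Ldisc \<kappa>) (coef l n q)" and cVs: "square_integrable (Ldisc \<kappa>) (coef l n (V k))" for n k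
    using square_integrable_coef[OF l q(1,2)] square_integrable_coef[OF l V(1,2)] by blast+
  have cL: "coef l n q \<in> L2 (disc \<kappa>)" "coef l n (V k) \<in> L2 (disc \<kappa>)" for n k
    unfolding L2_iff by (rule cq cVs)+
  have wc: "weak_deriv (disc \<kappa>) [i] (coef l n q) (coef l n (V (emb i)))" for i n
  proof (rule weak_deriv_limit[OF open_disc bounded_disc _ _ cL weak_deriv_smooth[OF open_disc smooth_coef[OF l sm]] cf])
    show "coef l n (\<phi> j) \<in> L2 (disc \<kappa>)" "pderivs [i] (coef l n (\<phi> j)) \<in> L2 (disc \<kappa>)" for j
      unfolding L2_iff pderiv_coef[OF l sm] by (rule cs)+
    show "(\<lambda>j. sqnorm (Ldisc \<kappa>) (\<lambda>x. pderivs [i] (coef l n (\<phi> j)) x - coef l n (V (emb i)) x)) \<longlonglongrightarrow> 0"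
      unfolding pderiv_coef[OF l sm] by (rule cV)
  qed
  \<comment> \<open>The relation holds for every \<phi> j, and both sides converge in the square
    mean; this makes the weight with n^2 summable through the third component of v.\<close>
  have c3: "sqnorm (Ldisc \<kappa>) (coef l n (V 3)) = (norm (mode_factor l n))\<^sup>2 * sqnorm (Ldisc \<kappa>) (coef l n q)" for n
  proof -
    have "AE x in Ldisc \<kappa>. coef l n (V 3) x = mode_factor l n * coef l n q x"
    proof (rule L2_tendsto_unique_AE[OF cs(2) cVs square_integrable_cmult[OF cq] cV])
      show "(\<lambda>j. sqnorm (Ldisc \<kappa>) (\<lambda>x. coef l n (pderivs [3] (\<phi> j)) x - mode_factor l n * coef l n q x)) \<longlonglongrightarrow> 0"
        unfolding coef_pderiv_3_periodic[OF l \<phi>] right_diff_distrib[symmetric] sqnorm_cmult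
        by (rule tendsto_mult_right_zero[OF cf])
    qed
    then have "sqnorm (Ldisc \<kappa>) (coef l n (V 3)) = sqnorm (Ldisc \<kappa>) (\<lambda>x. mode_factor l n * coef l n q x)"
      by (rule sqnorm_cong_AE[rotated 2]) (intro square_integrable_measurable square_integrable_cmult cq cVs)+
    then show ?thesis by (simp only: sqnorm_cmult)
  qed
  have "(\<lambda>n. l * sqnorm (Ldisc \<kappa>) (coef l n q) + (\<Sum>i\<in>UNIV. l * sqnorm (Ldisc \<kappa>) (coef l n (V (emb i)))) + l * sqnorm (Ldisc \<kappa>) (coef l n (V 3))) summable_on UNIV"
    unfolding sum_2 by (intro summable_on_add summable_coef l q V)
  then have "(\<lambda>n. \<Sum>m\<le>1. (2 * pi * of_int n) ^ (2 * m) / l powi (2 * int m - 1) * (sobolev_norm (1 - m) (disc \<kappa>) (coef l n q))\<^sup>2) summable_on UNIV"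
    unfolding Hp_1_term[OF l cL wc] c3 .
  then have Hp: "q \<in> Hp 1 \<kappa> l"
    unfolding Hp_def
    by (intro CollectI conjI exI[of _ "\<lambda>n. coef l n q"] allI sobolev_1I[OF qL vkL wq] sobolev_1I[OF cL wc]
        fourier_series_L2_norm[OF l qL q(1,2)]) simp_all
  have "has_trace_SF \<kappa> l q (\<lambda>_. 0)"
    unfolding has_trace_SF_def
  proof (intro conjI exI[of _ \<phi>] allI sm)
    show "(\<lambda>j. sobolev_norm 1 (cyl \<kappa> l) (\<lambda>a. q a - \<phi> j a)) \<longlonglongrightarrow> 0"
      unfolding sobolev_norm_1_tendsto_iff[OF open_cyl bounded_cyl qL vkL wq sm]
      by (intro conjI allI limq limk)
    show "(\<lambda>j. LINT a|SF_measure \<kappa> l. (norm (\<phi> j a - 0))\<^sup>2) \<longlonglongrightarrow> 0"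
      by (simp add: SF_integral_test_function[OF \<kappa> \<phi>])
  qed simp_all
  with Hp have "q \<in> H1p_zero \<kappa> l" by (simp add: H1p_zero_def)
  moreover have "is_weak_gradient (cyl \<kappa> l) q v"
    unfolding is_weak_gradient_def by (intro conjI allI vL wq)
  ultimately show ?thesis by (intro bexI[where x = q])
qed

section \<open>Pairing solenoidal fields with gradients\<close>

lemma summable_on_int_tendsto_0:
  fixes f :: "int \<Rightarrow> real"
  assumes "f summable_on UNIV" shows "(\<lambda>k. f (int k)) \<longlonglongrightarrow> 0"
proof -
  have "f summable_on range int" by (rule summable_on_subset_banach[OF assms subset_UNIV])
  then have "(f \<circ> int) summable_on UNIV" by (simp add: summable_on_reindex)
  from summable_LIMSEQ_zero[OF summable_on_imp_summable[OF this]] show ?thesis by (simp add: o_def)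
qed

text \<open>These are the terms m = 1 of the norm in \<open>Hp 1\<close>. It is the place where
  periodicity acts: with a jump across the end discs the products would tend to minus the jump
  divided by l. As the coefficients in \<open>Hp\<close> come from an existential, they must first
  be identified with \<open>coef\<close> by uniqueness of Fourier series.\<close>

lemma Hp_1_coef:
  assumes l: "0 < l" and q: "q \<in> Hp 1 \<kappa> l"
    and Q: "Q \<in> borel_measurable borel" "square_integrable (Lcyl \<kappa> l) Q" "AE a in Lcyl \<kappa> l. q a = Q a"
  shows "(\<lambda>k. sqnorm (Ldisc \<kappa>) (\<lambda>x. mode_factor l (int k) * coef l (int k) Q x)) \<longlonglongrightarrow> 0"
proof -
  obtain c where cS: "\<And>n. c n \<in> sobolev 1 (disc \<kappa>)"
    and lim: "(\<lambda>N. L2_norm (cyl \<kappa> l) (\<lambda>a. q a - (\<Sum>n\<in>{- int N..int N}. fourier_mode l n (c n) a))) \<longlonglongrightarrow> 0"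
    and sum: "(\<lambda>n. \<Sum>m\<le>1. (2 * pi * of_int n) ^ (2 * m) / l powi (2 * int m - 1) * (sobolev_norm (1 - m) (disc \<kappa>) (c n))\<^sup>2) summable_on UNIV"
      (is "?f summable_on UNIV")
    using q unfolding Hp_def by blast
  have cL: "c n \<in> L2 (disc \<kappa>)" for n using cS[of n] by (simp add: sobolev_def)
  then have cs: "square_integrable (Ldisc \<kappa>) (c n)" for n by (simp add: L2_iff)
  have "\<exists>g. g \<in> borel_measurable borel \<and> (AE x in Ldisc \<kappa>. c n x = g x)" for n
    by (rule borel_representative[OF disc_borel square_integrable_measurable[OF cs[of n]]]) blast
  then obtain g where g: "\<And>n. g n \<in> borel_measurable borel" "\<And>n. AE x in Ldisc \<kappa>. c n x = g n x"
    using choice[of "\<lambda>n g. g \<in> borel_measurable borel \<and> (AE x in Ldisc \<kappa>. c n x = g x)"] by blast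
  have gs: "square_integrable (Ldisc \<kappa>) (g n)" for n
    using cs[of n] square_integrable_cong_AE[OF square_integrable_measurable[OF cs] borel_measurable_lebesgue_on[OF g(1)] g(2)] by simp
  have "AE a in Lcyl \<kappa> l. \<forall>n. c n (horiz a) = g n (horiz a)"
    unfolding AE_all_countable by (intro allI AE_cyl_horiz l g(2))
  with Q(3) have ae: "AE a in Lcyl \<kappa> l. q a - (\<Sum>n\<in>{- int N..int N}. fourier_mode l n (c n) a) = Q a - (\<Sum>n\<in>{- int N..int N}. fourier_mode l n (g n) a)" for N
    by eventually_elim (simp add: fourier_mode_def)
  have gm: "(\<lambda>a. Q a - (\<Sum>n\<in>{- int N..int N}. fourier_mode l n (g n) a)) \<in> borel_measurable (Lcyl \<kappa> l)" for N
    by (intro borel_measurable_lebesgue_on borel_measurable_diff borel_measurable_sum fourier_mode_measurable g Q)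
  have "(\<lambda>N. sqnorm (Lcyl \<kappa> l) (\<lambda>a. Q a - (\<Sum>n\<in>{- int N..int N}. fourier_mode l n (g n) a))) \<longlonglongrightarrow> 0"
    using lim unfolding L2_norm_tendsto_0_iff sqnorm_cong_AE[OF measurable_lebesgue_on_cong_AE[OF cyl_borel gm ae] gm ae] .
  then have gQ: "AE x in Ldisc \<kappa>. g n x = coef l n Q x" for n
    by (rule fourier_coef_unique[OF l Q(1,2) g(1) gs])
  have "AE x in Ldisc \<kappa>. c n x = coef l n Q x" for n
    using g(2)[of n] gQ[of n] by eventually_elim simp
  then have ceq: "sqnorm (Ldisc \<kappa>) (c n) = sqnorm (Ldisc \<kappa>) (coef l n Q)" for n
    by (rule sqnorm_cong_AE[OF square_integrable_measurable[OF cs] square_integrable_measurable[OF square_integrable_coef[OF l Q(1,2)]]])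
  have le: "l * sqnorm (Ldisc \<kappa>) (\<lambda>x. mode_factor l n * coef l n Q x) \<le> ?f n" for n
  proof -
    let ?t = "\<lambda>m. (2 * pi * of_int n) ^ (2 * m) / l powi (2 * int m - 1) * (sobolev_norm (1 - m) (disc \<kappa>) (c n))\<^sup>2"
    have s: "sqnorm (Ldisc \<kappa>) (coef l n Q) = (sobolev_norm 0 (disc \<kappa>) (c n))\<^sup>2"
      by (simp only: sobolev_norm_0[OF open_disc bounded_disc cL] ceq)
    have "l * sqnorm (Ldisc \<kappa>) (\<lambda>x. mode_factor l n * coef l n Q x) = ?t 1"
      unfolding sqnorm_cmult norm_mode_factor_sq power_divide s
      using l by (simp add: power2_eq_square)
    also have "\<dots> \<le> ?f n"
      by (rule member_le_sum[where f = ?t]) (use l in \<open>auto intro!: mult_nonneg_nonneg divide_nonneg_nonneg zero_le_power_int simp: power_mult\<close>)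
    finally show ?thesis .
  qed
  have "(\<lambda>k. l * sqnorm (Ldisc \<kappa>) (\<lambda>x. mode_factor l (int k) * coef l (int k) Q x)) \<longlonglongrightarrow> 0"
  proof (rule tendsto_sandwich[OF _ _ tendsto_const summable_on_int_tendsto_0[OF sum]])
    show "\<forall>\<^sub>F k in sequentially. l * sqnorm (Ldisc \<kappa>) (\<lambda>x. mode_factor l (int k) * coef l (int k) Q x) \<le> ?f (int k)"
      by (rule always_eventually) (rule allI, rule le)
    show "\<forall>\<^sub>F k in sequentially. 0 \<le> l * sqnorm (Ldisc \<kappa>) (\<lambda>x. mode_factor l (int k) * coef l (int k) Q x)"
      using l by (intro always_eventually allI) simp
  qed
  from tendsto_mult_left[OF this, of "1 / l"] l show ?thesis by simp
qed

text \<open>For smooth \<open>\<phi>\<close> the difference of the two sides is the jump of \<open>\<phi>\<close> across the end discs, whatever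
  \<open>n\<close> is; hence in the limit it is a function of \<open>x\<close> only, and it tends to \<open>0\<close> with \<open>n\<close>.\<close>

lemma coef_vertical_derivative:
  assumes l: "0 < l" and q: "q \<in> Hp 1 \<kappa> l"
    and Q: "Q \<in> borel_measurable borel" "square_integrable (Lcyl \<kappa> l) Q" "AE a in Lcyl \<kappa> l. q a = Q a"
    and W: "W \<in> borel_measurable borel" "square_integrable (Lcyl \<kappa> l) W"
    and \<phi>: "\<And>j. smooth (\<phi> j)"
    and lim: "(\<lambda>j. sqnorm (Lcyl \<kappa> l) (\<lambda>a. \<phi> j a - Q a)) \<longlonglongrightarrow> 0" "(\<lambda>j. sqnorm (Lcyl \<kappa> l) (\<lambda>a. pderivs [3] (\<phi> j) a - W a)) \<longlonglongrightarrow> 0"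
  shows "AE x in Ldisc \<kappa>. coef l n W x = mode_factor l n * coef l n Q x"
proof -
  note si = square_integrable_smooth[OF bounded_cyl open_cyl]
  define J where "J n x = coef l n W x - mode_factor l n * coef l n Q x" for n x
  define B where "B j x = (\<phi> j (join (x, l)) - \<phi> j (join (x, 0))) / l" for j x
  note cs = square_integrable_coef[OF l smooth_borel[OF \<phi>] si[OF \<phi>]]
    square_integrable_coef[OF l smooth_borel[OF smooth_pderiv[OF \<phi>]] si[OF smooth_pderiv[OF \<phi>]]]
    square_integrable_coef[OF l Q(1,2)] square_integrable_coef[OF l W]
  have B: "B j = (\<lambda>x. coef l n (pderivs [3] (\<phi> j)) x - mode_factor l n * coef l n (\<phi> j) x)" for n j
    unfolding coef_pderiv_3[OF l \<phi>] B_def mode_factor_def by simp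
  have Bs: "square_integrable (Ldisc \<kappa>) (B j)" for j
    unfolding B[of j 0] by (intro square_integrable_diff square_integrable_cmult cs)
  have Js: "square_integrable (Ldisc \<kappa>) (J n)" for n
    unfolding J_def[abs_def] by (intro square_integrable_diff square_integrable_cmult cs)
  have BJ: "(\<lambda>j. sqnorm (Ldisc \<kappa>) (\<lambda>x. B j x - J n x)) \<longlonglongrightarrow> 0" for n
  proof -
    have eq: "B j x - J n x = (coef l n (pderivs [3] (\<phi> j)) x - coef l n W x) + (- mode_factor l n) * (coef l n (\<phi> j) x - coef l n Q x)" for j x
      unfolding B[of j n] J_def by (simp add: algebra_simps del: pderivs.simps)
    show ?thesis unfolding eq
    proof (rule sqnorm_add_tendsto)
      show "(\<lambda>j. sqnorm (Ldisc \<kappa>) (\<lambda>x. coef l n (pderivs [3] (\<phi> j)) x - coef l n W x)) \<longlonglongrightarrow> 0"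
        by (rule coef_tendsto[OF l smooth_borel[OF smooth_pderiv[OF \<phi>]] si[OF smooth_pderiv[OF \<phi>]] W lim(2)])
      show "(\<lambda>j. sqnorm (Ldisc \<kappa>) (\<lambda>x. - mode_factor l n * (coef l n (\<phi> j) x - coef l n Q x))) \<longlonglongrightarrow> 0"
        unfolding sqnorm_cmult
        by (rule tendsto_mult_right_zero[OF coef_tendsto[OF l smooth_borel[OF \<phi>] si[OF \<phi>] Q(1,2) lim(1)]])
    qed (intro square_integrable_diff square_integrable_cmult cs)+
  qed
  have const: "sqnorm (Ldisc \<kappa>) (J n) = sqnorm (Ldisc \<kappa>) (J m)" for n m
    by (rule sqnorm_cong_AE[OF square_integrable_measurable[OF Js] square_integrable_measurable[OF Js] L2_tendsto_unique_AE[OF Bs Js Js BJ BJ]])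
  \<comment> \<open>Since \<open>J n\<close> has the same norm for every n, it may be estimated at
    index k and k sent to infinity: the first term vanishes by Bessel's inequality, the second by
    \<open>Hp_1_coef\<close>.\<close>
  have "(\<lambda>k. 2 * sqnorm (Ldisc \<kappa>) (coef l (int k) W) + 2 * sqnorm (Ldisc \<kappa>) (\<lambda>x. mode_factor l (int k) * coef l (int k) Q x)) \<longlonglongrightarrow> 2 * 0 + 2 * 0"
  proof (intro tendsto_intros Hp_1_coef[OF l q Q])
    show "(\<lambda>k. sqnorm (Ldisc \<kappa>) (coef l (int k) W)) \<longlonglongrightarrow> 0"
      using tendsto_mult_left[OF summable_on_int_tendsto_0[OF summable_coef[OF l W]], of "1 / l"] l by simp
  qed
  moreover have "sqnorm (Ldisc \<kappa>) (J n) \<le> 2 * sqnorm (Ldisc \<kappa>) (coef l (int k) W) + 2 * sqnorm (Ldisc \<kappa>) (\<lambda>x. mode_factor l (int k) * coef l (int k) Q x)" for k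
    unfolding const[of n "int k"] unfolding J_def by (intro sqnorm_diff_le square_integrable_cmult cs)
  ultimately have "sqnorm (Ldisc \<kappa>) (J n) \<le> 2 * 0 + 2 * 0"
    by (intro LIMSEQ_le_const) blast+
  then have "sqnorm (Ldisc \<kappa>) (J n) = 0" by (simp add: order_antisym)
  from sqnorm_eq_0_AE[OF Js this] show ?thesis
    by eventually_elim (simp add: J_def)
qed

text \<open>Each mode of the gradient pairs to 0 with u, and the Fourier sums of its components
  converge in the square mean, so the whole pairing is 0. The functions
  \<open>coef l n (\<phi> j)\<close> are the smooth approximants required by
  \<open>mode_orthogonality\<close>, their boundary values being controlled by
  \<open>circle_coef_le\<close>.\<close>

lemma L2_inner_gradient_eq_0:
  assumes \<kappa>: "0 < \<kappa>" and l: "0 < l" and u: "u \<in> P0 \<kappa> l"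
    and q: "q \<in> H1p_zero \<kappa> l" and v: "is_weak_gradient (cyl \<kappa> l) q v"
  shows "L2_inner (cyl \<kappa> l) u v = 0"
proof -
  note si = square_integrable_smooth[OF bounded_cyl open_cyl]
  have qH: "q \<in> Hp 1 \<kappa> l" using q by (simp add: H1p_zero_def)
  have qL: "q \<in> L2 (cyl \<kappa> l)" using qH by (simp add: Hp_def sobolev_def)
  have vs: "square_integrable (Lcyl \<kappa> l) v" and wv: "weak_deriv (cyl \<kappa> l) [k] q (\<lambda>a. v a $ k)" for k
    using v by (auto simp: is_weak_gradient_def L2_iff)
  note vk = square_integrable_vec_nth[OF vs]
  have vkL: "(\<lambda>a. v a $ k) \<in> L2 (cyl \<kappa> l)" for k unfolding L2_iff by (rule vk)
  have us: "square_integrable (Lcyl \<kappa> l) (\<lambda>a. u a $ k)" for k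
    using u by (simp add: P0_def Hp_def sobolev_def L2_iff)
  have div: "divergence_free \<kappa> l u" using u by (simp add: P0_def)
  obtain \<phi> where \<phi>: "\<And>j. smooth (\<phi> j)"
    and H1: "(\<lambda>j. sobolev_norm 1 (cyl \<kappa> l) (\<lambda>a. q a - \<phi> j a)) \<longlonglongrightarrow> 0"
    and tr: "(\<lambda>j. LINT a|SF_measure \<kappa> l. (norm (\<phi> j a - 0))\<^sup>2) \<longlonglongrightarrow> 0"
    using q unfolding H1p_zero_def has_trace_SF_def by blast
  note lims = H1[unfolded sobolev_norm_1_tendsto_iff[OF open_cyl bounded_cyl qL vkL wv \<phi>]]
  obtain Q where Q: "Q \<in> borel_measurable borel" "square_integrable (Lcyl \<kappa> l) Q" "AE a in Lcyl \<kappa> l. q a = Q a"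
    by (rule L2_cyl_representative[OF qL])
  have "\<exists>V. V \<in> borel_measurable borel \<and> square_integrable (Lcyl \<kappa> l) V \<and> (AE a in Lcyl \<kappa> l. v a $ k = V a)" for k
    by (rule L2_cyl_representative[OF vkL[of k]]) blast
  then obtain V where V: "\<And>k. V k \<in> borel_measurable borel" "\<And>k. square_integrable (Lcyl \<kappa> l) (V k)" "\<And>k. AE a in Lcyl \<kappa> l. v a $ k = V k a"
    using choice[of "\<lambda>k V. V \<in> borel_measurable borel \<and> square_integrable (Lcyl \<kappa> l) V \<and> (AE a in Lcyl \<kappa> l. v a $ k = V a)"] by blast
  have limQ: "(\<lambda>j. sqnorm (Lcyl \<kappa> l) (\<lambda>a. \<phi> j a - Q a)) \<longlonglongrightarrow> 0"
    using lims[THEN conjunct1] unfolding sqnorm_diff_cong_AE[OF si[OF \<phi>] L2_iff[THEN iffD1, OF qL] Q(2,3)] .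
  have limV: "(\<lambda>j. sqnorm (Lcyl \<kappa> l) (\<lambda>a. pderivs [k] (\<phi> j) a - V k a)) \<longlonglongrightarrow> 0" for k
    using lims[THEN conjunct2, THEN spec, of k] unfolding sqnorm_diff_cong_AE[OF si[OF smooth_pderiv[OF \<phi>]] vk V(2,3)] .
  note cQ = coef_measurable[OF Q(1)] square_integrable_coef[OF l Q(1,2)]
  note cV = coef_measurable[OF V(1)] square_integrable_coef[OF l V(1,2)]
  let ?T = "\<lambda>k n. LINT a|Lcyl \<kappa> l. u a $ k * cnj (fourier_mode l n (coef l n (V k)) a)"
  have mode: "(\<Sum>k\<in>UNIV. ?T k n) = 0" for n
  proof -
    have "(\<Sum>i\<in>UNIV. LINT a|Lcyl \<kappa> l. u a $ emb i * cnj (fourier_mode l n (coef l n (V (emb i))) a))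
      + (LINT a|Lcyl \<kappa> l. u a $ 3 * cnj (fourier_mode l n (\<lambda>x. mode_factor l n * coef l n Q x) a)) = 0"
    proof (rule mode_orthogonality[OF \<kappa> l us div smooth_coef[OF l \<phi>] cQ cV])
      show "(\<lambda>j. sqnorm (Ldisc \<kappa>) (\<lambda>x. coef l n (\<phi> j) x - coef l n Q x)) \<longlonglongrightarrow> 0"
        by (rule coef_tendsto[OF l smooth_borel[OF \<phi>] si[OF \<phi>] Q(1,2) limQ])
      show "(\<lambda>j. sqnorm (Ldisc \<kappa>) (\<lambda>x. pderivs [i] (coef l n (\<phi> j)) x - coef l n (V (emb i)) x)) \<longlonglongrightarrow> 0" for i
        unfolding pderiv_coef[OF l \<phi>]
        by (rule coef_tendsto[OF l smooth_borel[OF smooth_pderiv[OF \<phi>]] si[OF smooth_pderiv[OF \<phi>]] V(1,2) limV])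
      show "(\<lambda>j. LINT \<theta>|lborel. indicator {0<..<2 * pi} \<theta> * (norm (coef l n (\<phi> j) (circ \<kappa> \<theta>)))\<^sup>2) \<longlonglongrightarrow> 0"
      proof (rule tendsto_sandwich[OF _ _ tendsto_const])
        show "(\<lambda>j. (LINT a|SF_measure \<kappa> l. (norm (\<phi> j a))\<^sup>2) / (l * \<kappa>)) \<longlonglongrightarrow> 0"
          using tendsto_mult_left_zero[OF tr, of "1 / (l * \<kappa>)"] by simp
        show "\<forall>\<^sub>F j in sequentially. (LINT \<theta>|lborel. indicator {0<..<2 * pi} \<theta> * (norm (coef l n (\<phi> j) (circ \<kappa> \<theta>)))\<^sup>2)
            \<le> (LINT a|SF_measure \<kappa> l. (norm (\<phi> j a))\<^sup>2) / (l * \<kappa>)"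
          by (intro always_eventually allI circle_coef_le \<kappa> l \<phi>)
        show "\<forall>\<^sub>F j in sequentially. 0 \<le> (LINT \<theta>|lborel. indicator {0<..<2 * pi} \<theta> * (norm (coef l n (\<phi> j) (circ \<kappa> \<theta>)))\<^sup>2)"
          by (intro always_eventually allI Bochner_Integration.integral_nonneg) simp
      qed
    qed
    \<comment> \<open>\<open>mode_orthogonality\<close> involves the mode factor times the
      coefficient of q, whereas the gradient has the coefficient of its third component;
      \<open>coef_vertical_derivative\<close> identifies the two almost everywhere.\<close>
    moreover have "(LINT a|Lcyl \<kappa> l. u a $ 3 * cnj (fourier_mode l n (\<lambda>x. mode_factor l n * coef l n Q x) a)) = ?T 3 n"
    proof (rule integral_cong_AE)
      have "AE a in Lcyl \<kappa> l. coef l n (V 3) (horiz a) = mode_factor l n * coef l n Q (horiz a)"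
        by (rule AE_cyl_horiz[OF l coef_vertical_derivative[OF l qH Q V(1,2) \<phi> limQ limV]])
      then show "AE a in Lcyl \<kappa> l. u a $ 3 * cnj (fourier_mode l n (\<lambda>x. mode_factor l n * coef l n Q x) a)
          = u a $ 3 * cnj (fourier_mode l n (coef l n (V 3)) a)"
        by eventually_elim (simp add: fourier_mode_def)
    qed (intro borel_measurable_times borel_measurable_cnj borel_measurable_lebesgue_on fourier_mode_measurable
        borel_measurable_const cQ cV square_integrable_measurable us)+
    ultimately show ?thesis by (simp add: sum_3 sum_2)
  qed
  let ?S = "\<lambda>k N a. \<Sum>n\<in>{- int N..int N}. fourier_mode l n (coef l n (V k)) a"
  have fs: "square_integrable (Lcyl \<kappa> l) (fourier_mode l n (coef l n (V k)))" for n k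
    by (rule square_integrable_fourier_mode_borel[OF l cV])
  have S: "(\<lambda>N. LINT a|Lcyl \<kappa> l. cnj (?S k N a) * u a $ k) \<longlonglongrightarrow> (LINT a|Lcyl \<kappa> l. cnj (V k a) * u a $ k)" for k
  proof (rule L2_tendsto_integral_mult)
    show "(\<lambda>N. sqnorm (Lcyl \<kappa> l) (\<lambda>a. cnj (?S k N a) - cnj (V k a))) \<longlonglongrightarrow> 0"
      using fourier_cyl_convergence[OF l V(1,2)]
      unfolding complex_cnj_diff[symmetric] sqnorm_def complex_mod_cnj by (simp only: norm_minus_commute)
  qed (intro square_integrable_cnj square_integrable_sum fs V us)+
  have Sn: "(LINT a|Lcyl \<kappa> l. cnj (?S k N a) * u a $ k) = (\<Sum>n\<in>{- int N..int N}. ?T k n)" for k N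
  proof -
    have "(LINT a|Lcyl \<kappa> l. cnj (?S k N a) * u a $ k) = (LINT a|Lcyl \<kappa> l. (\<Sum>n\<in>{- int N..int N}. u a $ k * cnj (fourier_mode l n (coef l n (V k)) a)))"
      by (rule Bochner_Integration.integral_cong) (simp_all add: sum_distrib_left mult.commute)
    also have "\<dots> = (\<Sum>n\<in>{- int N..int N}. ?T k n)"
      by (rule Bochner_Integration.integral_sum) (intro integrable_mult_complex square_integrable_cnj fs us)
    finally show ?thesis .
  qed
  have "(\<lambda>N. \<Sum>k\<in>UNIV. \<Sum>n\<in>{- int N..int N}. ?T k n) \<longlonglongrightarrow> (\<Sum>k\<in>UNIV. LINT a|Lcyl \<kappa> l. cnj (V k a) * u a $ k)"
    unfolding Sn[symmetric] by (intro tendsto_sum S)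
  moreover have "(\<Sum>k\<in>UNIV. \<Sum>n\<in>{- int N..int N}. ?T k n) = 0" for N
    by (subst sum.swap) (simp only: mode sum.neutral_const)
  ultimately have V0: "(\<Sum>k\<in>UNIV. LINT a|Lcyl \<kappa> l. cnj (V k a) * u a $ k) = 0"
    by (simp only: LIMSEQ_const_iff)
  have "L2_inner (cyl \<kappa> l) u v = (\<Sum>k\<in>UNIV. LINT a|Lcyl \<kappa> l. u a $ k * cnj (v a $ k))"
    unfolding L2_inner_def
    by (rule Bochner_Integration.integral_sum) (intro integrable_mult_complex square_integrable_cnj us vk)
  also have "\<dots> = (\<Sum>k\<in>UNIV. LINT a|Lcyl \<kappa> l. cnj (V k a) * u a $ k)"
  proof (rule sum.cong[OF refl], rule integral_cong_AE)
    show "AE a in Lcyl \<kappa> l. u a $ k * cnj (v a $ k) = cnj (V k a) * u a $ k" for k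
      using V(3)[of k] by eventually_elim simp
  qed (intro borel_measurable_times borel_measurable_cnj square_integrable_measurable us vk V(2))+
  finally show ?thesis using V0 by simp
qed

theorem proposition2p1:
  fixes \<kappa> l :: real
  assumes "0 < \<kappa>" and "\<kappa> < 1" and "0 < l"
  shows "L2_orth (cyl \<kappa> l) (P0 \<kappa> l) =
           {v. \<exists>q \<in> H1p_zero \<kappa> l. is_weak_gradient (cyl \<kappa> l) q v}"
proof (intro equalityI subsetI)
  fix v assume v: "v \<in> L2_orth (cyl \<kappa> l) (P0 \<kappa> l)"
  then have vs: "square_integrable (Lcyl \<kappa> l) v" by (simp add: L2_orth_def L2_iff)
  obtain \<phi> where "\<And>j. \<phi> j \<in> periodic_test_functions \<kappa> l"
    "(\<lambda>j. sqnorm (Lcyl \<kappa> l) (\<lambda>a. gradient (\<phi> j) a - v a)) \<longlonglongrightarrow> 0"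
    by (rule L2_orth_P0_approx[OF assms(3) v]) blast
  from limit_of_test_gradients[OF assms(1,3) vs this]
  show "v \<in> {v. \<exists>q \<in> H1p_zero \<kappa> l. is_weak_gradient (cyl \<kappa> l) q v}" by simp
next
  fix v assume "v \<in> {v. \<exists>q \<in> H1p_zero \<kappa> l. is_weak_gradient (cyl \<kappa> l) q v}"
  then obtain q where q: "q \<in> H1p_zero \<kappa> l" "is_weak_gradient (cyl \<kappa> l) q v" by blast
  then have "v \<in> L2 (cyl \<kappa> l)" by (simp add: is_weak_gradient_def)
  then show "v \<in> L2_orth (cyl \<kappa> l) (P0 \<kappa> l)"
    unfolding L2_orth_def using L2_inner_gradient_eq_0[OF assms(1,3) _ q] by blast
qed

end
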